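(* Let $(I(t),\varphi(t))$ be a solution of the system $\dot I=-\varepsilon\,\partial H_1/\partial\varphi$, $\dot\varphi=\omega(\tau)+\varepsilon\,\partial H_1/\partial I$, $\tau=\varepsilon t$, on $[t_-,t_+]$, in the setting and with the notation described in the context. Then $$I_++\varepsilon u_1(I_+,\varphi_+,\tau_+)=I_-+\varepsilon u_1(I_-,\varphi_-,\tau_-)-\sqrt{\varepsilon}\int_{-\infty}^{+\infty}\frac{\partial H_1(I_*,\varphi_*+\frac{\omega'_*}{2}\theta^2,\tau_* )}{\partial\varphi}\,d\theta+O(\varepsilon^{3/2})$$ and $$\begin{aligned}\varphi_++\varepsilon v_1(I_+,\varphi_+,\tau_+)={}&\varphi_-+\varepsilon v_1(I_-,\varphi_-,\tau_-)+\frac1\varepsilon\int_{\tau_-}^{\tau_+}\omega(\tau)\,d\tau+\int_{\tau_-}^{\tau_*}\frac{\partial\bar H_1(J_-,\tau)}{\partial I}\,d\tau+\int_{\tau_*}^{\tau_+}\frac{\partial\bar H_1(J_+,\tau)}{\partial I}\,d\tau\\&+\sqrt{\varepsilon}\int_{-\infty}^{+\infty}\frac{\partial\widetilde H_1(I_*,\varphi_*+\frac{\omega'_*}{2}\theta^2,\tau_* )}{\partial I}\,d\theta+\mathrm{p.v.}\;\varepsilon\int_{\tau_-}^{\tau_+}\frac{\partial\mathcal R_2(I_*,\tau)}{\partial I}\,d\tau\\&-\frac{\varepsilon^{3/2}\ln\varepsilon}{4\omega'_*}\,\frac{\partial^3\langle\widetilde H_1^2\rangle^\varphi(I_*,\tau_*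 )}{\partial I^3}\int_{-\infty}^{+\infty}\frac{\partial H_1(I_*,\varphi_*+\frac{\omega'_*}{2}\theta^2,\tau_* )}{\partial\varphi}\,d\theta+O(\varepsilon^{3/2}).\end{aligned}$$
   Context: Setting. $D_I,D_\tau\subset\mathbb R$ are open intervals, $\varepsilon$ is a small parameter, $0<\varepsilon\ll1$, and $\tau=\varepsilon t$ is slow time. The Hamiltonian $H(I,\varphi,\tau)=\omega(\tau)I+\varepsilon H_1(I,\varphi,\tau)$ is of class $C^4$ on $D_I\times\mathbb R\times D_\tau$ (that is, $\omega$ and $H_1$, which do not depend on $\varepsilon$, are $C^4$), and $H_1$ is $2\pi$-periodic in $\varphi$. There is $\tau_*\in D_\tau$ with $\omega(\tau_* )=0$, $\omega'_*:=\omega'(\tau_* )\neq0$, and $\omega(\tau)\ne0$ for $\tau\in D_\tau\setminus\{\tau_*\}$. The equations of motion are $\dot I=-\varepsilon\,\partial H_1(I,\varphi,\tau)/\partial\varphi$, $\dot\varphi=\omega(\tau)+\varepsilon\,\partial H_1(I,\varphi,\tau)/\partial I$, where the dot is $d/dt$. Constants $\tau_-<\tau_*<\tau_+$ in $D_\tau$, independent of $\varepsilon$, are fixed; $t_\pm=\tau_\pm/\varepsilon$, $t_*=\tau_*/\varepsilon$. For a solution on $[t_-,t_+]$: $I_\pm=I(t_\pm)$, $\varphi_\pm=\varphi(t_\pm)$, $I_*=I(t_* )$, $\varphi_*=\varphi(t_* )$ (here $\varphi$ is real-valued, not reduced mod $2\pi$). Notation. $\langle f\rangle^\varphi=\frac1{2\pi}\int_0^{2\pi}f(\varphi)\,d\varphi$;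 $\bar H_1(I,\tau)=\langle H_1\rangle^\varphi$; $\widetilde H_1=H_1-\bar H_1$; for $\tau\neq\tau_*$, $u_1(I,\varphi,\tau)=\widetilde H_1(I,\varphi,\tau)/\omega(\tau)$ and $$v_1(I,\varphi,\tau)=-\int_0^\varphi\frac{\partial u_1(I,\psi,\tau)}{\partial I}\,d\psi+\Big\langle\int_0^\varphi\frac{\partial u_1(I,\psi,\tau)}{\partial I}\,d\psi\Big\rangle^\varphi;$$ $J_\pm=I_\pm+\varepsilon u_1(I_\pm,\varphi_\pm,\tau_\pm)$; $\mathcal R_2(I,\tau)=-\frac{1}{2\omega(\tau)}\frac{\partial\langle\widetilde H_1^2\rangle^\varphi(I,\tau)}{\partial I}$. The notation p.v. denotes the Cauchy principal value at $\tau=\tau_*$. The integrals over $\theta\in(-\infty,+\infty)$ are (conditionally convergent) improper integrals. $O(\varepsilon^a)$ denotes a quantity bounded in absolute value by $C\varepsilon^a$ for all sufficiently small $\varepsilon>0$, with $C$ independent of $\varepsilon$ and of the solution as long as $I(t)$ stays in a fixed compact subset of $D_I$ for $t\in[t_-,t_+]$. *)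

theory Defs
  imports "HOL-Analysis.Analysis"
begin

(* Class C^k on an open set: in finite dimension, f is C^(k+1) iff it is differentiable
   and all its directional derivatives are C^k. *)
primrec Ck_on :: "nat \<Rightarrow> 'a::euclidean_space set \<Rightarrow> ('a \<Rightarrow> real) \<Rightarrow> bool" where
  "Ck_on 0 S f \<longleftrightarrow> continuous_on S f"
| "Ck_on (Suc k) S f \<longleftrightarrow>
     (\<forall>x\<in>S. f differentiable (at x)) \<and>
     (\<forall>v. Ck_on k S (\<lambda>x. frechet_derivative f (at x) v))"

(* Functions of (I, phi, tau) are curried, with the arguments in this order. *)

definition d_I :: "(real \<Rightarrow> real \<Rightarrow> real \<Rightarrow> real) \<Rightarrow> real \<Rightarrow> real \<Rightarrow> real \<Rightarrow> real" where
  "d_I F I \<phi> \<tau> = deriv (\<lambda>x. F x \<phi> \<tau>) I"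

definition d_phi :: "(real \<Rightarrow> real \<Rightarrow> real \<Rightarrow> real) \<Rightarrow> real \<Rightarrow> real \<Rightarrow> real \<Rightarrow> real" where
  "d_phi F I \<phi> \<tau> = deriv (\<lambda>x. F I x \<tau>) \<phi>"

definition phase_mean :: "(real \<Rightarrow> real) \<Rightarrow> real" where
  "phase_mean f = 1 / (2 * pi) * integral {0..2 * pi} f"

definition H_bar :: "(real \<Rightarrow> real \<Rightarrow> real \<Rightarrow> real) \<Rightarrow> real \<Rightarrow> real \<Rightarrow> real" where
  "H_bar H1 I \<tau> = phase_mean (\<lambda>\<phi>. H1 I \<phi> \<tau>)"

definition H_tilde :: "(real \<Rightarrow> real \<Rightarrow> real \<Rightarrow> real) \<Rightarrow> real \<Rightarrow> real \<Rightarrow> real \<Rightarrow> real" where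
  "H_tilde H1 I \<phi> \<tau> = H1 I \<phi> \<tau> - H_bar H1 I \<tau>"

definition H_tilde_sq_mean :: "(real \<Rightarrow> real \<Rightarrow> real \<Rightarrow> real) \<Rightarrow> real \<Rightarrow> real \<Rightarrow> real" where
  "H_tilde_sq_mean H1 I \<tau> = phase_mean (\<lambda>\<phi>. (H_tilde H1 I \<phi> \<tau>)\<^sup>2)"

definition u1 ::
  "(real \<Rightarrow> real) \<Rightarrow> (real \<Rightarrow> real \<Rightarrow> real \<Rightarrow> real) \<Rightarrow> real \<Rightarrow> real \<Rightarrow> real \<Rightarrow> real" where
  "u1 \<omega> H1 I \<phi> \<tau> = H_tilde H1 I \<phi> \<tau> / \<omega> \<tau>"

(* The integral from 0 to phi has to be the oriented one, since phi may be negative;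
   integral {0..phi} would be 0 in that case. *)
definition u1_I_primitive ::
  "(real \<Rightarrow> real) \<Rightarrow> (real \<Rightarrow> real \<Rightarrow> real \<Rightarrow> real) \<Rightarrow> real \<Rightarrow> real \<Rightarrow> real \<Rightarrow> real" where
  "u1_I_primitive \<omega> H1 I \<phi> \<tau> = (LBINT \<psi>=ereal 0..ereal \<phi>. d_I (u1 \<omega> H1) I \<psi> \<tau>)"

definition v1 ::
  "(real \<Rightarrow> real) \<Rightarrow> (real \<Rightarrow> real \<Rightarrow> real \<Rightarrow> real) \<Rightarrow> real \<Rightarrow> real \<Rightarrow> real \<Rightarrow> real" where
  "v1 \<omega> H1 I \<phi> \<tau> =
     - u1_I_primitive \<omega> H1 I \<phi> \<tau> + phase_mean (\<lambda>\<phi>'. u1_I_primitive \<omega> H1 I \<phi>' \<tau>)"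

definition R2 ::
  "(real \<Rightarrow> real) \<Rightarrow> (real \<Rightarrow> real \<Rightarrow> real \<Rightarrow> real) \<Rightarrow> real \<Rightarrow> real \<Rightarrow> real" where
  "R2 \<omega> H1 I \<tau> = - (1 / (2 * \<omega> \<tau>)) * deriv (\<lambda>x. H_tilde_sq_mean H1 x \<tau>) I"

(* Cauchy principal value at c of the integral of f over [a, b], for a < c < b. *)
definition has_pv_integral ::
  "(real \<Rightarrow> real) \<Rightarrow> real \<Rightarrow> real \<Rightarrow> real \<Rightarrow> real \<Rightarrow> bool" where
  "has_pv_integral f a c b l \<longleftrightarrow>
     (\<forall>\<delta>>0. f integrable_on {a..c - \<delta>} \<and> f integrable_on {c + \<delta>..b}) \<and>
     ((\<lambda>\<delta>. integral {a..c - \<delta>} f + integral {c + \<delta>..b} f) \<longlongrightarrow> l) (at_right 0)"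

definition pv_integral :: "(real \<Rightarrow> real) \<Rightarrow> real \<Rightarrow> real \<Rightarrow> real \<Rightarrow> real" where
  "pv_integral f a c b = (THE l. has_pv_integral f a c b l)"

definition is_solution ::
  "(real \<Rightarrow> real) \<Rightarrow> (real \<Rightarrow> real \<Rightarrow> real \<Rightarrow> real) \<Rightarrow> real \<Rightarrow> real set
     \<Rightarrow> (real \<Rightarrow> real) \<Rightarrow> (real \<Rightarrow> real) \<Rightarrow> bool" where
  "is_solution \<omega> H1 \<epsilon> T I \<phi> \<longleftrightarrow>
     (\<forall>t\<in>T.
        (I has_real_derivative - \<epsilon> * d_phi H1 (I t) (\<phi> t) (\<epsilon> * t)) (at t within T) \<and>
        (\<phi> has_real_derivative \<omega> (\<epsilon> * t) + \<epsilon> * d_I H1 (I t) (\<phi> t) (\<epsilon> * t)) (at t within T))"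

(* For a locally integrable integrand, the Henstock-Kurzweil integral over the whole line is
   the possibly only conditionally convergent improper integral, with the two limits taken
   independently. The integrals over theta are meant in this sense; they do not exist as
   Lebesgue integrals in general. *)
lemma has_integral_UNIV_iff_improper:
  fixes f :: "real \<Rightarrow> real"
  assumes "\<And>a b. f integrable_on {a..b}"
  shows "(f has_integral l) UNIV \<longleftrightarrow>
     ((\<lambda>(a, b). integral {a..b} f) \<longlongrightarrow> l) (at_bot \<times>\<^sub>F at_top)"
proof -
  have no_box: "\<not> (\<exists>a b. (UNIV :: real set) = cbox a b)"
    using bounded_cbox not_bounded_UNIV by (metis (no_types))
  have hi: "(f has_integral z) {a..b} \<longleftrightarrow> z = integral {a..b} f" for a b z
    using integrable_integral[OF assms[of a b]] integral_unique[of f z "{a..b}"] by auto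
  have L: "(f has_integral l) UNIV \<longleftrightarrow>
      (\<forall>e>0. \<exists>B>0. \<forall>a b. ball 0 B \<subseteq> {a..b} \<longrightarrow> \<bar>integral {a..b} f - l\<bar> < e)"
    by (rule trans[OF has_integral_alt[of f l UNIV, unfolded if_not_P[OF no_box]]]) (simp add: hi)
  have R: "((\<lambda>(a, b). integral {a..b} f) \<longlongrightarrow> l) (at_bot \<times>\<^sub>F at_top) \<longleftrightarrow>
      (\<forall>e>0. \<forall>\<^sub>F p in at_bot \<times>\<^sub>F at_top. \<bar>integral {fst p..snd p} f - l\<bar> < e)"
    by (simp add: tendsto_iff dist_real_def case_prod_beta)
  have E: "(\<exists>B>0. \<forall>a b. ball 0 B \<subseteq> {a..b} \<longrightarrow> P a b) \<longleftrightarrow>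
      (\<forall>\<^sub>F p in at_bot \<times>\<^sub>F at_top. P (fst p) (snd p))" for P :: "real \<Rightarrow> real \<Rightarrow> bool"
  proof
    assume "\<exists>B>0. \<forall>a b. ball 0 B \<subseteq> {a..b} \<longrightarrow> P a b"
    then obtain B where B: "B > 0" "\<And>a b. ball 0 B \<subseteq> {a..b} \<Longrightarrow> P a b" by blast
    have "P a b" if "a \<le> - B" "b \<ge> B" for a b
    proof (rule B(2), rule subsetI)
      fix x :: real assume "x \<in> ball 0 B"
      then have "\<bar>x\<bar> < B" by (simp add: dist_real_def)
      with that show "x \<in> {a..b}" by (simp add: abs_less_iff)
    qed
    then show "\<forall>\<^sub>F p in at_bot \<times>\<^sub>F at_top. P (fst p) (snd p)"
      unfolding eventually_prod_filter
      by (intro exI[of _ "\<lambda>a. a \<le> - B"] exI[of _ "\<lambda>b. b \<ge> B"])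
        (auto simp: eventually_le_at_bot eventually_ge_at_top)
  next
    assume "\<forall>\<^sub>F p in at_bot \<times>\<^sub>F at_top. P (fst p) (snd p)"
    then obtain Q R where "\<forall>\<^sub>F a in at_bot. Q a" "\<forall>\<^sub>F b in at_top. R b"
      and P: "\<And>a b. Q a \<Longrightarrow> R b \<Longrightarrow> P a b"
      unfolding eventually_prod_filter by auto
    then obtain M N where M: "\<And>a. a \<le> M \<Longrightarrow> Q a" and N: "\<And>b. b \<ge> N \<Longrightarrow> R b"
      unfolding eventually_at_bot_linorder eventually_at_top_linorder by blast
    define B where "B = 1 + \<bar>M\<bar> + \<bar>N\<bar>"
    have "a \<le> M \<and> N \<le> b" if "ball 0 B \<subseteq> {a..b}" for a b
    proof -
      have "- \<bar>M\<bar> \<in> ball 0 B" "\<bar>N\<bar> \<in> ball 0 B" by (auto simp: B_def)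
      with that have "- \<bar>M\<bar> \<in> {a..b}" "\<bar>N\<bar> \<in> {a..b}" by blast+
      then have "a \<le> - \<bar>M\<bar>" "\<bar>N\<bar> \<le> b" by simp_all
      then show ?thesis by linarith
    qed
    then have "\<forall>a b. ball 0 B \<subseteq> {a..b} \<longrightarrow> P a b"
      using M N P by blast
    moreover have "B > 0" by (simp add: B_def)
    ultimately show "\<exists>B>0. \<forall>a b. ball 0 B \<subseteq> {a..b} \<longrightarrow> P a b" by blast
  qed
  show ?thesis
    unfolding L R by (intro all_cong1 imp_cong refl E)
qed

end

theory Submission
  imports Defs
begin

text \<open>
  A change of slow time makes the frequency linear, so that \<open>d\<phi>/ds = a s / \<epsilon> + O(1)\<close> with \<open>s = 0\<close> at the resonance. The
  integral along a solution of a function \<open>F\<close> of zero mean in the phase is compared with the integral along the frozen motion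
  \<open>I = I\<^sub>*\<close>, \<open>\<phi> = \<phi>\<^sub>* + a s\<^sup>2 / (2 \<epsilon>)\<close>, which is an explicit Fresnel type integral of order \<open>sqrt \<epsilon>\<close> up to a boundary
  term. The displacement from the frozen motion is odd in \<open>s\<close> to first order, hence the error at \<open>s\<close> and that at \<open>- s\<close>
  cancel up to \<open>O(s\<^sup>2)\<close>; this suffices for \<open>|s| \<le> sqrt \<epsilon>\<close>. For larger \<open>|s|\<close> the error is integrated by parts repeatedly, which
  leaves boundary terms, namely the corrections \<open>u1\<close> and \<open>v1\<close>, and a resonant term \<open>- \<epsilon> m / (a s)\<close>, where \<open>m\<close> is the
  mean that the second integration by parts produces. With \<open>F\<close> the force, for which \<open>m\<close> vanishes, this is the jump of the
  action. For the phase, it is applied to the oscillating part of the drift, and to the force times the derivative of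
  the accumulated averaged drift. The action equals \<open>J\<^sub>-\<close> before and \<open>J\<^sub>+\<close> after the resonance up to \<open>O(\<epsilon> / s)\<close>, so the
  integral of the resonant term is that for \<open>I\<^sub>*\<close>, which gives the principal value, plus a multiple of
  \<open>\<epsilon> ln \<epsilon> (J\<^sub>+ - J\<^sub>-)\<close>, which gives the logarithmic term.
\<close>

text \<open>The obstacle is the size of the remainder left by the integrations by parts. On one side
  of the resonance it contains \<open>\<epsilon>\<^sup>2 / s ^ 4\<close>, whose integral from
  \<open>sqrt \<epsilon>\<close> on is of order \<open>sqrt \<epsilon>\<close>, as large as the main
  term. This needs a frozen phase that is exactly even in \<open>s\<close>, hence the change of
  time. The change preserves the smoothness of the Hamiltonian: its density \<open>w\<close> has
  order three only, but the change itself has order four. All constants are bounds over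
  \<open>{i0..i1}\<close>, \<open>{-L..M}\<close> and one period of the phase, so they depend
  neither on \<epsilon> nor on the solution. The range \<open>{i0..i1}\<close> is slightly larger
  than that of the action, because the averaged drift is evaluated at \<open>J\<^sub>+\<close> and
  \<open>J\<^sub>-\<close>. The \<open>4\<close> in the logarithmic term is made of
  \<open>ln (sqrt \<epsilon>) = ln \<epsilon> / 2\<close> and of the \<open>1 / 2\<close> in
  \<open>R2\<close>.\<close>

definition d_tau :: "(real \<Rightarrow> real \<Rightarrow> real \<Rightarrow> real) \<Rightarrow> real \<Rightarrow> real \<Rightarrow> real \<Rightarrow> real" where
  "d_tau F I \<phi> \<tau> = deriv (\<lambda>x. F I \<phi> x) \<tau>"

definition has_partials where
  "has_partials U V f f1 f2 f3 \<longleftrightarrow> (\<forall>x\<in>U. \<forall>y. \<forall>z\<in>V.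
     ((\<lambda>t. f t y z) has_real_derivative f1 x y z) (at x) \<and>
     ((\<lambda>t. f x t z) has_real_derivative f2 x y z) (at y) \<and>
     ((\<lambda>t. f x y t) has_real_derivative f3 x y z) (at z))"

text \<open>Smoothness of functions of action, phase and time on \<open>U \<times> UNIV \<times> V\<close> is expressed by partial derivatives
  rather than by \<open>Ck_on\<close>, whose directional derivatives are awkward to compute with.\<close>

primrec cd :: "nat \<Rightarrow> real set \<Rightarrow> real set \<Rightarrow> (real \<Rightarrow> real \<Rightarrow> real \<Rightarrow> real) \<Rightarrow> bool" where
  "cd 0 U V f \<longleftrightarrow> continuous_on (U \<times> UNIV \<times> V) (\<lambda>(x, y, z). f x y z)"
| "cd (Suc k) U V f \<longleftrightarrow> continuous_on (U \<times> UNIV \<times> V) (\<lambda>(x, y, z). f x y z) \<and>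
     has_partials U V f (d_I f) (d_phi f) (d_tau f) \<and>
     cd k U V (d_I f) \<and> cd k U V (d_phi f) \<and> cd k U V (d_tau f)"

section \<open>Calculus of functions with continuous partial derivatives\<close>

lemma has_partialsD:
  assumes "has_partials U V f f1 f2 f3" "x \<in> U" "z \<in> V"
  shows "((\<lambda>t. f t y z) has_real_derivative f1 x y z) (at x)"
    "((\<lambda>t. f x t z) has_real_derivative f2 x y z) (at y)"
    "((\<lambda>t. f x y t) has_real_derivative f3 x y z) (at z)"
  using assms unfolding has_partials_def by blast+

lemma has_partials_imp_eq:
  assumes "has_partials U V f f1 f2 f3" "x \<in> U" "z \<in> V"
  shows "d_I f x y z = f1 x y z" "d_phi f x y z = f2 x y z" "d_tau f x y z = f3 x y z"
  unfolding d_I_def d_phi_def d_tau_def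
  by (rule DERIV_imp_deriv, rule has_partialsD[OF assms])+

text \<open>Openness of \<open>U\<close> and \<open>V\<close> turns equality on the domain into
  equality near each point, so derivatives in action and time carry over; along the phase line the
  functions agree everywhere.\<close>

lemma has_partials_cong:
  assumes "open U" "open V" "\<And>x y z. x \<in> U \<Longrightarrow> z \<in> V \<Longrightarrow> f x y z = g x y z"
    "\<And>x y z. x \<in> U \<Longrightarrow> z \<in> V \<Longrightarrow> f1 x y z = g1 x y z"
    "\<And>x y z. x \<in> U \<Longrightarrow> z \<in> V \<Longrightarrow> f2 x y z = g2 x y z"
    "\<And>x y z. x \<in> U \<Longrightarrow> z \<in> V \<Longrightarrow> f3 x y z = g3 x y z"
    "has_partials U V f f1 f2 f3"
  shows "has_partials U V g g1 g2 g3"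
  unfolding has_partials_def
proof (intro ballI allI conjI)
  fix x y z assume x: "x \<in> U" and z: "z \<in> V"
  have D: "((\<lambda>t. f t y z) has_real_derivative g1 x y z) (at x)"
     "((\<lambda>t. f x t z) has_real_derivative g2 x y z) (at y)"
     "((\<lambda>t. f x y t) has_real_derivative g3 x y z) (at z)"
    using has_partialsD[OF assms(7) x z, of y] unfolding assms(4-6)[OF x z, of y] by blast+
  show "((\<lambda>t. g t y z) has_real_derivative g1 x y z) (at x)"
    by (rule has_field_derivative_transform_within_open[OF D(1) \<open>open U\<close> x]) (use assms(3) z in auto)
  show "((\<lambda>t. g x t z) has_real_derivative g2 x y z) (at y)"
    using D(2) assms(3) x z by simp
  show "((\<lambda>t. g x y t) has_real_derivative g3 x y z) (at z)"
    by (rule has_field_derivative_transform_within_open[OF D(3) \<open>open V\<close> z]) (use assms(3) x in auto)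
qed

lemma cd_cont: "cd k U V f \<Longrightarrow> continuous_on (U \<times> UNIV \<times> V) (\<lambda>(x, y, z). f x y z)"
  by (cases k) auto

lemma cd_partials: "cd (Suc k) U V f \<Longrightarrow> has_partials U V f (d_I f) (d_phi f) (d_tau f)"
  unfolding cd.simps(2) by blast

lemma cd_SucD: "cd (Suc k) U V f \<Longrightarrow> cd k U V f"
proof (induction k arbitrary: f)
  case (Suc k)
  have "cd (Suc k) U V (d_I f)" "cd (Suc k) U V (d_phi f)" "cd (Suc k) U V (d_tau f)"
    using Suc.prems unfolding cd.simps(2)[of "Suc k"] by blast+
  then have "cd k U V (d_I f)" "cd k U V (d_phi f)" "cd k U V (d_tau f)"
    by (blast intro: Suc.IH[of "d_I f"] Suc.IH[of "d_phi f"] Suc.IH[of "d_tau f"])+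
  then show ?case using Suc.prems unfolding cd.simps(2)[of "Suc k"] by simp
qed simp

lemma cd_le: "cd m U V f \<Longrightarrow> k \<le> m \<Longrightarrow> cd k U V f"
  by (induction m) (metis le_zero_eq, metis cd_SucD le_Suc_eq)

declare cd.simps(2) [simp del]

lemma cd_derivs:
  assumes "cd (Suc k) U V f"
  shows "cd k U V (d_I f)" "cd k U V (d_phi f)" "cd k U V (d_tau f)"
  using assms unfolding cd.simps(2) by blast+

lemma cd_cong:
  assumes "open U" "open V" "cd k U V f" "\<And>x y z. x \<in> U \<Longrightarrow> z \<in> V \<Longrightarrow> f x y z = g x y z"
  shows "cd k U V g"
  using assms(3,4)
proof (induction k arbitrary: f g)
  case 0
  have "continuous_on (U \<times> UNIV \<times> V) (\<lambda>(x, y, z). f x y z) \<longleftrightarrow>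
      continuous_on (U \<times> UNIV \<times> V) (\<lambda>(x, y, z). g x y z)"
    by (rule continuous_on_cong) (use 0 in auto)
  with 0 show ?case by simp
next
  case (Suc k)
  have hp: "has_partials U V g (d_I f) (d_phi f) (d_tau f)"
    by (rule has_partials_cong[OF assms(1,2) Suc.prems(2) refl refl refl cd_partials[OF Suc.prems(1)]])
  have eq: "d_I f x y z = d_I g x y z" "d_phi f x y z = d_phi g x y z" "d_tau f x y z = d_tau g x y z"
    if "x \<in> U" "z \<in> V" for x y z
    using has_partials_imp_eq[OF hp that, of y] by auto
  have "continuous_on (U \<times> UNIV \<times> V) (\<lambda>(x, y, z). g x y z)"
    using cd_cont[OF Suc.prems(1)]
    by (rule continuous_on_eq) (use Suc.prems(2) in auto)
  moreover have "cd k U V (d_I g)" "cd k U V (d_phi g)" "cd k U V (d_tau g)"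
    using Suc.IH[of "d_I f" "d_I g", OF _ eq(1)] Suc.IH[of "d_phi f" "d_phi g", OF _ eq(2)]
      Suc.IH[of "d_tau f" "d_tau g", OF _ eq(3)] Suc.prems(1)
    unfolding cd.simps(2) by blast+
  moreover have "has_partials U V g (d_I g) (d_phi g) (d_tau g)"
    by (rule has_partials_cong[OF assms(1,2) refl eq hp])
  ultimately show ?case unfolding cd.simps(2) by blast
qed

text \<open>\<open>cd\<close> refers to the derivatives chosen by \<open>deriv\<close>. Uniqueness
  of derivatives admits any explicit formulas \<open>f1\<close>, \<open>f2\<close>,
  \<open>f3\<close> in their place; the inductions on the order below rest on this.\<close>

lemma cd_SucI:
  assumes "open U" "open V" "continuous_on (U \<times> UNIV \<times> V) (\<lambda>(x, y, z). f x y z)"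
    "has_partials U V f f1 f2 f3" "cd k U V f1" "cd k U V f2" "cd k U V f3"
  shows "cd (Suc k) U V f"
proof -
  have eq: "f1 x y z = d_I f x y z" "f2 x y z = d_phi f x y z" "f3 x y z = d_tau f x y z"
    if "x \<in> U" "z \<in> V" for x y z
    using has_partials_imp_eq[OF assms(4) that, of y] by auto
  have "cd k U V (d_I f)" "cd k U V (d_phi f)" "cd k U V (d_tau f)"
    by (rule cd_cong[OF assms(1,2,5) eq(1)] cd_cong[OF assms(1,2,6) eq(2)] cd_cong[OF assms(1,2,7) eq(3)];
        assumption)+
  moreover have "has_partials U V f (d_I f) (d_phi f) (d_tau f)"
    by (rule has_partials_cong[OF assms(1,2) refl eq assms(4)])
  ultimately show ?thesis using assms(3) unfolding cd.simps(2) by blast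
qed

lemma has_partials_add:
  assumes "has_partials U V f f1 f2 f3" "has_partials U V g g1 g2 g3"
  shows "has_partials U V (\<lambda>x y z. f x y z + g x y z) (\<lambda>x y z. f1 x y z + g1 x y z)
    (\<lambda>x y z. f2 x y z + g2 x y z) (\<lambda>x y z. f3 x y z + g3 x y z)"
  using assms unfolding has_partials_def by (auto intro!: DERIV_add)

lemma has_partials_mult:
  assumes "has_partials U V f f1 f2 f3" "has_partials U V g g1 g2 g3"
  shows "has_partials U V (\<lambda>x y z. f x y z * g x y z)
    (\<lambda>x y z. f1 x y z * g x y z + g1 x y z * f x y z)
    (\<lambda>x y z. f2 x y z * g x y z + g2 x y z * f x y z)
    (\<lambda>x y z. f3 x y z * g x y z + g3 x y z * f x y z)"
  using assms unfolding has_partials_def by (auto intro!: DERIV_mult)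

lemma has_partials_const: "has_partials U V (\<lambda>x y z. c) (\<lambda>x y z. 0) (\<lambda>x y z. 0) (\<lambda>x y z. 0)"
  unfolding has_partials_def by auto

lemma has_partials_phi: "has_partials U V (\<lambda>x y z. y) (\<lambda>x y z. 0) (\<lambda>x y z. 1) (\<lambda>x y z. 0)"
  unfolding has_partials_def by auto

lemma has_partials_tau: "has_partials U V (\<lambda>x y z. z) (\<lambda>x y z. 0) (\<lambda>x y z. 0) (\<lambda>x y z. 1)"
  unfolding has_partials_def by auto

lemma continuous_on_case_add:
  fixes f g :: "real \<Rightarrow> real \<Rightarrow> real \<Rightarrow> real"
  assumes "continuous_on S (\<lambda>(x, y, z). f x y z)" "continuous_on S (\<lambda>(x, y, z). g x y z)"
  shows "continuous_on S (\<lambda>(x, y, z). f x y z + g x y z)"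
  using continuous_on_add[OF assms] by (simp add: case_prod_beta)

lemma continuous_on_case_mult:
  fixes f g :: "real \<Rightarrow> real \<Rightarrow> real \<Rightarrow> real"
  assumes "continuous_on S (\<lambda>(x, y, z). f x y z)" "continuous_on S (\<lambda>(x, y, z). g x y z)"
  shows "continuous_on S (\<lambda>(x, y, z). f x y z * g x y z)"
  using continuous_on_mult[OF assms] by (simp add: case_prod_beta)

lemma cd_const: assumes "open U" "open V" shows "cd k U V (\<lambda>x y z. c)"
proof (induction k arbitrary: c)
  case (Suc k)
  show ?case
    by (rule cd_SucI[OF assms _ has_partials_const]) (auto intro: Suc)
qed auto

lemma cd_phi: assumes "open U" "open V" shows "cd k U V (\<lambda>x y z. y)"
proof (cases k)
  case (Suc j)
  then show ?thesis
    by (auto intro!: cd_SucI[OF assms _ has_partials_phi] cd_const assms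
        continuous_intros simp: case_prod_beta)
qed (auto intro!: continuous_intros simp: case_prod_beta)

lemma cd_tau: assumes "open U" "open V" shows "cd k U V (\<lambda>x y z. z)"
proof (cases k)
  case (Suc j)
  then show ?thesis
    by (auto intro!: cd_SucI[OF assms _ has_partials_tau] cd_const assms
        continuous_intros simp: case_prod_beta)
qed (auto intro!: continuous_intros simp: case_prod_beta)

lemma cd_add:
  assumes "open U" "open V" "cd k U V f" "cd k U V g"
  shows "cd k U V (\<lambda>x y z. f x y z + g x y z)"
  using assms(3,4)
proof (induction k arbitrary: f g)
  case 0
  then show ?case by (auto intro: continuous_on_case_add)
next
  case (Suc k)
  note d = cd_derivs[OF Suc.prems(1)] cd_derivs[OF Suc.prems(2)]
  show ?case
    by (rule cd_SucI[OF assms(1,2) continuous_on_case_add[OF cd_cont[OF Suc.prems(1)] cd_cont[OF Suc.prems(2)]]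
         has_partials_add[OF cd_partials[OF Suc.prems(1)] cd_partials[OF Suc.prems(2)]]
         Suc.IH[OF d(1,4)] Suc.IH[OF d(2,5)] Suc.IH[OF d(3,6)]])
qed

lemma cd_mult:
  assumes "open U" "open V" "cd k U V f" "cd k U V g"
  shows "cd k U V (\<lambda>x y z. f x y z * g x y z)"
  using assms(3,4)
proof (induction k arbitrary: f g)
  case 0
  then show ?case by (auto intro: continuous_on_case_mult)
next
  case (Suc k)
  note d = cd_derivs[OF Suc.prems(1)] cd_derivs[OF Suc.prems(2)]
  note c = cd_SucD[OF Suc.prems(1)] cd_SucD[OF Suc.prems(2)]
  show ?case
    by (rule cd_SucI[OF assms(1,2) continuous_on_case_mult[OF cd_cont[OF Suc.prems(1)] cd_cont[OF Suc.prems(2)]]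
         has_partials_mult[OF cd_partials[OF Suc.prems(1)] cd_partials[OF Suc.prems(2)]]
         cd_add[OF assms(1,2) Suc.IH[OF d(1) c(2)] Suc.IH[OF d(4) c(1)]]
         cd_add[OF assms(1,2) Suc.IH[OF d(2) c(2)] Suc.IH[OF d(5) c(1)]]
         cd_add[OF assms(1,2) Suc.IH[OF d(3) c(2)] Suc.IH[OF d(6) c(1)]]])
qed

lemma cd_cmult:
  assumes "open U" "open V" "cd k U V f"
  shows "cd k U V (\<lambda>x y z. c * f x y z)"
  by (rule cd_mult[OF assms(1,2) cd_const[OF assms(1,2)] assms(3)])

lemma cd_minus:
  assumes "open U" "open V" "cd k U V f"
  shows "cd k U V (\<lambda>x y z. - f x y z)"
  using cd_cmult[OF assms, of "-1"] by simp

lemma cd_diff: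
  assumes "open U" "open V" "cd k U V f" "cd k U V g"
  shows "cd k U V (\<lambda>x y z. f x y z - g x y z)"
  using cd_add[OF assms(1-3) cd_minus[OF assms(1,2,4)]] by simp

lemma cd_inverse:
  assumes "open U" "open V" "cd k U V f" "\<And>x y z. x \<in> U \<Longrightarrow> z \<in> V \<Longrightarrow> f x y z \<noteq> 0"
  shows "cd k U V (\<lambda>x y z. inverse (f x y z))"
  using assms(3)
proof (induction k)
  case 0
  have "continuous_on (U \<times> UNIV \<times> V) (\<lambda>p. inverse ((\<lambda>(x, y, z). f x y z) p))"
    using 0 assms(4) by (intro continuous_on_inverse) auto
  then show ?case by (simp add: case_prod_beta)
next
  case (Suc k)
  have c: "continuous_on (U \<times> UNIV \<times> V) (\<lambda>p. inverse ((\<lambda>(x, y, z). f x y z) p))"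
    using cd_cont[OF Suc.prems] assms(4) by (intro continuous_on_inverse) auto
  note IH = Suc.IH[OF cd_SucD[OF Suc.prems]]
  have hp: "has_partials U V (\<lambda>x y z. inverse (f x y z))
     (\<lambda>x y z. - (inverse (f x y z) * d_I f x y z * inverse (f x y z)))
     (\<lambda>x y z. - (inverse (f x y z) * d_phi f x y z * inverse (f x y z)))
     (\<lambda>x y z. - (inverse (f x y z) * d_tau f x y z * inverse (f x y z)))"
    unfolding has_partials_def
    by (intro ballI allI conjI DERIV_inverse' has_partialsD[OF cd_partials[OF Suc.prems]] assms(4))
  note m = cd_mult[OF assms(1,2)]
  note d = cd_derivs[OF Suc.prems(1)]
  show ?case
    by (rule cd_SucI[OF assms(1,2) _ hp
          cd_minus[OF assms(1,2) m[OF m[OF IH d(1)] IH]] cd_minus[OF assms(1,2) m[OF m[OF IH d(2)] IH]]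
          cd_minus[OF assms(1,2) m[OF m[OF IH d(3)] IH]]])
      (use c in \<open>simp add: case_prod_beta\<close>)
qed

text \<open>The derivative contains the reciprocal root, which \<open>cd_inverse\<close> makes as
  smooth as the root itself, so the order rises by one at each step.\<close>

lemma cd_sqrt:
  assumes "open U" "open V" "cd k U V f" "\<And>x y z. x \<in> U \<Longrightarrow> z \<in> V \<Longrightarrow> f x y z > 0"
  shows "cd k U V (\<lambda>x y z. sqrt (f x y z))"
  using assms(3)
proof (induction k)
  case 0
  have "continuous_on (U \<times> UNIV \<times> V) (\<lambda>p. sqrt ((\<lambda>(x, y, z). f x y z) p))"
    using 0 by (intro continuous_on_real_sqrt) auto
  then show ?case by (simp add: case_prod_beta)
next
  case (Suc k)
  have c: "continuous_on (U \<times> UNIV \<times> V) (\<lambda>p. sqrt ((\<lambda>(x, y, z). f x y z) p))"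
    using cd_cont[OF Suc.prems] by (intro continuous_on_real_sqrt) auto
  have nz: "sqrt (f x y z) \<noteq> 0" if "x \<in> U" "z \<in> V" for x y z
    using assms(4)[OF that, of y] by simp
  have S: "cd k U V (\<lambda>x y z. sqrt (f x y z))"
    by (rule Suc.IH[OF cd_SucD[OF Suc.prems]])
  have IH: "cd k U V (\<lambda>x y z. inverse (sqrt (f x y z)))"
    by (rule cd_inverse[OF assms(1,2) S nz])
  have hp: "has_partials U V (\<lambda>x y z. sqrt (f x y z))
     (\<lambda>x y z. 1/2 * inverse (sqrt (f x y z)) * d_I f x y z)
     (\<lambda>x y z. 1/2 * inverse (sqrt (f x y z)) * d_phi f x y z)
     (\<lambda>x y z. 1/2 * inverse (sqrt (f x y z)) * d_tau f x y z)"
    unfolding has_partials_def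
  proof (intro ballI allI conjI)
    fix x y z assume xz: "x \<in> U" "z \<in> V"
    have D: "(sqrt has_real_derivative 1/2 * inverse (sqrt (f x y z))) (at (f x y z))"
      using DERIV_real_sqrt[OF assms(4)[OF xz, of y]] by (simp add: mult.commute)
    note P = has_partialsD[OF cd_partials[OF Suc.prems] xz, of y]
    show "((\<lambda>t. sqrt (f t y z)) has_real_derivative 1/2 * inverse (sqrt (f x y z)) * d_I f x y z) (at x)"
      by (rule DERIV_chain2[OF D P(1)])
    show "((\<lambda>t. sqrt (f x t z)) has_real_derivative 1/2 * inverse (sqrt (f x y z)) * d_phi f x y z) (at y)"
      by (rule DERIV_chain2[OF D P(2)])
    show "((\<lambda>t. sqrt (f x y t)) has_real_derivative 1/2 * inverse (sqrt (f x y z)) * d_tau f x y z) (at z)"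
      by (rule DERIV_chain2[OF D P(3)])
  qed
  note m = cd_mult[OF assms(1,2)]
  note d = cd_derivs[OF Suc.prems(1)]
  show ?case
    by (rule cd_SucI[OF assms(1,2) _ hp m[OF cd_cmult[OF assms(1,2) IH] d(1)]
          m[OF cd_cmult[OF assms(1,2) IH] d(2)] m[OF cd_cmult[OF assms(1,2) IH] d(3)]])
      (use c in \<open>simp add: case_prod_beta\<close>)
qed

section \<open>Passage from Frechet to partial derivatives\<close>

text \<open>The partial derivatives are the Frechet derivative applied to the three unit vectors,
  and the definition of \<open>Ck_on\<close> makes exactly such functions smooth of one order
  less.\<close>

lemma Ck_on_imp_cd:
  assumes "open U" "open V" "Ck_on k (U \<times> UNIV \<times> V) (\<lambda>(x, y, z). f x y z)"
  shows "cd k U V f"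
  using assms(3)
proof (induction k arbitrary: f)
  case 0
  then show ?case by simp
next
  case (Suc k)
  let ?F = "\<lambda>(x, y, z). f x y z"
  let ?S = "U \<times> (UNIV :: real set) \<times> V"
  have diff: "(?F has_derivative frechet_derivative ?F (at p)) (at p)" if "p \<in> ?S" for p
  proof -
    have "?F differentiable (at p)" using Suc.prems that unfolding Ck_on.simps by blast
    then show ?thesis by (simp only: frechet_derivative_works)
  qed
  have c: "continuous_on ?S ?F"
    by (intro continuous_at_imp_continuous_on ballI has_derivative_continuous[OF diff])
  have IH: "cd k U V (\<lambda>x y z. frechet_derivative ?F (at (x, y, z)) v)" for v
  proof (rule Suc.IH)
    have "Ck_on k ?S (\<lambda>p. frechet_derivative ?F (at p) v)"
      using Suc.prems unfolding Ck_on.simps by blast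
    moreover have "(\<lambda>(x, y, z). frechet_derivative ?F (at (x, y, z)) v) = (\<lambda>p. frechet_derivative ?F (at p) v)"
      by (rule ext) (simp only: split_paired_all case_prod_conv)
    ultimately show "Ck_on k ?S (\<lambda>(x, y, z). frechet_derivative ?F (at (x, y, z)) v)" by (simp only:)
  qed
  have hp: "has_partials U V f (\<lambda>x y z. frechet_derivative ?F (at (x, y, z)) (1, 0, 0))
     (\<lambda>x y z. frechet_derivative ?F (at (x, y, z)) (0, 1, 0))
     (\<lambda>x y z. frechet_derivative ?F (at (x, y, z)) (0, 0, 1))"
    unfolding has_partials_def
  proof (intro ballI allI conjI)
    fix x y z assume xz: "x \<in> U" "z \<in> V"
    let ?D = "frechet_derivative ?F (at (x, y, z))"
    have D: "(?F has_derivative ?D) (at (x, y, z))" using xz by (intro diff) auto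
    interpret D: bounded_linear ?D using D by (rule has_derivative_bounded_linear)
    \<comment> \<open>A curve with velocity \<open>v\<close> through the point gives the directional
      derivative along \<open>v\<close>; it is used with the three coordinate lines.\<close>
    have g: "((\<lambda>t. ?F (g t)) has_real_derivative ?D v) (at s)"
      if g: "(g has_derivative (\<lambda>h. h *\<^sub>R v)) (at s)" and "g s = (x, y, z)" for g s v
    proof -
      have "((\<lambda>t. ?F (g t)) has_derivative (\<lambda>h. ?D (h *\<^sub>R v))) (at s)"
        by (rule has_derivative_compose[OF g]) (use D that in simp)
      then show ?thesis by (simp add: has_field_derivative_def D.scaleR mult_commute_abs)
    qed
    show "((\<lambda>t. f t y z) has_real_derivative ?D (1, 0, 0)) (at x)"
    proof -
      have "((\<lambda>t. (t, y, z)) has_derivative (\<lambda>h. h *\<^sub>R (1, 0, 0))) (at x)"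
        by (auto intro!: derivative_eq_intros simp: zero_prod_def)
      from g[OF this refl] show ?thesis by simp
    qed
    show "((\<lambda>t. f x t z) has_real_derivative ?D (0, 1, 0)) (at y)"
    proof -
      have "((\<lambda>t. (x, t, z)) has_derivative (\<lambda>h. h *\<^sub>R (0, 1, 0))) (at y)"
        by (auto intro!: derivative_eq_intros)
      from g[OF this refl] show ?thesis by simp
    qed
    show "((\<lambda>t. f x y t) has_real_derivative ?D (0, 0, 1)) (at z)"
    proof -
      have "((\<lambda>t. (x, y, t)) has_derivative (\<lambda>h. h *\<^sub>R (0, 0, 1))) (at z)"
        by (auto intro!: derivative_eq_intros)
      from g[OF this refl] show ?thesis by simp
    qed
  qed
  show ?case
    by (rule cd_SucI[OF assms(1,2) c hp IH IH IH])
qed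

text \<open>The frequency depends on time alone, but is treated as a function of all three
  variables, so that one calculus covers both data.\<close>

lemma Ck_on_imp_cd_tau:
  assumes "open U" "open V" "Ck_on k V g"
  shows "cd k U V (\<lambda>x y z. g z)"
  using assms(3)
proof (induction k arbitrary: g)
  case 0
  then have "continuous_on V g" by simp
  then have "continuous_on (U \<times> UNIV \<times> V) (\<lambda>p. g (snd (snd p)))"
    by (rule continuous_on_compose2[where g=g]) (auto intro!: continuous_intros)
  then show ?case by (simp add: case_prod_beta)
next
  case (Suc k)
  have D: "(g has_real_derivative frechet_derivative g (at z) 1) (at z)" if "z \<in> V" for z
  proof -
    have D: "(g has_derivative frechet_derivative g (at z)) (at z)"
      using Suc.prems that unfolding Ck_on.simps frechet_derivative_works[symmetric] by blast
    interpret D: bounded_linear "frechet_derivative g (at z)" using D by (rule has_derivative_bounded_linear)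
    have "frechet_derivative g (at z) h = frechet_derivative g (at z) 1 * h" for h
      using D.scaleR[of h 1] by simp
    then have "frechet_derivative g (at z) = (\<lambda>h. frechet_derivative g (at z) 1 * h)" by blast
    then show ?thesis using D unfolding has_field_derivative_def by simp
  qed
  have "continuous_on V g"
    using D by (intro continuous_at_imp_continuous_on ballI) (rule DERIV_isCont)
  then have "continuous_on (U \<times> UNIV \<times> V) (\<lambda>p. g (snd (snd p)))"
    by (rule continuous_on_compose2[where g=g]) (auto intro!: continuous_intros)
  then have c: "continuous_on (U \<times> UNIV \<times> V) (\<lambda>(x, y, z). g z)" by (simp add: case_prod_beta)
  have IH: "cd k U V (\<lambda>x y z. frechet_derivative g (at z) 1)"
    using Suc.prems by (intro Suc.IH) simp
  have hp: "has_partials U V (\<lambda>x y z. g z) (\<lambda>x y z. 0) (\<lambda>x y z. 0) (\<lambda>x y z. frechet_derivative g (at z) 1)"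
    unfolding has_partials_def using D by simp
  show ?case by (rule cd_SucI[OF assms(1,2) c hp cd_const cd_const IH]) fact+
qed

section \<open>Integrals depending on parameters\<close>

text \<open>One family of integrands serves the phase mean (\<open>\<alpha> = 0\<close>,
  \<open>\<beta> = t\<close>), the primitive in the phase (\<open>\<alpha> = t\<close>) and the
  primitive in time (\<open>\<gamma> = t\<close>).\<close>

lemma continuous_on_param_integrand:
  fixes f :: "real \<Rightarrow> real \<Rightarrow> real \<Rightarrow> real" and l u :: real and c \<alpha> \<beta> \<gamma> :: "real \<Rightarrow> real"
  assumes "continuous_on (U \<times> UNIV \<times> V) (\<lambda>(x, y, z). f x y z)"
    "continuous_on {l..u} c" "continuous_on {l..u} \<alpha>" "continuous_on {l..u} \<beta>" "continuous_on {l..u} \<gamma>"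
    "\<And>t z. t \<in> {l..u} \<Longrightarrow> z \<in> V \<Longrightarrow> \<gamma> t * z \<in> V"
  shows "continuous_on ((U \<times> UNIV \<times> V) \<times> {l..u})
    (\<lambda>((x, y, z), t). c t * f x (\<alpha> t * y + \<beta> t) (\<gamma> t * z))"
proof -
  have s: "continuous_on ((U \<times> UNIV \<times> V) \<times> {l..u}) (\<lambda>p. g (snd p))" if "continuous_on {l..u} g"
    for g :: "real \<Rightarrow> real"
    by (rule continuous_on_compose2[OF that]) (auto intro!: continuous_intros)
  have "continuous_on ((U \<times> UNIV \<times> V) \<times> {l..u})
    (\<lambda>p. c (snd p) * (\<lambda>(x, y, z). f x y z)
      (fst (fst p), \<alpha> (snd p) * fst (snd (fst p)) + \<beta> (snd p), \<gamma> (snd p) * snd (snd (fst p))))"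
    by (rule continuous_on_mult[OF s[OF assms(2)]], rule continuous_on_compose2[OF assms(1)])
      (auto intro!: continuous_on_Pair continuous_on_add continuous_on_mult s assms(3-5)
        continuous_on_fst continuous_on_snd continuous_on_id intro: assms(6))
  then show ?thesis by (simp add: case_prod_beta)
qed

lemma has_partials_integral:
  fixes f :: "real \<Rightarrow> real \<Rightarrow> real \<Rightarrow> real" and l u :: real and c \<alpha> \<beta> \<gamma> :: "real \<Rightarrow> real"
  assumes U: "open U" "convex U" and V: "open V" "convex V"
    and f: "cd (Suc k) U V f"
    and c: "continuous_on {l..u} c" "continuous_on {l..u} \<alpha>" "continuous_on {l..u} \<beta>" "continuous_on {l..u} \<gamma>"
      "\<And>t z. t \<in> {l..u} \<Longrightarrow> z \<in> V \<Longrightarrow> \<gamma> t * z \<in> V"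
  shows "has_partials U V (\<lambda>x y z. integral {l..u} (\<lambda>t. c t * f x (\<alpha> t * y + \<beta> t) (\<gamma> t * z)))
    (\<lambda>x y z. integral {l..u} (\<lambda>t. c t * d_I f x (\<alpha> t * y + \<beta> t) (\<gamma> t * z)))
    (\<lambda>x y z. integral {l..u} (\<lambda>t. (c t * \<alpha> t) * d_phi f x (\<alpha> t * y + \<beta> t) (\<gamma> t * z)))
    (\<lambda>x y z. integral {l..u} (\<lambda>t. (c t * \<gamma> t) * d_tau f x (\<alpha> t * y + \<beta> t) (\<gamma> t * z)))"
  unfolding has_partials_def
proof (intro ballI allI conjI)
  fix x y z assume x: "x \<in> U" and z: "z \<in> V"
  note P = has_partialsD[OF cd_partials[OF f]]
  note F = continuous_on_param_integrand[OF cd_cont[OF f] c]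
  have ca: "continuous_on {l..u} (\<lambda>t. c t * \<alpha> t)" "continuous_on {l..u} (\<lambda>t. c t * \<gamma> t)"
    using c by (auto intro!: continuous_intros)
  note F1 = continuous_on_param_integrand[OF cd_cont[OF cd_derivs(1)[OF f]] c]
  note F2 = continuous_on_param_integrand[OF cd_cont[OF cd_derivs(2)[OF f]] ca(1) c(2-5)]
  note F3 = continuous_on_param_integrand[OF cd_cont[OF cd_derivs(3)[OF f]] ca(2) c(2-5)]
  have I: "(\<lambda>t. c t * f x (\<alpha> t * y + \<beta> t) (\<gamma> t * z)) integrable_on cbox l u"
    if "x \<in> U" "z \<in> V" for x y z
  proof -
    have "continuous_on (cbox l u) (\<lambda>t. (\<lambda>((x, y, z), t). c t * f x (\<alpha> t * y + \<beta> t) (\<gamma> t * z)) ((x, y, z), t))"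
      by (rule continuous_on_compose2[OF F]) (auto intro!: continuous_intros simp: that)
    then show ?thesis by (intro integrable_continuous) simp
  qed
  show "((\<lambda>x. integral {l..u} (\<lambda>t. c t * f x (\<alpha> t * y + \<beta> t) (\<gamma> t * z))) has_real_derivative
      integral {l..u} (\<lambda>t. c t * d_I f x (\<alpha> t * y + \<beta> t) (\<gamma> t * z))) (at x)"
  proof -
    have "((\<lambda>x. integral (cbox l u) (\<lambda>t. c t * f x (\<alpha> t * y + \<beta> t) (\<gamma> t * z))) has_real_derivative
      integral (cbox l u) (\<lambda>t. c t * d_I f x (\<alpha> t * y + \<beta> t) (\<gamma> t * z))) (at x within U)"
    proof (rule leibniz_rule_field_derivative[OF _ I _ x U(2)])
      show "continuous_on (U \<times> cbox l u) (\<lambda>(x, t). c t * d_I f x (\<alpha> t * y + \<beta> t) (\<gamma> t * z))"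
      proof -
        have "continuous_on (U \<times> {l..u}) (\<lambda>p. (\<lambda>((x, y, z), t). c t * d_I f x (\<alpha> t * y + \<beta> t) (\<gamma> t * z)) ((fst p, y, z), snd p))"
          by (rule continuous_on_compose2[OF F1]) (use x z in \<open>auto intro!: continuous_intros\<close>)
        then show ?thesis by (simp add: case_prod_beta)
      qed
      show "((\<lambda>x. c t * f x (\<alpha> t * y + \<beta> t) (\<gamma> t * z)) has_real_derivative
          c t * d_I f x' (\<alpha> t * y + \<beta> t) (\<gamma> t * z)) (at x' within U)" if "x' \<in> U" "t \<in> cbox l u" for x' t
        by (rule DERIV_cmult[OF has_field_derivative_at_within[OF P(1)[OF that(1) c(5)[OF _ z]]]])
          (use that in simp)
    qed (use z in auto)
    then show ?thesis using at_within_open[OF x U(1)] by simp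
  qed
  show "((\<lambda>y. integral {l..u} (\<lambda>t. c t * f x (\<alpha> t * y + \<beta> t) (\<gamma> t * z))) has_real_derivative
      integral {l..u} (\<lambda>t. (c t * \<alpha> t) * d_phi f x (\<alpha> t * y + \<beta> t) (\<gamma> t * z))) (at y)"
  proof -
    have "((\<lambda>y. integral (cbox l u) (\<lambda>t. c t * f x (\<alpha> t * y + \<beta> t) (\<gamma> t * z))) has_real_derivative
      integral (cbox l u) (\<lambda>t. (c t * \<alpha> t) * d_phi f x (\<alpha> t * y + \<beta> t) (\<gamma> t * z))) (at y within UNIV)"
    proof (rule leibniz_rule_field_derivative[OF _ I])
      show "continuous_on (UNIV \<times> cbox l u) (\<lambda>(y, t). (c t * \<alpha> t) * d_phi f x (\<alpha> t * y + \<beta> t) (\<gamma> t * z))"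
      proof -
        have "continuous_on (UNIV \<times> {l..u}) (\<lambda>p. (\<lambda>((x, y, z), t). (c t * \<alpha> t) * d_phi f x (\<alpha> t * y + \<beta> t) (\<gamma> t * z)) ((x, fst p, z), snd p))"
          by (rule continuous_on_compose2[OF F2]) (use x z in \<open>auto intro!: continuous_intros\<close>)
        then show ?thesis by (simp add: case_prod_beta)
      qed
      show "((\<lambda>y. c t * f x (\<alpha> t * y + \<beta> t) (\<gamma> t * z)) has_real_derivative
          (c t * \<alpha> t) * d_phi f x (\<alpha> t * y' + \<beta> t) (\<gamma> t * z)) (at y' within UNIV)" if "t \<in> cbox l u" for y' t
      proof -
        have t: "\<gamma> t * z \<in> V" using c(5) that z by simp
        have "((\<lambda>y. f x (\<alpha> t * y + \<beta> t) (\<gamma> t * z)) has_real_derivative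
          d_phi f x (\<alpha> t * y' + \<beta> t) (\<gamma> t * z) * \<alpha> t) (at y')"
          by (rule DERIV_chain2[where f="\<lambda>y. f x y (\<gamma> t * z)" and g="\<lambda>y. \<alpha> t * y + \<beta> t", OF P(2)[OF x t]])
            (auto intro!: derivative_eq_intros)
        from DERIV_cmult[OF this, of "c t"] show ?thesis by (simp add: mult_ac)
      qed
    qed (use x z in auto)
    then show ?thesis by simp
  qed
  show "((\<lambda>z. integral {l..u} (\<lambda>t. c t * f x (\<alpha> t * y + \<beta> t) (\<gamma> t * z))) has_real_derivative
      integral {l..u} (\<lambda>t. (c t * \<gamma> t) * d_tau f x (\<alpha> t * y + \<beta> t) (\<gamma> t * z))) (at z)"
  proof -
    have "((\<lambda>z. integral (cbox l u) (\<lambda>t. c t * f x (\<alpha> t * y + \<beta> t) (\<gamma> t * z))) has_real_derivative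
      integral (cbox l u) (\<lambda>t. (c t * \<gamma> t) * d_tau f x (\<alpha> t * y + \<beta> t) (\<gamma> t * z))) (at z within V)"
    proof (rule leibniz_rule_field_derivative[OF _ I _ z V(2)])
      show "continuous_on (V \<times> cbox l u) (\<lambda>(z, t). (c t * \<gamma> t) * d_tau f x (\<alpha> t * y + \<beta> t) (\<gamma> t * z))"
      proof -
        have "continuous_on (V \<times> {l..u}) (\<lambda>p. (\<lambda>((x, y, z), t). (c t * \<gamma> t) * d_tau f x (\<alpha> t * y + \<beta> t) (\<gamma> t * z)) ((x, y, fst p), snd p))"
          by (rule continuous_on_compose2[OF F3]) (use x z in \<open>auto intro!: continuous_intros\<close>)
        then show ?thesis by (simp add: case_prod_beta)
      qed
      show "((\<lambda>z. c t * f x (\<alpha> t * y + \<beta> t) (\<gamma> t * z)) has_real_derivative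
          (c t * \<gamma> t) * d_tau f x (\<alpha> t * y + \<beta> t) (\<gamma> t * z')) (at z' within V)"
        if "z' \<in> V" "t \<in> cbox l u" for z' t
      proof -
        have t: "\<gamma> t * z' \<in> V" using c(5) that by simp
        have "((\<lambda>z. f x (\<alpha> t * y + \<beta> t) (\<gamma> t * z)) has_real_derivative
          d_tau f x (\<alpha> t * y + \<beta> t) (\<gamma> t * z') * \<gamma> t) (at z' within V)"
          by (rule DERIV_chain2[where f="f x (\<alpha> t * y + \<beta> t)" and g="\<lambda>z. \<gamma> t * z", OF P(3)[OF x t]])
            (rule DERIV_cmult_Id)
        from DERIV_cmult[OF this, of "c t"] show ?thesis by (simp add: mult_ac)
      qed
    qed (use x in auto)
    then show ?thesis using at_within_open[OF z V(1)] by simp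
  qed
qed

text \<open>Differentiation in the phase or in time multiplies the weight \<open>c\<close> by
  \<open>\<alpha>\<close> or \<open>\<gamma>\<close>, so the family is closed under differentiation
  and the induction runs over all weights.\<close>

lemma cd_integral:
  fixes f :: "real \<Rightarrow> real \<Rightarrow> real \<Rightarrow> real" and l u :: real and c \<alpha> \<beta> \<gamma> :: "real \<Rightarrow> real"
  assumes U: "open U" "convex U" and V: "open V" "convex V"
    and f: "cd k U V f"
    and c: "continuous_on {l..u} c" "continuous_on {l..u} \<alpha>" "continuous_on {l..u} \<beta>" "continuous_on {l..u} \<gamma>"
      "\<And>t z. t \<in> {l..u} \<Longrightarrow> z \<in> V \<Longrightarrow> \<gamma> t * z \<in> V"
  shows "cd k U V (\<lambda>x y z. integral {l..u} (\<lambda>t. c t * f x (\<alpha> t * y + \<beta> t) (\<gamma> t * z)))"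
proof -
  have cont: "continuous_on (U \<times> UNIV \<times> V)
      (\<lambda>(x, y, z). integral {l..u} (\<lambda>t. c t * f x (\<alpha> t * y + \<beta> t) (\<gamma> t * z)))"
    if "continuous_on {l..u} c" "continuous_on (U \<times> UNIV \<times> V) (\<lambda>(x, y, z). f x y z)"
    for c :: "real \<Rightarrow> real" and f :: "real \<Rightarrow> real \<Rightarrow> real \<Rightarrow> real"
    using integral_continuous_on_param[of "U \<times> UNIV \<times> V" l u
        "\<lambda>(x, y, z) t. c t * f x (\<alpha> t * y + \<beta> t) (\<gamma> t * z)"]
      continuous_on_param_integrand[OF that(2,1) c(2-5)] by (simp add: case_prod_beta)
  show ?thesis using f c(1)
  proof (induction k arbitrary: f c)
    case 0
    then show ?case by (simp add: cont)
  next
    case (Suc k)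
    have ca: "continuous_on {l..u} (\<lambda>t. c t * \<alpha> t)" "continuous_on {l..u} (\<lambda>t. c t * \<gamma> t)"
      using c Suc.prems by (auto intro!: continuous_intros)
    note d = cd_derivs[OF Suc.prems(1)]
    show ?case
      by (rule cd_SucI[OF U(1) V(1) cont[OF Suc.prems(2) cd_cont[OF Suc.prems(1)]]
          has_partials_integral[OF U V Suc.prems c(2-4)]
          Suc.IH[OF d(1) Suc.prems(2)] Suc.IH[OF d(2) ca(1)] Suc.IH[OF d(3) ca(2)]]) (rule c(5))
  qed
qed

text \<open>The derivative of \<open>S\<close> is prescribed as a function \<open>W\<close> of the
  value \<open>S z\<close>, so the time derivative of a composition is again a composition, of
  \<open>d_tau f * W\<close> with \<open>S\<close>. The bound \<open>Suc n\<close> says that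
  \<open>S\<close> is smoother than \<open>W\<close> by one order; thus a Hamiltonian of order four
  survives a time change whose density has order three.\<close>

lemma cd_comp_tau:
  assumes "open U" "open V" "open V'" "cd n U V (\<lambda>x y z. W z)"
    and S: "\<And>z. z \<in> V' \<Longrightarrow> S z \<in> V" "\<And>z. z \<in> V' \<Longrightarrow> (S has_real_derivative W (S z)) (at z)"
    and "k \<le> Suc n" "cd k U V f"
  shows "cd k U V' (\<lambda>x y z. f x y (S z))"
proof -
  have cS: "continuous_on V' S"
    using S(2) by (intro continuous_at_imp_continuous_on ballI) (rule DERIV_isCont)
  have cont: "continuous_on (U \<times> UNIV \<times> V') (\<lambda>(x, y, z). f x y (S z))"
    if "continuous_on (U \<times> UNIV \<times> V) (\<lambda>(x, y, z). f x y z)" for f :: "real \<Rightarrow> real \<Rightarrow> real \<Rightarrow> real"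
  proof -
    have "continuous_on (U \<times> UNIV \<times> V') (\<lambda>p. (\<lambda>(x, y, z). f x y z) (fst p, fst (snd p), S (snd (snd p))))"
      by (rule continuous_on_compose2[OF that])
        (auto intro!: continuous_intros continuous_on_compose2[OF cS] S(1))
    then show ?thesis by (simp add: case_prod_beta)
  qed
  show ?thesis using assms(7,8)
  proof (induction k arbitrary: f)
    case 0
    then show ?case by (simp add: cont)
  next
    case (Suc k)
    note d = cd_derivs[OF Suc.prems(2)]
    have k: "k \<le> Suc n" "k \<le> n" using Suc.prems by auto
    have hp: "has_partials U V' (\<lambda>x y z. f x y (S z)) (\<lambda>x y z. d_I f x y (S z)) (\<lambda>x y z. d_phi f x y (S z))
       (\<lambda>x y z. d_tau f x y (S z) * W (S z))"
      unfolding has_partials_def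
    proof (intro ballI allI conjI)
      fix x y z assume x: "x \<in> U" and z: "z \<in> V'"
      note P = has_partialsD[OF cd_partials[OF Suc.prems(2)] x S(1)[OF z], of y]
      show "((\<lambda>t. f t y (S z)) has_real_derivative d_I f x y (S z)) (at x)" by (rule P(1))
      show "((\<lambda>t. f x t (S z)) has_real_derivative d_phi f x y (S z)) (at y)" by (rule P(2))
      show "((\<lambda>t. f x y (S t)) has_real_derivative d_tau f x y (S z) * W (S z)) (at z)"
        by (rule DERIV_chain2[OF P(3) S(2)[OF z]])
    qed
    show ?case
      by (rule cd_SucI[OF assms(1,3) cont[OF cd_cont[OF Suc.prems(2)]] hp
          Suc.IH[OF k(1) d(1)] Suc.IH[OF k(1) d(2)]
          Suc.IH[OF k(1) cd_mult[OF assms(1,2) d(3) cd_le[OF assms(4) k(2)]]]])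
  qed
qed

section \<open>Differentiability and the chain rule\<close>

lemma cd_has_derivative:
  assumes U: "open U" and V: "open V" and f: "cd (Suc k) U V f" and x: "x \<in> U" and z: "z \<in> V"
  shows "((\<lambda>(x, y, z). f x y z) has_derivative
    (\<lambda>(a, b, c). d_I f x y z * a + d_phi f x y z * b + d_tau f x y z * c)) (at (x, y, z))"
  unfolding has_derivative_at_alt
proof (intro conjI allI impI)
  show "bounded_linear (\<lambda>(a, b, c). d_I f x y z * a + d_phi f x y z * b + d_tau f x y z * c)"
    unfolding case_prod_beta by (intro bounded_linear_intros)
  fix e :: real assume e: "e > 0"
  let ?S = "U \<times> (UNIV :: real set) \<times> V"
  have oS: "open ?S" using U V by (intro open_Times) auto
  have near: "\<exists>d>0. \<forall>q. dist q (x, y, z) < d \<longrightarrow> \<bar>(\<lambda>(x, y, z). g x y z) q - g x y z\<bar> < e / 3"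
    if "continuous_on ?S (\<lambda>(x, y, z). g x y z)" for g :: "real \<Rightarrow> real \<Rightarrow> real \<Rightarrow> real"
  proof -
    have "isCont (\<lambda>(x, y, z). g x y z) (x, y, z)"
      using that oS x z by (subst (asm) continuous_on_eq_continuous_at) auto
    then show ?thesis using e unfolding continuous_at_eps_delta dist_real_def
      by (metis (no_types, lifting) case_prod_conv divide_pos_pos zero_less_numeral)
  qed
  note d = cd_derivs[OF f]
  obtain d1 where d1: "d1 > 0" "\<And>q. dist q (x, y, z) < d1 \<Longrightarrow> \<bar>(\<lambda>(x, y, z). d_I f x y z) q - d_I f x y z\<bar> < e / 3"
    using near[OF cd_cont[OF d(1)]] by blast
  obtain d2 where d2: "d2 > 0" "\<And>q. dist q (x, y, z) < d2 \<Longrightarrow> \<bar>(\<lambda>(x, y, z). d_phi f x y z) q - d_phi f x y z\<bar> < e / 3"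
    using near[OF cd_cont[OF d(2)]] by blast
  obtain d3 where d3: "d3 > 0" "\<And>q. dist q (x, y, z) < d3 \<Longrightarrow> \<bar>(\<lambda>(x, y, z). d_tau f x y z) q - d_tau f x y z\<bar> < e / 3"
    using near[OF cd_cont[OF d(3)]] by blast
  obtain d4 where d4: "d4 > 0" "ball (x, y, z) d4 \<subseteq> ?S"
    using oS x z unfolding open_contains_ball by (metis SigmaI UNIV_I)
  \<comment> \<open>With the division by 3, three coordinates within \<open>r\<close> of the centre
    give a distance below each of the four radii.\<close>
  define r where "r = Min {d1, d2, d3, d4} / 3"
  have r: "r > 0" "3 * r \<le> d1" "3 * r \<le> d2" "3 * r \<le> d3" "3 * r \<le> d4" using d1 d2 d3 d4 by (auto simp: r_def)
  have nb: "dist (x', y', z') (x, y, z) < 3 * r" if "\<bar>x' - x\<bar> < r" "\<bar>y' - y\<bar> < r" "\<bar>z' - z\<bar> < r" for x' y' z'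
  proof -
    have "dist (x', y', z') (x, y, z) = norm (x' - x, y' - y, z' - z)" by (simp add: dist_norm)
    also have "\<dots> \<le> norm (x' - x) + (norm (y' - y) + norm (z' - z))"
      by (rule order_trans[OF norm_Pair_le add_left_mono[OF norm_Pair_le]])
    finally show ?thesis using that by simp
  qed
  have inS: "(x', y', z') \<in> ?S" if "\<bar>x' - x\<bar> < r" "\<bar>y' - y\<bar> < r" "\<bar>z' - z\<bar> < r" for x' y' z'
  proof -
    have "(x', y', z') \<in> ball (x, y, z) d4" using nb[OF that] r by (simp add: dist_commute)
    then show "(x', y', z') \<in> ?S" using d4(2) by blast
  qed
  have inU: "x' \<in> U" if "\<bar>x' - x\<bar> < r" for x' using inS[OF that, of y z] r by simp
  have inV: "z' \<in> V" if "\<bar>z' - z\<bar> < r" for z' using inS[of x y, OF _ _ that] r by simp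
  show "\<exists>d>0. \<forall>q. norm (q - (x, y, z)) < d \<longrightarrow>
      norm ((case q of (x, y, z) \<Rightarrow> f x y z) - (case (x, y, z) of (x, y, z) \<Rightarrow> f x y z) -
        (case q - (x, y, z) of (a, b, c) \<Rightarrow> d_I f x y z * a + d_phi f x y z * b + d_tau f x y z * c))
      \<le> e * norm (q - (x, y, z))"
  proof (intro exI[of _ r] conjI allI impI r(1))
    fix q :: "real \<times> real \<times> real" assume q: "norm (q - (x, y, z)) < r"
    obtain x' y' z' where q': "q = (x', y', z')" by (cases q)
    define N where "N = norm (q - (x, y, z))"
    have "\<bar>x' - x\<bar> \<le> N" using norm_fst_le[of "x' - x" "(y' - y, z' - z)"] by (simp add: N_def q')
    moreover have "norm (y' - y, z' - z) \<le> N" using norm_snd_le[of "(y' - y, z' - z)" "x' - x"] by (simp add: N_def q')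
    moreover have "\<bar>y' - y\<bar> \<le> norm (y' - y, z' - z)" "\<bar>z' - z\<bar> \<le> norm (y' - y, z' - z)"
      using norm_fst_le[of "y' - y" "z' - z"] norm_snd_le[of "z' - z" "y' - y"] by auto
    ultimately have N: "\<bar>x' - x\<bar> \<le> N" "\<bar>y' - y\<bar> \<le> N" "\<bar>z' - z\<bar> \<le> N" by linarith+
    have Nr: "N < r" using q by (simp add: N_def)
    \<comment> \<open>Mean value inequality for \<open>h\<close> minus its linear part, with a share
      of \<open>e / 3\<close> for each of the three coordinate steps from \<open>(x, y, z)\<close>
      to \<open>(x', y', z')\<close>.\<close>
    have seg: "\<bar>h u - h v - c * (u - v)\<bar> \<le> e / 3 * \<bar>u - v\<bar>"
      if "\<And>t. t \<in> closed_segment u v \<Longrightarrow> (h has_real_derivative h' t) (at t)"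
        "\<And>t. t \<in> closed_segment u v \<Longrightarrow> \<bar>h' t - c\<bar> \<le> e / 3" for h h' :: "real \<Rightarrow> real" and u v c
    proof -
      have "norm ((\<lambda>t. h t - c * t) u - (\<lambda>t. h t - c * t) v) \<le> e / 3 * norm (u - v)"
        by (rule field_differentiable_bound[where f'="\<lambda>t. h' t - c" and S="closed_segment u v"])
          (auto intro!: derivative_eq_intros that(1)[THEN has_field_derivative_at_within]
            simp del: le_divide_eq_numeral1 simp: that(2))
      then show ?thesis by (simp add: algebra_simps)
    qed
    have sg: "\<bar>t - v\<bar> \<le> \<bar>u - v\<bar>" if "t \<in> closed_segment u v" for t u v :: real
      using that by (auto simp: closed_segment_eq_real_ivl split: if_splits)
    note P = has_partialsD[OF cd_partials[OF f]]
    have A: "\<bar>f x' y' z' - f x y' z' - d_I f x y z * (x' - x)\<bar> \<le> e / 3 * \<bar>x' - x\<bar>"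
    proof (rule seg)
      fix t assume "t \<in> closed_segment x' x"
      then have t: "\<bar>t - x\<bar> < r" using sg N Nr by fastforce
      show "((\<lambda>t. f t y' z') has_real_derivative d_I f t y' z') (at t)"
        using t N Nr by (intro P(1) inU inV) auto
      show "\<bar>d_I f t y' z' - d_I f x y z\<bar> \<le> e / 3"
        using d1(2)[of "(t, y', z')"] nb[of t y' z'] t N Nr r by auto
    qed
    have B: "\<bar>f x y' z' - f x y z' - d_phi f x y z * (y' - y)\<bar> \<le> e / 3 * \<bar>y' - y\<bar>"
    proof (rule seg)
      fix t assume "t \<in> closed_segment y' y"
      then have t: "\<bar>t - y\<bar> < r" using sg N Nr by fastforce
      show "((\<lambda>t. f x t z') has_real_derivative d_phi f x t z') (at t)"
        using x N Nr by (intro P(2) inV) auto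
      show "\<bar>d_phi f x t z' - d_phi f x y z\<bar> \<le> e / 3"
        using d2(2)[of "(x, t, z')"] nb[of x t z'] t N Nr r by auto
    qed
    have C: "\<bar>f x y z' - f x y z - d_tau f x y z * (z' - z)\<bar> \<le> e / 3 * \<bar>z' - z\<bar>"
    proof (rule seg)
      fix t assume "t \<in> closed_segment z' z"
      then have t: "\<bar>t - z\<bar> < r" using sg N Nr by fastforce
      show "((\<lambda>t. f x y t) has_real_derivative d_tau f x y t) (at t)"
        using x t r by (intro P(3) inV) auto
      show "\<bar>d_tau f x y t - d_tau f x y z\<bar> \<le> e / 3"
        using d3(2)[of "(x, y, t)"] nb[of x y t] t r by auto
    qed
    have "\<bar>f x' y' z' - f x y z - (d_I f x y z * (x' - x) + d_phi f x y z * (y' - y) + d_tau f x y z * (z' - z))\<bar>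
      \<le> e / 3 * \<bar>x' - x\<bar> + e / 3 * \<bar>y' - y\<bar> + e / 3 * \<bar>z' - z\<bar>"
      using A B C by linarith
    also have "\<dots> \<le> e / 3 * N + e / 3 * N + e / 3 * N"
      using N e by (intro add_mono mult_left_mono) auto
    finally show "norm ((case q of (x, y, z) \<Rightarrow> f x y z) - (case (x, y, z) of (x, y, z) \<Rightarrow> f x y z) -
        (case q - (x, y, z) of (a, b, c) \<Rightarrow> d_I f x y z * a + d_phi f x y z * b + d_tau f x y z * c))
      \<le> e * norm (q - (x, y, z))"
      by (simp add: q' N_def)
  qed
qed

text \<open>The derivative is taken within \<open>T\<close>, since a solution on a closed interval
  has only one-sided derivatives at the ends.\<close>

lemma cd_chain:
  assumes "open U" "open V" "cd (Suc k) U V f" "X s \<in> U" "Z s \<in> V"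
    and X: "(X has_real_derivative X') (at s within T)"
    and Y: "(Y has_real_derivative Y') (at s within T)"
    and Z: "(Z has_real_derivative Z') (at s within T)"
  shows "((\<lambda>s. f (X s) (Y s) (Z s)) has_real_derivative
    d_I f (X s) (Y s) (Z s) * X' + d_phi f (X s) (Y s) (Z s) * Y' + d_tau f (X s) (Y s) (Z s) * Z') (at s within T)"
proof -
  have p: "((\<lambda>s. (X s, Y s, Z s)) has_derivative (\<lambda>h. (X' * h, Y' * h, Z' * h))) (at s within T)"
    using X Y Z unfolding has_field_derivative_def by (intro has_derivative_Pair)
  have "((\<lambda>s. (\<lambda>(x, y, z). f x y z) (X s, Y s, Z s)) has_derivative
     (\<lambda>h. (\<lambda>(a, b, c). d_I f (X s) (Y s) (Z s) * a + d_phi f (X s) (Y s) (Z s) * b + d_tau f (X s) (Y s) (Z s) * c)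
        (X' * h, Y' * h, Z' * h))) (at s within T)"
    by (rule has_derivative_compose[OF p cd_has_derivative[OF assms(1-5)]])
  then show ?thesis
    unfolding has_field_derivative_def prod.case
    by (rule back_subst[of "\<lambda>D. (_ has_derivative D) _"]) (auto simp: fun_eq_iff algebra_simps)
qed

section \<open>Periodic functions of the phase\<close>

definition phase_periodic :: "real set \<Rightarrow> real set \<Rightarrow> (real \<Rightarrow> real \<Rightarrow> real \<Rightarrow> real) \<Rightarrow> bool" where
  "phase_periodic U V f \<longleftrightarrow> (\<forall>x\<in>U. \<forall>y. \<forall>z\<in>V. f x (y + 2 * pi) z = f x y z)"

lemma phase_periodicD: "phase_periodic U V f \<Longrightarrow> x \<in> U \<Longrightarrow> z \<in> V \<Longrightarrow> f x (y + 2 * pi) z = f x y z"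
  by (simp add: phase_periodic_def)

text \<open>The shifted function has the shifted partial derivatives and is the same function, so
  uniqueness of derivatives applies.\<close>

lemma phase_periodic_derivs:
  assumes "open U" "open V" "cd (Suc k) U V f" "phase_periodic U V f"
  shows "phase_periodic U V (d_I f)" "phase_periodic U V (d_phi f)" "phase_periodic U V (d_tau f)"
proof -
  have g: "has_partials U V f (\<lambda>x y z. d_I f x (y + 2 * pi) z) (\<lambda>x y z. d_phi f x (y + 2 * pi) z)
     (\<lambda>x y z. d_tau f x (y + 2 * pi) z)"
  proof (rule has_partials_cong[OF assms(1,2) _ refl refl refl])
    show "f x (y + 2 * pi) z = f x y z" if "x \<in> U" "z \<in> V" for x y z
      using assms(4) that by (rule phase_periodicD)
    show "has_partials U V (\<lambda>x y z. f x (y + 2 * pi) z) (\<lambda>x y z. d_I f x (y + 2 * pi) z)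
      (\<lambda>x y z. d_phi f x (y + 2 * pi) z) (\<lambda>x y z. d_tau f x (y + 2 * pi) z)"
      unfolding has_partials_def
    proof (intro ballI allI conjI)
      fix x y z assume xz: "x \<in> U" "z \<in> V"
      note P = has_partialsD[OF cd_partials[OF assms(3)] xz, of "y + 2 * pi"]
      show "((\<lambda>t. f t (y + 2 * pi) z) has_real_derivative d_I f x (y + 2 * pi) z) (at x)" by (rule P(1))
      show "((\<lambda>t. f x (y + 2 * pi) t) has_real_derivative d_tau f x (y + 2 * pi) z) (at z)" by (rule P(3))
      show "((\<lambda>t. f x (t + 2 * pi) z) has_real_derivative d_phi f x (y + 2 * pi) z) (at y)"
        using P(2) by (simp add: DERIV_shift)
    qed
  qed
  show "phase_periodic U V (d_I f)" "phase_periodic U V (d_phi f)" "phase_periodic U V (d_tau f)"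
    unfolding phase_periodic_def
    by (intro ballI allI, rule has_partials_imp_eq[OF g, symmetric]; assumption)+
qed

lemma phase_periodic_reduce:
  obtains y' where "y' \<in> {0..2 * pi}"
    "\<And>U V f x z. phase_periodic U V f \<Longrightarrow> x \<in> U \<Longrightarrow> z \<in> V \<Longrightarrow> f x y z = f x y' z"
proof -
  have nat: "f x (y + 2 * pi * real n) z = f x y z" if "phase_periodic U V f" "x \<in> U" "z \<in> V" for U V f x y z n
  proof (induction n)
    case (Suc n)
    then show ?case using phase_periodicD[OF that, of "y + 2 * pi * real n"] by (simp add: algebra_simps)
  qed simp
  \<comment> \<open>Shifts by natural multiples are available, so for \<open>k \<ge> 0\<close> the
    shift goes from \<open>y'\<close> up to \<open>y\<close>, and for negative \<open>k\<close> from
    \<open>y\<close> up to \<open>y'\<close>.\<close>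
  define k where "k = \<lfloor>y / (2 * pi)\<rfloor>"
  define y' where "y' = y - 2 * pi * of_int k"
  have "of_int k \<le> y / (2 * pi)" "y / (2 * pi) \<le> of_int k + 1" unfolding k_def by linarith+
  then have "y' \<in> {0..2 * pi}" by (simp add: y'_def field_simps)
  moreover have "f x y z = f x y' z" if "phase_periodic U V f" "x \<in> U" "z \<in> V" for U V f x z
  proof (cases "k \<ge> 0")
    case True
    then show ?thesis using nat[OF that, of y' "nat k"] by (simp add: y'_def)
  next
    case False
    then show ?thesis using nat[OF that, of y "nat (- k)"] by (simp add: y'_def)
  qed
  ultimately show ?thesis using that by blast
qed

text \<open>Periodicity replaces the phase line by \<open>{0..2 * pi}\<close>, so that compactness
  applies although the phase of a solution covers distances of order
  \<open>1 / \<epsilon>\<close>.\<close>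

lemma phase_periodic_bounded:
  assumes "cd k U V f" "phase_periodic U V f" "{i0..i1} \<subseteq> U" "{z0..z1} \<subseteq> V"
  shows "\<exists>B>0. \<forall>x\<in>{i0..i1}. \<forall>y. \<forall>z\<in>{z0..z1}. \<bar>f x y z\<bar> \<le> B"
proof -
  have "compact ((\<lambda>(x, y, z). f x y z) ` ({i0..i1} \<times> {0..2 * pi} \<times> {z0..z1}))"
    by (intro compact_continuous_image continuous_on_subset[OF cd_cont[OF assms(1)]] compact_Times compact_Icc)
      (use assms(3,4) in auto)
  then obtain B where B: "B > 0" "\<And>v. v \<in> (\<lambda>(x, y, z). f x y z) ` ({i0..i1} \<times> {0..2 * pi} \<times> {z0..z1}) \<Longrightarrow> norm v \<le> B"
    using compact_imp_bounded bounded_pos by metis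
  have "\<bar>f x y z\<bar> \<le> B" if "x \<in> {i0..i1}" "z \<in> {z0..z1}" for x y z
  proof -
    obtain y' where y': "y' \<in> {0..2 * pi}"
      "\<And>U V f x z. phase_periodic U V f \<Longrightarrow> x \<in> U \<Longrightarrow> z \<in> V \<Longrightarrow> f x y z = f x y' z"
      by (rule phase_periodic_reduce) blast
    have "f x y z = f x y' z" using y'(2)[OF assms(2)] that assms(3,4) by blast
    moreover have "norm (f x y' z) \<le> B" by (rule B(2)) (use that y'(1) in force)
    ultimately show ?thesis by simp
  qed
  with B(1) show ?thesis by blast
qed

text \<open>Kept a function of all three arguments, constant in the phase, so that
  \<open>cd\<close>, \<open>d_I\<close> and the other operators apply to it.\<close>

definition mean :: "(real \<Rightarrow> real \<Rightarrow> real \<Rightarrow> real) \<Rightarrow> real \<Rightarrow> real \<Rightarrow> real \<Rightarrow> real" where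
  "mean f x y z = phase_mean (\<lambda>\<phi>. f x \<phi> z)"

text \<open>The primitive vanishing at \<open>y = 0\<close>, scaled to the unit interval so that it is also correct for \<open>y < 0\<close>;
  \<open>zprim\<close> is the primitive of zero mean, and is periodic if \<open>f\<close> has zero mean.\<close>

definition prim :: "(real \<Rightarrow> real \<Rightarrow> real \<Rightarrow> real) \<Rightarrow> real \<Rightarrow> real \<Rightarrow> real \<Rightarrow> real" where
  "prim f x y z = y * integral {0..1} (\<lambda>t. f x (t * y) z)"

definition zprim :: "(real \<Rightarrow> real \<Rightarrow> real \<Rightarrow> real) \<Rightarrow> real \<Rightarrow> real \<Rightarrow> real \<Rightarrow> real" where
  "zprim f x y z = prim f x y z - mean (prim f) x y z"

lemma mean_eq: "mean f = (\<lambda>x y z. integral {0..2 * pi} (\<lambda>t. 1 / (2 * pi) * f x (0 * y + t) (1 * z)))"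
  by (simp add: mean_def phase_mean_def fun_eq_iff)

lemma prim_eq: "prim f = (\<lambda>x y z. y * integral {0..1} (\<lambda>t. 1 * f x (t * y + 0) (1 * z)))"
  by (simp add: prim_def fun_eq_iff)

context
  fixes U V :: "real set"
  assumes U: "open U" "convex U" and V: "open V" "convex V"
begin

lemma cd_mean: "cd k U V f \<Longrightarrow> cd k U V (mean f)"
  unfolding mean_eq by (rule cd_integral[OF U V]) (auto intro!: continuous_intros)

lemma cd_prim: "cd k U V f \<Longrightarrow> cd k U V (prim f)"
  unfolding prim_eq
  by (intro cd_mult[OF U(1) V(1) cd_phi[OF U(1) V(1)]] cd_integral[OF U V]) (auto intro!: continuous_intros)

lemma cd_zprim: "cd k U V f \<Longrightarrow> cd k U V (zprim f)"
  unfolding zprim_def[abs_def] by (intro cd_diff[OF U(1) V(1)] cd_prim cd_mean)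

lemma has_partials_mean:
  assumes "cd (Suc k) U V f" "x \<in> U" "z \<in> V"
  shows "((\<lambda>t. mean f t y z) has_real_derivative mean (d_I f) x y z) (at x)"
proof -
  have h: "has_partials U V (mean f) (mean (d_I f))
    (\<lambda>x y z. integral {0..2 * pi} (\<lambda>t. (1 / (2 * pi) * 0) * d_phi f x (0 * y + t) (1 * z)))
    (\<lambda>x y z. integral {0..2 * pi} (\<lambda>t. (1 / (2 * pi) * 1) * d_tau f x (0 * y + t) (1 * z)))"
    unfolding mean_eq by (rule has_partials_integral[OF U V assms(1)]) (auto intro!: continuous_intros)
  show ?thesis by (rule has_partialsD(1)[OF h assms(2,3)])
qed

lemma d_I_mean:
  assumes "cd (Suc k) U V f" "x \<in> U" "z \<in> V"
  shows "d_I (mean f) x y z = mean (d_I f) x y z"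
  unfolding d_I_def[of "mean f"] by (rule DERIV_imp_deriv[OF has_partials_mean[OF assms]])

lemma has_partials_prim:
  assumes "cd (Suc k) U V f" "x \<in> U" "z \<in> V"
  shows "((\<lambda>t. prim f t y z) has_real_derivative prim (d_I f) x y z) (at x)"
proof -
  have h: "has_partials U V (\<lambda>x y z. integral {0..1} (\<lambda>t. 1 * f x (t * y + 0) (1 * z)))
    (\<lambda>x y z. integral {0..1} (\<lambda>t. 1 * d_I f x (t * y + 0) (1 * z)))
    (\<lambda>x y z. integral {0..1} (\<lambda>t. (1 * t) * d_phi f x (t * y + 0) (1 * z)))
    (\<lambda>x y z. integral {0..1} (\<lambda>t. (1 * 1) * d_tau f x (t * y + 0) (1 * z)))"
    by (rule has_partials_integral[OF U V assms(1)]) (auto intro!: continuous_intros)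
  show ?thesis unfolding prim_eq by (rule DERIV_cmult[OF has_partialsD(1)[OF h assms(2,3)]])
qed

lemma has_derivative_zprim_I:
  assumes "cd (Suc k) U V f" "x \<in> U" "z \<in> V"
  shows "((\<lambda>t. zprim f t y z) has_real_derivative zprim (d_I f) x y z) (at x)"
proof -
  have 1: "cd (Suc k) U V (prim f)" by (rule cd_prim[OF assms(1)])
  have "d_I (prim f) x y z = prim (d_I f) x y z" for y
    unfolding d_I_def[of "prim f"] by (rule DERIV_imp_deriv[OF has_partials_prim[OF assms]])
  then have 2: "mean (d_I (prim f)) x y z = mean (prim (d_I f)) x y z" by (simp add: mean_def)
  show ?thesis
    unfolding zprim_def[abs_def] 2[symmetric]
    by (rule DERIV_diff[OF has_partials_prim[OF assms] has_partials_mean[OF 1 assms(2,3)]])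
qed

lemma d_I_zprim:
  assumes "cd (Suc k) U V f" "x \<in> U" "z \<in> V"
  shows "d_I (zprim f) x y z = zprim (d_I f) x y z"
  unfolding d_I_def[of "zprim f"] by (rule DERIV_imp_deriv[OF has_derivative_zprim_I[OF assms]])

lemma cd_phase_cont:
  assumes "cd k U V f" "x \<in> U" "z \<in> V"
  shows "continuous_on S (\<lambda>y. f x y z)"
proof -
  have "continuous_on S (\<lambda>y. (\<lambda>(x, y, z). f x y z) (x, y, z))"
    by (rule continuous_on_compose2[OF cd_cont[OF assms(1)]]) (use assms in \<open>auto intro!: continuous_intros\<close>)
  then show ?thesis by simp
qed

text \<open>Continuity gives an antiderivative on the whole line, and the chain rule for
  \<open>G (t * y)\<close> in \<open>t\<close> turns the integral over the unit interval into
  \<open>G y - G 0\<close> for either sign of \<open>y\<close>.\<close>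

lemma prim_antiderivative:
  assumes "cd k U V f" "x \<in> U" "z \<in> V"
  obtains G where "\<And>y. (G has_real_derivative f x y z) (at y)" "\<And>y. prim f x y z = G y - G 0"
proof -
  have "\<And>y. isCont (\<lambda>y. f x y z) y"
    using cd_phase_cont[OF assms, of UNIV] by (simp add: continuous_on_eq_continuous_at)
  then obtain G where G: "\<And>y. (G has_real_derivative f x y z) (at y)"
    using einterval_antiderivative[of "-\<infinity>" "\<infinity>" "\<lambda>y. f x y z"]
    by (auto simp: has_real_derivative_iff_has_vector_derivative)
  have "prim f x y z = G y - G 0" for y
  proof -
    have "((\<lambda>t. y * f x (t * y) z) has_integral (G (1 * y) - G (0 * y))) {0..1}"
    proof (rule fundamental_theorem_of_calculus)
      fix t :: real
      have "((\<lambda>t. G (t * y)) has_real_derivative f x (t * y) z * y) (at t within {0..1})"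
        by (rule DERIV_chain2[OF G]) (auto intro!: derivative_eq_intros)
      then show "((\<lambda>t. G (t * y)) has_vector_derivative y * f x (t * y) z) (at t within {0..1})"
        by (simp add: has_real_derivative_iff_has_vector_derivative mult.commute)
    qed simp
    from integral_unique[OF this] show ?thesis by (simp add: prim_def)
  qed
  with G show ?thesis using that by blast
qed

lemma has_derivative_zprim_phi:
  assumes "cd k U V f" "x \<in> U" "z \<in> V"
  shows "((\<lambda>y. zprim f x y z) has_real_derivative f x y z) (at y)"
proof -
  obtain G where G: "\<And>y. (G has_real_derivative f x y z) (at y)" "\<And>y. prim f x y z = G y - G 0"
    by (rule prim_antiderivative[OF assms]) blast
  have "((\<lambda>y. G y - G 0 - mean (prim f) x 0 z) has_real_derivative f x y z) (at y)"
    by (auto intro!: derivative_eq_intros G(1))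
  then show ?thesis by (simp add: zprim_def G(2) mean_def)
qed

text \<open>The increment of \<open>G\<close> over a period has derivative zero, and its constant
  value is \<open>2 * pi\<close> times the mean of \<open>f\<close>.\<close>

lemma phase_periodic_zprim:
  assumes "cd k U V f" "phase_periodic U V f" "\<And>x z. x \<in> U \<Longrightarrow> z \<in> V \<Longrightarrow> mean f x 0 z = 0"
  shows "phase_periodic U V (zprim f)"
  unfolding phase_periodic_def
proof (intro ballI allI)
  fix x y z assume xz: "x \<in> U" "z \<in> V"
  obtain G where G: "\<And>y. (G has_real_derivative f x y z) (at y)" "\<And>y. prim f x y z = G y - G 0"
    by (rule prim_antiderivative[OF assms(1) xz]) blast
  have "((\<lambda>y. G (y + 2 * pi) - G y) has_real_derivative f x (y + 2 * pi) z - f x y z) (at y)" for y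
    by (intro DERIV_diff G(1)) (use G(1)[of "y + 2 * pi"] in \<open>simp add: DERIV_shift\<close>)
  then have "((\<lambda>y. G (y + 2 * pi) - G y) has_real_derivative 0) (at y)" for y
    using phase_periodicD[OF assms(2) xz] by simp
  then have c: "G (y + 2 * pi) - G y = G (0 + 2 * pi) - G 0"
    using DERIV_isconst_all by blast
  have "((\<lambda>y. f x y z) has_integral (G (2 * pi) - G 0)) {0..2 * pi}"
    by (rule fundamental_theorem_of_calculus)
      (use G(1) in \<open>auto simp: has_real_derivative_iff_has_vector_derivative[symmetric] intro: has_field_derivative_at_within\<close>)
  then have "G (2 * pi) - G 0 = 0"
    using assms(3)[OF xz] by (simp add: mean_def phase_mean_def integral_unique)
  then show "zprim f x (y + 2 * pi) z = zprim f x y z"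
    using c by (simp add: zprim_def mean_def G(2))
qed

text \<open>Connects the scaled primitive with the oriented integral in
  \<open>u1_I_primitive\<close>.\<close>

lemma prim_interval_integral:
  assumes "cd k U V f" "x \<in> U" "z \<in> V"
  shows "(LBINT \<psi>=ereal 0..ereal y. f x \<psi> z) = prim f x y z"
proof -
  obtain G where G: "\<And>y. (G has_real_derivative f x y z) (at y)" "\<And>y. prim f x y z = G y - G 0"
    by (rule prim_antiderivative[OF assms]) blast
  show ?thesis
    unfolding G(2)
    by (rule interval_integral_FTC_finite[OF cd_phase_cont[OF assms]])
      (use G(1) in \<open>auto simp: has_real_derivative_iff_has_vector_derivative[symmetric] intro: has_field_derivative_at_within\<close>)
qed

end

section \<open>The oscillatory model integral\<close>

text \<open>\<open>- A / s ^ n\<close> is a primitive of the bound on \<open>h'\<close>, so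
  \<open>h\<close> and \<open>- h\<close> become nondecreasing when \<open>A / s ^ n\<close> is
  subtracted. No integrability of \<open>h'\<close> enters, and the bound does not deteriorate as
  \<open>S\<close> grows.\<close>

lemma power_deriv_bound:
  fixes h h' :: "real \<Rightarrow> real"
  assumes "0 < r" "r \<le> S" "0 < n"
    and D: "\<And>s. s \<in> {r..S} \<Longrightarrow> (h has_real_derivative h' s) (at s within {r..S})"
    and B: "\<And>s. s \<in> {r..S} \<Longrightarrow> \<bar>h' s\<bar> \<le> A * (n / s ^ Suc n)"
  shows "\<bar>h S - h r\<bar> \<le> A / r ^ n"
proof -
  obtain m where m: "n = Suc m" using \<open>0 < n\<close> by (cases n) auto
  have P: "((\<lambda>s. A / s ^ n) has_real_derivative - (A * (n / s ^ Suc n))) (at s)" if "s \<ge> r" for s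
  proof -
    have s: "s ^ n \<noteq> 0" "s \<noteq> 0" using that \<open>0 < r\<close> by auto
    show ?thesis
      by (rule DERIV_cong[OF DERIV_divide[OF DERIV_const DERIV_pow[of n s] s(1)]])
        (use s(2) in \<open>simp add: m field_simps\<close>)
  qed
  have ch: "continuous_on {r..S} h"
    using D by (meson DERIV_continuous continuous_on_eq_continuous_within)
  have cp: "continuous_on {r..S} (\<lambda>s. A / s ^ n)"
    using \<open>0 < r\<close> by (intro continuous_intros) auto
  have Dh: "(h has_real_derivative h' s) (at s)" if "r < s" "s < S" for s
    using D[of s] that at_within_Icc_at[of r s S] by simp
  have 1: "- h r - A / r ^ n \<le> - h S - A / S ^ n"
  proof (rule DERIV_nonneg_imp_increasing_open[OF \<open>r \<le> S\<close>])
    fix s assume s: "r < s" "s < S"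
    have "((\<lambda>s. - h s - A / s ^ n) has_real_derivative (- h' s - - (A * (n / s ^ Suc n)))) (at s)"
      by (intro DERIV_diff DERIV_minus Dh[OF s] P) (use s in simp)
    moreover have "0 \<le> - h' s - - (A * (n / s ^ Suc n))" using B[of s] s by (simp add: abs_le_iff)
    ultimately show "\<exists>y. ((\<lambda>s. - h s - A / s ^ n) has_real_derivative y) (at s) \<and> 0 \<le> y" by blast
  qed (intro continuous_intros ch cp)
  have 2: "h r - A / r ^ n \<le> h S - A / S ^ n"
  proof (rule DERIV_nonneg_imp_increasing_open[OF \<open>r \<le> S\<close>])
    fix s assume s: "r < s" "s < S"
    have "((\<lambda>s. h s - A / s ^ n) has_real_derivative (h' s - - (A * (n / s ^ Suc n)))) (at s)"
      by (intro DERIV_diff DERIV_minus Dh[OF s] P) (use s in simp)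
    moreover have "0 \<le> h' s - - (A * (n / s ^ Suc n))" using B[of s] s by (simp add: abs_le_iff)
    ultimately show "\<exists>y. ((\<lambda>s. h s - A / s ^ n) has_real_derivative y) (at s) \<and> 0 \<le> y" by blast
  qed (intro continuous_intros ch cp)
  have "0 \<le> A * (n / r ^ Suc n)" using B[of r] \<open>r \<le> S\<close> by (smt (verit) atLeastAtMost_iff)
  moreover have "0 < n / r ^ Suc n" using \<open>0 < r\<close> \<open>0 < n\<close> by simp
  ultimately have "A \<ge> 0" using mult_neg_pos not_less by blast
  then have "0 \<le> A / S ^ n" using \<open>0 < r\<close> \<open>r \<le> S\<close> by simp
  with 1 2 show ?thesis by linarith
qed

text \<open>Two integrations by parts: \<open>Z\<close> is an antiderivative of the integrand up to
  \<open>3 * g2 / (a\<^sup>2 * \<theta> ^ 4)\<close>, hence \<open>P - Z\<close> converges with the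
  rate \<open>1 / R ^ 3\<close>. The estimate keeps the first boundary term, which is only of order
  \<open>1 / R\<close>, and puts the second one into the error. The \<open>4\<close> stems from
  these two errors of equal size and from the two halves of the line.\<close>

lemma oscillatory_integral:
  fixes f g g2 :: "real \<Rightarrow> real" and a p B :: real
  assumes a: "a \<noteq> 0"
    and g: "\<And>y. (g has_real_derivative f y) (at y)" and g2: "\<And>y. (g2 has_real_derivative g y) (at y)"
    and B: "\<And>y. \<bar>g2 y\<bar> \<le> B" "\<And>y. \<bar>g y\<bar> \<le> B"
    and f: "continuous_on UNIV f"
  obtains T where "((\<lambda>\<theta>. f (p + a / 2 * \<theta>\<^sup>2)) has_integral T) UNIV"
    "\<And>R. R > 0 \<Longrightarrow> \<bar>T - 2 * (integral {0..R} (\<lambda>\<theta>. f (p + a / 2 * \<theta>\<^sup>2)) - g (p + a / 2 * R\<^sup>2) / (a * R))\<bar>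
       \<le> (4 * B / a\<^sup>2) / R ^ 3"
proof -
  define F where "F = (\<lambda>\<theta>. f (p + a / 2 * \<theta>\<^sup>2))"
  define P where "P R = integral {0..R} F" for R
  define Z where "Z R = g (p + a / 2 * R\<^sup>2) / (a * R) + g2 (p + a / 2 * R\<^sup>2) / (a\<^sup>2 * R ^ 3)" for R
  define J where "J R = P R - Z R" for R
  have cF: "continuous_on S F" for S
    unfolding F_def by (rule continuous_on_compose2[OF f]) (auto intro!: continuous_intros)
  have B0: "B \<ge> 0" using B(1)[of 0] by linarith
  have JR: "\<bar>J R' - J R\<bar> \<le> (B / a\<^sup>2) / R ^ 3" if "0 < R" "R \<le> R'" for R R'
  proof (rule power_deriv_bound[OF that])
    fix s assume s: "s \<in> {R..R'}"
    have P: "(P has_real_derivative F s) (at s within {R..R'})"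
      unfolding P_def
      by (rule has_field_derivative_subset[OF integral_has_real_derivative[of 0 R' F s]])
        (use s that cF in auto)
    have s0: "s \<noteq> 0" using s that by auto
    have q: "((\<lambda>s. p + a / 2 * s\<^sup>2) has_real_derivative a * s) (at s within {R..R'})"
      by (auto intro!: derivative_eq_intros)
    have d: "((\<lambda>s. a * s) has_real_derivative a) (at s within {R..R'})"
      "((\<lambda>s. a\<^sup>2 * s ^ 3) has_real_derivative a\<^sup>2 * (3 * s\<^sup>2)) (at s within {R..R'})"
      by (auto intro!: derivative_eq_intros)
    have nz: "a * s \<noteq> 0" "a\<^sup>2 * s ^ 3 \<noteq> 0" using a s0 by auto
    have Z: "(Z has_real_derivative (F s - 3 * g2 (p + a / 2 * s\<^sup>2) / (a\<^sup>2 * s ^ 4))) (at s within {R..R'})"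
      unfolding Z_def
      by (rule DERIV_cong[OF DERIV_add[OF DERIV_divide[OF DERIV_chain2[OF g q] d(1) nz(1)]
            DERIV_divide[OF DERIV_chain2[OF g2 q] d(2) nz(2)]]])
        (use s0 a in \<open>simp add: F_def field_simps eval_nat_numeral\<close>)
    show "(J has_real_derivative F s - (F s - 3 * g2 (p + a / 2 * s\<^sup>2) / (a\<^sup>2 * s ^ 4))) (at s within {R..R'})"
      unfolding J_def by (rule DERIV_diff[OF P Z])
    have "\<bar>3 * g2 (p + a / 2 * s\<^sup>2) / (a\<^sup>2 * s ^ 4)\<bar> = 3 * \<bar>g2 (p + a / 2 * s\<^sup>2)\<bar> / (a\<^sup>2 * s ^ 4)"
      by (simp add: abs_mult)
    also have "\<dots> \<le> 3 * B / (a\<^sup>2 * s ^ 4)"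
      by (intro divide_right_mono mult_left_mono B) auto
    finally show "\<bar>F s - (F s - 3 * g2 (p + a / 2 * s\<^sup>2) / (a\<^sup>2 * s ^ 4))\<bar> \<le> B / a\<^sup>2 * (real 3 / s ^ Suc 3)"
      by (simp add: field_simps eval_nat_numeral)
  qed auto
  have lim0: "((\<lambda>R. (B / a\<^sup>2) / R ^ 3) \<longlongrightarrow> 0) at_top"
    by (intro tendsto_divide_0[OF tendsto_const] filterlim_at_top_imp_at_infinity filterlim_pow_at_top filterlim_ident) auto
  \<comment> \<open>The shift by one keeps all arguments positive, where \<open>JR\<close>
    holds.\<close>
  have "Cauchy (\<lambda>n. J (real n + 1))"
  proof (rule metric_CauchyI)
    fix e :: real assume "e > 0"
    then have "\<forall>\<^sub>F R in at_top. (B / a\<^sup>2) / R ^ 3 < e"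
      using order_tendstoD(2)[OF lim0] by blast
    then obtain R0 where R0: "\<And>R. R \<ge> R0 \<Longrightarrow> (B / a\<^sup>2) / R ^ 3 < e"
      by (auto simp: eventually_at_top_linorder)
    have "dist (J (real m + 1)) (J (real n + 1)) < e" if "m \<ge> nat \<lceil>R0\<rceil>" "n \<ge> m" for m n
      using JR[of "real m + 1" "real n + 1"] R0[of "real m + 1"] that
      unfolding dist_real_def by (smt (verit) of_nat_0_le_iff of_nat_mono of_nat_ceiling)
    then show "\<exists>M. \<forall>m\<ge>M. \<forall>n\<ge>M. dist (J (real m + 1)) (J (real n + 1)) < e"
      by (intro exI[of _ "nat \<lceil>R0\<rceil>"]) (metis dist_commute nle_le)
  qed
  then obtain j where j: "(\<lambda>n. J (real n + 1)) \<longlonglongrightarrow> j"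
    using Cauchy_convergent convergent_def by blast
  have Jj: "\<bar>j - J R\<bar> \<le> (B / a\<^sup>2) / R ^ 3" if "0 < R" for R
  proof (rule tendsto_upperbound)
    show "(\<lambda>n. \<bar>J (real n + 1) - J R\<bar>) \<longlonglongrightarrow> \<bar>j - J R\<bar>" by (intro tendsto_intros j)
    show "\<forall>\<^sub>F n in sequentially. \<bar>J (real n + 1) - J R\<bar> \<le> (B / a\<^sup>2) / R ^ 3"
      using eventually_ge_at_top[of "nat \<lceil>R\<rceil>"]
      by eventually_elim (rule JR[OF that], linarith)
  qed simp
  have Z2: "\<bar>g2 (p + a / 2 * R\<^sup>2) / (a\<^sup>2 * R ^ 3)\<bar> \<le> (B / a\<^sup>2) / R ^ 3" if "0 < R" for R
  proof -
    have "\<bar>g2 (p + a / 2 * R\<^sup>2) / (a\<^sup>2 * R ^ 3)\<bar> = \<bar>g2 (p + a / 2 * R\<^sup>2)\<bar> / (a\<^sup>2 * R ^ 3)"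
      using that by (simp add: abs_mult)
    also have "\<dots> \<le> B / (a\<^sup>2 * R ^ 3)" using that by (intro divide_right_mono B) auto
    finally show ?thesis by simp
  qed
  have main: "\<bar>2 * j - 2 * (P R - g (p + a / 2 * R\<^sup>2) / (a * R))\<bar> \<le> (4 * B / a\<^sup>2) / R ^ 3" if "0 < R" for R
  proof -
    have "(4 * B / a\<^sup>2) / R ^ 3 = 4 * ((B / a\<^sup>2) / R ^ 3)" by simp
    have "\<bar>2 * j - 2 * (Q - X)\<bar> \<le> 4 * K" if "\<bar>j - (Q - (X + Y))\<bar> \<le> K" "\<bar>Y\<bar> \<le> K" for Q X Y K :: real
      using that unfolding abs_le_iff by argo
    note this[OF Jj[OF that, unfolded J_def Z_def] Z2[OF that]]
    then show ?thesis using \<open>(4 * B / a\<^sup>2) / R ^ 3 = _\<close> by simp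
  qed
  have "((\<lambda>R. J R - j) \<longlongrightarrow> 0) at_top"
    by (rule Lim_null_comparison[OF _ lim0])
      (use eventually_gt_at_top[of 0] in \<open>eventually_elim, use Jj in \<open>simp add: abs_minus_commute\<close>\<close>)
  moreover have "((\<lambda>R. g2 (p + a / 2 * R\<^sup>2) / (a\<^sup>2 * R ^ 3)) \<longlongrightarrow> 0) at_top"
    by (rule Lim_null_comparison[OF _ lim0])
      (use eventually_gt_at_top[of 0] in \<open>eventually_elim, use Z2 in simp\<close>)
  moreover have "((\<lambda>R. g (p + a / 2 * R\<^sup>2) / (a * R)) \<longlongrightarrow> 0) at_top"
  proof (rule Lim_null_comparison)
    show "((\<lambda>R. (B / \<bar>a\<bar>) / R) \<longlongrightarrow> 0) at_top"
      by (intro tendsto_divide_0[OF tendsto_const] filterlim_at_top_imp_at_infinity filterlim_ident)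
    show "\<forall>\<^sub>F R in at_top. norm (g (p + a / 2 * R\<^sup>2) / (a * R)) \<le> (B / \<bar>a\<bar>) / R"
      using eventually_gt_at_top[of 0]
    proof eventually_elim
      case (elim R)
      have "norm (g (p + a / 2 * R\<^sup>2) / (a * R)) = \<bar>g (p + a / 2 * R\<^sup>2)\<bar> / (\<bar>a\<bar> * R)"
        using elim by (simp add: abs_mult)
      also have "\<dots> \<le> B / (\<bar>a\<bar> * R)" using elim by (intro divide_right_mono B) auto
      finally show ?case by simp
    qed
  qed
  ultimately have "((\<lambda>R. (J R - j) + (g (p + a / 2 * R\<^sup>2) / (a * R) + g2 (p + a / 2 * R\<^sup>2) / (a\<^sup>2 * R ^ 3)) + j) \<longlongrightarrow> 0 + (0 + 0) + j) at_top"
    by (intro tendsto_intros)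
  then have Plim: "(P \<longlongrightarrow> j) at_top" unfolding J_def Z_def by simp
  have intF: "F integrable_on {u..v}" for u v by (intro integrable_continuous_real cF)
  \<comment> \<open>The integrand is even, so each end contributes \<open>j\<close>, independently
    of the other.\<close>
  have "((\<lambda>(u, v). integral {u..v} F) \<longlongrightarrow> 2 * j) (at_bot \<times>\<^sub>F at_top)"
  proof -
    have "((\<lambda>q. P (- fst q) + P (snd q)) \<longlongrightarrow> j + j) (at_bot \<times>\<^sub>F at_top)"
      by (intro tendsto_add filterlim_compose[OF Plim] filterlim_snd
          filterlim_compose[OF filterlim_uminus_at_top_at_bot filterlim_fst])
    moreover have "\<forall>\<^sub>F q in at_bot \<times>\<^sub>F at_top. P (- fst q) + P (snd q) = (case q of (u, v) \<Rightarrow> integral {u..v} F)"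
    proof -
      have "\<forall>\<^sub>F q in at_bot \<times>\<^sub>F at_top. fst q \<le> (0::real) \<and> (0::real) \<le> snd q"
        unfolding eventually_prod_filter
        by (rule exI[of _ "\<lambda>u. u \<le> 0"], rule exI[of _ "\<lambda>v. 0 \<le> v"])
          (auto simp: eventually_le_at_bot eventually_ge_at_top)
      then show ?thesis
      proof eventually_elim
        case (elim q)
        obtain u v where q: "q = (u, v)" by (cases q)
        have "integral {u..v} F = integral {u..0} F + integral {0..v} F"
          using elim q intF by (simp add: Henstock_Kurzweil_Integration.integral_combine)
        moreover have "integral {u..0} F = integral {0..-u} (\<lambda>x. F (- x))"
          using Henstock_Kurzweil_Integration.integral_reflect_real[where a=u and b=0 and f=F] by simp
        ultimately show ?case by (simp add: q P_def F_def)
      qed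
    qed
    ultimately show ?thesis by (simp add: tendsto_cong)
  qed
  then have "(F has_integral 2 * j) UNIV" by (simp add: has_integral_UNIV_iff_improper[OF intF])
  with main show ?thesis using that[of "2 * j"] unfolding P_def F_def by blast
qed

section \<open>Motion near the resonance\<close>

text \<open>The mean value inequality for \<open>h\<close> minus a linear function of slope
  \<open>c\<close>: with \<open>c = 0\<close> it gives Lipschitz bounds, with \<open>c\<close> a
  derivative at the base point Taylor bounds.\<close>

lemma deriv_approx:
  fixes h h' :: "real \<Rightarrow> real"
  assumes "\<And>t. t \<in> closed_segment u v \<Longrightarrow> (h has_real_derivative h' t) (at t within closed_segment u v)"
    "\<And>t. t \<in> closed_segment u v \<Longrightarrow> \<bar>h' t - c\<bar> \<le> K"
  shows "\<bar>h u - h v - c * (u - v)\<bar> \<le> K * \<bar>u - v\<bar>"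
proof -
  have "norm ((\<lambda>t. h t - c * t) u - (\<lambda>t. h t - c * t) v) \<le> K * norm (u - v)"
    by (rule field_differentiable_bound[where f'="\<lambda>t. h' t - c" and S="closed_segment u v"])
      (auto intro!: derivative_eq_intros assms(1) simp: assms(2))
  then show ?thesis by (simp add: algebra_simps)
qed

lemma closed_segment_real_bound: "t \<in> closed_segment u v \<Longrightarrow> \<bar>t - v\<bar> \<le> \<bar>u - v\<bar>" for t u v :: real
  by (auto simp: closed_segment_eq_real_ivl split: if_splits)

lemma closed_segment_real_subset: "u \<in> {a..b} \<Longrightarrow> v \<in> {a..b} \<Longrightarrow> closed_segment u v \<subseteq> {a..b}" for u v a b :: real
  by (simp add: closed_segment_subset)

text \<open>The system \<open>I' = - Hp\<close>, \<open>\<phi>' = a s / \<epsilon> + Hi\<close> in a slow time \<open>s\<close> vanishing at the resonance.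
  Along its solutions \<open>brk f\<close> is the derivative of \<open>f\<close> up to the fast term \<open>a s / \<epsilon> d_phi f\<close>, and
  \<open>fr f\<close> is \<open>f\<close> along the motion that is obtained by freezing \<open>I\<close> and dropping \<open>Hi\<close>.\<close>

locale resonance =
  fixes U V :: "real set" and a L M i0 i1 :: real and Hi Hp :: "real \<Rightarrow> real \<Rightarrow> real \<Rightarrow> real"
  assumes U: "open U" "convex U" and V: "open V" "convex V"
    and a: "a \<noteq> 0" and LM: "0 < L" "0 < M"
    and ran: "{i0..i1} \<subseteq> U" "{-L..M} \<subseteq> V"
    and Hi: "cd 2 U V Hi" "phase_periodic U V Hi"
    and Hp: "cd 2 U V Hp" "phase_periodic U V Hp"
begin

text \<open>Half the width of the largest symmetric window in \<open>{-L..M}\<close>; only inside it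
  can \<open>s\<close> be paired with \<open>- s\<close>.\<close>

definition S where "S = min L M"

lemma S: "0 < S" "S \<le> L" "S \<le> M" using LM by (auto simp: S_def)

text \<open>The condition \<open>sqrt \<epsilon> \<le> S\<close> places the resonance layer inside
  the window of pairing; smallness of \<epsilon> enters in this way only.\<close>

definition sol :: "real \<Rightarrow> (real \<Rightarrow> real) \<Rightarrow> (real \<Rightarrow> real) \<Rightarrow> bool" where
  "sol \<epsilon> I \<phi> \<longleftrightarrow> 0 < \<epsilon> \<and> sqrt \<epsilon> \<le> S \<and> (\<forall>s\<in>{-L..M}. I s \<in> {i0..i1} \<and>
     (I has_real_derivative - Hp (I s) (\<phi> s) s) (at s within {-L..M}) \<and>
     (\<phi> has_real_derivative a * s / \<epsilon> + Hi (I s) (\<phi> s) s) (at s within {-L..M}))"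

definition gd where "gd k f \<longleftrightarrow> cd k U V f \<and> phase_periodic U V f"

definition brk where "brk f x y z = d_tau f x y z + d_phi f x y z * Hi x y z - d_I f x y z * Hp x y z"

definition tr :: "(real \<Rightarrow> real \<Rightarrow> real \<Rightarrow> real) \<Rightarrow> (real \<Rightarrow> real) \<Rightarrow> (real \<Rightarrow> real) \<Rightarrow> real \<Rightarrow> real" where
  "tr f I \<phi> s = f (I s) (\<phi> s) s"

definition fr :: "(real \<Rightarrow> real \<Rightarrow> real \<Rightarrow> real) \<Rightarrow> real \<Rightarrow> (real \<Rightarrow> real) \<Rightarrow> (real \<Rightarrow> real) \<Rightarrow> real \<Rightarrow> real" where
  "fr f \<epsilon> I \<phi> s = f (I 0) (\<phi> 0 + a / 2 * (s\<^sup>2 / \<epsilon>)) 0"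

lemma solD:
  assumes "sol \<epsilon> I \<phi>"
  shows "0 < \<epsilon>" "sqrt \<epsilon> \<le> S"
    "\<And>s. s \<in> {-L..M} \<Longrightarrow> I s \<in> {i0..i1}"
    "\<And>s. s \<in> {-L..M} \<Longrightarrow> (I has_real_derivative - tr Hp I \<phi> s) (at s within {-L..M})"
    "\<And>s. s \<in> {-L..M} \<Longrightarrow> (\<phi> has_real_derivative a * s / \<epsilon> + tr Hi I \<phi> s) (at s within {-L..M})"
  using assms unfolding sol_def tr_def by blast+

section \<open>Smooth periodic functions on the range of the solutions\<close>

lemma gd_Hi: "gd 2 Hi" and gd_Hp: "gd 2 Hp"
  using Hi Hp by (auto simp: gd_def)

lemma gd_le: "gd m f \<Longrightarrow> k \<le> m \<Longrightarrow> gd k f"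
  unfolding gd_def using cd_le by blast

lemma gd_derivs:
  assumes "gd (Suc k) f" shows "gd k (d_I f)" "gd k (d_phi f)" "gd k (d_tau f)"
  using assms cd_derivs[of k U V f] phase_periodic_derivs[OF U(1) V(1), of k f] unfolding gd_def by blast+

lemma gd_mult: "gd k f \<Longrightarrow> gd k g \<Longrightarrow> gd k (\<lambda>x y z. f x y z * g x y z)"
  unfolding gd_def using cd_mult[OF U(1) V(1)] by (simp add: phase_periodic_def)

lemma gd_add: "gd k f \<Longrightarrow> gd k g \<Longrightarrow> gd k (\<lambda>x y z. f x y z + g x y z)"
  unfolding gd_def using cd_add[OF U(1) V(1)] by (simp add: phase_periodic_def)

lemma gd_diff: "gd k f \<Longrightarrow> gd k g \<Longrightarrow> gd k (\<lambda>x y z. f x y z - g x y z)"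
  unfolding gd_def using cd_diff[OF U(1) V(1)] by (simp add: phase_periodic_def)

text \<open>\<open>brk\<close> costs one derivative of \<open>f\<close>, and its result is at most
  as smooth as \<open>Hi\<close> and \<open>Hp\<close>, which have order two.\<close>

lemma gd_brk: "gd (Suc k) f \<Longrightarrow> k \<le> 2 \<Longrightarrow> gd k (brk f)"
  unfolding brk_def[abs_def]
  by (intro gd_add gd_diff gd_mult gd_derivs gd_le[OF gd_Hi] gd_le[OF gd_Hp])

lemma gd_bounded:
  assumes "gd k f"
  obtains B where "B > 0" "\<And>x y z. x \<in> {i0..i1} \<Longrightarrow> z \<in> {-L..M} \<Longrightarrow> \<bar>f x y z\<bar> \<le> B"
  using phase_periodic_bounded[of k U V f i0 i1 "-L" M] assms ran unfolding gd_def by blast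

lemma gd_partials:
  assumes "gd (Suc k) f" "x \<in> {i0..i1}" "z \<in> {-L..M}"
  shows "((\<lambda>t. f t y z) has_real_derivative d_I f x y z) (at x)"
    "((\<lambda>t. f x t z) has_real_derivative d_phi f x y z) (at y)"
    "((\<lambda>t. f x y t) has_real_derivative d_tau f x y z) (at z)"
proof -
  have "x \<in> U" "z \<in> V" "cd (Suc k) U V f" using assms ran unfolding gd_def by auto
  note P = has_partialsD[OF cd_partials[OF this(3)] this(1,2), of y]
  show "((\<lambda>t. f t y z) has_real_derivative d_I f x y z) (at x)"
    "((\<lambda>t. f x t z) has_real_derivative d_phi f x y z) (at y)"
    "((\<lambda>t. f x y t) has_real_derivative d_tau f x y z) (at z)"
    by (fact P)+
qed

text \<open>The three arguments are exchanged one at a time, along segments that stay in the range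
  because it is a product of intervals. The two phases may be arbitrarily far apart.\<close>

lemma gd_lipschitz:
  assumes "gd (Suc k) f"
  obtains C where "C > 0" "\<And>x x' y y' z z'. x \<in> {i0..i1} \<Longrightarrow> x' \<in> {i0..i1} \<Longrightarrow> z \<in> {-L..M} \<Longrightarrow> z' \<in> {-L..M} \<Longrightarrow>
    \<bar>f x y z - f x' y' z'\<bar> \<le> C * (\<bar>x - x'\<bar> + \<bar>y - y'\<bar> + \<bar>z - z'\<bar>)"
proof -
  note d = gd_derivs[OF assms]
  obtain B1 where B1: "B1 > 0" "\<And>x y z. x \<in> {i0..i1} \<Longrightarrow> z \<in> {-L..M} \<Longrightarrow> \<bar>d_I f x y z\<bar> \<le> B1"
    using gd_bounded[OF d(1)] by blast
  obtain B2 where B2: "B2 > 0" "\<And>x y z. x \<in> {i0..i1} \<Longrightarrow> z \<in> {-L..M} \<Longrightarrow> \<bar>d_phi f x y z\<bar> \<le> B2"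
    using gd_bounded[OF d(2)] by blast
  obtain B3 where B3: "B3 > 0" "\<And>x y z. x \<in> {i0..i1} \<Longrightarrow> z \<in> {-L..M} \<Longrightarrow> \<bar>d_tau f x y z\<bar> \<le> B3"
    using gd_bounded[OF d(3)] by blast
  define C where "C = B1 + B2 + B3"
  have C: "C > 0" "B1 \<le> C" "B2 \<le> C" "B3 \<le> C" using B1 B2 B3 by (auto simp: C_def)
  have "\<bar>f x y z - f x' y' z'\<bar> \<le> C * (\<bar>x - x'\<bar> + \<bar>y - y'\<bar> + \<bar>z - z'\<bar>)"
    if x: "x \<in> {i0..i1}" "x' \<in> {i0..i1}" and z: "z \<in> {-L..M}" "z' \<in> {-L..M}" for x x' y y' z z'
  proof -
    have sx: "t \<in> {i0..i1}" if "t \<in> closed_segment x x'" for t using closed_segment_real_subset[OF x] that by blast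
    have sz: "t \<in> {-L..M}" if "t \<in> closed_segment z z'" for t using closed_segment_real_subset[OF z] that by blast
    have "\<bar>f x y z - f x' y z - 0 * (x - x')\<bar> \<le> C * \<bar>x - x'\<bar>"
      by (rule deriv_approx[where h="\<lambda>t. f t y z"], rule has_field_derivative_at_within, rule gd_partials(1)[OF assms sx z(1)], assumption)
        (simp add: order_trans[OF B1(2)[OF sx z(1)] C(2)])
    moreover have "\<bar>f x' y z - f x' y' z - 0 * (y - y')\<bar> \<le> C * \<bar>y - y'\<bar>"
      by (rule deriv_approx[where h="\<lambda>t. f x' t z"], rule has_field_derivative_at_within, rule gd_partials(2)[OF assms x(2) z(1)])
        (simp add: order_trans[OF B2(2)[OF x(2) z(1)] C(3)])
    moreover have "\<bar>f x' y' z - f x' y' z' - 0 * (z - z')\<bar> \<le> C * \<bar>z - z'\<bar>"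
      by (rule deriv_approx[where h="\<lambda>t. f x' y' t"], rule has_field_derivative_at_within, rule gd_partials(3)[OF assms x(2) sz], assumption)
        (simp add: order_trans[OF B3(2)[OF x(2) sz] C(4)])
    ultimately show ?thesis unfolding distrib_left by linarith
  qed
  with C(1) show ?thesis using that by blast
qed

text \<open>The first derivatives are Lipschitz, so along each coordinate step they differ from
  those at the base point by at most \<open>C * N\<close>; the sum over the steps is the quadratic
  remainder.\<close>

lemma gd_taylor:
  assumes "gd (Suc (Suc k)) f"
  obtains C where "C > 0" "\<And>x x' y y' z z'. x \<in> {i0..i1} \<Longrightarrow> x' \<in> {i0..i1} \<Longrightarrow> z \<in> {-L..M} \<Longrightarrow> z' \<in> {-L..M} \<Longrightarrow>
    \<bar>f x y z - f x' y' z' - (d_I f x' y' z' * (x - x') + d_phi f x' y' z' * (y - y') + d_tau f x' y' z' * (z - z'))\<bar>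
      \<le> C * (\<bar>x - x'\<bar> + \<bar>y - y'\<bar> + \<bar>z - z'\<bar>)\<^sup>2"
proof -
  note d = gd_derivs[OF assms]
  define Lip where "Lip g C \<longleftrightarrow> (\<forall>x x' y y' z z'. x \<in> {i0..i1} \<longrightarrow> x' \<in> {i0..i1} \<longrightarrow> z \<in> {-L..M} \<longrightarrow> z' \<in> {-L..M} \<longrightarrow>
    \<bar>g x y z - g x' y' z'\<bar> \<le> C * (\<bar>x - x'\<bar> + \<bar>y - y'\<bar> + \<bar>z - z'\<bar>))" for g :: "real \<Rightarrow> real \<Rightarrow> real \<Rightarrow> real" and C :: real
  obtain C1 where C1: "C1 > 0" "Lip (d_I f) C1" unfolding Lip_def using gd_lipschitz[OF d(1)] by metis
  obtain C2 where C2: "C2 > 0" "Lip (d_phi f) C2" unfolding Lip_def using gd_lipschitz[OF d(2)] by metis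
  obtain C3 where C3: "C3 > 0" "Lip (d_tau f) C3" unfolding Lip_def using gd_lipschitz[OF d(3)] by metis
  define C where "C = C1 + C2 + C3"
  have C: "C > 0" using C1 C2 C3 by (auto simp: C_def)
  have up: "Lip g C" if "Lip g C'" "C' \<le> C" for g C'
    unfolding Lip_def
  proof (intro allI impI)
    fix x x' y y' z z' assume "x \<in> {i0..i1}" "x' \<in> {i0..i1}" "z \<in> {-L..M}" "z' \<in> {-L..M}"
    then have "\<bar>g x y z - g x' y' z'\<bar> \<le> C' * (\<bar>x - x'\<bar> + \<bar>y - y'\<bar> + \<bar>z - z'\<bar>)"
      using that(1) unfolding Lip_def by blast
    also have "\<dots> \<le> C * (\<bar>x - x'\<bar> + \<bar>y - y'\<bar> + \<bar>z - z'\<bar>)" using that(2) by (intro mult_right_mono) auto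
    finally show "\<bar>g x y z - g x' y' z'\<bar> \<le> C * (\<bar>x - x'\<bar> + \<bar>y - y'\<bar> + \<bar>z - z'\<bar>)" .
  qed
  have LC: "Lip (d_I f) C" "Lip (d_phi f) C" "Lip (d_tau f) C"
    using up[OF C1(2)] up[OF C2(2)] up[OF C3(2)] C1(1) C2(1) C3(1) by (simp_all add: C_def)
  have "\<bar>f x y z - f x' y' z' - (d_I f x' y' z' * (x - x') + d_phi f x' y' z' * (y - y') + d_tau f x' y' z' * (z - z'))\<bar>
      \<le> C * (\<bar>x - x'\<bar> + \<bar>y - y'\<bar> + \<bar>z - z'\<bar>)\<^sup>2"
    if x: "x \<in> {i0..i1}" "x' \<in> {i0..i1}" and z: "z \<in> {-L..M}" "z' \<in> {-L..M}" for x x' y y' z z'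
  proof -
    define N where "N = \<bar>x - x'\<bar> + \<bar>y - y'\<bar> + \<bar>z - z'\<bar>"
    have key: "\<bar>g u v w - g x' y' z'\<bar> \<le> C * N"
      if "Lip g C" "u \<in> {i0..i1}" "w \<in> {-L..M}" "\<bar>u - x'\<bar> \<le> \<bar>x - x'\<bar>" "\<bar>v - y'\<bar> \<le> \<bar>y - y'\<bar>" "\<bar>w - z'\<bar> \<le> \<bar>z - z'\<bar>" for g u v w
    proof -
      have "\<bar>g u v w - g x' y' z'\<bar> \<le> C * (\<bar>u - x'\<bar> + \<bar>v - y'\<bar> + \<bar>w - z'\<bar>)"
        using that(1-3) x(2) z(2) unfolding Lip_def by blast
      also have "\<dots> \<le> C * N" using C that(4-6) unfolding N_def by (intro mult_left_mono) auto
      finally show ?thesis .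
    qed
    have sx: "t \<in> {i0..i1}" "\<bar>t - x'\<bar> \<le> \<bar>x - x'\<bar>" if "t \<in> closed_segment x x'" for t
      using closed_segment_real_subset[OF x] closed_segment_real_bound that by blast+
    have sz: "t \<in> {-L..M}" "\<bar>t - z'\<bar> \<le> \<bar>z - z'\<bar>" if "t \<in> closed_segment z z'" for t
      using closed_segment_real_subset[OF z] closed_segment_real_bound that by blast+
    have "\<bar>f x y z - f x' y z - d_I f x' y' z' * (x - x')\<bar> \<le> C * N * \<bar>x - x'\<bar>"
      by (rule deriv_approx[where h="\<lambda>t. f t y z"], rule has_field_derivative_at_within, rule gd_partials(1)[OF assms sx(1) z(1)], assumption)
        (intro key LC(1) sx order_refl z(1))
    moreover have "\<bar>f x' y z - f x' y' z - d_phi f x' y' z' * (y - y')\<bar> \<le> C * N * \<bar>y - y'\<bar>"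
      by (rule deriv_approx[where h="\<lambda>t. f x' t z"], rule has_field_derivative_at_within, rule gd_partials(2)[OF assms x(2) z(1)])
        (intro key LC(2) x(2) closed_segment_real_bound order_refl z(1), simp_all)
    moreover have "\<bar>f x' y' z - f x' y' z' - d_tau f x' y' z' * (z - z')\<bar> \<le> C * N * \<bar>z - z'\<bar>"
      by (rule deriv_approx[where h="\<lambda>t. f x' y' t"], rule has_field_derivative_at_within, rule gd_partials(3)[OF assms x(2) sz(1)], assumption)
        (intro key LC(3) x(2) sz, simp_all)
    moreover have "C * N * \<bar>x - x'\<bar> + C * N * \<bar>y - y'\<bar> + C * N * \<bar>z - z'\<bar> = C * N\<^sup>2"
      by (simp add: N_def power2_eq_square algebra_simps)
    ultimately show ?thesis unfolding N_def by linarith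
  qed
  with C show ?thesis using that by blast
qed

lemma zero_in: "0 \<in> {-L..M}" using LM by auto

lemma in_range: assumes "s \<in> {0..S}" shows "s \<in> {-L..M}" "- s \<in> {-L..M}"
  using assms S LM by auto

lemma tr_deriv:
  assumes f: "gd (Suc k) f" and s: "sol \<epsilon> I \<phi>" "s \<in> {-L..M}"
  shows "(tr f I \<phi> has_real_derivative (a * s / \<epsilon> * tr (d_phi f) I \<phi> s + tr (brk f) I \<phi> s)) (at s within {-L..M})"
proof -
  have "((\<lambda>s. f (I s) (\<phi> s) s) has_real_derivative
     d_I f (I s) (\<phi> s) s * - tr Hp I \<phi> s + d_phi f (I s) (\<phi> s) s * (a * s / \<epsilon> + tr Hi I \<phi> s)
       + d_tau f (I s) (\<phi> s) s * 1) (at s within {-L..M})"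
    by (rule cd_chain[OF U(1) V(1), where Z="\<lambda>s. s"])
      (use f solD[OF s(1)] s(2) ran in \<open>auto simp: gd_def\<close>)
  then show ?thesis unfolding tr_def[of f, abs_def]
    by (rule DERIV_cong) (simp add: tr_def brk_def algebra_simps)
qed

lemma reflect_deriv:
  assumes "s \<in> {0..S}" "\<And>s. s \<in> {-L..M} \<Longrightarrow> (g has_real_derivative g' s) (at s within {-L..M})"
  shows "((\<lambda>s. g (- s)) has_real_derivative - g' (- s)) (at s within {0..S})"
proof -
  have "(g has_real_derivative g' (- s)) (at (- s) within uminus ` {0..S})"
    by (rule has_field_derivative_subset[OF assms(2)]) (use assms(1) in_range in auto)
  moreover have "(uminus has_real_derivative - 1) (at s within {0..S})"
    by (auto intro!: derivative_eq_intros)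
  ultimately have "(g \<circ> uminus has_real_derivative g' (- s) * - 1) (at s within {0..S})"
    by (rule DERIV_image_chain)
  then show ?thesis by (simp add: o_def)
qed

text \<open>After \<open>a / 2 * (s\<^sup>2 / \<epsilon>)\<close> is subtracted, the phase moves
  with the bounded velocity \<open>Hi\<close>, as the action does with \<open>- Hp\<close>. So the
  constant is free of \<epsilon> although the phase itself is fast.\<close>

lemma displacement:
  obtains C where "C > 0"
    "\<And>\<epsilon> I \<phi> s. sol \<epsilon> I \<phi> \<Longrightarrow> s \<in> {-L..M} \<Longrightarrow> \<bar>I s - I 0\<bar> \<le> C * \<bar>s\<bar>"
    "\<And>\<epsilon> I \<phi> s. sol \<epsilon> I \<phi> \<Longrightarrow> s \<in> {-L..M} \<Longrightarrow> \<bar>\<phi> s - (\<phi> 0 + a / 2 * (s\<^sup>2 / \<epsilon>))\<bar> \<le> C * \<bar>s\<bar>"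
proof -
  obtain B1 where B1: "B1 > 0" "\<And>x y z. x \<in> {i0..i1} \<Longrightarrow> z \<in> {-L..M} \<Longrightarrow> \<bar>Hi x y z\<bar> \<le> B1"
    using gd_bounded[OF gd_Hi] by blast
  obtain B2 where B2: "B2 > 0" "\<And>x y z. x \<in> {i0..i1} \<Longrightarrow> z \<in> {-L..M} \<Longrightarrow> \<bar>Hp x y z\<bar> \<le> B2"
    using gd_bounded[OF gd_Hp] by blast
  define C where "C = B1 + B2"
  have 1: "\<bar>I s - I 0\<bar> \<le> C * \<bar>s\<bar>" if so: "sol \<epsilon> I \<phi>" and s: "s \<in> {-L..M}" for \<epsilon> I \<phi> s
  proof -
    have "norm (I s - I 0) \<le> C * norm (s - 0)"
    proof (rule field_differentiable_bound[where S="{-L..M}" and f=I])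
      fix t assume t: "t \<in> {-L..M}"
      show "(I has_real_derivative - tr Hp I \<phi> t) (at t within {-L..M})" by (rule solD(4)[OF so t])
      show "norm (- tr Hp I \<phi> t) \<le> C"
        using B2(2)[OF solD(3)[OF so t] t, of "\<phi> t"] B1(1) by (simp add: tr_def C_def)
    qed (use s zero_in in auto)
    then show ?thesis by simp
  qed
  have 2: "\<bar>\<phi> s - (\<phi> 0 + a / 2 * (s\<^sup>2 / \<epsilon>))\<bar> \<le> C * \<bar>s\<bar>" if so: "sol \<epsilon> I \<phi>" and s: "s \<in> {-L..M}" for \<epsilon> I \<phi> s
  proof -
    have e: "\<epsilon> > 0" using solD[OF so] by blast
    have "norm ((\<lambda>s. \<phi> s - a / 2 * (s\<^sup>2 / \<epsilon>)) s - (\<lambda>s. \<phi> s - a / 2 * (s\<^sup>2 / \<epsilon>)) 0) \<le> C * norm (s - 0)"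
    proof (rule field_differentiable_bound[where S="{-L..M}"])
      fix t assume t: "t \<in> {-L..M}"
      have "((\<lambda>s. a / 2 * (s\<^sup>2 / \<epsilon>)) has_real_derivative a * t / \<epsilon>) (at t within {-L..M})"
        using e by (auto intro!: derivative_eq_intros)
      from DERIV_diff[OF solD(5)[OF so t] this]
      show "((\<lambda>s. \<phi> s - a / 2 * (s\<^sup>2 / \<epsilon>)) has_real_derivative tr Hi I \<phi> t) (at t within {-L..M})"
        by simp
      show "norm (tr Hi I \<phi> t) \<le> C"
        using B1(2)[OF solD(3)[OF so t] t, of "\<phi> t"] B2(1) by (simp add: tr_def C_def)
    qed (use s zero_in in auto)
    then show ?thesis by (simp add: algebra_simps)
  qed
  show ?thesis using that[OF _ 1 2] B1(1) B2(1) by (simp add: C_def)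
qed

lemma pair1:
  assumes f: "gd (Suc k) f"
  obtains C where "C > 0" "\<And>\<epsilon> I \<phi> s. sol \<epsilon> I \<phi> \<Longrightarrow> s \<in> {-L..M} \<Longrightarrow> \<bar>tr f I \<phi> s - fr f \<epsilon> I \<phi> s\<bar> \<le> C * \<bar>s\<bar>"
proof -
  obtain C where C: "C > 0"
    "\<And>\<epsilon> I \<phi> s. sol \<epsilon> I \<phi> \<Longrightarrow> s \<in> {-L..M} \<Longrightarrow> \<bar>I s - I 0\<bar> \<le> C * \<bar>s\<bar>"
    "\<And>\<epsilon> I \<phi> s. sol \<epsilon> I \<phi> \<Longrightarrow> s \<in> {-L..M} \<Longrightarrow> \<bar>\<phi> s - (\<phi> 0 + a / 2 * (s\<^sup>2 / \<epsilon>))\<bar> \<le> C * \<bar>s\<bar>"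
    using displacement by blast
  obtain D where D: "D > 0" "\<And>x x' y y' z z'. x \<in> {i0..i1} \<Longrightarrow> x' \<in> {i0..i1} \<Longrightarrow> z \<in> {-L..M} \<Longrightarrow> z' \<in> {-L..M} \<Longrightarrow>
    \<bar>f x y z - f x' y' z'\<bar> \<le> D * (\<bar>x - x'\<bar> + \<bar>y - y'\<bar> + \<bar>z - z'\<bar>)"
    using gd_lipschitz[OF f] by blast
  have "\<bar>tr f I \<phi> s - fr f \<epsilon> I \<phi> s\<bar> \<le> D * (C + C + 1) * \<bar>s\<bar>" if so: "sol \<epsilon> I \<phi>" and s: "s \<in> {-L..M}" for \<epsilon> I \<phi> s
  proof -
    have "\<bar>tr f I \<phi> s - fr f \<epsilon> I \<phi> s\<bar> \<le> D * (\<bar>I s - I 0\<bar> + \<bar>\<phi> s - (\<phi> 0 + a / 2 * (s\<^sup>2 / \<epsilon>))\<bar> + \<bar>s - 0\<bar>)"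
      unfolding tr_def fr_def by (rule D(2)) (use solD(3)[OF so] s zero_in in blast)+
    also have "\<dots> \<le> D * (C * \<bar>s\<bar> + C * \<bar>s\<bar> + \<bar>s\<bar>)"
      using C(2)[OF so s] C(3)[OF so s] D(1) by (intro mult_left_mono add_mono) auto
    finally show ?thesis by (simp add: algebra_simps)
  qed
  then show ?thesis using that[of "D * (C + C + 1)"] C(1) D(1) by simp
qed

lemma pair_diff:
  assumes f: "gd (Suc k) f"
  obtains C where "C > 0" "\<And>\<epsilon> I \<phi> s. sol \<epsilon> I \<phi> \<Longrightarrow> s \<in> {0..S} \<Longrightarrow> \<bar>tr f I \<phi> s - tr f I \<phi> (- s)\<bar> \<le> C * s"
proof -
  obtain C where C: "C > 0" "\<And>\<epsilon> I \<phi> s. sol \<epsilon> I \<phi> \<Longrightarrow> s \<in> {-L..M} \<Longrightarrow> \<bar>tr f I \<phi> s - fr f \<epsilon> I \<phi> s\<bar> \<le> C * \<bar>s\<bar>"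
    using pair1[OF f] by blast
  have "\<bar>tr f I \<phi> s - tr f I \<phi> (- s)\<bar> \<le> 2 * C * s" if so: "sol \<epsilon> I \<phi>" and s: "s \<in> {0..S}" for \<epsilon> I \<phi> s
  proof -
    have "fr f \<epsilon> I \<phi> (- s) = fr f \<epsilon> I \<phi> s" by (simp add: fr_def)
    then show ?thesis using C(2)[OF so in_range(1)[OF s]] C(2)[OF so in_range(2)[OF s]] s by auto
  qed
  then show ?thesis using that[of "2 * C"] C(1) by simp
qed

lemma pair_displacement:
  obtains C where "C > 0"
    "\<And>\<epsilon> I \<phi> s. sol \<epsilon> I \<phi> \<Longrightarrow> s \<in> {0..S} \<Longrightarrow> \<bar>I s + I (- s) - 2 * I 0\<bar> \<le> C * s\<^sup>2"
    "\<And>\<epsilon> I \<phi> s. sol \<epsilon> I \<phi> \<Longrightarrow> s \<in> {0..S} \<Longrightarrow> \<bar>\<phi> s + \<phi> (- s) - 2 * (\<phi> 0 + a / 2 * (s\<^sup>2 / \<epsilon>))\<bar> \<le> C * s\<^sup>2"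
proof -
  obtain C1 where C1: "C1 > 0" "\<And>\<epsilon> I \<phi> s. sol \<epsilon> I \<phi> \<Longrightarrow> s \<in> {0..S} \<Longrightarrow> \<bar>tr Hi I \<phi> s - tr Hi I \<phi> (- s)\<bar> \<le> C1 * s"
    using pair_diff[of 1 Hi] gd_Hi by (metis Suc_1)
  obtain C2 where C2: "C2 > 0" "\<And>\<epsilon> I \<phi> s. sol \<epsilon> I \<phi> \<Longrightarrow> s \<in> {0..S} \<Longrightarrow> \<bar>tr Hp I \<phi> s - tr Hp I \<phi> (- s)\<bar> \<le> C2 * s"
    using pair_diff[of 1 Hp] gd_Hp by (metis Suc_1)
  define C where "C = C1 + C2"
  have bd: "\<bar>h s - h 0\<bar> \<le> C * s\<^sup>2"
    if "s \<in> {0..S}" "\<And>t. t \<in> {0..S} \<Longrightarrow> (h has_real_derivative h' t) (at t within {0..S})"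
      "\<And>t. t \<in> {0..S} \<Longrightarrow> \<bar>h' t\<bar> \<le> C * t" for h h' :: "real \<Rightarrow> real" and s
  proof -
    have "norm (h s - h 0) \<le> (C * s) * norm (s - 0)"
    proof (rule field_differentiable_bound[where S="{0..s}"])
      fix t assume t: "t \<in> {0..s}"
      show "(h has_real_derivative h' t) (at t within {0..s})"
        by (rule has_field_derivative_subset[OF that(2)]) (use t that(1) in auto)
      have "\<bar>h' t\<bar> \<le> C * t" using t that by auto
      also have "\<dots> \<le> C * s" using t C1(1) C2(1) by (intro mult_left_mono) (auto simp: C_def)
      finally show "norm (h' t) \<le> C * s" by simp
    qed (use that in auto)
    then show ?thesis using that(1) by (simp add: power2_eq_square)
  qed
  have 1: "\<bar>I s + I (- s) - 2 * I 0\<bar> \<le> C * s\<^sup>2" if so: "sol \<epsilon> I \<phi>" and s: "s \<in> {0..S}" for \<epsilon> I \<phi> s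
  proof -
    have "\<bar>(\<lambda>s. I s + I (- s)) s - (\<lambda>s. I s + I (- s)) 0\<bar> \<le> C * s\<^sup>2"
    proof (rule bd[OF s])
      fix t assume t: "t \<in> {0..S}"
      show "((\<lambda>s. I s + I (- s)) has_real_derivative - tr Hp I \<phi> t + - (- tr Hp I \<phi> (- t))) (at t within {0..S})"
        by (intro DERIV_add reflect_deriv[OF t solD(4)[OF so]]
            has_field_derivative_subset[OF solD(4)[OF so in_range(1)[OF t]]])
          (use in_range in auto)
      have "C2 * t \<le> C * t" using t C1(1) by (intro mult_right_mono) (auto simp: C_def)
      then show "\<bar>- tr Hp I \<phi> t + - (- tr Hp I \<phi> (- t))\<bar> \<le> C * t" using C2(2)[OF so t] by linarith
    qed
    then show ?thesis by simp
  qed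
  have 2: "\<bar>\<phi> s + \<phi> (- s) - 2 * (\<phi> 0 + a / 2 * (s\<^sup>2 / \<epsilon>))\<bar> \<le> C * s\<^sup>2" if so: "sol \<epsilon> I \<phi>" and s: "s \<in> {0..S}" for \<epsilon> I \<phi> s
  proof -
    have e: "\<epsilon> > 0" using solD[OF so] by blast
    have "\<bar>(\<lambda>s. \<phi> s + \<phi> (- s) - 2 * (a / 2 * (s\<^sup>2 / \<epsilon>))) s - (\<lambda>s. \<phi> s + \<phi> (- s) - 2 * (a / 2 * (s\<^sup>2 / \<epsilon>))) 0\<bar> \<le> C * s\<^sup>2"
    proof (rule bd[OF s])
      fix t assume t: "t \<in> {0..S}"
      have d: "((\<lambda>s. 2 * (a / 2 * (s\<^sup>2 / \<epsilon>))) has_real_derivative 2 * a * t / \<epsilon>) (at t within {0..S})"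
        using e by (auto intro!: derivative_eq_intros)
      have "((\<lambda>s. \<phi> s + \<phi> (- s) - 2 * (a / 2 * (s\<^sup>2 / \<epsilon>))) has_real_derivative
        (a * t / \<epsilon> + tr Hi I \<phi> t) + - (a * (- t) / \<epsilon> + tr Hi I \<phi> (- t)) - 2 * a * t / \<epsilon>) (at t within {0..S})"
        by (intro DERIV_diff[OF _ d] DERIV_add reflect_deriv[OF t solD(5)[OF so]]
            has_field_derivative_subset[OF solD(5)[OF so in_range(1)[OF t]]])
          (use in_range in auto)
      then show "((\<lambda>s. \<phi> s + \<phi> (- s) - 2 * (a / 2 * (s\<^sup>2 / \<epsilon>))) has_real_derivative
          tr Hi I \<phi> t - tr Hi I \<phi> (- t)) (at t within {0..S})"
        by (rule DERIV_cong) (simp add: field_simps)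
      have "C1 * t \<le> C * t" using t C2(1) by (intro mult_right_mono) (auto simp: C_def)
      then show "\<bar>tr Hi I \<phi> t - tr Hi I \<phi> (- t)\<bar> \<le> C * t" using C1(2)[OF so t] by linarith
    qed
    then show ?thesis by (simp add: algebra_simps)
  qed
  show ?thesis using that[OF _ 1 2] C1(1) C2(1) by (simp add: C_def)
qed

lemma pair2:
  assumes f: "gd (Suc (Suc k)) f"
  obtains C where "C > 0"
    "\<And>\<epsilon> I \<phi> s. sol \<epsilon> I \<phi> \<Longrightarrow> s \<in> {0..S} \<Longrightarrow> \<bar>tr f I \<phi> s + tr f I \<phi> (- s) - 2 * fr f \<epsilon> I \<phi> s\<bar> \<le> C * s\<^sup>2"
proof -
  obtain C where C: "C > 0"
    "\<And>\<epsilon> I \<phi> s. sol \<epsilon> I \<phi> \<Longrightarrow> s \<in> {-L..M} \<Longrightarrow> \<bar>I s - I 0\<bar> \<le> C * \<bar>s\<bar>"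
    "\<And>\<epsilon> I \<phi> s. sol \<epsilon> I \<phi> \<Longrightarrow> s \<in> {-L..M} \<Longrightarrow> \<bar>\<phi> s - (\<phi> 0 + a / 2 * (s\<^sup>2 / \<epsilon>))\<bar> \<le> C * \<bar>s\<bar>"
    using displacement by blast
  obtain P where P: "P > 0"
    "\<And>\<epsilon> I \<phi> s. sol \<epsilon> I \<phi> \<Longrightarrow> s \<in> {0..S} \<Longrightarrow> \<bar>I s + I (- s) - 2 * I 0\<bar> \<le> P * s\<^sup>2"
    "\<And>\<epsilon> I \<phi> s. sol \<epsilon> I \<phi> \<Longrightarrow> s \<in> {0..S} \<Longrightarrow> \<bar>\<phi> s + \<phi> (- s) - 2 * (\<phi> 0 + a / 2 * (s\<^sup>2 / \<epsilon>))\<bar> \<le> P * s\<^sup>2"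
    using pair_displacement by blast
  obtain D where D: "D > 0" "\<And>x x' y y' z z'. x \<in> {i0..i1} \<Longrightarrow> x' \<in> {i0..i1} \<Longrightarrow> z \<in> {-L..M} \<Longrightarrow> z' \<in> {-L..M} \<Longrightarrow>
    \<bar>f x y z - f x' y' z' - (d_I f x' y' z' * (x - x') + d_phi f x' y' z' * (y - y') + d_tau f x' y' z' * (z - z'))\<bar>
      \<le> D * (\<bar>x - x'\<bar> + \<bar>y - y'\<bar> + \<bar>z - z'\<bar>)\<^sup>2"
    using gd_taylor[OF f] by blast
  note d = gd_derivs[OF f]
  obtain B1 where B1: "B1 > 0" "\<And>x y z. x \<in> {i0..i1} \<Longrightarrow> z \<in> {-L..M} \<Longrightarrow> \<bar>d_I f x y z\<bar> \<le> B1"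
    using gd_bounded[OF d(1)] by blast
  obtain B2 where B2: "B2 > 0" "\<And>x y z. x \<in> {i0..i1} \<Longrightarrow> z \<in> {-L..M} \<Longrightarrow> \<bar>d_phi f x y z\<bar> \<le> B2"
    using gd_bounded[OF d(2)] by blast
  define A where "A = B1 * P + B2 * P + 2 * D * (C + C + 1)\<^sup>2"
  have "\<bar>tr f I \<phi> s + tr f I \<phi> (- s) - 2 * fr f \<epsilon> I \<phi> s\<bar> \<le> A * s\<^sup>2" if so: "sol \<epsilon> I \<phi>" and s: "s \<in> {0..S}" for \<epsilon> I \<phi> s
  proof -
    define q where "q = \<phi> 0 + a / 2 * (s\<^sup>2 / \<epsilon>)"
    define f1 f2 f3 where "f1 = d_I f (I 0) q 0" and "f2 = d_phi f (I 0) q 0" and "f3 = d_tau f (I 0) q 0"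
    have I0: "I 0 \<in> {i0..i1}" using solD(3)[OF so zero_in] .
    have T: "\<bar>tr f I \<phi> t - fr f \<epsilon> I \<phi> s - (f1 * (I t - I 0) + f2 * (\<phi> t - q) + f3 * t)\<bar> \<le> D * (C + C + 1)\<^sup>2 * s\<^sup>2"
      if t: "t \<in> {-L..M}" "\<bar>t\<bar> = s" for t
    proof -
      have "t\<^sup>2 = s\<^sup>2" using t(2) by (metis power2_abs)
      then have dt: "\<bar>I t - I 0\<bar> \<le> C * s" "\<bar>\<phi> t - q\<bar> \<le> C * s"
        using C(2)[OF so t(1)] C(3)[OF so t(1)] t(2) by (auto simp: q_def)
      have "\<bar>f (I t) (\<phi> t) t - f (I 0) q 0 - (f1 * (I t - I 0) + f2 * (\<phi> t - q) + f3 * (t - 0))\<bar>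
        \<le> D * (\<bar>I t - I 0\<bar> + \<bar>\<phi> t - q\<bar> + \<bar>t - 0\<bar>)\<^sup>2"
        unfolding f1_def f2_def f3_def by (rule D(2)[OF solD(3)[OF so t(1)] I0 t(1) zero_in])
      also have "\<dots> \<le> D * (C * s + C * s + s)\<^sup>2"
        using dt t(2) D(1) by (intro mult_left_mono power_mono add_mono) auto
      also have "\<dots> = D * (C + C + 1)\<^sup>2 * s\<^sup>2" by (simp add: power2_eq_square algebra_simps)
      finally show ?thesis by (simp add: tr_def fr_def q_def)
    qed
    have p: "\<bar>f1 * (I s + I (- s) - 2 * I 0)\<bar> \<le> B1 * (P * s\<^sup>2)"
      unfolding abs_mult f1_def using B1(2)[OF I0 zero_in] P(2)[OF so s] B1(1) by (intro mult_mono) auto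
    have q: "\<bar>f2 * (\<phi> s + \<phi> (- s) - 2 * q)\<bar> \<le> B2 * (P * s\<^sup>2)"
      unfolding abs_mult f2_def using B2(2)[OF I0 zero_in] P(3)[OF so s] B2(1) q_def by (intro mult_mono) auto
    have e: "tr f I \<phi> s + tr f I \<phi> (- s) - 2 * fr f \<epsilon> I \<phi> s =
      (tr f I \<phi> s - fr f \<epsilon> I \<phi> s - (f1 * (I s - I 0) + f2 * (\<phi> s - q) + f3 * s))
      + (tr f I \<phi> (- s) - fr f \<epsilon> I \<phi> s - (f1 * (I (- s) - I 0) + f2 * (\<phi> (- s) - q) + f3 * (- s)))
      + f1 * (I s + I (- s) - 2 * I 0) + f2 * (\<phi> s + \<phi> (- s) - 2 * q)" by (simp add: algebra_simps)
    have "\<bar>tr f I \<phi> s + tr f I \<phi> (- s) - 2 * fr f \<epsilon> I \<phi> s\<bar> \<le>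
      D * (C + C + 1)\<^sup>2 * s\<^sup>2 + D * (C + C + 1)\<^sup>2 * s\<^sup>2 + B1 * (P * s\<^sup>2) + B2 * (P * s\<^sup>2)"
      unfolding e
      by (intro order_trans[OF abs_triangle_ineq] add_mono p q T in_range s) (use s in auto)
    also have "\<dots> = A * s\<^sup>2" by (simp add: A_def algebra_simps)
    finally show ?thesis .
  qed
  moreover have "A > 0" unfolding A_def using B1 B2 P C D by (intro add_pos_nonneg mult_pos_pos) auto
  ultimately show ?thesis using that by blast
qed

end

lemma remainder_derivative:
  fixes Z f \<rho> :: "real \<Rightarrow> real"
  assumes "\<And>s. s \<in> {\<alpha>..\<beta>} \<Longrightarrow> (Z has_real_derivative f s + \<rho> s) (at s within {\<alpha>..\<beta>})"
    "continuous_on {\<alpha>..\<beta>} f" "s \<in> {\<alpha>..\<beta>}"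
  shows "((\<lambda>s. Z s - integral {\<alpha>..s} f) has_real_derivative \<rho> s) (at s within {\<alpha>..\<beta>})"
  using DERIV_diff[OF assms(1)[OF assms(3)] integral_has_real_derivative[OF assms(2,3)]] by simp

lemma abs_combine3:
  fixes z1 z2 y1 y2 i e1 e2 e3 :: real
  shows "\<bar>z1 - y1\<bar> \<le> e1 \<Longrightarrow> \<bar>z2 - y2\<bar> \<le> e2 \<Longrightarrow> \<bar>z2 - z1 - i\<bar> \<le> e3 \<Longrightarrow> \<bar>i - (y2 - y1)\<bar> \<le> e3 + (e1 + e2)"
  by linarith

text \<open>Differentiating \<open>G / s\<close> leaves \<open>brk G / s - G / s\<^sup>2\<close>.
  The \<open>G2\<close> term cancels the second part and the \<open>K\<close> term the oscillating
  portion of the first; what remains is \<open>m / s\<close> and terms with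
  \<open>\<epsilon>\<^sup>2\<close>.\<close>

lemma Z_algebra:
  fixes a \<epsilon> s :: real
  assumes "a \<noteq> 0" "\<epsilon> \<noteq> 0" "s \<noteq> 0"
  shows "\<epsilon> / a * (((a * s / \<epsilon> * F + bG) * s - g * 1) / (s * s))
    + \<epsilon>\<^sup>2 / a\<^sup>2 * (((a * s / \<epsilon> * g + bG2) * s ^ 3 - g2 * (3 * s\<^sup>2)) / (s ^ 3 * s ^ 3))
    - \<epsilon>\<^sup>2 / a\<^sup>2 * (((a * s / \<epsilon> * (bG - m) + bK) * s\<^sup>2 - k * (2 * s)) / (s\<^sup>2 * s\<^sup>2))
    = F + \<epsilon> / a * (m / s) + \<epsilon>\<^sup>2 / a\<^sup>2 * ((bG2 + 2 * k) / s ^ 3 - 3 * g2 / s ^ 4 - bK / s\<^sup>2)"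
  using assms by (simp add: field_simps eval_nat_numeral)

lemma Z0_algebra:
  fixes a \<epsilon> s :: real
  assumes "a \<noteq> 0" "\<epsilon> \<noteq> 0" "s \<noteq> 0"
  shows "\<epsilon> / a * ((F * (a * s / \<epsilon>) * s - g * 1) / (s * s))
    + \<epsilon>\<^sup>2 / a\<^sup>2 * ((g * (a * s / \<epsilon>) * s ^ 3 - g2 * (3 * s\<^sup>2)) / (s ^ 3 * s ^ 3))
    = F - 3 * (\<epsilon>\<^sup>2 / a\<^sup>2) * (g2 / s ^ 4)"
  using assms by (simp add: field_simps eval_nat_numeral)

context resonance
begin

lemma tr_cont:
  assumes "gd k f" "sol \<epsilon> I \<phi>" "T \<subseteq> {-L..M}"
  shows "continuous_on T (tr f I \<phi>)"
proof -
  have "continuous_on {-L..M} I" "continuous_on {-L..M} \<phi>"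
    using solD(4,5)[OF assms(2)] by (meson DERIV_continuous continuous_on_eq_continuous_within)+
  then have c: "continuous_on T I" "continuous_on T \<phi>" using assms(3) continuous_on_subset by blast+
  have "I s \<in> U" "s \<in> V" if "s \<in> T" for s
    using subsetD[OF assms(3) that] solD(3)[OF assms(2)] ran by auto
  then have "continuous_on T (\<lambda>s. (\<lambda>(x, y, z). f x y z) (I s, \<phi> s, s))"
    using assms(1) c unfolding gd_def
    by (intro continuous_on_compose2[OF cd_cont[of k U V f]]) (auto intro!: continuous_intros)
  then show ?thesis by (simp add: tr_def[abs_def])
qed

lemma fr_cont:
  assumes "gd k f" "sol \<epsilon> I \<phi>"
  shows "continuous_on T (fr f \<epsilon> I \<phi>)"
proof -
  have I0: "I 0 \<in> U" "0 \<in> V" using solD(3)[OF assms(2) zero_in] ran zero_in by auto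
  have "continuous_on T (\<lambda>s. (\<lambda>(x, y, z). f x y z) (I 0, \<phi> 0 + a / 2 * (s\<^sup>2 / \<epsilon>), 0))"
    by (rule continuous_on_compose2[OF cd_cont])
      (use assms(1) I0 solD(1)[OF assms(2)] in \<open>auto simp: gd_def intro!: continuous_intros\<close>)
  then show ?thesis by (simp add: fr_def[abs_def])
qed

lemma tr_cont_reflect:
  assumes "gd k f" "sol \<epsilon> I \<phi>" "T \<subseteq> {0..S}"
  shows "continuous_on T (\<lambda>s. tr f I \<phi> (- s))"
  by (rule continuous_on_compose2[OF tr_cont[OF assms(1,2) order_refl]])
    (use assms(3) in_range in \<open>auto intro!: continuous_intros\<close>)

end

text \<open>By repeated integration by parts, \<open>Z\<close> is an antiderivative of \<open>F + \<epsilon> m / (a s)\<close> along a solution, up to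
  \<open>rho\<close>. Near the resonance \<open>rho\<close> is too large on each side, but the sum of its values at \<open>s\<close> and \<open>- s\<close>, compared with
  that of the frozen motion, is smaller by a factor \<open>s\<close> or better (lemma \<open>inner\<close>).\<close>

section \<open>Integration by parts\<close>

locale resonance_term = resonance +
  fixes F G G2 K m :: "real \<Rightarrow> real \<Rightarrow> real \<Rightarrow> real"
  assumes gF: "gd (Suc (Suc 0)) F" and gG: "gd (Suc (Suc 0)) G" and gG2: "gd (Suc (Suc 0)) G2"
    and gK: "gd (Suc 0) K" and gm: "gd 0 m"
    and dG: "\<And>x y z. x \<in> U \<Longrightarrow> z \<in> V \<Longrightarrow> d_phi G x y z = F x y z"
    and dG2: "\<And>x y z. x \<in> U \<Longrightarrow> z \<in> V \<Longrightarrow> d_phi G2 x y z = G x y z"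
    and dK: "\<And>x y z. x \<in> U \<Longrightarrow> z \<in> V \<Longrightarrow> d_phi K x y z = brk G x y z - m x y z"
begin

definition Z where "Z \<epsilon> I \<phi> s = \<epsilon> / a * (tr G I \<phi> s / s) + \<epsilon>\<^sup>2 / a\<^sup>2 * (tr G2 I \<phi> s / s ^ 3)
  - \<epsilon>\<^sup>2 / a\<^sup>2 * (tr K I \<phi> s / s\<^sup>2)"

definition rho where "rho \<epsilon> I \<phi> s = \<epsilon>\<^sup>2 / a\<^sup>2 * ((tr (brk G2) I \<phi> s + 2 * tr K I \<phi> s) / s ^ 3
  - 3 * tr G2 I \<phi> s / s ^ 4 - tr (brk K) I \<phi> s / s\<^sup>2)"

lemma Z_deriv:
  assumes so: "sol \<epsilon> I \<phi>" and s: "s \<in> {-L..M}" "s \<noteq> 0"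
  shows "(Z \<epsilon> I \<phi> has_real_derivative (tr F I \<phi> s + \<epsilon> / a * (tr m I \<phi> s / s)) + rho \<epsilon> I \<phi> s) (at s within {-L..M})"
proof -
  have e: "\<epsilon> \<noteq> 0" using solD(1)[OF so] by simp
  have "I s \<in> U" "s \<in> V" using solD(3)[OF so s(1)] s ran by auto
  then have eq: "tr (d_phi G) I \<phi> s = tr F I \<phi> s" "tr (d_phi G2) I \<phi> s = tr G I \<phi> s"
    "tr (d_phi K) I \<phi> s = tr (brk G) I \<phi> s - tr m I \<phi> s"
    by (simp_all add: tr_def dG dG2 dK)
  note D = tr_deriv[OF gG so s(1), unfolded eq] tr_deriv[OF gG2 so s(1), unfolded eq] tr_deriv[OF gK so s(1), unfolded eq]
  have p: "((\<lambda>s. s) has_real_derivative 1) (at s within {-L..M})"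
    "((\<lambda>s. s ^ 3) has_real_derivative 3 * s\<^sup>2) (at s within {-L..M})"
    "((\<lambda>s. s\<^sup>2) has_real_derivative 2 * s) (at s within {-L..M})"
    by (auto intro!: derivative_eq_intros)
  have nz: "s \<noteq> 0" "s ^ 3 \<noteq> 0" "s\<^sup>2 \<noteq> 0" using s(2) by auto
  show ?thesis
    unfolding Z_def[abs_def] rho_def
    by (rule DERIV_cong[OF DERIV_diff[OF DERIV_add[OF DERIV_cmult[OF DERIV_divide[OF D(1) p(1) nz(1)]]
            DERIV_cmult[OF DERIV_divide[OF D(2) p(2) nz(2)]]] DERIV_cmult[OF DERIV_divide[OF D(3) p(3) nz(3)]]]
          Z_algebra[OF a e s(2)]])
qed

text \<open>For \<open>S \<le> \<bar>s\<bar>\<close> the divisors are bounded below, so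
  \<open>rho\<close> and the boundary terms with \<open>G2\<close> and \<open>K\<close> are of order
  \<open>\<epsilon>\<^sup>2\<close>; no pairing is involved.\<close>

lemma outer:
  obtains C where "C > 0" "\<And>\<epsilon> I \<phi> \<alpha> \<beta>. sol \<epsilon> I \<phi> \<Longrightarrow> \<alpha> \<le> \<beta> \<Longrightarrow> {\<alpha>..\<beta>} \<subseteq> {-L..M} \<Longrightarrow> (\<And>s. s \<in> {\<alpha>..\<beta>} \<Longrightarrow> S \<le> \<bar>s\<bar>) \<Longrightarrow>
    \<bar>integral {\<alpha>..\<beta>} (tr F I \<phi>) + \<epsilon> / a * integral {\<alpha>..\<beta>} (\<lambda>s. tr m I \<phi> s / s)
      - \<epsilon> / a * (tr G I \<phi> \<beta> / \<beta> - tr G I \<phi> \<alpha> / \<alpha>)\<bar> \<le> C * \<epsilon>\<^sup>2"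
proof -
  obtain B1 where B1: "B1 > 0" "\<And>x y z. x \<in> {i0..i1} \<Longrightarrow> z \<in> {-L..M} \<Longrightarrow> \<bar>brk G2 x y z\<bar> \<le> B1"
    using gd_bounded[OF gd_brk[OF gG2]] by auto
  obtain B2 where B2: "B2 > 0" "\<And>x y z. x \<in> {i0..i1} \<Longrightarrow> z \<in> {-L..M} \<Longrightarrow> \<bar>K x y z\<bar> \<le> B2"
    using gd_bounded[OF gK] by auto
  obtain B3 where B3: "B3 > 0" "\<And>x y z. x \<in> {i0..i1} \<Longrightarrow> z \<in> {-L..M} \<Longrightarrow> \<bar>G2 x y z\<bar> \<le> B3"
    using gd_bounded[OF gG2] by auto
  obtain B4 where B4: "B4 > 0" "\<And>x y z. x \<in> {i0..i1} \<Longrightarrow> z \<in> {-L..M} \<Longrightarrow> \<bar>brk K x y z\<bar> \<le> B4"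
    using gd_bounded[OF gd_brk[OF gK]] by auto
  \<comment> \<open>\<open>A\<close> bounds \<open>rho\<close>, and \<open>E\<close> the boundary
    terms of second order, both after division by \<open>\<epsilon>\<^sup>2\<close>.\<close>
  define A where "A = ((B1 + 2 * B2) / S ^ 3 + 3 * B3 / S ^ 4 + B4 / S\<^sup>2) / a\<^sup>2"
  define E where "E = (B3 / S ^ 3 + B2 / S\<^sup>2) / a\<^sup>2"
  have pos: "A > 0" "E > 0" using B1 B2 B3 B4 S a by (auto simp: A_def E_def intro!: divide_pos_pos add_pos_pos)
  have "\<bar>integral {\<alpha>..\<beta>} (tr F I \<phi>) + \<epsilon> / a * integral {\<alpha>..\<beta>} (\<lambda>s. tr m I \<phi> s / s)
      - \<epsilon> / a * (tr G I \<phi> \<beta> / \<beta> - tr G I \<phi> \<alpha> / \<alpha>)\<bar> \<le> (A * (L + M) + 2 * E) * \<epsilon>\<^sup>2"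
    if so: "sol \<epsilon> I \<phi>" and ab: "\<alpha> \<le> \<beta>" "{\<alpha>..\<beta>} \<subseteq> {-L..M}" and big: "\<And>s. s \<in> {\<alpha>..\<beta>} \<Longrightarrow> S \<le> \<bar>s\<bar>" for \<epsilon> I \<phi> \<alpha> \<beta>
  proof -
    have e: "\<epsilon> > 0" using solD(1)[OF so] .
    have nz: "s \<noteq> 0" if "s \<in> {\<alpha>..\<beta>}" for s using big[OF that] S(1) by auto
    have dv: "\<bar>x / s ^ n\<bar> \<le> B / S ^ n" if "s \<in> {\<alpha>..\<beta>}" "\<bar>x\<bar> \<le> B" for x s B n
    proof -
      have "\<bar>x\<bar> / \<bar>s\<bar> ^ n \<le> B / S ^ n"
        using that big[OF that(1)] S(1) by (intro frac_le power_mono zero_less_power) auto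
      then show ?thesis by (simp add: power_abs)
    qed
    have trb: "\<bar>tr (brk G2) I \<phi> s\<bar> \<le> B1" "\<bar>tr K I \<phi> s\<bar> \<le> B2" "\<bar>tr G2 I \<phi> s\<bar> \<le> B3" "\<bar>tr (brk K) I \<phi> s\<bar> \<le> B4"
      if "s \<in> {\<alpha>..\<beta>}" for s
      using that ab(2) solD(3)[OF so] B1(2) B2(2) B3(2) B4(2) unfolding tr_def by (meson subsetD)+
    define f where "f s = tr F I \<phi> s + \<epsilon> / a * (tr m I \<phi> s / s)" for s
    have cF: "continuous_on {\<alpha>..\<beta>} (tr F I \<phi>)" and cm: "continuous_on {\<alpha>..\<beta>} (\<lambda>s. tr m I \<phi> s / s)"
      by (intro continuous_on_divide continuous_on_id tr_cont[OF gF so ab(2)] tr_cont[OF gm so ab(2)] ballI nz; assumption)+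
    have cf: "continuous_on {\<alpha>..\<beta>} f"
      unfolding f_def by (intro continuous_intros cF cm)
    have rho: "\<bar>rho \<epsilon> I \<phi> s\<bar> \<le> A * \<epsilon>\<^sup>2" if s: "s \<in> {\<alpha>..\<beta>}" for s
    proof -
      have "\<bar>tr (brk G2) I \<phi> s + 2 * tr K I \<phi> s\<bar> \<le> B1 + 2 * B2" using trb[OF s] by linarith
      moreover have "\<bar>3 * tr G2 I \<phi> s\<bar> \<le> 3 * B3" using trb[OF s] by linarith
      ultimately have "\<bar>(tr (brk G2) I \<phi> s + 2 * tr K I \<phi> s) / s ^ 3 - 3 * tr G2 I \<phi> s / s ^ 4 - tr (brk K) I \<phi> s / s\<^sup>2\<bar>
        \<le> (B1 + 2 * B2) / S ^ 3 + 3 * B3 / S ^ 4 + B4 / S\<^sup>2"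
        using dv[OF s, of "tr (brk G2) I \<phi> s + 2 * tr K I \<phi> s" "B1 + 2 * B2" 3]
          dv[OF s, of "3 * tr G2 I \<phi> s" "3 * B3" 4] dv[OF s trb(4)[OF s], of 2] by linarith
      then have "\<epsilon>\<^sup>2 / a\<^sup>2 * \<bar>(tr (brk G2) I \<phi> s + 2 * tr K I \<phi> s) / s ^ 3 - 3 * tr G2 I \<phi> s / s ^ 4 - tr (brk K) I \<phi> s / s\<^sup>2\<bar>
        \<le> \<epsilon>\<^sup>2 / a\<^sup>2 * ((B1 + 2 * B2) / S ^ 3 + 3 * B3 / S ^ 4 + B4 / S\<^sup>2)" by (intro mult_left_mono) auto
      then show ?thesis by (simp add: rho_def A_def abs_mult mult.commute)
    qed
    have "norm ((\<lambda>s. Z \<epsilon> I \<phi> s - integral {\<alpha>..s} f) \<beta> - (\<lambda>s. Z \<epsilon> I \<phi> s - integral {\<alpha>..s} f) \<alpha>) \<le> A * \<epsilon>\<^sup>2 * norm (\<beta> - \<alpha>)"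
    proof (rule field_differentiable_bound[where S="{\<alpha>..\<beta>}" and f'="rho \<epsilon> I \<phi>"])
      fix s assume s: "s \<in> {\<alpha>..\<beta>}"
      show "((\<lambda>s. Z \<epsilon> I \<phi> s - integral {\<alpha>..s} f) has_real_derivative rho \<epsilon> I \<phi> s) (at s within {\<alpha>..\<beta>})"
        by (rule remainder_derivative[OF _ cf s], unfold f_def)
          (rule has_field_derivative_subset[OF Z_deriv[OF so] ab(2)], use ab nz in auto)
      show "norm (rho \<epsilon> I \<phi> s) \<le> A * \<epsilon>\<^sup>2" using rho[OF s] by simp
    qed (use ab in auto)
    also have "\<dots> \<le> A * \<epsilon>\<^sup>2 * (L + M)" using ab pos by (intro mult_left_mono) auto
    finally have 1: "\<bar>(Z \<epsilon> I \<phi> \<beta> - Z \<epsilon> I \<phi> \<alpha>) - integral {\<alpha>..\<beta>} f\<bar> \<le> A * (L + M) * \<epsilon>\<^sup>2"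
      by (simp add: algebra_simps)
    have 2: "integral {\<alpha>..\<beta>} f = integral {\<alpha>..\<beta>} (tr F I \<phi>) + \<epsilon> / a * integral {\<alpha>..\<beta>} (\<lambda>s. tr m I \<phi> s / s)"
      unfolding f_def
      by (subst integral_add, (intro integrable_continuous_real cF continuous_on_mult continuous_on_const cm)+,
          simp only: integral_mult_right)
    have 3: "\<bar>Z \<epsilon> I \<phi> s - \<epsilon> / a * (tr G I \<phi> s / s)\<bar> \<le> E * \<epsilon>\<^sup>2" if s: "s \<in> {\<alpha>..\<beta>}" for s
    proof -
      have "\<bar>tr G2 I \<phi> s / s ^ 3 - tr K I \<phi> s / s\<^sup>2\<bar> \<le> B3 / S ^ 3 + B2 / S\<^sup>2"
        using dv[OF s trb(3)[OF s], of 3] dv[OF s trb(2)[OF s], of 2] by linarith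
      then have "\<epsilon>\<^sup>2 / a\<^sup>2 * \<bar>tr G2 I \<phi> s / s ^ 3 - tr K I \<phi> s / s\<^sup>2\<bar> \<le> \<epsilon>\<^sup>2 / a\<^sup>2 * (B3 / S ^ 3 + B2 / S\<^sup>2)"
        by (intro mult_left_mono) auto
      moreover have "Z \<epsilon> I \<phi> s - \<epsilon> / a * (tr G I \<phi> s / s) = \<epsilon>\<^sup>2 / a\<^sup>2 * (tr G2 I \<phi> s / s ^ 3 - tr K I \<phi> s / s\<^sup>2)"
        by (simp add: Z_def algebra_simps)
      ultimately show ?thesis by (simp add: E_def abs_mult mult.commute)
    qed
    have "\<alpha> \<in> {\<alpha>..\<beta>}" "\<beta> \<in> {\<alpha>..\<beta>}" using ab by auto
    note abs_combine3[OF 3[OF this(1)] 3[OF this(2)] 1[unfolded 2]]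
    then have "\<bar>integral {\<alpha>..\<beta>} (tr F I \<phi>) + \<epsilon> / a * integral {\<alpha>..\<beta>} (\<lambda>s. tr m I \<phi> s / s)
      - (\<epsilon> / a * (tr G I \<phi> \<beta> / \<beta>) - \<epsilon> / a * (tr G I \<phi> \<alpha> / \<alpha>))\<bar> \<le> A * (L + M) * \<epsilon>\<^sup>2 + (E * \<epsilon>\<^sup>2 + E * \<epsilon>\<^sup>2)" .
    then show ?thesis by (simp add: right_diff_distrib distrib_right mult.assoc)
  qed
  moreover have "A * (L + M) + 2 * E > 0" using pos LM by (intro add_pos_pos mult_pos_pos) auto
  ultimately show ?thesis using that by blast
qed

lemma inner:
  obtains C where "C > 0" "\<And>\<epsilon> I \<phi>. sol \<epsilon> I \<phi> \<Longrightarrow>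
    \<bar>integral {sqrt \<epsilon>..S} (\<lambda>s. tr F I \<phi> s + tr F I \<phi> (- s) - 2 * fr F \<epsilon> I \<phi> s)
      + \<epsilon> / a * integral {sqrt \<epsilon>..S} (\<lambda>s. (tr m I \<phi> s - tr m I \<phi> (- s)) / s)
      - \<epsilon> / a * ((tr G I \<phi> S + tr G I \<phi> (- S) - 2 * fr G \<epsilon> I \<phi> S) / S)\<bar> \<le> C * (\<epsilon> * sqrt \<epsilon>)"
proof -
  obtain B2 where B2: "B2 > 0" "\<And>x y z. x \<in> {i0..i1} \<Longrightarrow> z \<in> {-L..M} \<Longrightarrow> \<bar>K x y z\<bar> \<le> B2"
    using gd_bounded[OF gK] by auto
  obtain B3 where B3: "B3 > 0" "\<And>x y z. x \<in> {i0..i1} \<Longrightarrow> z \<in> {-L..M} \<Longrightarrow> \<bar>G2 x y z\<bar> \<le> B3"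
    using gd_bounded[OF gG2] by auto
  obtain B4 where B4: "B4 > 0" "\<And>x y z. x \<in> {i0..i1} \<Longrightarrow> z \<in> {-L..M} \<Longrightarrow> \<bar>brk K x y z\<bar> \<le> B4"
    using gd_bounded[OF gd_brk[OF gK]] by auto
  obtain C1 where C1: "C1 > 0" "\<And>\<epsilon> I \<phi> s. sol \<epsilon> I \<phi> \<Longrightarrow> s \<in> {0..S} \<Longrightarrow> \<bar>tr (brk G2) I \<phi> s - tr (brk G2) I \<phi> (- s)\<bar> \<le> C1 * s"
    using pair_diff[OF gd_brk[OF gG2]] by auto
  obtain C2 where C2: "C2 > 0" "\<And>\<epsilon> I \<phi> s. sol \<epsilon> I \<phi> \<Longrightarrow> s \<in> {0..S} \<Longrightarrow> \<bar>tr K I \<phi> s - tr K I \<phi> (- s)\<bar> \<le> C2 * s"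
    using pair_diff[OF gK] by auto
  obtain C3 where C3: "C3 > 0" "\<And>\<epsilon> I \<phi> s. sol \<epsilon> I \<phi> \<Longrightarrow> s \<in> {0..S} \<Longrightarrow> \<bar>tr G2 I \<phi> s + tr G2 I \<phi> (- s) - 2 * fr G2 \<epsilon> I \<phi> s\<bar> \<le> C3 * s\<^sup>2"
    using pair2[OF gG2] by auto
  obtain C4 where C4: "C4 > 0" "\<And>\<epsilon> I \<phi> s. sol \<epsilon> I \<phi> \<Longrightarrow> s \<in> {0..S} \<Longrightarrow> \<bar>tr G I \<phi> s + tr G I \<phi> (- s) - 2 * fr G \<epsilon> I \<phi> s\<bar> \<le> C4 * s\<^sup>2"
    using pair2[OF gG] by auto
  define A where "A = (C1 + 2 * C2 + 3 * C3 + 2 * B4) / a\<^sup>2"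
  define E where "E = (4 * B3 / S ^ 3 + 2 * B2 / S\<^sup>2) / a\<^sup>2"
  define R where "R = C4 / \<bar>a\<bar> + (C3 + C2) / a\<^sup>2"
  have pos: "A > 0" "E > 0" "R > 0" using B2 B3 B4 C1 C2 C3 C4 S a
    by (auto simp: A_def E_def R_def intro!: divide_pos_pos add_pos_pos)
  have "\<bar>integral {sqrt \<epsilon>..S} (\<lambda>s. tr F I \<phi> s + tr F I \<phi> (- s) - 2 * fr F \<epsilon> I \<phi> s)
      + \<epsilon> / a * integral {sqrt \<epsilon>..S} (\<lambda>s. (tr m I \<phi> s - tr m I \<phi> (- s)) / s)
      - \<epsilon> / a * ((tr G I \<phi> S + tr G I \<phi> (- S) - 2 * fr G \<epsilon> I \<phi> S) / S)\<bar> \<le> (A + R + E * S) * (\<epsilon> * sqrt \<epsilon>)"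
    if so: "sol \<epsilon> I \<phi>" for \<epsilon> I \<phi>
  proof -
    define r where "r = sqrt \<epsilon>"
    have e: "\<epsilon> > 0" and rS: "r \<le> S" using solD(1,2)[OF so] by (auto simp: r_def)
    have r: "r > 0" "\<epsilon> = r\<^sup>2" using e by (auto simp: r_def)
    have sub: "{r..S} \<subseteq> {0..S}" "{r..S} \<subseteq> {-L..M}" using r in_range by auto
    define f where "f s = (tr F I \<phi> s + tr F I \<phi> (- s) - 2 * fr F \<epsilon> I \<phi> s) + \<epsilon> / a * ((tr m I \<phi> s - tr m I \<phi> (- s)) / s)" for s
    define Z0 where "Z0 s = \<epsilon> / a * (fr G \<epsilon> I \<phi> s / s) + \<epsilon>\<^sup>2 / a\<^sup>2 * (fr G2 \<epsilon> I \<phi> s / s ^ 3)" for s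
    define D where "D s = Z \<epsilon> I \<phi> s - Z \<epsilon> I \<phi> (- s) - 2 * Z0 s" for s
    define \<rho> where "\<rho> s = rho \<epsilon> I \<phi> s + rho \<epsilon> I \<phi> (- s) + 6 * (\<epsilon>\<^sup>2 / a\<^sup>2) * (fr G2 \<epsilon> I \<phi> s / s ^ 4)" for s
    have cF: "continuous_on {r..S} (\<lambda>s. tr F I \<phi> s + tr F I \<phi> (- s) - 2 * fr F \<epsilon> I \<phi> s)"
      by (intro continuous_intros tr_cont[OF gF so sub(2)] tr_cont_reflect[OF gF so sub(1)] fr_cont[OF gF so])
    have cm: "continuous_on {r..S} (\<lambda>s. (tr m I \<phi> s - tr m I \<phi> (- s)) / s)"
      by (intro continuous_intros tr_cont[OF gm so sub(2)] tr_cont_reflect[OF gm so sub(1)]) (use r in auto)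
    have cf: "continuous_on {r..S} f"
      unfolding f_def by (intro continuous_on_add[OF cF] continuous_intros cm)
    have D_deriv: "(D has_real_derivative f s + \<rho> s) (at s within {r..S})" if s: "s \<in> {r..S}" for s
    proof -
      have s0: "s \<noteq> 0" "s \<in> {0..S}" using s r by auto
      have 1: "(Z \<epsilon> I \<phi> has_real_derivative (tr F I \<phi> s + \<epsilon> / a * (tr m I \<phi> s / s)) + rho \<epsilon> I \<phi> s) (at s within {r..S})"
        by (rule has_field_derivative_subset[OF Z_deriv[OF so]]) (use s0 sub in_range in auto)
      have 2: "((\<lambda>s. Z \<epsilon> I \<phi> (- s)) has_real_derivative
         - ((tr F I \<phi> (- s) + \<epsilon> / a * (tr m I \<phi> (- s) / (- s))) + rho \<epsilon> I \<phi> (- s))) (at s within {r..S})"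
      proof -
        have "(Z \<epsilon> I \<phi> has_real_derivative (tr F I \<phi> (- s) + \<epsilon> / a * (tr m I \<phi> (- s) / (- s))) + rho \<epsilon> I \<phi> (- s)) (at (- s) within uminus ` {r..S})"
          by (rule has_field_derivative_subset[OF Z_deriv[OF so]]) (use s0 sub in_range in auto)
        moreover have "(uminus has_real_derivative - 1) (at s within {r..S})"
          by (auto intro!: derivative_eq_intros)
        ultimately have "(Z \<epsilon> I \<phi> \<circ> uminus has_real_derivative
          ((tr F I \<phi> (- s) + \<epsilon> / a * (tr m I \<phi> (- s) / (- s))) + rho \<epsilon> I \<phi> (- s)) * - 1) (at s within {r..S})"
          by (rule DERIV_image_chain)
        then show ?thesis by (simp add: o_def)
      qed
      have I0: "I 0 \<in> U" "0 \<in> V" using solD(3)[OF so zero_in] ran zero_in by auto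
      have q: "((\<lambda>s. \<phi> 0 + a / 2 * (s\<^sup>2 / \<epsilon>)) has_real_derivative a * s / \<epsilon>) (at s within {r..S})"
        using e by (auto intro!: derivative_eq_intros)
      have fG: "(fr G \<epsilon> I \<phi> has_real_derivative fr F \<epsilon> I \<phi> s * (a * s / \<epsilon>)) (at s within {r..S})"
        using DERIV_chain2[OF gd_partials(2)[OF gG solD(3)[OF so zero_in] zero_in] q]
        unfolding fr_def[abs_def] dG[OF I0] .
      have fG2: "(fr G2 \<epsilon> I \<phi> has_real_derivative fr G \<epsilon> I \<phi> s * (a * s / \<epsilon>)) (at s within {r..S})"
        using DERIV_chain2[OF gd_partials(2)[OF gG2 solD(3)[OF so zero_in] zero_in] q]
        unfolding fr_def[abs_def] dG2[OF I0] .
      have p: "((\<lambda>s. s) has_real_derivative 1) (at s within {r..S})"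
        "((\<lambda>s. s ^ 3) has_real_derivative 3 * s\<^sup>2) (at s within {r..S})"
        by (auto intro!: derivative_eq_intros)
      have nz: "s ^ 3 \<noteq> 0" using s0 by auto
      have 3: "(Z0 has_real_derivative fr F \<epsilon> I \<phi> s - 3 * (\<epsilon>\<^sup>2 / a\<^sup>2) * (fr G2 \<epsilon> I \<phi> s / s ^ 4)) (at s within {r..S})"
        unfolding Z0_def[abs_def]
        by (rule DERIV_cong[OF DERIV_add[OF DERIV_cmult[OF DERIV_divide[OF fG p(1) s0(1)]]
            DERIV_cmult[OF DERIV_divide[OF fG2 p(2) nz]]] Z0_algebra[OF a _ s0(1)]]) (use e in simp)
      show ?thesis
        unfolding D_def[abs_def]
        by (rule DERIV_cong[OF DERIV_diff[OF DERIV_diff[OF 1 2] DERIV_cmult[OF 3]]])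
          (simp add: f_def \<rho>_def algebra_simps diff_divide_distrib)
    qed
    have \<rho>: "\<bar>\<rho> s\<bar> \<le> A * \<epsilon>\<^sup>2 * (real 1 / s ^ Suc 1)" if s: "s \<in> {r..S}" for s
    proof -
      have s0: "s > 0" "s \<in> {0..S}" using s r by auto
      have eq: "\<rho> s = \<epsilon>\<^sup>2 / a\<^sup>2 * (((tr (brk G2) I \<phi> s - tr (brk G2) I \<phi> (- s)) + 2 * (tr K I \<phi> s - tr K I \<phi> (- s))) / s ^ 3
         - 3 * (tr G2 I \<phi> s + tr G2 I \<phi> (- s) - 2 * fr G2 \<epsilon> I \<phi> s) / s ^ 4
         - (tr (brk K) I \<phi> s + tr (brk K) I \<phi> (- s)) / s\<^sup>2)"
      proof -
        have "(- s) ^ 3 = - (s ^ 3)" "(- s) ^ 4 = s ^ 4" "(- s)\<^sup>2 = s\<^sup>2" by simp_all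
        then show ?thesis
          unfolding \<rho>_def rho_def by (simp add: diff_divide_distrib add_divide_distrib algebra_simps)
      qed
      have "\<bar>((tr (brk G2) I \<phi> s - tr (brk G2) I \<phi> (- s)) + 2 * (tr K I \<phi> s - tr K I \<phi> (- s))) / s ^ 3\<bar>
         \<le> (C1 + 2 * C2) / s\<^sup>2"
      proof -
        have "\<bar>(tr (brk G2) I \<phi> s - tr (brk G2) I \<phi> (- s)) + 2 * (tr K I \<phi> s - tr K I \<phi> (- s))\<bar> \<le> C1 * s + 2 * (C2 * s)"
          using C1(2)[OF so s0(2)] C2(2)[OF so s0(2)] unfolding abs_le_iff by argo
        then have "\<bar>(tr (brk G2) I \<phi> s - tr (brk G2) I \<phi> (- s)) + 2 * (tr K I \<phi> s - tr K I \<phi> (- s))\<bar> / s ^ 3 \<le> (C1 * s + 2 * (C2 * s)) / s ^ 3"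
          using s0 by (intro divide_right_mono) auto
        also have "\<dots> = (C1 + 2 * C2) / s\<^sup>2" using s0 by (simp add: field_simps eval_nat_numeral)
        finally show ?thesis using s0 by simp
      qed
      moreover have "\<bar>3 * (tr G2 I \<phi> s + tr G2 I \<phi> (- s) - 2 * fr G2 \<epsilon> I \<phi> s) / s ^ 4\<bar> \<le> 3 * C3 / s\<^sup>2"
      proof -
        have "3 * \<bar>tr G2 I \<phi> s + tr G2 I \<phi> (- s) - 2 * fr G2 \<epsilon> I \<phi> s\<bar> / s ^ 4 \<le> 3 * (C3 * s\<^sup>2) / s ^ 4"
          using s0 C3(2)[OF so s0(2)] by (intro divide_right_mono) auto
        also have "\<dots> = 3 * C3 / s\<^sup>2" using s0 by (simp add: field_simps eval_nat_numeral)
        finally have "3 * \<bar>tr G2 I \<phi> s + tr G2 I \<phi> (- s) - 2 * fr G2 \<epsilon> I \<phi> s\<bar> / s ^ 4 \<le> 3 * C3 / s\<^sup>2" .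
        moreover have "\<bar>3 * X / s ^ 4\<bar> = 3 * \<bar>X\<bar> / s ^ 4" for X using s0 by (simp add: abs_mult)
        ultimately show ?thesis by presburger
      qed
      moreover have "\<bar>(tr (brk K) I \<phi> s + tr (brk K) I \<phi> (- s)) / s\<^sup>2\<bar> \<le> 2 * B4 / s\<^sup>2"
      proof -
        have "\<bar>tr (brk K) I \<phi> s + tr (brk K) I \<phi> (- s)\<bar> \<le> 2 * B4"
          using B4(2)[OF solD(3)[OF so in_range(1)[OF s0(2)]] in_range(1)[OF s0(2)], of "\<phi> s"]
            B4(2)[OF solD(3)[OF so in_range(2)[OF s0(2)]] in_range(2)[OF s0(2)], of "\<phi> (- s)"]
          unfolding tr_def by linarith
        then show ?thesis using s0 by (simp add: divide_right_mono)
      qed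
      ultimately have "\<bar>((tr (brk G2) I \<phi> s - tr (brk G2) I \<phi> (- s)) + 2 * (tr K I \<phi> s - tr K I \<phi> (- s))) / s ^ 3
         - 3 * (tr G2 I \<phi> s + tr G2 I \<phi> (- s) - 2 * fr G2 \<epsilon> I \<phi> s) / s ^ 4
         - (tr (brk K) I \<phi> s + tr (brk K) I \<phi> (- s)) / s\<^sup>2\<bar> \<le> (C1 + 2 * C2) / s\<^sup>2 + 3 * C3 / s\<^sup>2 + 2 * B4 / s\<^sup>2"
        by linarith
      also have "\<dots> = (C1 + 2 * C2 + 3 * C3 + 2 * B4) / s\<^sup>2" by (simp add: add_divide_distrib)
      finally have bd: "\<bar>((tr (brk G2) I \<phi> s - tr (brk G2) I \<phi> (- s)) + 2 * (tr K I \<phi> s - tr K I \<phi> (- s))) / s ^ 3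
         - 3 * (tr G2 I \<phi> s + tr G2 I \<phi> (- s) - 2 * fr G2 \<epsilon> I \<phi> s) / s ^ 4
         - (tr (brk K) I \<phi> s + tr (brk K) I \<phi> (- s)) / s\<^sup>2\<bar> \<le> (C1 + 2 * C2 + 3 * C3 + 2 * B4) / s\<^sup>2" .
      have nn: "0 \<le> \<epsilon>\<^sup>2 / a\<^sup>2" by simp
      have "\<bar>\<rho> s\<bar> \<le> \<epsilon>\<^sup>2 / a\<^sup>2 * ((C1 + 2 * C2 + 3 * C3 + 2 * B4) / s\<^sup>2)"
        unfolding eq abs_mult[of "\<epsilon>\<^sup>2 / a\<^sup>2"] abs_of_nonneg[OF nn] by (rule mult_left_mono[OF bd nn])
      then show ?thesis by (simp add: A_def power2_eq_square mult_ac)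
    qed
    have "\<bar>(\<lambda>s. D s - integral {r..s} f) S - (\<lambda>s. D s - integral {r..s} f) r\<bar> \<le> A * \<epsilon>\<^sup>2 / r ^ 1"
      by (rule power_deriv_bound[OF r(1) rS _ remainder_derivative[OF D_deriv cf] \<rho>]) auto
    moreover have "A * \<epsilon>\<^sup>2 / r ^ 1 = A * (\<epsilon> * r)" using r by (simp add: power2_eq_square)
    ultimately have 1: "\<bar>D S - D r - integral {r..S} f\<bar> \<le> A * (\<epsilon> * r)" by simp
    have 2: "integral {r..S} f = integral {r..S} (\<lambda>s. tr F I \<phi> s + tr F I \<phi> (- s) - 2 * fr F \<epsilon> I \<phi> s)
      + \<epsilon> / a * integral {r..S} (\<lambda>s. (tr m I \<phi> s - tr m I \<phi> (- s)) / s)"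
      unfolding f_def
      by (subst integral_add, (intro integrable_continuous_real cF continuous_on_mult continuous_on_const cm)+,
          simp only: integral_mult_right)
    have Ds: "D s = \<epsilon> / a * ((tr G I \<phi> s + tr G I \<phi> (- s) - 2 * fr G \<epsilon> I \<phi> s) / s)
       + \<epsilon>\<^sup>2 / a\<^sup>2 * ((tr G2 I \<phi> s + tr G2 I \<phi> (- s) - 2 * fr G2 \<epsilon> I \<phi> s) / s ^ 3)
       - \<epsilon>\<^sup>2 / a\<^sup>2 * ((tr K I \<phi> s - tr K I \<phi> (- s)) / s\<^sup>2)" for s
      by (simp add: D_def Z_def Z0_def diff_divide_distrib add_divide_distrib algebra_simps)
    \<comment> \<open>At the inner end \<open>r = sqrt \<epsilon>\<close>, pairing makes the first
      boundary term of order \<open>\<epsilon> * r\<close> and the other two of order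
      \<open>\<epsilon>\<^sup>2 / r\<close>, which is the same.\<close>
    have 3: "\<bar>D r\<bar> \<le> R * (\<epsilon> * r)"
    proof -
      have rr: "r \<in> {0..S}" using r rS by auto
      have "\<bar>\<epsilon> / a * ((tr G I \<phi> r + tr G I \<phi> (- r) - 2 * fr G \<epsilon> I \<phi> r) / r)\<bar> \<le> \<epsilon> / \<bar>a\<bar> * (C4 * r\<^sup>2 / r)"
        using C4(2)[OF so rr] e r(1) unfolding abs_mult by (simp add: abs_mult divide_right_mono mult_left_mono)
      moreover have "\<bar>\<epsilon>\<^sup>2 / a\<^sup>2 * ((tr G2 I \<phi> r + tr G2 I \<phi> (- r) - 2 * fr G2 \<epsilon> I \<phi> r) / r ^ 3)\<bar> \<le> \<epsilon>\<^sup>2 / a\<^sup>2 * (C3 * r\<^sup>2 / r ^ 3)"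
        using C3(2)[OF so rr] e r(1) unfolding abs_mult by (simp add: abs_mult divide_right_mono mult_left_mono)
      moreover have "\<bar>\<epsilon>\<^sup>2 / a\<^sup>2 * ((tr K I \<phi> r - tr K I \<phi> (- r)) / r\<^sup>2)\<bar> \<le> \<epsilon>\<^sup>2 / a\<^sup>2 * (C2 * r / r\<^sup>2)"
        using C2(2)[OF so rr] e r(1) unfolding abs_mult by (simp add: abs_mult divide_right_mono mult_left_mono)
      ultimately have "\<bar>D r\<bar> \<le> \<epsilon> / \<bar>a\<bar> * (C4 * r\<^sup>2 / r) + \<epsilon>\<^sup>2 / a\<^sup>2 * (C3 * r\<^sup>2 / r ^ 3) + \<epsilon>\<^sup>2 / a\<^sup>2 * (C2 * r / r\<^sup>2)"
        unfolding Ds by linarith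
      also have "\<dots> = R * (\<epsilon> * r)" using r a by (simp add: R_def field_simps eval_nat_numeral)
      finally show ?thesis .
    qed
    \<comment> \<open>At the outer end only the \<open>G\<close> term is kept; the rest is of order
      \<open>\<epsilon> * r * r\<close>, and one factor \<open>r\<close> is bounded by
      \<open>S\<close>.\<close>
    have 4: "\<bar>D S - \<epsilon> / a * ((tr G I \<phi> S + tr G I \<phi> (- S) - 2 * fr G \<epsilon> I \<phi> S) / S)\<bar> \<le> E * S * (\<epsilon> * r)"
    proof -
      have SS: "S \<in> {0..S}" "S > 0" using S by auto
      note b = in_range[OF SS(1)]
      have "\<bar>tr G2 I \<phi> S + tr G2 I \<phi> (- S) - 2 * fr G2 \<epsilon> I \<phi> S\<bar> \<le> 4 * B3"
        using B3(2)[OF solD(3)[OF so b(1)] b(1), of "\<phi> S"] B3(2)[OF solD(3)[OF so b(2)] b(2), of "\<phi> (- S)"]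
          B3(2)[OF solD(3)[OF so zero_in] zero_in, of "\<phi> 0 + a / 2 * (S\<^sup>2 / \<epsilon>)"] unfolding tr_def fr_def by linarith
      then have 1: "\<bar>(tr G2 I \<phi> S + tr G2 I \<phi> (- S) - 2 * fr G2 \<epsilon> I \<phi> S) / S ^ 3\<bar> \<le> 4 * B3 / S ^ 3"
        using SS by (simp add: divide_right_mono)
      have "\<bar>tr K I \<phi> S - tr K I \<phi> (- S)\<bar> \<le> 2 * B2"
        using B2(2)[OF solD(3)[OF so b(1)] b(1), of "\<phi> S"] B2(2)[OF solD(3)[OF so b(2)] b(2), of "\<phi> (- S)"]
        unfolding tr_def by linarith
      then have 2: "\<bar>(tr K I \<phi> S - tr K I \<phi> (- S)) / S\<^sup>2\<bar> \<le> 2 * B2 / S\<^sup>2"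
        using SS by (simp add: divide_right_mono)
      have "\<bar>\<epsilon>\<^sup>2 / a\<^sup>2 * ((tr G2 I \<phi> S + tr G2 I \<phi> (- S) - 2 * fr G2 \<epsilon> I \<phi> S) / S ^ 3 - (tr K I \<phi> S - tr K I \<phi> (- S)) / S\<^sup>2)\<bar>
        \<le> \<epsilon>\<^sup>2 / a\<^sup>2 * (4 * B3 / S ^ 3 + 2 * B2 / S\<^sup>2)"
        unfolding abs_mult[of "\<epsilon>\<^sup>2 / a\<^sup>2"] abs_of_nonneg[OF divide_nonneg_nonneg[OF zero_le_power2 zero_le_power2]]
        by (intro mult_left_mono order_trans[OF abs_triangle_ineq4 add_mono[OF 1 2]]) simp
      also have "\<dots> = E * (\<epsilon> * r * r)" using r by (simp add: E_def power2_eq_square mult_ac)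
      also have "\<dots> \<le> E * (\<epsilon> * r * S)" using rS r e pos by (intro mult_left_mono) auto
      finally show ?thesis unfolding Ds by (simp add: right_diff_distrib algebra_simps)
    qed
    show ?thesis
      using abs_combine3[OF order_refl[of "\<bar>D r - 0\<bar>"] 4 1[unfolded 2]] 3
      unfolding r_def[symmetric] distrib_right by simp
  qed
  moreover have "A + R + E * S > 0" using pos S by (intro add_pos_pos mult_pos_pos) auto
  ultimately show ?thesis using that by blast
qed

end

section \<open>Averaging across the resonance\<close>

lemma averaging_combine:
  fixes k :: real
  assumes "\<bar>xr + k * mr - k * (gM - gS)\<bar> \<le> d1" "\<bar>xl + k * ml - k * (gL - gT)\<bar> \<le> d1"
    "\<bar>e2 + k * (md1 + md2) - k * (gS + gT' - 2 * g0)\<bar> \<le> d2" "\<bar>e1\<bar> \<le> d3" "\<bar>sT - 2 * P + 2 * (k * g0)\<bar> \<le> d4"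
    "gL = - gT'" "gT = - gL'"
  shows "\<bar>(xl + (e1 + e2 + 2 * P) + xr) - sT - k * (gM + gL') + k * ((md1 + mr) + (ml + md2))\<bar> \<le> 2 * d1 + d2 + d3 + d4"
proof -
  have "(xl + (e1 + e2 + 2 * P) + xr) - sT - k * (gM + gL') + k * ((md1 + mr) + (ml + md2)) =
    (xr + k * mr - k * (gM - gS)) + (xl + k * ml - k * (gL - gT)) + (e2 + k * (md1 + md2) - k * (gS + gT' - 2 * g0))
    + e1 - (sT - 2 * P + 2 * (k * g0))"
    by (simp add: assms(6,7) algebra_simps)
  then show ?thesis using assms(1-5) by linarith
qed

context resonance_term
begin

lemma model_integral:
  assumes "x \<in> {i0..i1}"
    and B: "\<And>y. \<bar>G x y 0\<bar> \<le> B" "\<And>y. \<bar>G2 x y 0\<bar> \<le> B"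
  shows "(\<lambda>\<theta>. F x (p + a / 2 * \<theta>\<^sup>2) 0) integrable_on UNIV"
    "R > 0 \<Longrightarrow> \<bar>integral UNIV (\<lambda>\<theta>. F x (p + a / 2 * \<theta>\<^sup>2) 0)
        - 2 * (integral {0..R} (\<lambda>\<theta>. F x (p + a / 2 * \<theta>\<^sup>2) 0) - G x (p + a / 2 * R\<^sup>2) 0 / (a * R))\<bar> \<le> (4 * B / a\<^sup>2) / R ^ 3"
proof -
  have x0: "x \<in> U" "0 \<in> V" using assms zero_in ran by auto
  have "cd (Suc (Suc 0)) U V F" using gF by (simp add: gd_def)
  then have "continuous_on UNIV (\<lambda>y. F x y 0)" by (rule cd_phase_cont[OF U V _ x0])
  then obtain T where T: "((\<lambda>\<theta>. F x (p + a / 2 * \<theta>\<^sup>2) 0) has_integral T) UNIV"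
    "\<And>R. R > 0 \<Longrightarrow> \<bar>T - 2 * (integral {0..R} (\<lambda>\<theta>. F x (p + a / 2 * \<theta>\<^sup>2) 0) - G x (p + a / 2 * R\<^sup>2) 0 / (a * R))\<bar>
       \<le> (4 * B / a\<^sup>2) / R ^ 3"
    using oscillatory_integral[OF a, of "\<lambda>y. G x y 0" "\<lambda>y. F x y 0" "\<lambda>y. G2 x y 0" B p]
      gd_partials(2)[OF gG assms(1) zero_in, unfolded dG[OF x0]] gd_partials(2)[OF gG2 assms(1) zero_in, unfolded dG2[OF x0]] B
    by blast
  show "(\<lambda>\<theta>. F x (p + a / 2 * \<theta>\<^sup>2) 0) integrable_on UNIV" using T(1) by blast
  show "\<bar>integral UNIV (\<lambda>\<theta>. F x (p + a / 2 * \<theta>\<^sup>2) 0)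
        - 2 * (integral {0..R} (\<lambda>\<theta>. F x (p + a / 2 * \<theta>\<^sup>2) 0) - G x (p + a / 2 * R\<^sup>2) 0 / (a * R))\<bar> \<le> (4 * B / a\<^sup>2) / R ^ 3"
    if "R > 0" using T(2)[OF that] integral_unique[OF T(1)] by simp
qed

definition T where "T I \<phi> = integral UNIV (\<lambda>\<theta>. F (I 0) (\<phi> 0 + a / 2 * \<theta>\<^sup>2) 0)" for I \<phi> :: "real \<Rightarrow> real"

text \<open>Stretching takes \<open>{0..S}\<close> to \<open>{0..S / sqrt \<epsilon>}\<close>. The
  tail beyond, after its first boundary term, is of order \<open>(sqrt \<epsilon> / S) ^ 3\<close>,
  and the factor \<open>sqrt \<epsilon>\<close> of the substitution raises this to
  \<open>\<epsilon>\<^sup>2\<close>.\<close>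

lemma model:
  obtains C where "C > 0" "\<And>\<epsilon> I \<phi>. sol \<epsilon> I \<phi> \<Longrightarrow>
    \<bar>sqrt \<epsilon> * T I \<phi> - 2 * integral {0..S} (fr F \<epsilon> I \<phi>) + 2 * (\<epsilon> / a * (fr G \<epsilon> I \<phi> S / S))\<bar> \<le> C * \<epsilon>\<^sup>2"
    "\<And>\<epsilon> I \<phi>. sol \<epsilon> I \<phi> \<Longrightarrow> \<bar>T I \<phi>\<bar> \<le> C"
proof -
  obtain B1 where B1: "B1 > 0" "\<And>x y z. x \<in> {i0..i1} \<Longrightarrow> z \<in> {-L..M} \<Longrightarrow> \<bar>G x y z\<bar> \<le> B1"
    using gd_bounded[OF gG] by auto
  obtain B2 where B2: "B2 > 0" "\<And>x y z. x \<in> {i0..i1} \<Longrightarrow> z \<in> {-L..M} \<Longrightarrow> \<bar>G2 x y z\<bar> \<le> B2"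
    using gd_bounded[OF gG2] by auto
  obtain B3 where B3: "B3 > 0" "\<And>x y z. x \<in> {i0..i1} \<Longrightarrow> z \<in> {-L..M} \<Longrightarrow> \<bar>F x y z\<bar> \<le> B3"
    using gd_bounded[OF gF] by auto
  define B where "B = B1 + B2"
  have B: "B > 0" "\<bar>G x y 0\<bar> \<le> B" "\<bar>G2 x y 0\<bar> \<le> B" if "x \<in> {i0..i1}" for x y
    using B1(1) B2(1) B1(2)[OF that zero_in, of y] B2(2)[OF that zero_in, of y] by (simp_all add: B_def)
  have B0: "B > 0" using B1 B2 by (simp add: B_def)
  define C where "C = (4 * B / a\<^sup>2) / S ^ 3"
  define C' where "C' = 2 * (B3 + B / \<bar>a\<bar>) + 4 * B / a\<^sup>2"
  have C: "C > 0" "C' > 0" using B0 B3(1) S a by (auto simp: C_def C'_def intro!: add_pos_pos)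
  have 1: "\<bar>sqrt \<epsilon> * T I \<phi> - 2 * integral {0..S} (fr F \<epsilon> I \<phi>) + 2 * (\<epsilon> / a * (fr G \<epsilon> I \<phi> S / S))\<bar> \<le> C * \<epsilon>\<^sup>2"
    if so: "sol \<epsilon> I \<phi>" for \<epsilon> I \<phi>
  proof -
    define r where "r = sqrt \<epsilon>"
    have e: "\<epsilon> > 0" using solD(1)[OF so] .
    have r: "r > 0" "\<epsilon> = r\<^sup>2" using e by (auto simp: r_def)
    have I0: "I 0 \<in> {i0..i1}" using solD(3)[OF so zero_in] .
    have "((fr F \<epsilon> I \<phi>) has_integral integral {0..S} (fr F \<epsilon> I \<phi>)) {0..S}"
      using integrable_integral[OF integrable_continuous_real[OF fr_cont[OF gF so, of "{0..S}"]]] by simp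
    from has_integral_stretch_real[OF this, of r]
    have "((\<lambda>\<theta>. fr F \<epsilon> I \<phi> (r * \<theta>)) has_integral (1 / r) * integral {0..S} (fr F \<epsilon> I \<phi>)) ((\<lambda>x. x / r) ` {0..S})"
      using r by simp
    moreover have "(\<lambda>x. x / r) ` {0..S} = {0..S / r}"
      using r S by (simp add: image_divide_atLeastAtMost)
    moreover have "fr F \<epsilon> I \<phi> (r * \<theta>) = F (I 0) (\<phi> 0 + a / 2 * \<theta>\<^sup>2) 0" for \<theta>
      using r by (simp add: fr_def power_mult_distrib)
    ultimately have "integral {0..S / r} (\<lambda>\<theta>. F (I 0) (\<phi> 0 + a / 2 * \<theta>\<^sup>2) 0) = (1 / r) * integral {0..S} (fr F \<epsilon> I \<phi>)"
      by (simp add: integral_unique)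
    moreover have "G (I 0) (\<phi> 0 + a / 2 * (S / r)\<^sup>2) 0 = fr G \<epsilon> I \<phi> S"
      using r by (simp add: fr_def power_divide)
    ultimately have "\<bar>T I \<phi> - 2 * ((1 / r) * integral {0..S} (fr F \<epsilon> I \<phi>) - fr G \<epsilon> I \<phi> S / (a * (S / r)))\<bar> \<le> (4 * B / a\<^sup>2) / (S / r) ^ 3"
      using model_integral(2)[OF I0 B(2,3)[OF I0], of "S / r" "\<phi> 0"] r S unfolding T_def by simp
    then have "r * \<bar>T I \<phi> - 2 * ((1 / r) * integral {0..S} (fr F \<epsilon> I \<phi>) - fr G \<epsilon> I \<phi> S / (a * (S / r)))\<bar> \<le> r * ((4 * B / a\<^sup>2) / (S / r) ^ 3)"
      using r by (intro mult_left_mono) auto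
    moreover have "r * \<bar>T I \<phi> - 2 * ((1 / r) * integral {0..S} (fr F \<epsilon> I \<phi>) - fr G \<epsilon> I \<phi> S / (a * (S / r)))\<bar>
      = \<bar>r * (T I \<phi> - 2 * ((1 / r) * integral {0..S} (fr F \<epsilon> I \<phi>) - fr G \<epsilon> I \<phi> S / (a * (S / r))))\<bar>"
      using r by (simp add: abs_mult)
    moreover have "r * (T I \<phi> - 2 * ((1 / r) * integral {0..S} (fr F \<epsilon> I \<phi>) - fr G \<epsilon> I \<phi> S / (a * (S / r)))) =
      r * T I \<phi> - 2 * integral {0..S} (fr F \<epsilon> I \<phi>) + 2 * (\<epsilon> / a * (fr G \<epsilon> I \<phi> S / S))"
      using r a S by (simp add: field_simps power2_eq_square)
    moreover have "r * ((4 * B / a\<^sup>2) / (S / r) ^ 3) = C * \<epsilon>\<^sup>2"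
      using r by (simp add: C_def field_simps eval_nat_numeral)
    ultimately show ?thesis unfolding r_def by metis
  qed
  \<comment> \<open>Truncation at \<open>1\<close> suffices here: a bounded integrand on
    \<open>{0..1}\<close>, one boundary term, and the error bound with \<open>R = 1\<close>.\<close>
  have 2: "\<bar>T I \<phi>\<bar> \<le> C'" if so: "sol \<epsilon> I \<phi>" for \<epsilon> I \<phi>
  proof -
    have I0: "I 0 \<in> {i0..i1}" using solD(3)[OF so zero_in] .
    then have x0: "I 0 \<in> U" "0 \<in> V" using zero_in ran by auto
    have "cd (Suc (Suc 0)) U V F" using gF by (simp add: gd_def)
    note cF = cd_phase_cont[OF U V this x0]
    have "continuous_on {0..1} (\<lambda>\<theta>. F (I 0) (\<phi> 0 + a / 2 * \<theta>\<^sup>2) 0)"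
      by (rule continuous_on_compose2[OF cF[of UNIV]]) (auto intro!: continuous_intros)
    then have i1: "norm (integral {0..1} (\<lambda>\<theta>. F (I 0) (\<phi> 0 + a / 2 * \<theta>\<^sup>2) 0)) \<le> B3 * (1 - 0)"
      by (intro integral_bound) (use B3(2)[OF I0 zero_in] in auto)
    have g1: "\<bar>G (I 0) (\<phi> 0 + a / 2 * 1\<^sup>2) 0 / (a * 1)\<bar> \<le> B / \<bar>a\<bar>"
      using B(2)[OF I0, of "\<phi> 0 + a / 2"] by (simp add: divide_right_mono)
    have helper: "\<bar>t\<bar> \<le> 2 * (b + c) + d" if "norm p \<le> b * (1 - 0)" "\<bar>g\<bar> \<le> c" "\<bar>t - 2 * (p - g)\<bar> \<le> d / 1 ^ 3"
      for p g t b c d :: real using that by simp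
    show ?thesis
      unfolding T_def C'_def
      by (rule helper[OF i1 g1 model_integral(2)[OF I0 B(2,3)[OF I0] zero_less_one]])
  qed
  show ?thesis
  proof (rule that[of "C + C'"])
    show "\<bar>sqrt \<epsilon> * T I \<phi> - 2 * integral {0..S} (fr F \<epsilon> I \<phi>) + 2 * (\<epsilon> / a * (fr G \<epsilon> I \<phi> S / S))\<bar> \<le> (C + C') * \<epsilon>\<^sup>2"
      if so: "sol \<epsilon> I \<phi>" for \<epsilon> I \<phi>
      by (rule order_trans[OF 1[OF so] mult_right_mono]) (use C in auto)
    show "\<bar>T I \<phi>\<bar> \<le> C + C'" if so: "sol \<epsilon> I \<phi>" for \<epsilon> I \<phi>
      using 2[OF so] C by linarith
  qed (use C in simp)
qed

text \<open>Three zones: \<open>outer\<close> outside the window, \<open>inner\<close> between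
  \<open>sqrt \<epsilon>\<close> and \<open>S\<close> on both sides, and the layer
  \<open>\<bar>s\<bar> \<le> sqrt \<epsilon>\<close>, where the paired error of order
  \<open>s\<^sup>2\<close> integrates to \<open>\<epsilon> * sqrt \<epsilon>\<close>. The resonant
  term is cut off at the layer because \<open>m / s\<close> is in general not integrable through the
  resonance.\<close>

lemma averaging:
  obtains C where "C > 0" "\<And>\<epsilon> I \<phi>. sol \<epsilon> I \<phi> \<Longrightarrow>
    \<bar>integral {-L..M} (tr F I \<phi>) - sqrt \<epsilon> * T I \<phi> - \<epsilon> / a * (tr G I \<phi> M / M + tr G I \<phi> (-L) / L)
      + \<epsilon> / a * (integral {sqrt \<epsilon>..M} (\<lambda>s. tr m I \<phi> s / s) + integral {-L..- sqrt \<epsilon>} (\<lambda>s. tr m I \<phi> s / s))\<bar>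
    \<le> C * (\<epsilon> * sqrt \<epsilon>)"
    "\<And>\<epsilon> I \<phi>. sol \<epsilon> I \<phi> \<Longrightarrow> \<bar>T I \<phi>\<bar> \<le> C"
proof -
  obtain C1 where C1: "C1 > 0" "\<And>\<epsilon> I \<phi> \<alpha> \<beta>. sol \<epsilon> I \<phi> \<Longrightarrow> \<alpha> \<le> \<beta> \<Longrightarrow> {\<alpha>..\<beta>} \<subseteq> {-L..M} \<Longrightarrow> (\<And>s. s \<in> {\<alpha>..\<beta>} \<Longrightarrow> S \<le> \<bar>s\<bar>) \<Longrightarrow>
    \<bar>integral {\<alpha>..\<beta>} (tr F I \<phi>) + \<epsilon> / a * integral {\<alpha>..\<beta>} (\<lambda>s. tr m I \<phi> s / s)
      - \<epsilon> / a * (tr G I \<phi> \<beta> / \<beta> - tr G I \<phi> \<alpha> / \<alpha>)\<bar> \<le> C1 * \<epsilon>\<^sup>2"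
    using outer by blast
  obtain C2 where C2: "C2 > 0" "\<And>\<epsilon> I \<phi>. sol \<epsilon> I \<phi> \<Longrightarrow>
    \<bar>integral {sqrt \<epsilon>..S} (\<lambda>s. tr F I \<phi> s + tr F I \<phi> (- s) - 2 * fr F \<epsilon> I \<phi> s)
      + \<epsilon> / a * integral {sqrt \<epsilon>..S} (\<lambda>s. (tr m I \<phi> s - tr m I \<phi> (- s)) / s)
      - \<epsilon> / a * ((tr G I \<phi> S + tr G I \<phi> (- S) - 2 * fr G \<epsilon> I \<phi> S) / S)\<bar> \<le> C2 * (\<epsilon> * sqrt \<epsilon>)"
    using inner by blast
  obtain C3 where C3: "C3 > 0" "\<And>\<epsilon> I \<phi> s. sol \<epsilon> I \<phi> \<Longrightarrow> s \<in> {0..S} \<Longrightarrow> \<bar>tr F I \<phi> s + tr F I \<phi> (- s) - 2 * fr F \<epsilon> I \<phi> s\<bar> \<le> C3 * s\<^sup>2"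
    using pair2[OF gF] by auto
  obtain C4 where C4: "C4 > 0" "\<And>\<epsilon> I \<phi>. sol \<epsilon> I \<phi> \<Longrightarrow>
    \<bar>sqrt \<epsilon> * T I \<phi> - 2 * integral {0..S} (fr F \<epsilon> I \<phi>) + 2 * (\<epsilon> / a * (fr G \<epsilon> I \<phi> S / S))\<bar> \<le> C4 * \<epsilon>\<^sup>2"
    "\<And>\<epsilon> I \<phi>. sol \<epsilon> I \<phi> \<Longrightarrow> \<bar>T I \<phi>\<bar> \<le> C4"
    using model by blast
  define C where "C = 2 * (C1 * S) + C2 + C3 + C4 * S"
  have 1: "\<bar>integral {-L..M} (tr F I \<phi>) - sqrt \<epsilon> * T I \<phi> - \<epsilon> / a * (tr G I \<phi> M / M + tr G I \<phi> (-L) / L)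
      + \<epsilon> / a * (integral {sqrt \<epsilon>..M} (\<lambda>s. tr m I \<phi> s / s) + integral {-L..- sqrt \<epsilon>} (\<lambda>s. tr m I \<phi> s / s))\<bar>
    \<le> C * (\<epsilon> * sqrt \<epsilon>)" if so: "sol \<epsilon> I \<phi>" for \<epsilon> I \<phi>
  proof -
    define r where "r = sqrt \<epsilon>"
    have e: "\<epsilon> > 0" and rS: "r \<le> S" using solD(1,2)[OF so] by (auto simp: r_def)
    have r: "r > 0" "\<epsilon> = r\<^sup>2" using e by (auto simp: r_def)
    have iF: "tr F I \<phi> integrable_on {u..v}" if "-L \<le> u" "v \<le> M" for u v
      by (rule integrable_continuous_real, rule tr_cont[OF gF so]) (use that in auto)
    have im: "(\<lambda>s. tr m I \<phi> s / s) integrable_on {u..v}" if "-L \<le> u" "v \<le> M" "0 < u \<or> v < 0" for u v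
      by (rule integrable_continuous_real, intro continuous_on_divide tr_cont[OF gm so] continuous_on_id) (use that in auto)
    define e' where "e' s = tr F I \<phi> s + tr F I \<phi> (- s) - 2 * fr F \<epsilon> I \<phi> s" for s
    have ce: "continuous_on {u..v} e'" if "0 \<le> u" "v \<le> S" for u v
      unfolding e'_def
      by (intro continuous_intros tr_cont[OF gF so] tr_cont_reflect[OF gF so] fr_cont[OF gF so])
        (use that S in auto)
    have ie: "e' integrable_on {u..v}" if "0 \<le> u" "v \<le> S" for u v
      by (rule integrable_continuous_real[OF ce[OF that]])
    have X0: "integral {-L..M} (tr F I \<phi>) = integral {-L..-S} (tr F I \<phi>) + integral {-S..S} (tr F I \<phi>) + integral {S..M} (tr F I \<phi>)"
      using Henstock_Kurzweil_Integration.integral_combine[of "-L" "-S" M "tr F I \<phi>"]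
        Henstock_Kurzweil_Integration.integral_combine[of "-S" S M "tr F I \<phi>"] S iF by simp
    have refl: "integral {-v..-u} g = integral {u..v} (\<lambda>s. g (- s))" for u v and g :: "real \<Rightarrow> real"
      using Henstock_Kurzweil_Integration.integral_reflect_real[where a="-v" and b="-u" and f=g] by simp
    have "integral {-S..S} (tr F I \<phi>) = integral {-S..0} (tr F I \<phi>) + integral {0..S} (tr F I \<phi>)"
      using Henstock_Kurzweil_Integration.integral_combine[of "-S" 0 S "tr F I \<phi>"] S iF by simp
    also have "integral {-S..0} (tr F I \<phi>) = integral {0..S} (\<lambda>s. tr F I \<phi> (- s))"
      using refl[of S 0] by simp
    also have "integral {0..S} (\<lambda>s. tr F I \<phi> (- s)) + integral {0..S} (tr F I \<phi>) =
        integral {0..S} (\<lambda>s. tr F I \<phi> (- s) + tr F I \<phi> s)"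
      by (rule integral_add[symmetric, OF integrable_continuous_real[OF tr_cont_reflect[OF gF so order_refl]] iF])
        (use S LM in auto)
    also have "\<dots> = integral {0..S} (\<lambda>s. e' s + 2 * fr F \<epsilon> I \<phi> s)"
      by (rule Henstock_Kurzweil_Integration.integral_cong) (simp add: e'_def)
    also have "\<dots> = integral {0..S} e' + 2 * integral {0..S} (fr F \<epsilon> I \<phi>)"
      by (subst integral_add, (intro ie integrable_continuous_real continuous_on_mult continuous_on_const fr_cont[OF gF so] order_refl)+,
          simp only: integral_mult_right)
    also have "integral {0..S} e' = integral {0..r} e' + integral {r..S} e'"
      using Henstock_Kurzweil_Integration.integral_combine[of 0 r S e'] r rS ie by simp
    finally have Xc: "integral {-S..S} (tr F I \<phi>) = integral {0..r} e' + integral {r..S} e' + 2 * integral {0..S} (fr F \<epsilon> I \<phi>)" .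
    have M1: "integral {r..M} (\<lambda>s. tr m I \<phi> s / s) = integral {r..S} (\<lambda>s. tr m I \<phi> s / s) + integral {S..M} (\<lambda>s. tr m I \<phi> s / s)"
      using Henstock_Kurzweil_Integration.integral_combine[of r S M "\<lambda>s. tr m I \<phi> s / s"] S r rS LM im by simp
    have M2: "integral {-L..-r} (\<lambda>s. tr m I \<phi> s / s) = integral {-L..-S} (\<lambda>s. tr m I \<phi> s / s) + integral {-S..-r} (\<lambda>s. tr m I \<phi> s / s)"
      using Henstock_Kurzweil_Integration.integral_combine[of "-L" "-S" "-r" "\<lambda>s. tr m I \<phi> s / s"] S r rS LM im by simp
    have M3: "integral {r..S} (\<lambda>s. (tr m I \<phi> s - tr m I \<phi> (- s)) / s) = integral {r..S} (\<lambda>s. tr m I \<phi> s / s) + integral {-S..-r} (\<lambda>s. tr m I \<phi> s / s)"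
    proof -
      have "continuous_on {r..S} (\<lambda>s. tr m I \<phi> (- s) / - s)"
        by (intro continuous_intros tr_cont_reflect[OF gm so]) (use r in auto)
      then have "integral {r..S} (\<lambda>s. tr m I \<phi> s / s) + integral {r..S} (\<lambda>s. tr m I \<phi> (- s) / - s)
        = integral {r..S} (\<lambda>s. tr m I \<phi> s / s + tr m I \<phi> (- s) / - s)"
        by (intro integral_add[symmetric] im integrable_continuous_real) (use S r LM in auto)
      then show ?thesis by (simp add: refl diff_divide_distrib)
    qed
    have o1: "\<bar>integral {S..M} (tr F I \<phi>) + \<epsilon> / a * integral {S..M} (\<lambda>s. tr m I \<phi> s / s)
      - \<epsilon> / a * (tr G I \<phi> M / M - tr G I \<phi> S / S)\<bar> \<le> C1 * \<epsilon>\<^sup>2"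
      by (rule C1(2)[OF so]) (use S LM in auto)
    have o2: "\<bar>integral {-L..-S} (tr F I \<phi>) + \<epsilon> / a * integral {-L..-S} (\<lambda>s. tr m I \<phi> s / s)
      - \<epsilon> / a * (tr G I \<phi> (-S) / (-S) - tr G I \<phi> (-L) / (-L))\<bar> \<le> C1 * \<epsilon>\<^sup>2"
      by (rule C1(2)[OF so]) (use S LM in auto)
    have i1: "\<bar>integral {r..S} e' + \<epsilon> / a * (integral {r..S} (\<lambda>s. tr m I \<phi> s / s) + integral {-S..-r} (\<lambda>s. tr m I \<phi> s / s))
      - \<epsilon> / a * (tr G I \<phi> S / S + tr G I \<phi> (- S) / S - 2 * (fr G \<epsilon> I \<phi> S / S))\<bar> \<le> C2 * (\<epsilon> * r)"
      using C2(2)[OF so] unfolding r_def[symmetric] M3 e'_def[abs_def] by (simp add: add_divide_distrib diff_divide_distrib)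
    have n1: "\<bar>integral {0..r} e'\<bar> \<le> C3 * (\<epsilon> * r)"
    proof -
      have "norm (integral {0..r} e') \<le> (C3 * r\<^sup>2) * (r - 0)"
      proof (rule integral_bound)
        show "norm (e' t) \<le> C3 * r\<^sup>2" if "t \<in> {0..r}" for t
        proof -
          have "\<bar>e' t\<bar> \<le> C3 * t\<^sup>2" unfolding e'_def by (rule C3(2)[OF so]) (use that rS in auto)
          also have "\<dots> \<le> C3 * r\<^sup>2" using that C3(1) by (intro mult_left_mono power_mono) auto
          finally show ?thesis by simp
        qed
      qed (use r rS ce in auto)
      then show ?thesis using r by (simp add: mult.assoc)
    qed
    have m1: "\<bar>r * T I \<phi> - 2 * integral {0..S} (fr F \<epsilon> I \<phi>) + 2 * (\<epsilon> / a * (fr G \<epsilon> I \<phi> S / S))\<bar> \<le> C4 * \<epsilon>\<^sup>2"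
      using C4(2)[OF so] by (simp add: r_def)
    have "\<bar>integral {-L..M} (tr F I \<phi>) - r * T I \<phi> - \<epsilon> / a * (tr G I \<phi> M / M + tr G I \<phi> (-L) / L)
      + \<epsilon> / a * (integral {r..M} (\<lambda>s. tr m I \<phi> s / s) + integral {-L..- r} (\<lambda>s. tr m I \<phi> s / s))\<bar>
      \<le> 2 * (C1 * \<epsilon>\<^sup>2) + C2 * (\<epsilon> * r) + C3 * (\<epsilon> * r) + C4 * \<epsilon>\<^sup>2"
      unfolding X0 Xc M1 M2
      by (rule averaging_combine[OF o1 o2 i1 n1 m1]) auto
    also have "\<dots> \<le> C * (\<epsilon> * r)"
    proof -
      have "\<epsilon>\<^sup>2 \<le> S * (\<epsilon> * r)" using r rS e by (simp add: power2_eq_square mult_ac mult_left_mono)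
      then have "C1 * \<epsilon>\<^sup>2 \<le> C1 * (S * (\<epsilon> * r))" "C4 * \<epsilon>\<^sup>2 \<le> C4 * (S * (\<epsilon> * r))"
        using C1(1) C4(1) by (auto intro: mult_left_mono)
      then show ?thesis by (simp add: C_def algebra_simps)
    qed
    finally show ?thesis by (simp add: r_def)
  qed
  show ?thesis
  proof (rule that[of "C + C4"])
    show "C + C4 > 0" using C1 C2 C3 C4 S by (auto simp: C_def intro!: add_pos_pos mult_pos_pos)
    have C: "0 \<le> C" using C1(1) C2(1) C3(1) C4(1) S by (auto simp: C_def intro!: add_nonneg_nonneg mult_nonneg_nonneg)
    show "\<bar>integral {-L..M} (tr F I \<phi>) - sqrt \<epsilon> * T I \<phi> - \<epsilon> / a * (tr G I \<phi> M / M + tr G I \<phi> (-L) / L)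
      + \<epsilon> / a * (integral {sqrt \<epsilon>..M} (\<lambda>s. tr m I \<phi> s / s) + integral {-L..- sqrt \<epsilon>} (\<lambda>s. tr m I \<phi> s / s))\<bar>
      \<le> (C + C4) * (\<epsilon> * sqrt \<epsilon>)" if so: "sol \<epsilon> I \<phi>" for \<epsilon> I \<phi>
      by (rule order_trans[OF 1[OF so] mult_right_mono]) (use C4(1) solD(1)[OF so] in auto)
    show "\<bar>T I \<phi>\<bar> \<le> C + C4" if so: "sol \<epsilon> I \<phi>" for \<epsilon> I \<phi> using C4(3)[OF so] C by linarith
  qed
qed

end

section \<open>The Hamiltonian system\<close>

lemma d_phi_eqI: "((\<lambda>t. f x t z) has_real_derivative c) (at y) \<Longrightarrow> d_phi f x y z = c"
  unfolding d_phi_def by (rule DERIV_imp_deriv)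

lemma d_I_eqI: "((\<lambda>t. f t y z) has_real_derivative c) (at x) \<Longrightarrow> d_I f x y z = c"
  unfolding d_I_def by (rule DERIV_imp_deriv)

lemma d_tau_eqI: "((\<lambda>t. f x y t) has_real_derivative c) (at z) \<Longrightarrow> d_tau f x y z = c"
  unfolding d_tau_def by (rule DERIV_imp_deriv)

text \<open>The primitive in time that starts at the resonance \<open>z = 0\<close>, scaled to the
  unit interval so that it is correct on both sides and inherits its smoothness from integrals with
  parameters.\<close>

definition tint :: "(real \<Rightarrow> real \<Rightarrow> real \<Rightarrow> real) \<Rightarrow> real \<Rightarrow> real \<Rightarrow> real \<Rightarrow> real" where
  "tint f x y z = z * integral {0..1} (\<lambda>t. f x y (t * z))"

lemma tint_eq: "tint f = (\<lambda>x y z. z * integral {0..1} (\<lambda>t. 1 * f x (1 * y + 0) (t * z)))"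
  by (simp add: tint_def fun_eq_iff)

context
  fixes U V :: "real set"
  assumes U: "open U" "convex U" and V: "open V" "convex V"
begin

lemma has_derivative_mean_tau:
  assumes "cd (Suc k) U V f" "x \<in> U" "z \<in> V"
  shows "((\<lambda>t. mean f x y t) has_real_derivative mean (d_tau f) x y z) (at z)"
proof -
  have h: "has_partials U V (mean f)
    (\<lambda>x y z. integral {0..2 * pi} (\<lambda>t. (1 / (2 * pi)) * d_I f x (0 * y + t) (1 * z)))
    (\<lambda>x y z. integral {0..2 * pi} (\<lambda>t. (1 / (2 * pi) * 0) * d_phi f x (0 * y + t) (1 * z)))
    (\<lambda>x y z. integral {0..2 * pi} (\<lambda>t. (1 / (2 * pi) * 1) * d_tau f x (0 * y + t) (1 * z)))"
    unfolding mean_eq by (rule has_partials_integral[OF U V assms(1)]) (auto intro!: continuous_intros)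
  have "mean (d_tau f) x y z = integral {0..2 * pi} (\<lambda>t. (1 / (2 * pi) * 1) * d_tau f x (0 * y + t) (1 * z))"
    by (simp add: mean_eq)
  then show ?thesis using has_partialsD(3)[OF h assms(2,3), of y] by simp
qed

lemma has_derivative_prim_tau:
  assumes "cd (Suc k) U V f" "x \<in> U" "z \<in> V"
  shows "((\<lambda>t. prim f x y t) has_real_derivative prim (d_tau f) x y z) (at z)"
proof -
  have h: "has_partials U V (\<lambda>x y z. integral {0..1} (\<lambda>t. 1 * f x (t * y + 0) (1 * z)))
    (\<lambda>x y z. integral {0..1} (\<lambda>t. 1 * d_I f x (t * y + 0) (1 * z)))
    (\<lambda>x y z. integral {0..1} (\<lambda>t. (1 * t) * d_phi f x (t * y + 0) (1 * z)))
    (\<lambda>x y z. integral {0..1} (\<lambda>t. (1 * 1) * d_tau f x (t * y + 0) (1 * z)))"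
    by (rule has_partials_integral[OF U V assms(1)]) (auto intro!: continuous_intros)
  have "prim (d_tau f) x y z = y * integral {0..1} (\<lambda>t. (1 * 1) * d_tau f x (t * y + 0) (1 * z))"
    by (simp add: prim_eq)
  then show ?thesis unfolding prim_eq[of f] using DERIV_cmult[OF has_partialsD(3)[OF h assms(2,3)], of y y] by metis
qed

lemma d_tau_zprim:
  assumes "cd (Suc k) U V f" "x \<in> U" "z \<in> V"
  shows "d_tau (zprim f) x y z = zprim (d_tau f) x y z"
proof (rule d_tau_eqI)
  have 1: "cd (Suc k) U V (prim f)" by (rule cd_prim[OF U V assms(1)])
  have "d_tau (prim f) x y z = prim (d_tau f) x y z" for y
    by (rule d_tau_eqI, rule has_derivative_prim_tau[OF assms])
  then have 2: "mean (d_tau (prim f)) x y z = mean (prim (d_tau f)) x y z" by (simp add: mean_def)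
  show "((\<lambda>t. zprim f x y t) has_real_derivative zprim (d_tau f) x y z) (at z)"
    unfolding zprim_def[abs_def] 2[symmetric]
    by (rule DERIV_diff[OF has_derivative_prim_tau[OF assms] has_derivative_mean_tau[OF 1 assms(2,3)]])
qed

lemma mean_minus_mean:
  assumes "cd k U V f" "cd k' U V g" "x \<in> U" "z \<in> V" "\<And>y. g x y z = g x 0 z" "g x 0 z = mean f x 0 z"
  shows "mean (\<lambda>x y z. f x y z - g x y z) x y z = 0"
proof -
  have "integral {0..2 * pi} (\<lambda>\<phi>. f x \<phi> z - g x 0 z) = integral {0..2 * pi} (\<lambda>\<phi>. f x \<phi> z) - integral {0..2 * pi} (\<lambda>\<phi>. g x 0 z)"
    by (intro integral_diff integrable_continuous_real cd_phase_cont[OF U V assms(1,3,4)] continuous_intros)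
  also have "integral {0..2 * pi} (\<lambda>\<phi>. g x 0 z) = 2 * pi * g x 0 z" by simp
  finally have "integral {0..2 * pi} (\<lambda>\<phi>. f x \<phi> z - g x 0 z) = 0"
    using assms(6) by (simp add: mean_def phase_mean_def)
  moreover have "(\<lambda>\<phi>. f x \<phi> z - g x \<phi> z) = (\<lambda>\<phi>. f x \<phi> z - g x 0 z)"
    by (intro ext arg_cong2[of _ _ _ _ minus] refl assms(5))
  ultimately show ?thesis unfolding mean_def phase_mean_def by simp
qed

lemma mean_zprim:
  assumes "cd k U V f" "x \<in> U" "z \<in> V"
  shows "mean (zprim f) x y z = 0"
  unfolding zprim_def[abs_def]
  by (rule mean_minus_mean[OF cd_prim[OF U V assms(1)] cd_mean[OF U V cd_prim[OF U V assms(1)]] assms(2,3)])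
    (simp_all add: mean_def)

text \<open>A mean that vanishes for all actions in the open set \<open>U\<close> has derivative
  zero there, and this derivative is the mean of \<open>d_I f\<close>.\<close>

lemma mean_d_I_zero:
  assumes "cd (Suc k) U V f" "\<And>x z. x \<in> U \<Longrightarrow> z \<in> V \<Longrightarrow> mean f x 0 z = 0" "x \<in> U" "z \<in> V"
  shows "mean (d_I f) x 0 z = 0"
proof -
  have "((\<lambda>t. mean f t 0 z) has_real_derivative 0) (at x)"
    by (rule has_field_derivative_transform_within_open[of "\<lambda>_. 0" 0 x U]) (use assms U in auto)
  then show ?thesis using has_partials_mean[OF U V assms(1,3,4), of 0] DERIV_unique by blast
qed

context
  assumes V0: "0 \<in> V"
begin

lemma scale_mem: "t \<in> {0..1} \<Longrightarrow> z \<in> V \<Longrightarrow> t * z \<in> V"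
  using convexD_alt[OF V(2) V0, of z t] by simp

lemma cd_tint: "cd k U V f \<Longrightarrow> cd k U V (tint f)"
  unfolding tint_eq
  by (rule cd_mult[OF U(1) V(1) cd_tau[OF U(1) V(1)] cd_integral[OF U V]])
    (auto intro!: continuous_intros scale_mem)

lemma tint_partials:
  assumes "cd (Suc k) U V f"
  shows "has_partials U V (\<lambda>x y z. integral {0..1} (\<lambda>t. 1 * f x (1 * y + 0) (t * z)))
    (\<lambda>x y z. integral {0..1} (\<lambda>t. 1 * d_I f x (1 * y + 0) (t * z)))
    (\<lambda>x y z. integral {0..1} (\<lambda>t. (1 * 1) * d_phi f x (1 * y + 0) (t * z)))
    (\<lambda>x y z. integral {0..1} (\<lambda>t. (1 * t) * d_tau f x (1 * y + 0) (t * z)))"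
  by (rule has_partials_integral[OF U V assms]) (auto intro!: continuous_intros scale_mem)

lemma d_I_tint:
  assumes "cd (Suc k) U V f" "x \<in> U" "z \<in> V"
  shows "d_I (tint f) x y z = tint (d_I f) x y z"
proof (rule d_I_eqI)
  show "((\<lambda>t. tint f t y z) has_real_derivative tint (d_I f) x y z) (at x)"
    using DERIV_cmult[OF has_partialsD(1)[OF tint_partials[OF assms(1)] assms(2,3)], of z y]
    by (simp add: tint_def)
qed

text \<open>The product rule gives two integrals over the unit interval, whose sum is the integral
  of the \<open>t\<close>-derivative of \<open>t * f x y (t * z)\<close>.\<close>

lemma d_tau_tint:
  assumes "cd (Suc k) U V f" "x \<in> U" "z \<in> V"
  shows "d_tau (tint f) x y z = f x y z"
proof (rule d_tau_eqI)
  let ?J = "integral {0..1} (\<lambda>t. f x y (t * z))" and ?K = "integral {0..1} (\<lambda>t. t * d_tau f x y (t * z))"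
  have "((\<lambda>t. integral {0..1} (\<lambda>s. f x y (s * t))) has_real_derivative ?K) (at z)"
    using has_partialsD(3)[OF tint_partials[OF assms(1)] assms(2,3), of y] by simp
  then have 1: "((\<lambda>t. tint f x y t) has_real_derivative 1 * ?J + ?K * z) (at z)"
    unfolding tint_def by (rule DERIV_mult[OF DERIV_ident])
  have c: "continuous_on {0..1} (\<lambda>t. g x y (t * z))" if "cd j U V g" for g j
  proof -
    have "continuous_on {0..1} (\<lambda>t. (\<lambda>(x, y, z). g x y z) (x, y, t * z))"
      by (rule continuous_on_compose2[OF cd_cont[OF that]])
        (use assms scale_mem in \<open>auto intro!: continuous_intros\<close>)
    then show ?thesis by simp
  qed
  have i1: "((\<lambda>t. f x y (t * z) + t * d_tau f x y (t * z) * z) has_integral (1 * f x y (1 * z) - 0 * f x y (0 * z))) {0..1}"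
  proof (rule fundamental_theorem_of_calculus)
    fix t :: real assume t: "t \<in> {0..1}"
    have "((\<lambda>t. f x y (t * z)) has_real_derivative d_tau f x y (t * z) * z) (at t within {0..1})"
      by (rule DERIV_chain2[where f="f x y" and g="\<lambda>t. t * z",
            OF has_partialsD(3)[OF cd_partials[OF assms(1)] assms(2) scale_mem[OF t assms(3)]]])
        (auto intro!: derivative_eq_intros)
    from DERIV_mult[OF DERIV_ident this]
    show "((\<lambda>t. t * f x y (t * z)) has_vector_derivative f x y (t * z) + t * d_tau f x y (t * z) * z) (at t within {0..1})"
      by (simp add: has_real_derivative_iff_has_vector_derivative mult_ac)
  qed simp
  have i2: "((\<lambda>t. f x y (t * z) + t * d_tau f x y (t * z) * z) has_integral (?J + ?K * z)) {0..1}"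
    by (intro has_integral_add has_integral_mult_left integrable_integral integrable_continuous_real
        c[OF assms(1)] continuous_on_mult continuous_on_id c[OF cd_derivs(3)[OF assms(1)]])
  have "?J + ?K * z = f x y z" using has_integral_unique[OF i2 i1] by simp
  then show "((\<lambda>t. tint f x y t) has_real_derivative f x y z) (at z)" using 1 by simp
qed

end

end

text \<open>The slow time is such that the frequency is \<open>a z\<close>; the factor \<open>w\<close> is the derivative of the old slow time with
  respect to the new one.\<close>

locale hamiltonian =
  fixes U V :: "real set" and a L M i0 i1 :: real and w :: "real \<Rightarrow> real" and H :: "real \<Rightarrow> real \<Rightarrow> real \<Rightarrow> real"
  assumes U: "open U" "convex U" and V: "open V" "convex V"
    and a: "a \<noteq> 0" and LM: "0 < L" "0 < M"
    and ran: "{i0..i1} \<subseteq> U" "{-L..M} \<subseteq> V"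
    and w: "cd 3 U V (\<lambda>x y z. w z)"
    and H: "cd 4 U V H" "phase_periodic U V H"
begin

abbreviation W where "W x y z \<equiv> w z"

text \<open>Multiplication by \<open>w\<close>, the rate of the old slow time in the new one, brings
  the equations of motion into the form of \<open>resonance\<close>.\<close>

sublocale resonance U V a L M i0 i1 "\<lambda>x y z. W x y z * d_I H x y z" "\<lambda>x y z. W x y z * d_phi H x y z"
proof
  have d: "cd 3 U V (d_I H)" "cd 3 U V (d_phi H)" using cd_derivs[of 3 U V H] H by simp_all
  have p: "phase_periodic U V (d_I H)" "phase_periodic U V (d_phi H)"
    using phase_periodic_derivs[OF U(1) V(1), of 3 H] H by simp_all
  show "cd 2 U V (\<lambda>x y z. w z * d_I H x y z)" "cd 2 U V (\<lambda>x y z. w z * d_phi H x y z)"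
    by (rule cd_le[OF cd_mult[OF U(1) V(1) w d(1)]] cd_le[OF cd_mult[OF U(1) V(1) w d(2)]]; simp)+
  show "phase_periodic U V (\<lambda>x y z. w z * d_I H x y z)" "phase_periodic U V (\<lambda>x y z. w z * d_phi H x y z)"
    using p by (auto simp: phase_periodic_def)
qed (use U V a LM ran in auto)

lemma V0: "0 \<in> V" using zero_in ran by auto

section \<open>Averaged and oscillating parts of the Hamiltonian\<close>

definition hb where "hb = mean H"
definition h where "h x y z = H x y z - hb x y z"
definition Y where "Y = zprim h"
text \<open>The correction \<open>v1\<close> of the phase, up to the factor
  \<open>- 1 / \<omega>\<close>.\<close>

definition A1 where "A1 = zprim (d_I h)"
definition B1 where "B1 = zprim A1"
text \<open>Half of the second action derivative of \<open>h\<^sup>2\<close>. Its mean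
  \<open>mc\<close>, divided by \<open>- \<omega>\<close>, is the action derivative of
  \<open>R2\<close>.\<close>

definition q where "q x y z = d_I h x y z * d_I h x y z + h x y z * d_I (d_I h) x y z"
definition mc where "mc = mean q"
definition X where "X = zprim (\<lambda>x y z. q x y z - mc x y z)"
text \<open>The averaged drift of the phase; \<open>Q\<close> is its accumulation since the
  resonance, and \<open>Q1\<close> the action derivative of \<open>Q\<close>.\<close>

definition P0 where "P0 x y z = W x y z * d_I hb x y z"
definition Q where "Q = tint P0"
definition Q1 where "Q1 = tint (d_I P0)"
definition W' where "W' = d_tau W"

text \<open>Demanded for all arguments, not only on the domain, so that such a function can be
  replaced by a constant inside a derivative in the phase.\<close>

definition yind :: "(real \<Rightarrow> real \<Rightarrow> real \<Rightarrow> real) \<Rightarrow> bool" where "yind f \<longleftrightarrow> (\<forall>x y z. f x y z = f x 0 z)"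

lemma yind_mean: "yind (mean f)" by (simp add: yind_def mean_def)

lemma yind_derivs: assumes "yind f" shows "yind (d_I f)" "yind (d_tau f)" "d_phi f x y z = 0"
proof -
  have e: "f x y z = f x 0 z" for x y z using assms by (simp add: yind_def)
  have "deriv (\<lambda>t. f t y z) x = deriv (\<lambda>t. f t 0 z) x" "deriv (\<lambda>t. f x y t) z = deriv (\<lambda>t. f x 0 t) z" for x y z
    by (intro arg_cong2[of _ _ _ _ deriv] ext e refl)+
  then show "yind (d_I f)" "yind (d_tau f)"
    unfolding yind_def d_I_def d_tau_def by simp_all
  have "(\<lambda>t. f x t z) = (\<lambda>t. f x 0 z)" by (intro ext e)
  then show "d_phi f x y z = 0" by (intro d_phi_eqI) simp
qed

lemma yind_W: "yind W" by (simp add: yind_def)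

lemma yind_deriv: "yind f \<Longrightarrow> ((\<lambda>t. f x t z) has_real_derivative 0) (at y)"
proof -
  assume "yind f"
  then have "(\<lambda>t. f x t z) = (\<lambda>t. f x 0 z)" unfolding yind_def by (intro ext) blast
  then show ?thesis by simp
qed

lemma yind_mult: "yind f \<Longrightarrow> yind g \<Longrightarrow> yind (\<lambda>x y z. f x y z * g x y z)"
  unfolding yind_def by metis

lemma yind_tint: "yind f \<Longrightarrow> yind (tint f)"
proof -
  assume f: "yind f"
  have "(\<lambda>t. f x y (t * z)) = (\<lambda>t. f x 0 (t * z))" for x y z
    using f unfolding yind_def by (intro ext) blast
  then have "tint f x y z = tint f x 0 z" for x y z unfolding tint_def by (rule arg_cong)
  then show ?thesis unfolding yind_def by blast
qed

lemma yind_hb: "yind hb" by (simp add: hb_def yind_mean)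

lemma yind_P0: "yind P0"
  unfolding P0_def[abs_def] by (intro yind_mult yind_W yind_derivs yind_hb)

lemma yind_Q1: "yind Q1" unfolding Q1_def by (intro yind_tint yind_derivs yind_P0)

lemma yind_mc: "yind mc" by (simp add: mc_def yind_mean)

lemma gd_cd: "gd k f \<Longrightarrow> cd k U V f" by (simp add: gd_def)

lemma gd_mean: "gd k f \<Longrightarrow> gd k (mean f)"
  using cd_mean[OF U V, of k f] by (simp add: gd_def phase_periodic_def mean_def)

lemma gd_zprim: "gd k f \<Longrightarrow> (\<And>x z. x \<in> U \<Longrightarrow> z \<in> V \<Longrightarrow> mean f x 0 z = 0) \<Longrightarrow> gd k (zprim f)"
  using cd_zprim[OF U V, of k f] phase_periodic_zprim[OF U V, of k f] by (simp add: gd_def)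

lemma gd_tint: "gd k f \<Longrightarrow> gd k (tint f)"
  using cd_tint[OF U V V0, of k f] scale_mem[OF U V V0]
  by (auto simp: gd_def phase_periodic_def tint_def intro!: Henstock_Kurzweil_Integration.integral_cong)

lemma gd_H: "gd (Suc 3) H" using H by (simp add: gd_def)
lemma gd_W: "gd 3 W" using w by (simp add: gd_def phase_periodic_def)
lemma gd_hb: "gd (Suc 3) hb" unfolding hb_def by (rule gd_mean[OF gd_H])
lemma gd_h: "gd (Suc 3) h" unfolding h_def[abs_def] by (rule gd_diff[OF gd_H gd_hb])

lemma mean_h: "x \<in> U \<Longrightarrow> z \<in> V \<Longrightarrow> mean h x y z = 0"
  unfolding h_def[abs_def] hb_def
  by (rule mean_minus_mean[OF U V gd_cd[OF gd_H] gd_cd[OF gd_mean[OF gd_H]]]) (auto simp: mean_def)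

lemma gd_dh: "gd 3 (d_I h)" "gd 3 (d_phi h)" "gd 3 (d_tau h)" "gd 2 (d_I (d_I h))"
proof -
  show "gd 3 (d_I h)" "gd 3 (d_phi h)" "gd 3 (d_tau h)" by (rule gd_derivs[OF gd_h])+
  then show "gd 2 (d_I (d_I h))" using gd_derivs(1)[of 2 "d_I h"] by simp
qed

lemma gd_q: "gd 2 q"
  unfolding q_def[abs_def]
  by (intro gd_add gd_mult gd_dh gd_le[OF gd_h] gd_le[OF gd_dh(1)]) auto

lemma gd_Y: "gd (Suc 3) Y" unfolding Y_def by (rule gd_zprim[OF gd_h mean_h])
lemma gd_A1: "gd 3 A1" unfolding A1_def by (rule gd_zprim[OF gd_dh(1) mean_d_I_zero[OF U V gd_cd[OF gd_h] mean_h]])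
lemma gd_B1: "gd 3 B1" unfolding B1_def
  by (rule gd_zprim[OF gd_A1], unfold A1_def, rule mean_zprim[OF U V gd_cd[OF gd_dh(1)]])
lemma gd_mc: "gd 2 mc" unfolding mc_def by (rule gd_mean[OF gd_q])
lemma gd_X: "gd 2 X" unfolding X_def
  by (rule gd_zprim[OF gd_diff[OF gd_q gd_mc]], unfold mc_def, rule mean_minus_mean[OF U V gd_cd[OF gd_q] gd_cd[OF gd_mean[OF gd_q]]])
    (auto simp: mean_def)

lemma gd_dhb: "gd 3 (d_I hb)" by (rule gd_derivs[OF gd_hb])
lemma gd_P0: "gd 3 P0" unfolding P0_def[abs_def] by (rule gd_mult[OF gd_W gd_dhb])
lemma gd_Q: "gd 3 Q" unfolding Q_def by (rule gd_tint[OF gd_P0])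
lemma gd_dP0: "gd 2 (d_I P0)" using gd_derivs(1)[of 2 P0] gd_P0 by simp
lemma gd_Q1: "gd 2 Q1" unfolding Q1_def by (rule gd_tint[OF gd_dP0])
lemma gd_W': "gd 2 W'" unfolding W'_def using gd_derivs(3)[of 2 W] gd_W by simp

lemma gd_phi_deriv: "gd (Suc k) f \<Longrightarrow> x \<in> U \<Longrightarrow> z \<in> V \<Longrightarrow> ((\<lambda>t. f x t z) has_real_derivative d_phi f x y z) (at y)"
  by (rule has_partialsD(2)[OF cd_partials[OF gd_cd]])

context
  fixes x z :: real
  assumes xz: "x \<in> U" "z \<in> V"
begin

lemma h_y: "((\<lambda>t. h x t z) has_real_derivative d_phi h x y z) (at y)"
  by (rule gd_phi_deriv[OF gd_h xz])

lemma Y_y: "((\<lambda>t. Y x t z) has_real_derivative h x y z) (at y)"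
  unfolding Y_def by (rule has_derivative_zprim_phi[OF U V gd_cd[OF gd_h] xz])

lemma A1_y: "((\<lambda>t. A1 x t z) has_real_derivative d_I h x y z) (at y)"
  unfolding A1_def by (rule has_derivative_zprim_phi[OF U V gd_cd[OF gd_dh(1)] xz])

lemma B1_y: "((\<lambda>t. B1 x t z) has_real_derivative A1 x y z) (at y)"
  unfolding B1_def by (rule has_derivative_zprim_phi[OF U V gd_cd[OF gd_A1] xz])

lemma X_y: "((\<lambda>t. X x t z) has_real_derivative q x y z - mc x y z) (at y)"
  unfolding X_def by (rule has_derivative_zprim_phi[OF U V gd_cd[OF gd_diff[OF gd_q gd_mc]] xz])

lemma dY_y: "((\<lambda>t. d_tau Y x t z) has_real_derivative d_tau h x y z) (at y)"
  unfolding Y_def d_tau_zprim[OF U V gd_cd[OF gd_h] xz]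
  by (rule has_derivative_zprim_phi[OF U V gd_cd[OF gd_dh(3)] xz])

lemma dB1_y: "((\<lambda>t. d_tau B1 x t z) has_real_derivative d_tau A1 x y z) (at y)"
proof -
  have 1: "cd (Suc 2) U V A1" "gd 2 (d_tau A1)" using gd_A1 gd_derivs(3)[of 2 A1] by (simp_all add: gd_def)
  show ?thesis
    unfolding B1_def d_tau_zprim[OF U V 1(1) xz]
    by (rule has_derivative_zprim_phi[OF U V gd_cd[OF 1(2)] xz])
qed

lemma dA1_y: "((\<lambda>t. d_I A1 x t z) has_real_derivative d_I (d_I h) x y z) (at y)"
proof -
  have 1: "cd (Suc 2) U V (d_I h)" using gd_dh(1) by (simp add: gd_def)
  show ?thesis
    unfolding A1_def d_I_zprim[OF U V 1 xz]
    by (rule has_derivative_zprim_phi[OF U V gd_cd[OF gd_dh(4)] xz])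
qed

lemma d_phi_h: "d_phi h x y z = d_phi H x y z"
  using DERIV_diff[OF gd_phi_deriv[OF gd_H xz] yind_deriv[OF yind_hb]] by (intro d_phi_eqI) (simp add: h_def)

lemma d_I_h: "d_I h x y z = d_I H x y z - d_I hb x y z"
  unfolding h_def[abs_def]
  by (rule d_I_eqI, rule DERIV_diff, rule has_partialsD(1)[OF cd_partials[OF gd_cd[OF gd_H]] xz],
      rule has_partialsD(1)[OF cd_partials[OF gd_cd[OF gd_hb]] xz])

text \<open>\<open>brk\<close> is a first order differential operator, hence a derivation.\<close>

lemma brk_mult:
  assumes "gd (Suc k) f" "gd (Suc k) g"
  shows "brk (\<lambda>x y z. f x y z * g x y z) x y z = f x y z * brk g x y z + g x y z * brk f x y z"
  using has_partials_imp_eq[OF has_partials_mult[OF cd_partials[OF gd_cd[OF assms(1)]] cd_partials[OF gd_cd[OF assms(2)]]] xz, of y]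
  unfolding brk_def by (simp add: algebra_simps)

lemma brk_W: "brk W x y z = W' x y z"
proof -
  have "d_I W x y z = 0" "d_phi W x y z = 0" by (auto intro: d_I_eqI d_phi_eqI)
  then show ?thesis by (simp add: brk_def W'_def)
qed

end

definition K1 where "K1 x y z = W' x y z * Y x y z + W x y z * d_tau Y x y z + W x y z * W x y z * h x y z * d_I hb x y z"

lemma gd_K1: "gd 2 K1"
proof -
  have dY: "gd 3 (d_tau Y)" by (rule gd_derivs[OF gd_Y])
  show ?thesis
    unfolding K1_def[abs_def]
    by (intro gd_add gd_mult gd_W' gd_le[OF gd_W] gd_le[OF gd_Y] gd_le[OF gd_h] gd_le[OF gd_dhb] gd_le[OF dY]) auto
qed

text \<open>The oscillating part acts on itself by a Poisson bracket, which vanishes: in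
  \<open>brk\<close> the products \<open>d_phi h * d_I h\<close> and \<open>d_I h * d_phi h\<close>
  cancel. What is left is linear in \<open>h\<close>, hence of zero mean; this is why the force has
  no resonant term.\<close>

lemma K1_y: 
  assumes xz: "x \<in> U" "z \<in> V"
  shows "((\<lambda>t. K1 x t z) has_real_derivative brk (\<lambda>x y z. W x y z * h x y z) x y z) (at y)"
proof -
  have "gd (Suc 2) W" "gd (Suc 2) h" using gd_W gd_le[OF gd_h, of 3] by simp_all
  note b = brk_mult[OF xz this, of y]
  obtain cW where W'c: "\<And>t. W' x t z = cW"
    using yind_derivs(2)[OF yind_W] unfolding W'_def yind_def by blast
  obtain ch where hbc: "\<And>t. d_I hb x t z = ch"
    using yind_derivs(1)[OF yind_hb] unfolding yind_def by blast
  show ?thesis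
    unfolding K1_def b brk_W[OF xz] unfolding W'c hbc
    by (rule derivative_eq_intros Y_y[OF xz] dY_y[OF xz] h_y[OF xz] refl)+
      (simp add: brk_def d_phi_h[OF xz] d_I_h[OF xz] hbc algebra_simps)
qed

text \<open>The instance for the force. Its boundary term \<open>W * h / (a * s)\<close> is
  \<open>u1\<close>, so it governs the jump of the corrected action.\<close>

sublocale T1: resonance_term U V a L M i0 i1 "\<lambda>x y z. W x y z * d_I H x y z" "\<lambda>x y z. W x y z * d_phi H x y z"
  "\<lambda>x y z. W x y z * d_phi H x y z" "\<lambda>x y z. W x y z * h x y z" "\<lambda>x y z. W x y z * Y x y z" K1 "\<lambda>x y z. 0"
proof
  have 2: "Suc (Suc 0) \<le> 3" "Suc (Suc 0) \<le> Suc 3" "Suc 0 \<le> 2" by auto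
  show "gd (Suc (Suc 0)) (\<lambda>x y z. W x y z * d_phi H x y z)"
    by (rule gd_le[OF gd_mult[OF gd_W gd_derivs(2)[OF gd_H]] 2(1)])
  show "gd (Suc (Suc 0)) (\<lambda>x y z. W x y z * h x y z)"
    by (rule gd_mult[OF gd_le[OF gd_W 2(1)] gd_le[OF gd_h 2(2)]])
  show "gd (Suc (Suc 0)) (\<lambda>x y z. W x y z * Y x y z)"
    by (rule gd_mult[OF gd_le[OF gd_W 2(1)] gd_le[OF gd_Y 2(2)]])
  show "gd (Suc 0) K1" by (rule gd_le[OF gd_K1 2(3)])
  show "gd 0 (\<lambda>x y z. 0)" using cd_const[OF U(1) V(1)] by (simp add: gd_def phase_periodic_def)
  fix x y z assume xz: "x \<in> U" "z \<in> V"
  show "d_phi (\<lambda>x y z. W x y z * h x y z) x y z = W x y z * d_phi H x y z"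
    by (rule d_phi_eqI) (use DERIV_cmult[OF h_y[OF xz]] d_phi_h[OF xz] in simp)
  show "d_phi (\<lambda>x y z. W x y z * Y x y z) x y z = W x y z * h x y z"
    by (rule d_phi_eqI, rule DERIV_cmult, rule Y_y[OF xz])
  show "d_phi K1 x y z = brk (\<lambda>x y z. W x y z * h x y z) x y z - 0"
    using d_phi_eqI[where f=K1, OF K1_y[OF xz, of y]] by simp
qed

text \<open>An antiderivative in the phase of \<open>brk\<close> of \<open>W * A1\<close>, minus its
  mean. The one product without an immediate primitive, \<open>- d_I A1 * d_phi h\<close>, is
  integrated by parts: this gives the last summand and leaves \<open>h * d_I (d_I h)\<close>, which
  together with \<open>d_I h * d_I h\<close> forms \<open>q\<close>. The mean of \<open>q\<close>
  has no periodic primitive and becomes the resonant term.\<close>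

definition K2 where "K2 x y z = W' x y z * B1 x y z + W x y z * d_tau B1 x y z + W x y z * W x y z * A1 x y z * d_I hb x y z
  + W x y z * W x y z * X x y z - W x y z * W x y z * d_I A1 x y z * h x y z"

lemma gd_K2: "gd 2 K2"
proof -
  have d: "gd 2 (d_tau B1)" "gd 2 (d_I A1)" using gd_derivs[of 2 B1] gd_derivs[of 2 A1] gd_A1 gd_B1 by simp_all
  show ?thesis
    unfolding K2_def[abs_def]
    by (intro d gd_add gd_diff gd_mult gd_W' gd_X gd_le[OF gd_W] gd_le[OF gd_A1] gd_le[OF gd_B1] gd_le[OF gd_h] gd_le[OF gd_dhb]) auto
qed

text \<open>Oscillating part of the drift of the phase; the second order averaging produces the resonant term \<open>mc\<close>.\<close>

sublocale T2: resonance_term U V a L M i0 i1 "\<lambda>x y z. W x y z * d_I H x y z" "\<lambda>x y z. W x y z * d_phi H x y z"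
  "\<lambda>x y z. W x y z * d_I h x y z" "\<lambda>x y z. W x y z * A1 x y z" "\<lambda>x y z. W x y z * B1 x y z" K2
  "\<lambda>x y z. W x y z * W x y z * mc x y z"
proof
  have 2: "Suc (Suc 0) \<le> 3" "Suc 0 \<le> 2" "0 \<le> (3::nat)" "0 \<le> (2::nat)" by auto
  show "gd (Suc (Suc 0)) (\<lambda>x y z. W x y z * d_I h x y z)"
    by (rule gd_le[OF gd_mult[OF gd_W gd_dh(1)] 2(1)])
  show "gd (Suc (Suc 0)) (\<lambda>x y z. W x y z * A1 x y z)"
    by (rule gd_le[OF gd_mult[OF gd_W gd_A1] 2(1)])
  show "gd (Suc (Suc 0)) (\<lambda>x y z. W x y z * B1 x y z)"
    by (rule gd_le[OF gd_mult[OF gd_W gd_B1] 2(1)])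
  show "gd (Suc 0) K2" by (rule gd_le[OF gd_K2 2(2)])
  show "gd 0 (\<lambda>x y z. W x y z * W x y z * mc x y z)"
    by (intro gd_mult gd_le[OF gd_W 2(3)] gd_le[OF gd_mc 2(4)])
  fix x y z assume xz: "x \<in> U" "z \<in> V"
  show "d_phi (\<lambda>x y z. W x y z * A1 x y z) x y z = W x y z * d_I h x y z"
    by (rule d_phi_eqI, rule DERIV_cmult, rule A1_y[OF xz])
  show "d_phi (\<lambda>x y z. W x y z * B1 x y z) x y z = W x y z * A1 x y z"
    by (rule d_phi_eqI, rule DERIV_cmult, rule B1_y[OF xz])
  have "gd (Suc 2) W" "gd (Suc 2) A1" using gd_W gd_A1 by simp_all
  note b = brk_mult[OF xz this, of y]
  obtain cW where W'c: "\<And>t. W' x t z = cW"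
    using yind_derivs(2)[OF yind_W] unfolding W'_def yind_def by blast
  obtain ch where hbc: "\<And>t. d_I hb x t z = ch"
    using yind_derivs(1)[OF yind_hb] unfolding yind_def by blast
  have dA: "d_phi A1 x y z = d_I h x y z" by (rule d_phi_eqI, rule A1_y[OF xz])
  have "((\<lambda>t. K2 x t z) has_real_derivative
     brk (\<lambda>x y z. W x y z * A1 x y z) x y z - W x y z * W x y z * mc x y z) (at y)"
    unfolding K2_def b brk_W[OF xz] unfolding W'c hbc
    by (rule derivative_eq_intros B1_y[OF xz] dB1_y[OF xz] A1_y[OF xz] X_y[OF xz] dA1_y[OF xz] h_y[OF xz] refl)+
      (simp add: brk_def dA d_phi_h[OF xz] d_I_h[OF xz] hbc q_def algebra_simps)
  then show "d_phi K2 x y z = brk (\<lambda>x y z. W x y z * A1 x y z) x y z - W x y z * W x y z * mc x y z"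
    by (rule d_phi_eqI)
qed

text \<open>Found from the product rule for \<open>brk\<close>. The action derivative of
  \<open>Q1\<close> meets the force in the product \<open>h * d_phi h\<close>, which is the phase
  derivative of \<open>h\<^sup>2 / 2\<close> and has zero mean; so again there is no resonant
  term.\<close>

definition K3 where "K3 x y z = Q1 x y z * K1 x y z + W x y z * Y x y z * d_tau Q1 x y z
  - 1 / 2 * (W x y z * W x y z * (h x y z * h x y z) * d_I Q1 x y z)"

text \<open>Effect of the change of the action on the averaged drift \<open>Q\<close> of the phase.\<close>

sublocale T3: resonance_term U V a L M i0 i1 "\<lambda>x y z. W x y z * d_I H x y z" "\<lambda>x y z. W x y z * d_phi H x y z"
  "\<lambda>x y z. Q1 x y z * (W x y z * d_phi H x y z)" "\<lambda>x y z. Q1 x y z * (W x y z * h x y z)"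
  "\<lambda>x y z. Q1 x y z * (W x y z * Y x y z)" K3 "\<lambda>x y z. 0"
proof
  have Q12: "gd (Suc (Suc 0)) Q1" using gd_Q1 by (simp add: numeral_2_eq_2)
  show "gd (Suc (Suc 0)) (\<lambda>x y z. Q1 x y z * (W x y z * d_phi H x y z))" by (rule gd_mult[OF Q12 T1.gF])
  show "gd (Suc (Suc 0)) (\<lambda>x y z. Q1 x y z * (W x y z * h x y z))" by (rule gd_mult[OF Q12 T1.gG])
  show "gd (Suc (Suc 0)) (\<lambda>x y z. Q1 x y z * (W x y z * Y x y z))" by (rule gd_mult[OF Q12 T1.gG2])
  have c: "gd (Suc 0) (\<lambda>x y z. 1 / 2)" using cd_const[OF U(1) V(1)] by (simp add: gd_def phase_periodic_def)
  show "gd (Suc 0) K3" unfolding K3_def[abs_def]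
    by (intro gd_add gd_diff gd_mult c gd_derivs[OF Q12] gd_le[OF Q12] gd_le[OF gd_W] gd_le[OF gd_h] gd_le[OF gd_Y] T1.gK) auto
  show "gd 0 (\<lambda>x y z. 0)" by (rule T1.gm)
  fix x y z assume xz: "x \<in> U" "z \<in> V"
  obtain c1 c2 c3 where Qc: "\<And>t. Q1 x t z = c1" "\<And>t. d_tau Q1 x t z = c2" "\<And>t. d_I Q1 x t z = c3"
    using yind_Q1 yind_derivs[OF yind_Q1] unfolding yind_def by metis
  show "d_phi (\<lambda>x y z. Q1 x y z * (W x y z * h x y z)) x y z = Q1 x y z * (W x y z * d_phi H x y z)"
    by (rule d_phi_eqI, unfold Qc(1), rule DERIV_cmult) (use DERIV_cmult[OF h_y[OF xz]] d_phi_h[OF xz] in simp)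
  show "d_phi (\<lambda>x y z. Q1 x y z * (W x y z * Y x y z)) x y z = Q1 x y z * (W x y z * h x y z)"
    by (rule d_phi_eqI, unfold Qc(1), rule DERIV_cmult, rule DERIV_cmult, rule Y_y[OF xz])
  have "gd (Suc 0) Q1" "gd (Suc 0) (\<lambda>x y z. W x y z * h x y z)" using gd_le[OF Q12] gd_le[OF T1.gG] by auto
  note b = brk_mult[OF xz this, of y]
  have d0: "d_phi Q1 x y z = 0" by (rule yind_derivs(3)[OF yind_Q1])
  have "((\<lambda>t. K3 x t z) has_real_derivative
     brk (\<lambda>x y z. Q1 x y z * (W x y z * h x y z)) x y z) (at y)"
    unfolding K3_def b unfolding Qc
    by (rule derivative_eq_intros K1_y[OF xz] Y_y[OF xz] h_y[OF xz] refl)+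
      (simp add: brk_def[of Q1] d0 d_phi_h[OF xz] Qc algebra_simps)
  then show "d_phi K3 x y z = brk (\<lambda>x y z. Q1 x y z * (W x y z * h x y z)) x y z - 0"
    using d_phi_eqI by simp
qed

end

section \<open>Jumps of the action and the phase\<close>

lemma integral_bound_inverse_square:
  fixes f :: "real \<Rightarrow> real"
  assumes "0 < r" "r \<le> E" "continuous_on {r..E} f" "\<And>s. s \<in> {r..E} \<Longrightarrow> \<bar>f s\<bar> \<le> A / s\<^sup>2 + B" "0 \<le> A"
  shows "\<bar>integral {r..E} f\<bar> \<le> A / r + B * (E - r)"
proof -
  have "((\<lambda>s. A / s\<^sup>2 + B) has_integral ((- A / E + B * E) - (- A / r + B * r))) {r..E}"
  proof (rule fundamental_theorem_of_calculus[OF assms(2)])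
    fix s assume "s \<in> {r..E}"
    then have "s \<noteq> 0" using assms(1) by auto
    then have "((\<lambda>s. - A / s + B * s) has_real_derivative A / s\<^sup>2 + B) (at s within {r..E})"
      by (auto intro!: derivative_eq_intros simp: power2_eq_square)
    then show "((\<lambda>s. - A / s + B * s) has_vector_derivative A / s\<^sup>2 + B) (at s within {r..E})"
      by (simp add: has_real_derivative_iff_has_vector_derivative)
  qed
  then have I: "integral {r..E} (\<lambda>s. A / s\<^sup>2 + B) = A / r - A / E + B * (E - r)" "(\<lambda>s. A / s\<^sup>2 + B) integrable_on {r..E}"
    by (auto simp: integral_unique algebra_simps)
  have "norm (integral {r..E} f) \<le> integral {r..E} (\<lambda>s. A / s\<^sup>2 + B)"
    by (rule integral_norm_bound_integral[OF integrable_continuous_real[OF assms(3)] I(2)]) (use assms(4) in simp)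
  moreover have "0 \<le> A / E" using assms by simp
  ultimately show ?thesis using I(1) by simp
qed

text \<open>The inequality \<open>ln x \<le> x - 1\<close> at \<open>x\<close> and at
  \<open>1 / x\<close>. It serves to absorb a logarithm into a spare power of
  \<open>sqrt \<epsilon>\<close>.\<close>

lemma abs_ln_bound: "0 < x \<Longrightarrow> x * \<bar>ln x\<bar> \<le> 1 + x\<^sup>2" for x :: real
proof -
  assume x: "0 < x"
  have "ln x \<le> x - 1" using ln_le_minus_one[OF x] .
  then have 1: "x * ln x \<le> x * x" using x by (intro mult_left_mono) auto
  have "ln (inverse x) \<le> inverse x - 1" using ln_le_minus_one[of "inverse x"] x by simp
  then have "x * (- ln x) \<le> x * (inverse x - 1)" using x by (intro mult_left_mono) (auto simp: ln_inverse)
  then have 2: "- (x * ln x) \<le> 1 - x" using x by (simp add: algebra_simps)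
  have "x * \<bar>ln x\<bar> = \<bar>x * ln x\<bar>" using x by (simp add: abs_mult)
  moreover have "\<bar>p\<bar> \<le> 1 + q" if "p \<le> q" "- p \<le> 1 - x" "0 \<le> q" for p q :: real
    using that x by linarith
  ultimately show ?thesis using 1 2 by (simp only: power2_eq_square zero_le_square)
qed

context hamiltonian
begin

abbreviation Hi where "Hi \<equiv> (\<lambda>x y z. W x y z * d_I H x y z)"
abbreviation Hp where "Hp \<equiv> (\<lambda>x y z. W x y z * d_phi H x y z)"
abbreviation Wh where "Wh \<equiv> (\<lambda>x y z. W x y z * h x y z)"
abbreviation WA where "WA \<equiv> (\<lambda>x y z. W x y z * A1 x y z)"
abbreviation m where "m \<equiv> (\<lambda>x y z. W x y z * W x y z * mc x y z)"

section \<open>The action on either side of the resonance\<close>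

definition E where "E \<sigma> = (if \<sigma> = (1::real) then M else L)"

text \<open>\<open>\<sigma>\<close> is \<open>1\<close> after and \<open>- 1\<close> before the
  resonance, and \<open>\<sigma> * E \<sigma>\<close> is the corresponding end of the range, where
  the second summand is \<open>\<epsilon> * u1\<close>.\<close>

definition J where "J \<sigma> \<epsilon> I \<phi> = I (\<sigma> * E \<sigma>) + \<epsilon> / a * (tr Wh I \<phi> (\<sigma> * E \<sigma>) / (\<sigma> * E \<sigma>))"

lemma E_bounds: "0 < E \<sigma>" "S \<le> E \<sigma>" "E \<sigma> \<le> L + M" using LM S by (auto simp: E_def)

lemma E_range: "\<sigma> = 1 \<or> \<sigma> = -1 \<Longrightarrow> t \<in> {0..E \<sigma>} \<Longrightarrow> \<sigma> * t \<in> {-L..M}"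
  using LM by (auto simp: E_def)

lemma solU: "sol \<epsilon> I \<phi> \<Longrightarrow> s \<in> {-L..M} \<Longrightarrow> I s \<in> U" "s \<in> {-L..M} \<Longrightarrow> s \<in> V"
  using solD(3) ran by blast+

text \<open>The corrected action \<open>g\<close> has a derivative of order
  \<open>\<epsilon> / s\<^sup>2\<close>, so its distance from the value at the end is of order
  \<open>\<epsilon> / s\<close>, as is the correction itself. At the edge
  \<open>s = sqrt \<epsilon>\<close> of the layer this is \<open>sqrt \<epsilon>\<close>.\<close>

lemma action_close:
  obtains C where "C > 0" "\<And>\<epsilon> I \<phi> \<sigma> s. sol \<epsilon> I \<phi> \<Longrightarrow> \<sigma> = 1 \<or> \<sigma> = -1 \<Longrightarrow> s \<in> {sqrt \<epsilon>..E \<sigma>} \<Longrightarrow>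
    \<bar>I (\<sigma> * s) - J \<sigma> \<epsilon> I \<phi>\<bar> \<le> C * (\<epsilon> / s)"
proof -
  obtain B1 where B1: "B1 > 0" "\<And>x y z. x \<in> {i0..i1} \<Longrightarrow> z \<in> {-L..M} \<Longrightarrow> \<bar>brk Wh x y z\<bar> \<le> B1"
    using gd_bounded[OF gd_brk[OF T1.gG]] by auto
  obtain B2 where B2: "B2 > 0" "\<And>x y z. x \<in> {i0..i1} \<Longrightarrow> z \<in> {-L..M} \<Longrightarrow> \<bar>Wh x y z\<bar> \<le> B2"
    using gd_bounded[OF T1.gG] by auto
  define A where "A = (B1 * (L + M) + B2) / \<bar>a\<bar>"
  define C where "C = A + B2 / \<bar>a\<bar>"
  have pos: "A > 0" "C > 0" using B1 B2 LM a by (auto simp: A_def C_def intro!: add_pos_pos divide_pos_pos)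
  have "\<bar>I (\<sigma> * s) - J \<sigma> \<epsilon> I \<phi>\<bar> \<le> C * (\<epsilon> / s)"
    if so: "sol \<epsilon> I \<phi>" and \<sigma>: "\<sigma> = 1 \<or> \<sigma> = -1" and s: "s \<in> {sqrt \<epsilon>..E \<sigma>}" for \<epsilon> I \<phi> \<sigma> s
  proof -
    have e: "\<epsilon> > 0" using solD(1)[OF so] .
    then have s0: "0 < s" "s \<le> E \<sigma>" using s by (auto intro: less_le_trans[of 0 "sqrt \<epsilon>"])
    define g where "g s = I s + \<epsilon> / a * (tr Wh I \<phi> s / s)" for s
    define g' where "g' s = \<epsilon> / a * (tr (brk Wh) I \<phi> s / s - tr Wh I \<phi> s / s\<^sup>2)" for s
    have D: "(g has_real_derivative g' t) (at t within {-L..M})" if t: "t \<in> {-L..M}" "t \<noteq> 0" for t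
    proof -
      have eq: "tr (d_phi Wh) I \<phi> t = tr Hp I \<phi> t"
        unfolding tr_def by (rule T1.dG[OF solU(1)[OF so t(1)] solU(2)[OF t(1)]])
      have "(g has_real_derivative - tr Hp I \<phi> t + \<epsilon> / a * (((a * t / \<epsilon> * tr Hp I \<phi> t + tr (brk Wh) I \<phi> t) * t
          - tr Wh I \<phi> t * 1) / (t * t))) (at t within {-L..M})"
        unfolding g_def[abs_def]
        by (rule DERIV_add[OF solD(4)[OF so t(1)] DERIV_cmult[OF DERIV_divide[OF
             tr_deriv[OF T1.gG so t(1), unfolded eq] DERIV_ident t(2)]]])
      then show ?thesis
        by (rule DERIV_cong) (use a e t(2) in \<open>simp add: g'_def field_simps power2_eq_square\<close>)
    qed
    have B: "\<bar>g' t\<bar> \<le> A * \<epsilon> * (1 / t\<^sup>2)" if t: "t \<in> {-L..M}" "t \<noteq> 0" for t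
    proof -
      have "\<bar>tr (brk Wh) I \<phi> t\<bar> \<le> B1" "\<bar>tr Wh I \<phi> t\<bar> \<le> B2"
        unfolding tr_def by (rule B1(2) B2(2); use solD(3)[OF so t(1)] t(1) in blast)+
      then have "\<bar>tr (brk Wh) I \<phi> t / t\<bar> \<le> B1 * (L + M) / t\<^sup>2" "\<bar>tr Wh I \<phi> t / t\<^sup>2\<bar> \<le> B2 / t\<^sup>2"
      proof -
        assume b: "\<bar>tr (brk Wh) I \<phi> t\<bar> \<le> B1" "\<bar>tr Wh I \<phi> t\<bar> \<le> B2"
        have "\<bar>t\<bar> \<le> L + M" using t LM by auto
        then have "\<bar>tr (brk Wh) I \<phi> t\<bar> * \<bar>t\<bar> / t\<^sup>2 \<le> B1 * (L + M) / t\<^sup>2"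
          using b by (intro divide_right_mono mult_mono) (use B1 in auto)
        moreover have "\<bar>tr (brk Wh) I \<phi> t\<bar> * \<bar>t\<bar> / t\<^sup>2 = \<bar>tr (brk Wh) I \<phi> t / t\<bar>"
          using t(2) by (simp add: field_simps power2_eq_square abs_mult)
        ultimately show "\<bar>tr (brk Wh) I \<phi> t / t\<bar> \<le> B1 * (L + M) / t\<^sup>2" by simp
        show "\<bar>tr Wh I \<phi> t / t\<^sup>2\<bar> \<le> B2 / t\<^sup>2" using b(2) by (simp add: divide_right_mono)
      qed
      then have k: "\<bar>tr (brk Wh) I \<phi> t / t - tr Wh I \<phi> t / t\<^sup>2\<bar> \<le> B1 * (L + M) / t\<^sup>2 + B2 / t\<^sup>2"
        by (rule order_trans[OF abs_triangle_ineq4 add_mono])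
      have "\<bar>g' t\<bar> = \<epsilon> / \<bar>a\<bar> * \<bar>tr (brk Wh) I \<phi> t / t - tr Wh I \<phi> t / t\<^sup>2\<bar>"
        using e unfolding g'_def abs_mult by simp
      also have "\<dots> \<le> \<epsilon> / \<bar>a\<bar> * (B1 * (L + M) / t\<^sup>2 + B2 / t\<^sup>2)"
        using e by (intro mult_left_mono k) auto
      also have "\<dots> = A * \<epsilon> * (1 / t\<^sup>2)" by (simp add: A_def add_divide_distrib[symmetric])
      finally show ?thesis .
    qed
    \<comment> \<open>The factor \<open>\<sigma>\<close> in the argument lets one estimate on
      positive times serve both sides.\<close>
    have "\<bar>(\<lambda>t. g (\<sigma> * t)) (E \<sigma>) - (\<lambda>t. g (\<sigma> * t)) s\<bar> \<le> A * \<epsilon> / s ^ 1"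
    proof (rule power_deriv_bound[OF s0])
      fix t assume t: "t \<in> {s..E \<sigma>}"
      then have t': "\<sigma> * t \<in> {-L..M}" "\<sigma> * t \<noteq> 0" using E_range[OF \<sigma>, of t] s0 \<sigma> by auto
      have "(g has_real_derivative g' (\<sigma> * t)) (at (\<sigma> * t) within (*) \<sigma> ` {s..E \<sigma>})"
        by (rule has_field_derivative_subset[OF D[OF t']]) (use E_range[OF \<sigma>] s0 in force)
      moreover have "((*) \<sigma> has_real_derivative \<sigma>) (at t within {s..E \<sigma>})"
        by (rule DERIV_cmult_Id)
      ultimately have "(g \<circ> (*) \<sigma> has_real_derivative g' (\<sigma> * t) * \<sigma>) (at t within {s..E \<sigma>})"
        by (rule DERIV_image_chain)
      then show "((\<lambda>t. g (\<sigma> * t)) has_real_derivative g' (\<sigma> * t) * \<sigma>) (at t within {s..E \<sigma>})"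
        by (simp add: o_def)
      show "\<bar>g' (\<sigma> * t) * \<sigma>\<bar> \<le> A * \<epsilon> * (real 1 / t ^ Suc 1)"
        using B[OF t'] \<sigma> by (auto simp: power2_eq_square)
    qed simp
    moreover have "g (\<sigma> * E \<sigma>) = J \<sigma> \<epsilon> I \<phi>" by (simp add: g_def J_def)
    ultimately have 1: "\<bar>J \<sigma> \<epsilon> I \<phi> - g (\<sigma> * s)\<bar> \<le> A * (\<epsilon> / s)" by simp
    have ss: "\<sigma> * s \<in> {-L..M}" using E_range[OF \<sigma>, of s] s0 by auto
    have "\<bar>tr Wh I \<phi> (\<sigma> * s)\<bar> \<le> B2" unfolding tr_def by (rule B2(2)[OF solD(3)[OF so ss] ss])
    then have "\<epsilon> / \<bar>a\<bar> * (\<bar>tr Wh I \<phi> (\<sigma> * s)\<bar> / s) \<le> \<epsilon> / \<bar>a\<bar> * (B2 / s)"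
      using e s0 by (intro mult_left_mono divide_right_mono) auto
    moreover have "\<bar>g (\<sigma> * s) - I (\<sigma> * s)\<bar> = \<epsilon> / \<bar>a\<bar> * (\<bar>tr Wh I \<phi> (\<sigma> * s)\<bar> / s)"
      using e s0 \<sigma> by (auto simp: g_def abs_mult)
    moreover have "\<epsilon> / \<bar>a\<bar> * (B2 / s) = B2 / \<bar>a\<bar> * (\<epsilon> / s)" by simp
    ultimately have 2: "\<bar>g (\<sigma> * s) - I (\<sigma> * s)\<bar> \<le> B2 / \<bar>a\<bar> * (\<epsilon> / s)" by metis
    show ?thesis using 1 2 unfolding C_def distrib_right by linarith
  qed
  with pos show ?thesis using that by blast
qed

text \<open>Along the solution \<open>f\<close> is replaced by its value at
  \<open>J \<sigma>\<close>, then by its linearisation at \<open>I 0\<close> with the slope at the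
  resonance. After division by \<open>s\<close> the errors are of order
  \<open>\<epsilon> / s\<^sup>2\<close> and \<open>sqrt \<epsilon>\<close>, both with integrals of
  order \<open>sqrt \<epsilon>\<close>. The linear part is a constant \<open>k\<close> over
  \<open>s\<close>, and the lower limit of its integral yields the logarithm.\<close>

lemma side:
  assumes f: "gd (Suc (Suc 0)) f" "yind f"
  obtains C where "C > 0" "\<And>\<epsilon> I \<phi> \<sigma>. sol \<epsilon> I \<phi> \<Longrightarrow> \<sigma> = 1 \<or> \<sigma> = -1 \<Longrightarrow> J \<sigma> \<epsilon> I \<phi> \<in> {i0..i1} \<Longrightarrow>
    \<bar>integral {sqrt \<epsilon>..E \<sigma>} (\<lambda>s. tr f I \<phi> (\<sigma> * s) / s) - integral {sqrt \<epsilon>..E \<sigma>} (\<lambda>s. f (I 0) 0 (\<sigma> * s) / s)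
      + ln (sqrt \<epsilon>) * (d_I f (I 0) 0 0 * (J \<sigma> \<epsilon> I \<phi> - I 0))\<bar> \<le> C * sqrt \<epsilon>"
proof -
  obtain C1 where C1: "C1 > 0" "\<And>\<epsilon> I \<phi> \<sigma> s. sol \<epsilon> I \<phi> \<Longrightarrow> \<sigma> = 1 \<or> \<sigma> = -1 \<Longrightarrow> s \<in> {sqrt \<epsilon>..E \<sigma>} \<Longrightarrow>
    \<bar>I (\<sigma> * s) - J \<sigma> \<epsilon> I \<phi>\<bar> \<le> C1 * (\<epsilon> / s)"
    using action_close by blast
  obtain C2 where C2: "C2 > 0" "\<And>\<epsilon> I \<phi> s. sol \<epsilon> I \<phi> \<Longrightarrow> s \<in> {-L..M} \<Longrightarrow> \<bar>I s - I 0\<bar> \<le> C2 * \<bar>s\<bar>"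
    "\<And>\<epsilon> I \<phi> s. sol \<epsilon> I \<phi> \<Longrightarrow> s \<in> {-L..M} \<Longrightarrow> \<bar>\<phi> s - (\<phi> 0 + a / 2 * (s\<^sup>2 / \<epsilon>))\<bar> \<le> C2 * \<bar>s\<bar>"
    using displacement by blast
  obtain D1 where D1: "D1 > 0" "\<And>x x' y y' z z'. x \<in> {i0..i1} \<Longrightarrow> x' \<in> {i0..i1} \<Longrightarrow> z \<in> {-L..M} \<Longrightarrow> z' \<in> {-L..M} \<Longrightarrow>
    \<bar>f x y z - f x' y' z'\<bar> \<le> D1 * (\<bar>x - x'\<bar> + \<bar>y - y'\<bar> + \<bar>z - z'\<bar>)"
    using gd_lipschitz[OF f(1)] by blast
  obtain D2 where D2: "D2 > 0" "\<And>x x' y y' z z'. x \<in> {i0..i1} \<Longrightarrow> x' \<in> {i0..i1} \<Longrightarrow> z \<in> {-L..M} \<Longrightarrow> z' \<in> {-L..M} \<Longrightarrow>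
    \<bar>f x y z - f x' y' z' - (d_I f x' y' z' * (x - x') + d_phi f x' y' z' * (y - y') + d_tau f x' y' z' * (z - z'))\<bar>
      \<le> D2 * (\<bar>x - x'\<bar> + \<bar>y - y'\<bar> + \<bar>z - z'\<bar>)\<^sup>2"
    using gd_taylor[OF f(1)] by blast
  obtain D3 where D3: "D3 > 0" "\<And>x x' y y' z z'. x \<in> {i0..i1} \<Longrightarrow> x' \<in> {i0..i1} \<Longrightarrow> z \<in> {-L..M} \<Longrightarrow> z' \<in> {-L..M} \<Longrightarrow>
    \<bar>d_I f x y z - d_I f x' y' z'\<bar> \<le> D3 * (\<bar>x - x'\<bar> + \<bar>y - y'\<bar> + \<bar>z - z'\<bar>)"
    using gd_lipschitz[OF gd_derivs(1)[OF f(1)]] by blast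
  obtain B where B: "B > 0" "\<And>x y z. x \<in> {i0..i1} \<Longrightarrow> z \<in> {-L..M} \<Longrightarrow> \<bar>d_I f x y z\<bar> \<le> B"
    using gd_bounded[OF gd_derivs(1)[OF f(1)]] by auto
  define P where "P = C1 + C2"
  define N where "N = D2 * P\<^sup>2 + D3 * P"
  define Q where "Q = B * P * (\<bar>ln L\<bar> + \<bar>ln M\<bar>)"
  define C where "C = D1 * C1 + N * (L + M) + Q"
  have pos: "P > 0" "N > 0" "Q \<ge> 0" using C1 C2 D2 D3 B by (auto simp: P_def N_def Q_def intro!: add_pos_pos mult_pos_pos mult_nonneg_nonneg)
  then have Cp: "C > 0" using C1 D1 LM unfolding C_def by (intro add_pos_nonneg add_pos_pos mult_pos_pos) auto
  have "\<bar>integral {sqrt \<epsilon>..E \<sigma>} (\<lambda>s. tr f I \<phi> (\<sigma> * s) / s) - integral {sqrt \<epsilon>..E \<sigma>} (\<lambda>s. f (I 0) 0 (\<sigma> * s) / s)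
      + ln (sqrt \<epsilon>) * (d_I f (I 0) 0 0 * (J \<sigma> \<epsilon> I \<phi> - I 0))\<bar> \<le> C * sqrt \<epsilon>"
    if so: "sol \<epsilon> I \<phi>" and \<sigma>: "\<sigma> = 1 \<or> \<sigma> = -1" and Jr: "J \<sigma> \<epsilon> I \<phi> \<in> {i0..i1}" for \<epsilon> I \<phi> \<sigma>
  proof -
    define r where "r = sqrt \<epsilon>"
    define j where "j = J \<sigma> \<epsilon> I \<phi>"
    define k where "k = d_I f (I 0) 0 0 * (j - I 0)"
    have e: "\<epsilon> > 0" and rS: "r \<le> S" using solD(1,2)[OF so] by (auto simp: r_def)
    have r: "r > 0" "\<epsilon> = r\<^sup>2" using e by (auto simp: r_def)
    have rE: "r \<le> E \<sigma>" using rS E_bounds(2)[of \<sigma>] by linarith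
    have I0: "I 0 \<in> {i0..i1}" by (rule solD(3)[OF so zero_in])
    have rng: "\<sigma> * s \<in> {-L..M}" if "s \<in> {r..E \<sigma>}" for s using E_range[OF \<sigma>, of s] that r by auto
    have abs\<sigma>: "\<bar>\<sigma> * s\<bar> = s" if "s \<ge> 0" for s using \<sigma> that by auto
    \<comment> \<open>Both \<open>J \<sigma>\<close> and \<open>I 0\<close> are within a multiple of
      \<open>r\<close> of the action at \<open>\<sigma> * r\<close>, because
      \<open>\<epsilon> / r = r\<close>.\<close>
    have jI: "\<bar>j - I 0\<bar> \<le> P * r"
    proof -
      have er: "\<epsilon> / r = r" using r by (simp add: power2_eq_square)
      have "\<bar>I (\<sigma> * r) - j\<bar> \<le> C1 * (\<epsilon> / r)" unfolding j_def by (rule C1(2)[OF so \<sigma>]) (use rE r_def in auto)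
      then have "\<bar>I (\<sigma> * r) - j\<bar> \<le> C1 * r" unfolding er .
      moreover have "\<bar>I (\<sigma> * r) - I 0\<bar> \<le> C2 * r"
        using C2(2)[OF so rng[of r]] rE abs\<sigma>[of r] r by auto
      ultimately show ?thesis unfolding P_def distrib_right by linarith
    qed
    have yi: "f x y z = f x 0 z" for x y z using f(2) unfolding yind_def by blast
    have pt: "\<bar>(tr f I \<phi> (\<sigma> * s) - f (I 0) 0 (\<sigma> * s) - k) / s\<bar> \<le> (D1 * C1 * \<epsilon>) / s\<^sup>2 + N * r" if s: "s \<in> {r..E \<sigma>}" for s
    proof -
      have s0: "s > 0" "r \<le> s" using s r by auto
      note sr = rng[OF s]
      have "\<bar>f (I (\<sigma> * s)) 0 (\<sigma> * s) - f j 0 (\<sigma> * s)\<bar> \<le> D1 * (\<bar>I (\<sigma> * s) - j\<bar> + \<bar>0 - 0\<bar> + \<bar>\<sigma> * s - \<sigma> * s\<bar>)"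
        by (rule D1(2)[OF solD(3)[OF so sr] Jr[folded j_def] sr sr])
      also have "\<dots> \<le> D1 * (C1 * (\<epsilon> / s))"
        using C1(2)[OF so \<sigma>, of s] s D1(1) unfolding j_def r_def by (intro mult_left_mono) auto
      finally have 1: "\<bar>f (I (\<sigma> * s)) 0 (\<sigma> * s) - f j 0 (\<sigma> * s)\<bar> \<le> D1 * (C1 * (\<epsilon> / s))" .
      have "\<bar>f j 0 (\<sigma> * s) - f (I 0) 0 (\<sigma> * s) - (d_I f (I 0) 0 (\<sigma> * s) * (j - I 0)
          + d_phi f (I 0) 0 (\<sigma> * s) * (0 - 0) + d_tau f (I 0) 0 (\<sigma> * s) * (\<sigma> * s - \<sigma> * s))\<bar>
          \<le> D2 * (\<bar>j - I 0\<bar> + \<bar>0 - 0\<bar> + \<bar>\<sigma> * s - \<sigma> * s\<bar>)\<^sup>2"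
        by (rule D2(2)[OF Jr[folded j_def] I0 sr sr])
      also have "\<dots> \<le> D2 * (P * r)\<^sup>2" using jI D2(1) by (intro mult_left_mono power_mono) auto
      also have "\<dots> = D2 * P\<^sup>2 * (r * r)" by (simp add: power2_eq_square)
      also have "\<dots> \<le> D2 * P\<^sup>2 * (r * s)" using s0 r D2(1) by (intro mult_left_mono) auto
      finally have 2: "\<bar>f j 0 (\<sigma> * s) - f (I 0) 0 (\<sigma> * s) - d_I f (I 0) 0 (\<sigma> * s) * (j - I 0)\<bar> \<le> D2 * P\<^sup>2 * (r * s)" by simp
      have "\<bar>d_I f (I 0) 0 (\<sigma> * s) - d_I f (I 0) 0 0\<bar> \<le> D3 * (\<bar>I 0 - I 0\<bar> + \<bar>0 - 0\<bar> + \<bar>\<sigma> * s - 0\<bar>)"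
        by (rule D3(2)[OF I0 I0 sr zero_in])
      then have "\<bar>d_I f (I 0) 0 (\<sigma> * s) - d_I f (I 0) 0 0\<bar> * \<bar>j - I 0\<bar> \<le> (D3 * s) * (P * r)"
        using jI abs\<sigma>[of s] s0 D3(1) by (intro mult_mono) auto
      then have 3: "\<bar>d_I f (I 0) 0 (\<sigma> * s) * (j - I 0) - k\<bar> \<le> D3 * P * (r * s)"
      proof -
        have "d_I f (I 0) 0 (\<sigma> * s) * (j - I 0) - k = (d_I f (I 0) 0 (\<sigma> * s) - d_I f (I 0) 0 0) * (j - I 0)"
          by (simp add: k_def left_diff_distrib)
        then show ?thesis using \<open>_ \<le> (D3 * s) * (P * r)\<close> by (simp only: abs_mult) (simp add: mult_ac)
      qed
      have "tr f I \<phi> (\<sigma> * s) = f (I (\<sigma> * s)) 0 (\<sigma> * s)" unfolding tr_def by (rule yi)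
      then have "\<bar>tr f I \<phi> (\<sigma> * s) - f (I 0) 0 (\<sigma> * s) - k\<bar> \<le> D1 * (C1 * (\<epsilon> / s)) + (D2 * P\<^sup>2 * (r * s) + D3 * P * (r * s))"
        using 1 2 3 by linarith
      then have "\<bar>tr f I \<phi> (\<sigma> * s) - f (I 0) 0 (\<sigma> * s) - k\<bar> / s \<le> (D1 * (C1 * (\<epsilon> / s)) + (D2 * P\<^sup>2 * (r * s) + D3 * P * (r * s))) / s"
        using s0 by (intro divide_right_mono) auto
      also have "\<dots> = (D1 * C1 * \<epsilon>) / s\<^sup>2 + N * r" using s0 by (simp add: N_def field_simps power2_eq_square)
      finally show ?thesis using s0 by simp
    qed
    have cs: "continuous_on {r..E \<sigma>} (\<lambda>s. \<sigma> * s)" by (intro continuous_intros)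
    have c1: "continuous_on {r..E \<sigma>} (\<lambda>s. tr f I \<phi> (\<sigma> * s))"
      by (rule continuous_on_compose2[OF tr_cont[OF f(1) so order_refl] cs]) (use rng in blast)
    have c2: "continuous_on {r..E \<sigma>} (\<lambda>s. f (I 0) 0 (\<sigma> * s))"
    proof -
      have "continuous_on {r..E \<sigma>} (\<lambda>s. (\<lambda>(x, y, z). f x y z) (I 0, 0, \<sigma> * s))"
        by (rule continuous_on_compose2[OF cd_cont[OF gd_cd[OF f(1)]]])
          (use rng I0 ran in \<open>auto intro!: continuous_intros\<close>)
      then show ?thesis by simp
    qed
    have nz: "s \<noteq> 0" if "s \<in> {r..E \<sigma>}" for s using that r by auto
    have c3: "continuous_on {r..E \<sigma>} (\<lambda>s. tr f I \<phi> (\<sigma> * s) / s)" "continuous_on {r..E \<sigma>} (\<lambda>s. f (I 0) 0 (\<sigma> * s) / s)"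
      "continuous_on {r..E \<sigma>} (\<lambda>s. k / s)"
      by (intro continuous_on_divide c1 c2 continuous_on_id continuous_on_const ballI nz; assumption)+
    have lnI: "((\<lambda>s. k / s) has_integral (k * ln (E \<sigma>) - k * ln r)) {r..E \<sigma>}"
    proof (rule fundamental_theorem_of_calculus[OF rE])
      fix s assume "s \<in> {r..E \<sigma>}"
      then have "s > 0" using r by auto
      then have "((\<lambda>s. k * ln s) has_real_derivative k / s) (at s within {r..E \<sigma>})"
        by (auto intro!: derivative_eq_intros simp: divide_inverse)
      then show "((\<lambda>s. k * ln s) has_vector_derivative k / s) (at s within {r..E \<sigma>})"
        by (simp add: has_real_derivative_iff_has_vector_derivative)
    qed
    have "integral {r..E \<sigma>} (\<lambda>s. (tr f I \<phi> (\<sigma> * s) - f (I 0) 0 (\<sigma> * s) - k) / s)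
      = integral {r..E \<sigma>} (\<lambda>s. tr f I \<phi> (\<sigma> * s) / s - f (I 0) 0 (\<sigma> * s) / s - k / s)"
      by (simp add: diff_divide_distrib)
    also have "\<dots> = integral {r..E \<sigma>} (\<lambda>s. tr f I \<phi> (\<sigma> * s) / s) - integral {r..E \<sigma>} (\<lambda>s. f (I 0) 0 (\<sigma> * s) / s)
        - integral {r..E \<sigma>} (\<lambda>s. k / s)"
      by (simp only: integral_diff integrable_diff integrable_continuous_real[OF c3(1)] integrable_continuous_real[OF c3(2)]
          integrable_continuous_real[OF c3(3)])
    also have "integral {r..E \<sigma>} (\<lambda>s. k / s) = k * ln (E \<sigma>) - k * ln r" by (rule integral_unique[OF lnI])
    finally have eq: "integral {r..E \<sigma>} (\<lambda>s. (tr f I \<phi> (\<sigma> * s) - f (I 0) 0 (\<sigma> * s) - k) / s) =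
      integral {r..E \<sigma>} (\<lambda>s. tr f I \<phi> (\<sigma> * s) / s) - integral {r..E \<sigma>} (\<lambda>s. f (I 0) 0 (\<sigma> * s) / s) - (k * ln (E \<sigma>) - k * ln r)" .
    have "\<bar>integral {r..E \<sigma>} (\<lambda>s. (tr f I \<phi> (\<sigma> * s) - f (I 0) 0 (\<sigma> * s) - k) / s)\<bar> \<le> (D1 * C1 * \<epsilon>) / r + N * r * (E \<sigma> - r)"
      by (rule integral_bound_inverse_square[OF r(1) rE _ pt])
        (use c1 c2 r(1) D1(1) C1(1) e in \<open>auto intro!: continuous_intros\<close>)
    also have "\<dots> \<le> D1 * C1 * r + N * (L + M) * r"
    proof -
      have "D1 * C1 * \<epsilon> / r = D1 * C1 * r" using r by (simp add: power2_eq_square)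
      moreover have "N * r * (E \<sigma> - r) \<le> N * r * (L + M)"
        using E_bounds(3)[of \<sigma>] r pos by (intro mult_left_mono) auto
      ultimately show ?thesis by (simp add: mult_ac)
    qed
    finally have b1: "\<bar>integral {r..E \<sigma>} (\<lambda>s. (tr f I \<phi> (\<sigma> * s) - f (I 0) 0 (\<sigma> * s) - k) / s)\<bar> \<le> D1 * C1 * r + N * (L + M) * r" .
    \<comment> \<open>The logarithm at the far end is fixed and \<open>k\<close> is of order
      \<open>sqrt \<epsilon>\<close>, so this limit of the integral goes into the error.\<close>
    have b2: "\<bar>k * ln (E \<sigma>)\<bar> \<le> Q * r"
    proof -
      have "\<bar>k\<bar> \<le> B * (P * r)" unfolding k_def abs_mult using B(2)[OF I0 zero_in] jI B(1) by (intro mult_mono) auto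
      moreover have "\<bar>ln (E \<sigma>)\<bar> \<le> \<bar>ln L\<bar> + \<bar>ln M\<bar>" by (auto simp: E_def)
      ultimately have "\<bar>k\<bar> * \<bar>ln (E \<sigma>)\<bar> \<le> (B * (P * r)) * (\<bar>ln L\<bar> + \<bar>ln M\<bar>)" using B(1) pos r by (intro mult_mono) auto
      then show ?thesis by (simp add: Q_def abs_mult mult_ac)
    qed
    have fin: "\<bar>u - v + lr * k\<bar> \<le> x1 + x2 + x3" if "\<bar>u - v - (k * le - k * lr)\<bar> \<le> x1 + x2" "\<bar>k * le\<bar> \<le> x3" for u v lr le x1 x2 x3
      using that by (simp add: mult.commute[of lr])
    have "\<bar>integral {r..E \<sigma>} (\<lambda>s. tr f I \<phi> (\<sigma> * s) / s) - integral {r..E \<sigma>} (\<lambda>s. f (I 0) 0 (\<sigma> * s) / s) + ln r * k\<bar>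
      \<le> D1 * C1 * r + N * (L + M) * r + Q * r"
      by (rule fin[OF b1[unfolded eq] b2])
    then show ?thesis by (simp add: r_def j_def k_def C_def distrib_right)
  qed
  with Cp show ?thesis using that by blast
qed


section \<open>Exact integrals along a solution\<close>

lemma int_Hp:
  assumes so: "sol \<epsilon> I \<phi>"
  shows "integral {-L..M} (tr Hp I \<phi>) = I (- L) - I M"
proof -
  have "((\<lambda>s. - tr Hp I \<phi> s) has_integral (I M - I (- L))) {-L..M}"
    by (rule fundamental_theorem_of_calculus)
      (use LM solD(4)[OF so] in \<open>auto simp: has_real_derivative_iff_has_vector_derivative\<close>)
  from has_integral_neg[OF this] show ?thesis by (simp add: integral_unique)
qed

text \<open>\<open>Q\<close> changes along a solution at the rate \<open>P0 - Q1 * Hp\<close>, since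
  its phase derivative vanishes and its time derivative is \<open>P0\<close>. So the averaged drift
  becomes a difference of end values plus a force integral, to which \<open>T3\<close>
  applies.\<close>

lemma int_P0:
  assumes so: "sol \<epsilon> I \<phi>"
  shows "integral {-L..M} (tr P0 I \<phi>) = tr Q I \<phi> M - tr Q I \<phi> (- L)
    + integral {-L..M} (tr (\<lambda>x y z. Q1 x y z * Hp x y z) I \<phi>)"
proof -
  have gQ: "gd (Suc 2) Q" using gd_Q by simp
  have "((\<lambda>s. tr P0 I \<phi> s - tr (\<lambda>x y z. Q1 x y z * Hp x y z) I \<phi> s) has_integral (tr Q I \<phi> M - tr Q I \<phi> (- L))) {-L..M}"
  proof (rule fundamental_theorem_of_calculus)
    fix s assume s: "s \<in> {-L..M}"
    note xz = solU(1)[OF so s] solU(2)[OF s]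
    have "yind Q" unfolding Q_def by (rule yind_tint[OF yind_P0])
    then have 1: "tr (d_phi Q) I \<phi> s = 0" unfolding tr_def by (rule yind_derivs(3))
    have "cd (Suc 2) U V P0" using gd_cd[OF gd_P0] by simp
    note d = d_tau_tint[OF U V V0 this xz, of "\<phi> s"] d_I_tint[OF U V V0 this xz, of "\<phi> s"]
    have 2: "tr (brk Q) I \<phi> s = tr P0 I \<phi> s - tr (\<lambda>x y z. Q1 x y z * Hp x y z) I \<phi> s"
      using 1 by (simp add: tr_def brk_def Q_def Q1_def d)
    have "(tr Q I \<phi> has_real_derivative tr P0 I \<phi> s - tr (\<lambda>x y z. Q1 x y z * Hp x y z) I \<phi> s) (at s within {-L..M})"
      using tr_deriv[OF gQ so s] unfolding 1 2 by simp
    then show "(tr Q I \<phi> has_vector_derivative tr P0 I \<phi> s - tr (\<lambda>x y z. Q1 x y z * Hp x y z) I \<phi> s) (at s within {-L..M})"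
      by (simp add: has_real_derivative_iff_has_vector_derivative)
  qed (use LM in simp)
  then have "integral {-L..M} (\<lambda>s. tr P0 I \<phi> s - tr (\<lambda>x y z. Q1 x y z * Hp x y z) I \<phi> s) = tr Q I \<phi> M - tr Q I \<phi> (- L)"
    by (rule integral_unique)
  moreover have "integral {-L..M} (\<lambda>s. tr P0 I \<phi> s - tr (\<lambda>x y z. Q1 x y z * Hp x y z) I \<phi> s)
    = integral {-L..M} (tr P0 I \<phi>) - integral {-L..M} (tr (\<lambda>x y z. Q1 x y z * Hp x y z) I \<phi>)"
    by (intro integral_diff integrable_continuous_real tr_cont[OF gd_P0 so] tr_cont[OF T3.gF so] order_refl)
  ultimately show ?thesis by simp
qed

lemma int_phase:
  assumes so: "sol \<epsilon> I \<phi>"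
  shows "\<phi> M - \<phi> (- L) = a / (2 * \<epsilon>) * (M\<^sup>2 - L\<^sup>2) + integral {-L..M} (tr P0 I \<phi>)
    + integral {-L..M} (tr (\<lambda>x y z. W x y z * d_I h x y z) I \<phi>)"
proof -
  have e: "\<epsilon> > 0" by (rule solD(1)[OF so])
  have "((\<lambda>s. tr P0 I \<phi> s + tr (\<lambda>x y z. W x y z * d_I h x y z) I \<phi> s) has_integral
     ((\<phi> M - a / (2 * \<epsilon>) * M\<^sup>2) - (\<phi> (- L) - a / (2 * \<epsilon>) * (- L)\<^sup>2))) {-L..M}"
  proof (rule fundamental_theorem_of_calculus)
    fix s assume s: "s \<in> {-L..M}"
    note xz = solU(1)[OF so s] solU(2)[OF s]
    have 1: "tr Hi I \<phi> s = tr P0 I \<phi> s + tr (\<lambda>x y z. W x y z * d_I h x y z) I \<phi> s"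
    proof -
      have "d_I H (I s) (\<phi> s) s = d_I h (I s) (\<phi> s) s + d_I hb (I s) (\<phi> s) s" using d_I_h[OF xz, of "\<phi> s"] by simp
      then show ?thesis unfolding tr_def P0_def by (simp add: distrib_left)
    qed
    have "((\<lambda>s. a / (2 * \<epsilon>) * s\<^sup>2) has_real_derivative a * s / \<epsilon>) (at s within {-L..M})"
      using e by (auto intro!: derivative_eq_intros)
    from DERIV_diff[OF solD(5)[OF so s] this]
    show "((\<lambda>s. \<phi> s - a / (2 * \<epsilon>) * s\<^sup>2) has_vector_derivative tr P0 I \<phi> s + tr (\<lambda>x y z. W x y z * d_I h x y z) I \<phi> s) (at s within {-L..M})"
      unfolding 1 by (simp add: has_real_derivative_iff_has_vector_derivative)
  qed (use LM in simp)
  then have "integral {-L..M} (\<lambda>s. tr P0 I \<phi> s + tr (\<lambda>x y z. W x y z * d_I h x y z) I \<phi> s) =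
     (\<phi> M - a / (2 * \<epsilon>) * M\<^sup>2) - (\<phi> (- L) - a / (2 * \<epsilon>) * (- L)\<^sup>2)"
    by (rule integral_unique)
  moreover have "integral {-L..M} (\<lambda>s. tr P0 I \<phi> s + tr (\<lambda>x y z. W x y z * d_I h x y z) I \<phi> s) =
    integral {-L..M} (tr P0 I \<phi>) + integral {-L..M} (tr (\<lambda>x y z. W x y z * d_I h x y z) I \<phi>)"
    by (intro integral_add integrable_continuous_real tr_cont[OF gd_P0 so] tr_cont[OF T2.gF so] order_refl)
  ultimately show ?thesis by (simp add: algebra_simps)
qed

lemma J_plus: "J 1 \<epsilon> I \<phi> = I M + \<epsilon> / a * (tr Wh I \<phi> M / M)"
  by (simp add: J_def E_def)

lemma J_minus: "J (- 1) \<epsilon> I \<phi> = I (- L) - \<epsilon> / a * (tr Wh I \<phi> (- L) / L)"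
  by (simp add: J_def E_def)

text \<open>The force integrates to \<open>I (- L) - I M\<close>, and the boundary terms of
  \<open>T1\<close> are the corrections in \<open>J\<close>, so the averaging estimate reads as a
  jump of the corrected action.\<close>

lemma action_jump:
  obtains C where "C > 0" "\<And>\<epsilon> I \<phi>. sol \<epsilon> I \<phi> \<Longrightarrow>
    \<bar>J 1 \<epsilon> I \<phi> - J (-1) \<epsilon> I \<phi> + sqrt \<epsilon> * T1.T I \<phi>\<bar> \<le> C * (\<epsilon> * sqrt \<epsilon>)"
    "\<And>\<epsilon> I \<phi>. sol \<epsilon> I \<phi> \<Longrightarrow> \<bar>T1.T I \<phi>\<bar> \<le> C"
proof -
  obtain C where C: "C > 0" "\<And>\<epsilon> I \<phi>. sol \<epsilon> I \<phi> \<Longrightarrow>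
    \<bar>integral {-L..M} (tr Hp I \<phi>) - sqrt \<epsilon> * T1.T I \<phi> - \<epsilon> / a * (tr Wh I \<phi> M / M + tr Wh I \<phi> (-L) / L)
      + \<epsilon> / a * (integral {sqrt \<epsilon>..M} (\<lambda>s. tr (\<lambda>x y z. 0) I \<phi> s / s) + integral {-L..- sqrt \<epsilon>} (\<lambda>s. tr (\<lambda>x y z. 0) I \<phi> s / s))\<bar>
    \<le> C * (\<epsilon> * sqrt \<epsilon>)"
    "\<And>\<epsilon> I \<phi>. sol \<epsilon> I \<phi> \<Longrightarrow> \<bar>T1.T I \<phi>\<bar> \<le> C"
    using T1.averaging by blast
  have 1: "\<bar>J 1 \<epsilon> I \<phi> - J (-1) \<epsilon> I \<phi> + sqrt \<epsilon> * T1.T I \<phi>\<bar> \<le> C * (\<epsilon> * sqrt \<epsilon>)" if so: "sol \<epsilon> I \<phi>" for \<epsilon> I \<phi>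
  proof -
    have "\<bar>(im - ip) - rt - k * (g1 + g2) + k * (0 + 0)\<bar> = \<bar>(ip + k * g1) - (im - k * g2) + rt\<bar>" for im ip rt k g1 g2 :: real
      by (simp add: algebra_simps abs_minus_commute) 
    moreover have "integral {sqrt \<epsilon>..M} (\<lambda>s. tr (\<lambda>x y z. 0) I \<phi> s / s) = 0" "integral {-L..- sqrt \<epsilon>} (\<lambda>s. tr (\<lambda>x y z. 0) I \<phi> s / s) = 0"
      by (simp_all add: tr_def)
    ultimately show ?thesis using C(2)[OF so] unfolding int_Hp[OF so] J_plus J_minus by metis
  qed
  show ?thesis using that[OF C(1) 1 C(3)] .
qed

text \<open>The resonant integral with the action frozen at its value at the resonance; it will be
  compared with \<open>- a\<close> times a principal value.\<close>

definition far0 where "far0 \<epsilon> I = integral {sqrt \<epsilon>..M} (\<lambda>s. m (I 0) 0 s / s) + integral {-L..- sqrt \<epsilon>} (\<lambda>s. m (I 0) 0 s / s)"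

lemma reflect_integral: "integral {-v..-u} g = integral {u..v} (\<lambda>s. g (- s))" for g :: "real \<Rightarrow> real"
  using Henstock_Kurzweil_Integration.integral_reflect_real[where a="-v" and b="-u" and f=g] by simp

lemma yind_m: "yind m"
proof -
  have e: "mc x y z = mc x 0 z" for x y z using yind_mc unfolding yind_def by blast
  show ?thesis unfolding yind_def by (intro allI arg_cong2[of _ _ _ _ "(*)"] refl e)
qed

lemma gd_m: "gd (Suc (Suc 0)) m"
  using gd_mult[OF gd_mult[OF gd_le[OF gd_W] gd_le[OF gd_W]] gd_mc] by (simp add: numeral_2_eq_2)

text \<open>Before the resonance the integral changes sign under reflection, so the two one-sided
  estimates are subtracted: \<open>I 0\<close> drops out and the logarithm multiplies the jump of
  the corrected action.\<close>

lemma far_field: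
  obtains C where "C > 0" "\<And>\<epsilon> I \<phi>. sol \<epsilon> I \<phi> \<Longrightarrow> J 1 \<epsilon> I \<phi> \<in> {i0..i1} \<Longrightarrow> J (-1) \<epsilon> I \<phi> \<in> {i0..i1} \<Longrightarrow>
    \<bar>(integral {sqrt \<epsilon>..M} (\<lambda>s. tr m I \<phi> s / s) + integral {-L..- sqrt \<epsilon>} (\<lambda>s. tr m I \<phi> s / s)) - far0 \<epsilon> I
      + ln (sqrt \<epsilon>) * (d_I m (I 0) 0 0 * (J 1 \<epsilon> I \<phi> - J (-1) \<epsilon> I \<phi>))\<bar> \<le> C * sqrt \<epsilon>"
proof -
  obtain C where C: "C > 0" "\<And>\<epsilon> I \<phi> \<sigma>. sol \<epsilon> I \<phi> \<Longrightarrow> \<sigma> = 1 \<or> \<sigma> = -1 \<Longrightarrow> J \<sigma> \<epsilon> I \<phi> \<in> {i0..i1} \<Longrightarrow>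
    \<bar>integral {sqrt \<epsilon>..E \<sigma>} (\<lambda>s. tr m I \<phi> (\<sigma> * s) / s) - integral {sqrt \<epsilon>..E \<sigma>} (\<lambda>s. m (I 0) 0 (\<sigma> * s) / s)
      + ln (sqrt \<epsilon>) * (d_I m (I 0) 0 0 * (J \<sigma> \<epsilon> I \<phi> - I 0))\<bar> \<le> C * sqrt \<epsilon>"
    using side[OF gd_m yind_m] by blast
  have "\<bar>(integral {sqrt \<epsilon>..M} (\<lambda>s. tr m I \<phi> s / s) + integral {-L..- sqrt \<epsilon>} (\<lambda>s. tr m I \<phi> s / s)) - far0 \<epsilon> I
      + ln (sqrt \<epsilon>) * (d_I m (I 0) 0 0 * (J 1 \<epsilon> I \<phi> - J (-1) \<epsilon> I \<phi>))\<bar> \<le> 2 * C * sqrt \<epsilon>"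
    if so: "sol \<epsilon> I \<phi>" and Jr: "J 1 \<epsilon> I \<phi> \<in> {i0..i1}" "J (-1) \<epsilon> I \<phi> \<in> {i0..i1}" for \<epsilon> I \<phi>
  proof -
    have c: "\<bar>(p1 + p2) - (v1 + v2) + l * (k * (jp - jm))\<bar> \<le> 2 * x"
      if "\<bar>p1 - v1 + l * (k * (jp - i))\<bar> \<le> x" "\<bar>- p2 - - v2 + l * (k * (jm - i))\<bar> \<le> x"
      for p1 p2 v1 v2 l k jp jm i x :: real
    proof -
      have "(p1 + p2) - (v1 + v2) + l * (k * (jp - jm)) = (p1 - v1 + l * (k * (jp - i))) - (- p2 - - v2 + l * (k * (jm - i)))"
        by (simp add: algebra_simps)
      then show ?thesis using that by linarith
    qed
    have "integral {sqrt \<epsilon>..L} (\<lambda>s. tr m I \<phi> (- s) / s) = - integral {-L..- sqrt \<epsilon>} (\<lambda>s. tr m I \<phi> s / s)"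
      "integral {sqrt \<epsilon>..L} (\<lambda>s. m (I 0) 0 (- s) / s) = - integral {-L..- sqrt \<epsilon>} (\<lambda>s. m (I 0) 0 s / s)"
      unfolding reflect_integral by (simp_all flip: integral_neg)
    then have 2: "\<bar>- integral {-L..- sqrt \<epsilon>} (\<lambda>s. tr m I \<phi> s / s) - - integral {-L..- sqrt \<epsilon>} (\<lambda>s. m (I 0) 0 s / s)
      + ln (sqrt \<epsilon>) * (d_I m (I 0) 0 0 * (J (-1) \<epsilon> I \<phi> - I 0))\<bar> \<le> C * sqrt \<epsilon>"
      using C(2)[OF so _ Jr(2)] by (simp add: E_def)
    have 1: "\<bar>integral {sqrt \<epsilon>..M} (\<lambda>s. tr m I \<phi> s / s) - integral {sqrt \<epsilon>..M} (\<lambda>s. m (I 0) 0 s / s)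
      + ln (sqrt \<epsilon>) * (d_I m (I 0) 0 0 * (J 1 \<epsilon> I \<phi> - I 0))\<bar> \<le> C * sqrt \<epsilon>"
      using C(2)[OF so _ Jr(1)] by (simp add: E_def)
    show ?thesis using c[OF 1 2] unfolding far0_def by (simp add: mult.assoc)
  qed
  then show ?thesis using that[of "2 * C"] C(1) by simp
qed

text \<open>Taylor expansion of \<open>Q\<close> from the action to the corrected action. Its linear
  term is \<open>Q1\<close> times the correction, exactly the boundary term left by
  \<open>T3\<close>; this is why the averaged drift in the result is evaluated at the corrected
  actions.\<close>

lemma drift_endpoints:
  obtains C where "C > 0" "\<And>\<epsilon> I \<phi>. sol \<epsilon> I \<phi> \<Longrightarrow> J 1 \<epsilon> I \<phi> \<in> {i0..i1} \<Longrightarrow>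
     \<bar>Q (J 1 \<epsilon> I \<phi>) 0 M - tr Q I \<phi> M - \<epsilon> / a * (tr (\<lambda>x y z. Q1 x y z * Wh x y z) I \<phi> M / M)\<bar> \<le> C * \<epsilon>\<^sup>2"
    "\<And>\<epsilon> I \<phi>. sol \<epsilon> I \<phi> \<Longrightarrow> J (-1) \<epsilon> I \<phi> \<in> {i0..i1} \<Longrightarrow>
     \<bar>Q (J (-1) \<epsilon> I \<phi>) 0 (- L) - tr Q I \<phi> (- L) + \<epsilon> / a * (tr (\<lambda>x y z. Q1 x y z * Wh x y z) I \<phi> (- L) / L)\<bar> \<le> C * \<epsilon>\<^sup>2"
proof -
  have gQ: "gd (Suc (Suc 1)) Q" using gd_Q by (simp add: numeral_3_eq_3)
  obtain D where D: "D > 0" "\<And>x x' y y' z z'. x \<in> {i0..i1} \<Longrightarrow> x' \<in> {i0..i1} \<Longrightarrow> z \<in> {-L..M} \<Longrightarrow> z' \<in> {-L..M} \<Longrightarrow>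
    \<bar>Q x y z - Q x' y' z' - (d_I Q x' y' z' * (x - x') + d_phi Q x' y' z' * (y - y') + d_tau Q x' y' z' * (z - z'))\<bar>
      \<le> D * (\<bar>x - x'\<bar> + \<bar>y - y'\<bar> + \<bar>z - z'\<bar>)\<^sup>2"
    using gd_taylor[OF gQ] by blast
  obtain B where B: "B > 0" "\<And>x y z. x \<in> {i0..i1} \<Longrightarrow> z \<in> {-L..M} \<Longrightarrow> \<bar>Wh x y z\<bar> \<le> B"
    using gd_bounded[OF T1.gG] by auto
  define C where "C = D * (B / (\<bar>a\<bar> * S))\<^sup>2"
  have Cp: "C > 0" using D B S a by (auto simp: C_def)
  have key: "\<bar>Q j 0 s - tr Q I \<phi> s - k / a * (tr (\<lambda>x y z. Q1 x y z * Wh x y z) I \<phi> s / e)\<bar> \<le> C * k\<^sup>2"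
    if so: "sol \<epsilon> I \<phi>" and s: "s \<in> {-L..M}" and j: "j \<in> {i0..i1}" "j = I s + k / a * (tr Wh I \<phi> s / e)" and e: "S \<le> e" for \<epsilon> I \<phi> s j k e
  proof -
    note xz = solU(1)[OF so s] solU(2)[OF s]
    have "yind Q" unfolding Q_def by (rule yind_tint[OF yind_P0])
    then have q: "Q j (\<phi> s) s = Q j 0 s" unfolding yind_def by blast
    have "cd (Suc 2) U V P0" using gd_cd[OF gd_P0] by simp
    note d = d_I_tint[OF U V V0 this xz, of "\<phi> s", folded Q_def Q1_def]
    have "\<bar>Q j (\<phi> s) s - Q (I s) (\<phi> s) s - (d_I Q (I s) (\<phi> s) s * (j - I s) + d_phi Q (I s) (\<phi> s) s * (\<phi> s - \<phi> s) + d_tau Q (I s) (\<phi> s) s * (s - s))\<bar>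
      \<le> D * (\<bar>j - I s\<bar> + \<bar>\<phi> s - \<phi> s\<bar> + \<bar>s - s\<bar>)\<^sup>2"
      by (rule D(2)[OF j(1) solD(3)[OF so s] s s])
    then have 1: "\<bar>Q j 0 s - tr Q I \<phi> s - Q1 (I s) (\<phi> s) s * (j - I s)\<bar> \<le> D * \<bar>j - I s\<bar>\<^sup>2"
      unfolding d q tr_def by simp
    have "\<bar>tr Wh I \<phi> s\<bar> \<le> B" unfolding tr_def by (rule B(2)[OF solD(3)[OF so s] s])
    then have "\<bar>tr Wh I \<phi> s\<bar> / e \<le> B / S" using S(1) e B(1) by (intro frac_le) auto
    then have "\<bar>k\<bar> / \<bar>a\<bar> * (\<bar>tr Wh I \<phi> s\<bar> / e) \<le> \<bar>k\<bar> / \<bar>a\<bar> * (B / S)" by (intro mult_left_mono) auto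
    moreover have "\<bar>j - I s\<bar> = \<bar>k\<bar> / \<bar>a\<bar> * (\<bar>tr Wh I \<phi> s\<bar> / e)" using S(1) e by (simp add: j(2) abs_mult)
    ultimately have "\<bar>j - I s\<bar> \<le> \<bar>k\<bar> / \<bar>a\<bar> * (B / S)" by simp
    then have "D * \<bar>j - I s\<bar>\<^sup>2 \<le> D * (\<bar>k\<bar> / \<bar>a\<bar> * (B / S))\<^sup>2" using D(1) by (intro mult_left_mono power_mono) auto
    also have "\<dots> = C * k\<^sup>2" using a S by (simp add: C_def power_mult_distrib power_divide)
    finally have "D * \<bar>j - I s\<bar>\<^sup>2 \<le> C * k\<^sup>2" .
    moreover have "Q1 (I s) (\<phi> s) s * (j - I s) = k / a * (tr (\<lambda>x y z. Q1 x y z * Wh x y z) I \<phi> s / e)"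
      by (simp add: j(2) tr_def)
    ultimately show ?thesis using 1 by simp
  qed
  have rM: "M \<in> {-L..M}" "- L \<in> {-L..M}" using LM by auto
  show ?thesis
  proof (rule that[OF Cp])
    show "\<bar>Q (J 1 \<epsilon> I \<phi>) 0 M - tr Q I \<phi> M - \<epsilon> / a * (tr (\<lambda>x y z. Q1 x y z * Wh x y z) I \<phi> M / M)\<bar> \<le> C * \<epsilon>\<^sup>2"
      if "sol \<epsilon> I \<phi>" "J 1 \<epsilon> I \<phi> \<in> {i0..i1}" for \<epsilon> I \<phi>
      by (rule key[OF that(1) rM(1) that(2) J_plus S(3)])
    show "\<bar>Q (J (-1) \<epsilon> I \<phi>) 0 (- L) - tr Q I \<phi> (- L) + \<epsilon> / a * (tr (\<lambda>x y z. Q1 x y z * Wh x y z) I \<phi> (- L) / L)\<bar> \<le> C * \<epsilon>\<^sup>2"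
      if "sol \<epsilon> I \<phi>" "J (-1) \<epsilon> I \<phi> \<in> {i0..i1}" for \<epsilon> I \<phi>
      using key[OF that(1) rM(2) that(2), of "- \<epsilon>" L] J_minus S(2) by simp
  qed
qed

text \<open>\<open>Q1\<close> accumulates from the resonance on and vanishes there, so the
  correction to the averaged drift has no term of order \<open>sqrt \<epsilon>\<close>.\<close>

lemma T3_zero: "T3.T I \<phi> = 0"
  unfolding T3.T_def by (simp add: Q1_def tint_def)

lemma phase_jump_algebra:
  fixes k :: real
  assumes "dphi = ph + (qM - qL + f3) + f2"
    and "\<bar>f3 - k * (g1 + g2)\<bar> \<le> x1" "\<bar>jM - qM - k * g1\<bar> \<le> x2" "\<bar>jL - qL + k * g2\<bar> \<le> x2"
    and "\<bar>f2 - rt - k * b + k * far\<bar> \<le> x3" "\<bar>k * (far - far' + l * (m0 * dj))\<bar> \<le> x4" "\<bar>k * (l * (m0 * (dj + t)))\<bar> \<le> x5"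
  shows "\<bar>dphi - ph - (jM - jL) - rt - k * b + k * far' + k * (l * (m0 * t))\<bar> \<le> x1 + 2 * x2 + x3 + x4 + x5"
proof -
  have "dphi - ph - (jM - jL) - rt - k * b + k * far' + k * (l * (m0 * t)) =
    (f3 - k * (g1 + g2)) - (jM - qM - k * g1) + (jL - qL + k * g2) + (f2 - rt - k * b + k * far)
    - k * (far - far' + l * (m0 * dj)) + k * (l * (m0 * (dj + t)))"
    by (simp add: assms(1) algebra_simps)
  then show ?thesis using assms(2-) by linarith
qed

text \<open>The logarithm comes with the jump of the corrected action, which
  \<open>action_jump\<close> replaces by \<open>- sqrt \<epsilon> * T1.T\<close>. The error made is
  of order \<open>\<epsilon> * sqrt \<epsilon>\<close> times
  \<open>\<epsilon> * ln (sqrt \<epsilon>)\<close>, and the latter factor is bounded.\<close>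

lemma phase_jump:
  obtains C where "C > 0" "\<And>\<epsilon> I \<phi>. sol \<epsilon> I \<phi> \<Longrightarrow> J 1 \<epsilon> I \<phi> \<in> {i0..i1} \<Longrightarrow> J (-1) \<epsilon> I \<phi> \<in> {i0..i1} \<Longrightarrow>
    \<bar>\<phi> M - \<phi> (- L) - a / (2 * \<epsilon>) * (M\<^sup>2 - L\<^sup>2) - (Q (J 1 \<epsilon> I \<phi>) 0 M - Q (J (-1) \<epsilon> I \<phi>) 0 (- L))
      - sqrt \<epsilon> * T2.T I \<phi> - \<epsilon> / a * (tr WA I \<phi> M / M + tr WA I \<phi> (- L) / L) + \<epsilon> / a * far0 \<epsilon> I
      + \<epsilon> / a * (ln (sqrt \<epsilon>) * (d_I m (I 0) 0 0 * (sqrt \<epsilon> * T1.T I \<phi>)))\<bar> \<le> C * (\<epsilon> * sqrt \<epsilon>)"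
proof -
  obtain C1 where C1: "C1 > 0" "\<And>\<epsilon> I \<phi>. sol \<epsilon> I \<phi> \<Longrightarrow>
    \<bar>J 1 \<epsilon> I \<phi> - J (-1) \<epsilon> I \<phi> + sqrt \<epsilon> * T1.T I \<phi>\<bar> \<le> C1 * (\<epsilon> * sqrt \<epsilon>)"
    "\<And>\<epsilon> I \<phi>. sol \<epsilon> I \<phi> \<Longrightarrow> \<bar>T1.T I \<phi>\<bar> \<le> C1"
    using action_jump by blast
  obtain C2 where C2: "C2 > 0" "\<And>\<epsilon> I \<phi>. sol \<epsilon> I \<phi> \<Longrightarrow>
    \<bar>integral {-L..M} (tr (\<lambda>x y z. W x y z * d_I h x y z) I \<phi>) - sqrt \<epsilon> * T2.T I \<phi> - \<epsilon> / a * (tr WA I \<phi> M / M + tr WA I \<phi> (-L) / L)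
      + \<epsilon> / a * (integral {sqrt \<epsilon>..M} (\<lambda>s. tr m I \<phi> s / s) + integral {-L..- sqrt \<epsilon>} (\<lambda>s. tr m I \<phi> s / s))\<bar>
    \<le> C2 * (\<epsilon> * sqrt \<epsilon>)" "\<And>\<epsilon> I \<phi>. sol \<epsilon> I \<phi> \<Longrightarrow> \<bar>T2.T I \<phi>\<bar> \<le> C2"
    using T2.averaging by blast
  obtain C3 where C3: "C3 > 0" "\<And>\<epsilon> I \<phi>. sol \<epsilon> I \<phi> \<Longrightarrow>
    \<bar>integral {-L..M} (tr (\<lambda>x y z. Q1 x y z * Hp x y z) I \<phi>) - sqrt \<epsilon> * T3.T I \<phi>
      - \<epsilon> / a * (tr (\<lambda>x y z. Q1 x y z * Wh x y z) I \<phi> M / M + tr (\<lambda>x y z. Q1 x y z * Wh x y z) I \<phi> (-L) / L)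
      + \<epsilon> / a * (integral {sqrt \<epsilon>..M} (\<lambda>s. tr (\<lambda>x y z. 0) I \<phi> s / s) + integral {-L..- sqrt \<epsilon>} (\<lambda>s. tr (\<lambda>x y z. 0) I \<phi> s / s))\<bar>
    \<le> C3 * (\<epsilon> * sqrt \<epsilon>)" "\<And>\<epsilon> I \<phi>. sol \<epsilon> I \<phi> \<Longrightarrow> \<bar>T3.T I \<phi>\<bar> \<le> C3"
    using T3.averaging by blast
  obtain C4 where C4: "C4 > 0" "\<And>\<epsilon> I \<phi>. sol \<epsilon> I \<phi> \<Longrightarrow> J 1 \<epsilon> I \<phi> \<in> {i0..i1} \<Longrightarrow>
     \<bar>Q (J 1 \<epsilon> I \<phi>) 0 M - tr Q I \<phi> M - \<epsilon> / a * (tr (\<lambda>x y z. Q1 x y z * Wh x y z) I \<phi> M / M)\<bar> \<le> C4 * \<epsilon>\<^sup>2"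
    "\<And>\<epsilon> I \<phi>. sol \<epsilon> I \<phi> \<Longrightarrow> J (-1) \<epsilon> I \<phi> \<in> {i0..i1} \<Longrightarrow>
     \<bar>Q (J (-1) \<epsilon> I \<phi>) 0 (- L) - tr Q I \<phi> (- L) + \<epsilon> / a * (tr (\<lambda>x y z. Q1 x y z * Wh x y z) I \<phi> (- L) / L)\<bar> \<le> C4 * \<epsilon>\<^sup>2"
    using drift_endpoints by blast
  obtain C5 where C5: "C5 > 0" "\<And>\<epsilon> I \<phi>. sol \<epsilon> I \<phi> \<Longrightarrow> J 1 \<epsilon> I \<phi> \<in> {i0..i1} \<Longrightarrow> J (-1) \<epsilon> I \<phi> \<in> {i0..i1} \<Longrightarrow>
    \<bar>(integral {sqrt \<epsilon>..M} (\<lambda>s. tr m I \<phi> s / s) + integral {-L..- sqrt \<epsilon>} (\<lambda>s. tr m I \<phi> s / s)) - far0 \<epsilon> I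
      + ln (sqrt \<epsilon>) * (d_I m (I 0) 0 0 * (J 1 \<epsilon> I \<phi> - J (-1) \<epsilon> I \<phi>))\<bar> \<le> C5 * sqrt \<epsilon>"
    using far_field by blast
  obtain B where B: "B > 0" "\<And>x y z. x \<in> {i0..i1} \<Longrightarrow> z \<in> {-L..M} \<Longrightarrow> \<bar>d_I m x y z\<bar> \<le> B"
    using gd_bounded[OF gd_derivs(1)[OF gd_m]] by auto
  \<comment> \<open>\<open>\<epsilon> * \<bar>ln r\<bar> = r * (r * \<bar>ln r\<bar>)\<close> is at
    most \<open>S * (1 + S\<^sup>2)\<close>; the other factors bound the slope of \<open>m\<close>
    and the error of the action jump.\<close>
  define R where "R = (S + S * S\<^sup>2) * (B * C1) / \<bar>a\<bar>"
  define C where "C = C3 + 2 * (C4 * S) + C2 + C5 / \<bar>a\<bar> + R"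
  have R0: "R \<ge> 0" using S B C1 by (simp add: R_def)
  have "\<bar>\<phi> M - \<phi> (- L) - a / (2 * \<epsilon>) * (M\<^sup>2 - L\<^sup>2) - (Q (J 1 \<epsilon> I \<phi>) 0 M - Q (J (-1) \<epsilon> I \<phi>) 0 (- L))
      - sqrt \<epsilon> * T2.T I \<phi> - \<epsilon> / a * (tr WA I \<phi> M / M + tr WA I \<phi> (- L) / L) + \<epsilon> / a * far0 \<epsilon> I
      + \<epsilon> / a * (ln (sqrt \<epsilon>) * (d_I m (I 0) 0 0 * (sqrt \<epsilon> * T1.T I \<phi>)))\<bar> \<le> C * (\<epsilon> * sqrt \<epsilon>)"
    if so: "sol \<epsilon> I \<phi>" and Jr: "J 1 \<epsilon> I \<phi> \<in> {i0..i1}" "J (-1) \<epsilon> I \<phi> \<in> {i0..i1}" for \<epsilon> I \<phi>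
  proof -
    define r where "r = sqrt \<epsilon>"
    have e: "\<epsilon> > 0" and rS: "r \<le> S" using solD(1,2)[OF so] by (auto simp: r_def)
    have r: "r > 0" "\<epsilon> = r\<^sup>2" using e by (auto simp: r_def)
    have I0: "I 0 \<in> {i0..i1}" by (rule solD(3)[OF so zero_in])
    have a1: "\<phi> M - \<phi> (- L) = a / (2 * \<epsilon>) * (M\<^sup>2 - L\<^sup>2) + (tr Q I \<phi> M - tr Q I \<phi> (- L)
        + integral {-L..M} (tr (\<lambda>x y z. Q1 x y z * Hp x y z) I \<phi>))
      + integral {-L..M} (tr (\<lambda>x y z. W x y z * d_I h x y z) I \<phi>)"
      using int_phase[OF so] unfolding int_P0[OF so] .
    have z: "integral {sqrt \<epsilon>..M} (\<lambda>s. tr (\<lambda>x y z. 0) I \<phi> s / s) = 0" "integral {-L..- sqrt \<epsilon>} (\<lambda>s. tr (\<lambda>x y z. 0) I \<phi> s / s) = 0"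
      by (simp_all add: tr_def)
    have a2: "\<bar>integral {-L..M} (tr (\<lambda>x y z. Q1 x y z * Hp x y z) I \<phi>)
      - \<epsilon> / a * (tr (\<lambda>x y z. Q1 x y z * Wh x y z) I \<phi> M / M + tr (\<lambda>x y z. Q1 x y z * Wh x y z) I \<phi> (-L) / L)\<bar> \<le> C3 * (\<epsilon> * r)"
      using C3(2)[OF so] unfolding z T3_zero r_def by simp
    have a6: "\<bar>\<epsilon> / a * ((integral {r..M} (\<lambda>s. tr m I \<phi> s / s) + integral {-L..- r} (\<lambda>s. tr m I \<phi> s / s)) - far0 \<epsilon> I
      + ln r * (d_I m (I 0) 0 0 * (J 1 \<epsilon> I \<phi> - J (-1) \<epsilon> I \<phi>)))\<bar> \<le> C5 / \<bar>a\<bar> * (\<epsilon> * r)"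
    proof -
      have "\<epsilon> / \<bar>a\<bar> * \<bar>(integral {r..M} (\<lambda>s. tr m I \<phi> s / s) + integral {-L..- r} (\<lambda>s. tr m I \<phi> s / s)) - far0 \<epsilon> I
        + ln r * (d_I m (I 0) 0 0 * (J 1 \<epsilon> I \<phi> - J (-1) \<epsilon> I \<phi>))\<bar> \<le> \<epsilon> / \<bar>a\<bar> * (C5 * r)"
        using C5(2)[OF so Jr] e unfolding r_def by (intro mult_left_mono) auto
      moreover have "\<bar>\<epsilon> / a * X\<bar> = \<epsilon> / \<bar>a\<bar> * \<bar>X\<bar>" for X using e by (simp add: abs_mult)
      moreover have "\<epsilon> / \<bar>a\<bar> * (C5 * r) = C5 / \<bar>a\<bar> * (\<epsilon> * r)" by simp
      ultimately show ?thesis by metis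
    qed
    have a7: "\<bar>\<epsilon> / a * (ln r * (d_I m (I 0) 0 0 * ((J 1 \<epsilon> I \<phi> - J (-1) \<epsilon> I \<phi>) + r * T1.T I \<phi>)))\<bar> \<le> R * (\<epsilon> * r)"
    proof -
      have "\<epsilon> * \<bar>ln r\<bar> \<le> r * (1 + r\<^sup>2)"
        using mult_left_mono[OF abs_ln_bound[OF r(1)], of r] r by (simp add: power2_eq_square mult.assoc)
      also have "\<dots> \<le> S * (1 + S\<^sup>2)" using r rS by (intro mult_mono add_mono power_mono) auto
      finally have l: "\<epsilon> * \<bar>ln r\<bar> \<le> S * (1 + S\<^sup>2)" .
      have b: "\<bar>d_I m (I 0) 0 0\<bar> * \<bar>(J 1 \<epsilon> I \<phi> - J (-1) \<epsilon> I \<phi>) + r * T1.T I \<phi>\<bar> \<le> B * (C1 * (\<epsilon> * r))"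
        using B(2)[OF I0 zero_in, of 0] C1(2)[OF so] B(1) unfolding r_def by (intro mult_mono) auto
      have "(\<epsilon> * \<bar>ln r\<bar>) * (\<bar>d_I m (I 0) 0 0\<bar> * \<bar>(J 1 \<epsilon> I \<phi> - J (-1) \<epsilon> I \<phi>) + r * T1.T I \<phi>\<bar>)
        \<le> (S * (1 + S\<^sup>2)) * (B * (C1 * (\<epsilon> * r)))"
        by (rule mult_mono[OF l b]) (use S in auto)
      then have "(\<epsilon> * \<bar>ln r\<bar>) * (\<bar>d_I m (I 0) 0 0\<bar> * \<bar>(J 1 \<epsilon> I \<phi> - J (-1) \<epsilon> I \<phi>) + r * T1.T I \<phi>\<bar>) / \<bar>a\<bar>
        \<le> (S * (1 + S\<^sup>2)) * (B * (C1 * (\<epsilon> * r))) / \<bar>a\<bar>"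
        by (rule divide_right_mono) simp
      moreover have "(S * (1 + S\<^sup>2)) * (B * (C1 * (\<epsilon> * r))) / \<bar>a\<bar> = R * (\<epsilon> * r)"
        by (simp add: R_def algebra_simps)
      moreover have "\<bar>\<epsilon> / a * (l * (d * x))\<bar> = (\<epsilon> * \<bar>l\<bar>) * (\<bar>d\<bar> * \<bar>x\<bar>) / \<bar>a\<bar>" for l d x
        using e by (simp add: abs_mult)
      ultimately show ?thesis by metis
    qed
    have "\<bar>\<phi> M - \<phi> (- L) - a / (2 * \<epsilon>) * (M\<^sup>2 - L\<^sup>2) - (Q (J 1 \<epsilon> I \<phi>) 0 M - Q (J (-1) \<epsilon> I \<phi>) 0 (- L))
      - r * T2.T I \<phi> - \<epsilon> / a * (tr WA I \<phi> M / M + tr WA I \<phi> (- L) / L) + \<epsilon> / a * far0 \<epsilon> I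
      + \<epsilon> / a * (ln r * (d_I m (I 0) 0 0 * (r * T1.T I \<phi>)))\<bar>
      \<le> C3 * (\<epsilon> * r) + 2 * (C4 * \<epsilon>\<^sup>2) + C2 * (\<epsilon> * r) + C5 / \<bar>a\<bar> * (\<epsilon> * r) + R * (\<epsilon> * r)"
      by (rule phase_jump_algebra[OF a1 a2 C4(2)[OF so Jr(1)] C4(3)[OF so Jr(2)] C2(2)[OF so, folded r_def] a6 a7])
    also have "\<dots> \<le> C3 * (\<epsilon> * r) + 2 * (C4 * (S * (\<epsilon> * r))) + C2 * (\<epsilon> * r) + C5 / \<bar>a\<bar> * (\<epsilon> * r) + R * (\<epsilon> * r)"
    proof -
      have "\<epsilon>\<^sup>2 \<le> S * (\<epsilon> * r)" using r rS e by (simp add: power2_eq_square mult_ac mult_left_mono)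
      then have "C4 * \<epsilon>\<^sup>2 \<le> C4 * (S * (\<epsilon> * r))" using C4(1) by (intro mult_left_mono) auto
      then show ?thesis by simp
    qed
    also have "\<dots> = C * (\<epsilon> * r)" by (simp add: C_def algebra_simps)
    finally show ?thesis unfolding r_def .
  qed
  moreover have "C > 0" unfolding C_def using C1(1) C2(1) C3(1) C4(1) C5(1) S R0 a
    by (intro add_pos_nonneg add_pos_pos mult_pos_pos divide_pos_pos) auto
  ultimately show ?thesis using that by blast
qed

end

section \<open>Linearising the frequency by a change of time\<close>

text \<open>A function of time alone has the same smoothness over every open set of actions. The
  time change is built over \<open>UNIV\<close>, before a set of actions is given.\<close>

lemma cd_UNIV_imp:
  assumes "open U" "open V" "cd k UNIV V (\<lambda>x y z. f z)"
  shows "cd k U V (\<lambda>x y z. f z)"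
  using assms(3)
proof (induction k arbitrary: f)
  case 0
  then have "continuous_on (UNIV \<times> UNIV \<times> V) (\<lambda>(x :: real, y :: real, z). f z)" by simp
  from continuous_on_subset[OF this, of "U \<times> UNIV \<times> V"] show ?case by auto
next
  case (Suc k)
  have dt: "d_tau (\<lambda>x y z. f z) = (\<lambda>x y z. deriv f z)" by (simp add: d_tau_def fun_eq_iff)
  have "continuous_on (U \<times> UNIV \<times> V) (\<lambda>(x :: real, y :: real, z). f z)"
    by (rule continuous_on_subset[OF cd_cont[OF Suc.prems]]) auto
  moreover have "has_partials U V (\<lambda>x y z. f z) (\<lambda>x y z. 0) (\<lambda>x y z. 0) (\<lambda>x y z. deriv f z)"
    using has_partialsD(3)[OF cd_partials[OF Suc.prems], of 0] by (auto simp: has_partials_def dt)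
  moreover have "cd k U V (\<lambda>x y z. deriv f z)"
    using cd_derivs(3)[OF Suc.prems] unfolding dt by (rule Suc.IH)
  ultimately show ?case using cd_const[OF assms(1,2), of k 0] by (intro cd_SucI[OF assms(1,2)])
qed

text \<open>The new time \<open>z = T \<tau>\<close> satisfies \<open>\<omega> d\<tau> = a z dz\<close>. It is smooth through the resonance because \<open>\<omega>\<close> vanishes to
  first order there, so that \<open>z\<^sup>2\<close> is a smooth positive multiple of \<open>(\<tau> - \<tau>s)\<^sup>2\<close>.\<close>

lemma time_change:
  fixes D :: "real set" and \<omega> :: "real \<Rightarrow> real" and \<tau>s a :: real
  assumes D: "open D" "is_interval D" and \<omega>: "Ck_on 4 D \<omega>" and \<tau>s: "\<tau>s \<in> D" "\<omega> \<tau>s = 0"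
    and a: "a = deriv \<omega> \<tau>s" "a \<noteq> 0" and nz: "\<And>\<tau>. \<tau> \<in> D - {\<tau>s} \<Longrightarrow> \<omega> \<tau> \<noteq> 0"
  obtains V S T w where "open V" "convex V" "0 \<in> V"
    "\<And>z. z \<in> V \<Longrightarrow> S z \<in> D" "\<And>z. z \<in> V \<Longrightarrow> T (S z) = z"
    "\<And>\<tau>. \<tau> \<in> D \<Longrightarrow> T \<tau> \<in> V" "\<And>\<tau>. \<tau> \<in> D \<Longrightarrow> S (T \<tau>) = \<tau>"
    "S 0 = \<tau>s" "w 0 = 1" "\<And>z. z \<in> V \<Longrightarrow> 0 < w z" "\<And>z. z \<in> V \<Longrightarrow> \<omega> (S z) * w z = a * z"
    "\<And>z. z \<in> V \<Longrightarrow> (S has_real_derivative w z) (at z)"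
    "\<And>\<tau>. \<tau> \<in> D \<Longrightarrow> (T has_real_derivative 1 / w (T \<tau>)) (at \<tau>)"
    "\<And>\<tau> \<tau>'. \<tau> \<in> D \<Longrightarrow> \<tau>' \<in> D \<Longrightarrow> \<tau> < \<tau>' \<Longrightarrow> T \<tau> < T \<tau>'"
    "\<And>U. open U \<Longrightarrow> cd 3 U V (\<lambda>x y z. w z)"
    "\<And>U f. open U \<Longrightarrow> cd 4 U D f \<Longrightarrow> cd 4 U V (\<lambda>x y z. f x y (S z))"
proof -
  define V0 where "V0 = (\<lambda>s. s - \<tau>s) ` D"
  have mem: "s \<in> V0 \<longleftrightarrow> \<tau>s + s \<in> D" for s by (auto simp: V0_def image_iff algebra_simps)
  have V0: "open V0" "convex V0" "0 \<in> V0"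
  proof -
    show "open V0" unfolding V0_def using open_translation_subtract[OF D(1)] by simp
    show "convex V0" unfolding V0_def using D(2) convex_translation_subtract[of D \<tau>s] is_interval_convex by simp
    show "0 \<in> V0" using \<tau>s by (simp add: mem)
  qed
  have sm: "t * z \<in> V0" if "t \<in> {0..1}" "z \<in> V0" for t z
    by (rule scale_mem[OF open_UNIV convex_UNIV V0(1,2,3) that])
  define \<omega>0 where "\<omega>0 s = \<omega> (\<tau>s + s)" for s
  define d\<omega> where "d\<omega> s = deriv \<omega>0 s" for s
  \<comment> \<open>\<open>q\<close> is the shifted frequency divided by \<open>a * z\<close>,
    written as an integral so that it is smooth at \<open>0\<close>. By the same device
    \<open>p\<close> is the primitive of \<open>z * q z\<close> from \<open>0\<close>, divided by
    \<open>z\<^sup>2 / 2\<close>. The new time will be \<open>z * sqrt (p z)\<close>.\<close>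
  define q where "q z = integral {0..1} (\<lambda>t. 1 / a * d\<omega> (t * z))" for z
  define p where "p z = integral {0..1} (\<lambda>t. (2 * t) * q (t * z))" for z
  have shift: "cd 4 U V0 (\<lambda>x y z. f x y (\<tau>s + z))" if "open U" "cd 4 U D f" for U f
    by (rule cd_comp_tau[where W="\<lambda>_. 1" and n=4, OF that(1) D(1) V0(1) cd_const[OF that(1) D(1)]])
      (use that mem in \<open>auto intro!: derivative_eq_intros\<close>)
  have c\<omega>: "cd 4 U V0 (\<lambda>x y z. \<omega>0 z)" if "open U" for U
    unfolding \<omega>0_def by (rule shift[OF that Ck_on_imp_cd_tau[OF that D(1) \<omega>]])
  have dt: "d_tau (\<lambda>x y z. g z) = (\<lambda>x y z. deriv g z)" for g by (simp add: d_tau_def fun_eq_iff)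
  have cd\<omega>: "cd 3 U V0 (\<lambda>x y z. d\<omega> z)" if "open U" for U
  proof -
    have "cd (Suc 3) U V0 (\<lambda>x y z. \<omega>0 z)" using c\<omega>[OF that] by simp
    from cd_derivs(3)[OF this] show ?thesis unfolding dt d\<omega>_def .
  qed
  have cq: "cd 3 UNIV V0 (\<lambda>x y z. q z)"
    using cd_integral[OF open_UNIV convex_UNIV V0(1,2) cd\<omega>[OF open_UNIV], of 0 1 "\<lambda>t. 1 / a" "\<lambda>t. 1" "\<lambda>t. 0" "\<lambda>t. t"] sm
    unfolding q_def[abs_def] by (auto intro!: continuous_intros)
  have cp: "cd 3 UNIV V0 (\<lambda>x y z. p z)"
    using cd_integral[OF open_UNIV convex_UNIV V0(1,2) cq, of 0 1 "\<lambda>t. 2 * t" "\<lambda>t. 1" "\<lambda>t. 0" "\<lambda>t. t"] sm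
    unfolding p_def[abs_def] by (auto intro!: continuous_intros)
  have contV: "continuous_on V0 g" if "cd k UNIV V0 (\<lambda>x y z. g z)" for g k
  proof -
    have "continuous_on V0 (\<lambda>z. (\<lambda>(x :: real, y :: real, z). g z) (0, 0, z))"
      by (rule continuous_on_compose2[OF cd_cont[OF that]]) (auto intro!: continuous_intros)
    then show ?thesis by simp
  qed
  have \<omega>D: "(\<omega>0 has_real_derivative d\<omega> z) (at z)" if "z \<in> V0" for z
    using has_partialsD(3)[OF cd_partials[of 3 UNIV V0 "\<lambda>x y z. \<omega>0 z"], of _ z] c\<omega>[OF open_UNIV] that
    unfolding dt d\<omega>_def by simp
  have \<omega>q: "a * z * q z = \<omega>0 z" if z: "z \<in> V0" for z
  proof -
    have "((\<lambda>t. d\<omega> (t * z) * z) has_integral (\<omega>0 (1 * z) - \<omega>0 (0 * z))) {0..1}"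
    proof (rule fundamental_theorem_of_calculus)
      fix t :: real assume t: "t \<in> {0..1}"
      have "((\<lambda>t. \<omega>0 (t * z)) has_real_derivative d\<omega> (t * z) * z) (at t within {0..1})"
        by (rule DERIV_chain2[where f=\<omega>0 and g="\<lambda>t. t * z", OF \<omega>D[OF sm[OF t z]]]) (auto intro!: derivative_eq_intros)
      then show "((\<lambda>t. \<omega>0 (t * z)) has_vector_derivative d\<omega> (t * z) * z) (at t within {0..1})"
        by (simp add: has_real_derivative_iff_has_vector_derivative)
    qed simp
    from integral_unique[OF this] have "integral {0..1} (\<lambda>t. d\<omega> (t * z)) * z = \<omega>0 z"
      using \<tau>s by (simp add: \<omega>0_def)
    moreover have "q z = 1 / a * integral {0..1} (\<lambda>t. d\<omega> (t * z))" unfolding q_def by (simp only: integral_mult_right)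
    ultimately show ?thesis using a by (simp add: mult.commute)
  qed
  have d0: "d\<omega> 0 = a"
  proof -
    have "(\<omega> has_real_derivative d\<omega> 0) (at \<tau>s)"
      using \<omega>D[OF V0(3)] DERIV_shift[of \<omega> "d\<omega> 0" 0 \<tau>s] by (simp add: \<omega>0_def[abs_def] add.commute)
    from DERIV_imp_deriv[OF this] show ?thesis using a(1) by simp
  qed
  have q0: "q 0 = 1" using a d0 by (simp add: q_def)
  have p0: "p 0 = 1"
  proof -
    have "((\<lambda>t::real. 2 * t) has_integral (1\<^sup>2 - 0\<^sup>2)) {0..1}"
      by (rule fundamental_theorem_of_calculus)
        (auto simp: has_real_derivative_iff_has_vector_derivative[symmetric] intro!: derivative_eq_intros)
    from integral_unique[OF this] show ?thesis by (simp add: p_def q0)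
  qed
  have qnz: "q z \<noteq> 0" if "z \<in> V0" for z
  proof (cases "z = 0")
    case False
    then have "\<omega>0 z \<noteq> 0" using nz[of "\<tau>s + z"] that by (simp add: \<omega>0_def mem)
    then show ?thesis using \<omega>q[OF that] by auto
  qed (simp add: q0)
  \<comment> \<open>\<open>q\<close> has no zero, since the frequency vanishes only at the resonance
    and \<open>q 0 = 1\<close>; connectedness then fixes the sign.\<close>
  have qpos: "0 < q z" if z: "z \<in> V0" for z
  proof (rule ccontr)
    assume "\<not> 0 < q z"
    then have "q z \<le> 0" by simp
    have "connected (q ` V0)" by (rule connected_continuous_image[OF contV[OF cq] convex_connected[OF V0(2)]])
    then have "0 \<in> q ` V0"
      using connectedD_interval[of "q ` V0" "q z" "q 0" 0] z V0(3) \<open>q z \<le> 0\<close> q0 by simp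
    then show False using qnz by auto
  qed
  \<comment> \<open>\<open>p z\<close> is an average of \<open>q\<close> over the segment from
    \<open>0\<close> to \<open>z\<close>, with weight \<open>2 * t\<close> of total mass one, hence
    at least the minimum of \<open>q\<close> there.\<close>
  have ppos: "0 < p z" if z: "z \<in> V0" for z
  proof -
    have c: "continuous_on {0..1} (\<lambda>t. q (t * z))"
      by (rule continuous_on_compose2[OF contV[OF cq]]) (use sm z in \<open>auto intro!: continuous_intros\<close>)
    then obtain t0 where t0: "t0 \<in> {0..1}" "\<And>t. t \<in> {0..1} \<Longrightarrow> q (t0 * z) \<le> q (t * z)"
      using continuous_attains_inf[of "{0..1::real}" "\<lambda>t. q (t * z)"] by auto
    have "((\<lambda>t::real. 2 * t * q (t0 * z)) has_integral (1\<^sup>2 * q (t0 * z) - 0\<^sup>2 * q (t0 * z))) {0..1}"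
      by (rule fundamental_theorem_of_calculus)
        (auto simp: has_real_derivative_iff_has_vector_derivative[symmetric] intro!: derivative_eq_intros)
    then have i: "((\<lambda>t::real. 2 * t * q (t0 * z)) has_integral q (t0 * z)) {0..1}" by simp
    have "q (t0 * z) \<le> p z" unfolding p_def
      by (rule has_integral_le[OF i integrable_integral[OF integrable_continuous_real]])
        (use c t0 in \<open>auto intro!: continuous_intros mult_left_mono\<close>)
    then show ?thesis using qpos[OF sm[OF t0(1) z]] by linarith
  qed
  define p' where "p' z = deriv p z" for z
  have pD: "(p has_real_derivative p' z) (at z)" if "z \<in> V0" for z
    using has_partialsD(3)[OF cd_partials[of 2 UNIV V0 "\<lambda>x y z. p z"], of _ z] cp that
    unfolding dt p'_def by simp
  \<comment> \<open>The relation between \<open>p\<close> and \<open>q\<close> as primitive and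
    integrand, \<open>(z\<^sup>2 * p z)' = 2 * z * q z\<close>, divided by \<open>z\<close>; at
    \<open>0\<close> the values are known.\<close>
  have pq: "2 * p z + z * p' z = 2 * q z" if z: "z \<in> V0" for z
  proof (cases "z = 0")
    case False
    have cg: "cd (Suc 2) UNIV V0 (\<lambda>x y z. z * q z)"
      using cd_mult[OF open_UNIV V0(1) cd_tau[OF open_UNIV V0(1), of 3] cq] by simp
    have t: "tint (\<lambda>x y z. z * q z) 0 0 z = z\<^sup>2 * p z / 2" for z
    proof -
      have "tint (\<lambda>x y z. z * q z) 0 0 z = z * integral {0..1} (\<lambda>t. z / 2 * (2 * t * q (t * z)))"
        by (simp add: tint_def mult_ac)
      also have "\<dots> = z * (z / 2 * p z)" unfolding p_def by (simp only: integral_mult_right)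
      finally show ?thesis by (simp add: power2_eq_square)
    qed
    have "((\<lambda>z. z\<^sup>2 * p z / 2) has_real_derivative (2 * z * p z + p' z * z\<^sup>2) / 2) (at z)"
      by (auto intro!: derivative_eq_intros pD[OF z])
    then have "d_tau (tint (\<lambda>x y z. z * q z)) 0 0 z = (2 * z * p z + p' z * z\<^sup>2) / 2"
      by (intro d_tau_eqI) (simp add: t)
    moreover have "d_tau (tint (\<lambda>x y z. z * q z)) 0 0 z = z * q z"
      by (rule d_tau_tint[OF open_UNIV convex_UNIV V0 cg UNIV_I z])
    ultimately have "z * (2 * p z + z * p' z) = z * (2 * q z)" by (simp add: algebra_simps power2_eq_square)
    then show ?thesis using False by simp
  qed (simp add: p0 q0)
  define \<sigma> where "\<sigma> z = z * sqrt (p z)" for z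
  have \<sigma>D: "(\<sigma> has_real_derivative q z / sqrt (p z)) (at z)" if z: "z \<in> V0" for z
  proof -
    have P: "sqrt (p z) > 0" "sqrt (p z) * sqrt (p z) = p z" using ppos[OF z] by auto
    have s: "((\<lambda>z. sqrt (p z)) has_real_derivative inverse (sqrt (p z)) / 2 * p' z) (at z)"
      by (rule DERIV_chain2[OF DERIV_real_sqrt[OF ppos[OF z]] pD[OF z]])
    have "(\<sigma> has_real_derivative 1 * sqrt (p z) + (inverse (sqrt (p z)) / 2 * p' z) * z) (at z)"
      unfolding \<sigma>_def[abs_def] by (rule DERIV_mult[OF DERIV_ident s])
    moreover have "1 * sqrt (p z) + (inverse (sqrt (p z)) / 2 * p' z) * z = (2 * p z + z * p' z) / (2 * sqrt (p z))"
      using P by (simp add: field_simps)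
    ultimately show ?thesis unfolding pq[OF z] by simp
  qed
  have \<sigma>mono: "\<sigma> x < \<sigma> y" if "x \<in> V0" "y \<in> V0" "x < y" for x y
  proof (rule DERIV_pos_imp_increasing[OF that(3)])
    fix t assume "x \<le> t" "t \<le> y"
    then have "t \<in> V0" using V0(2) that unfolding is_interval_convex_1[symmetric] is_interval_1 by blast
    then show "\<exists>y. (\<sigma> has_real_derivative y) (at t) \<and> 0 < y"
      using \<sigma>D qpos ppos by (intro exI[of _ "q t / sqrt (p t)"]) auto
  qed
  have \<sigma>inj: "inj_on \<sigma> V0"
    by (rule inj_onI) (metis \<sigma>mono less_irrefl linorder_neqE_linordered_idom)
  have \<sigma>c: "continuous_on V0 \<sigma>"
    using \<sigma>D by (intro continuous_at_imp_continuous_on ballI) (rule DERIV_isCont)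
  define V where "V = \<sigma> ` V0"
  define g where "g = the_inv_into V0 \<sigma>"
  have g\<sigma>: "g (\<sigma> x) = x" if "x \<in> V0" for x unfolding g_def by (rule the_inv_into_f_f[OF \<sigma>inj that])
  have gV: "g z \<in> V0" "\<sigma> (g z) = z" if "z \<in> V" for z using that g\<sigma> by (auto simp: V_def)
  \<comment> \<open>The reciprocal of the derivative of \<open>\<sigma>\<close>, as a function of
    the old time: in this form \<open>cd_comp_tau\<close> makes \<open>g\<close> smoother than
    \<open>W\<close> by one order.\<close>
  define W where "W z = sqrt (p z) * inverse (q z)" for z
  have gD: "(g has_real_derivative W (g z)) (at z)" if z: "z \<in> V" for z
  proof -
    have "(g has_derivative (*) (W (g z))) (at (\<sigma> (g z)))"
    proof (rule has_derivative_inverse_strong[OF V0(1) gV(1)[OF z] \<sigma>c g\<sigma>])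
      show "(\<sigma> has_derivative (*) (q (g z) / sqrt (p (g z)))) (at (g z))"
        using \<sigma>D[OF gV(1)[OF z]] by (simp add: has_field_derivative_def)
      show "(*) (q (g z) / sqrt (p (g z))) \<circ> (*) (W (g z)) = id"
        using qpos[OF gV(1)[OF z]] ppos[OF gV(1)[OF z]] by (auto simp: fun_eq_iff W_def field_simps)
    qed
    then show ?thesis using gV(2)[OF z] by (simp add: has_field_derivative_def)
  qed
  have cW: "cd 3 U V0 (\<lambda>x y z. W z)" if U: "open U" for U
  proof -
    have up: "cd 3 U V0 (\<lambda>x y z. f z)" if "cd 3 UNIV V0 (\<lambda>x y z. f z)" for f
      by (rule cd_UNIV_imp[OF U V0(1) that])
    show ?thesis unfolding W_def
      by (intro cd_mult[OF U V0(1)] cd_sqrt[OF U V0(1) up[OF cp] ppos] cd_inverse[OF U V0(1) up[OF cq] qnz])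
  qed
  have oV: "open V" unfolding V_def by (rule invariance_of_domain[OF \<sigma>c V0(1) \<sigma>inj])
  have vV: "convex V"
    unfolding V_def is_interval_convex_1[symmetric] is_interval_connected_1
    by (rule connected_continuous_image[OF \<sigma>c convex_connected[OF V0(2)]])
  show ?thesis
  proof (rule that[of V "\<lambda>z. \<tau>s + g z" "\<lambda>\<tau>. \<sigma> (\<tau> - \<tau>s)" "\<lambda>z. W (g z)"])
    show "open V" "convex V" by fact+
    have \<sigma>0: "\<sigma> 0 = 0" by (simp add: \<sigma>_def)
    show "0 \<in> V" unfolding V_def using V0(3) \<sigma>0 by force
    have g0: "g 0 = 0" using g\<sigma>[OF V0(3)] \<sigma>0 by simp
    then show "\<tau>s + g 0 = \<tau>s" "W (g 0) = 1" by (simp_all add: W_def p0 q0)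
    have iV: "\<tau> - \<tau>s \<in> V0" if "\<tau> \<in> D" for \<tau> using that by (simp add: mem)
    show "\<tau>s + g z \<in> D" if "z \<in> V" for z using gV(1)[OF that] by (simp add: mem)
    show "\<sigma> (\<tau>s + g z - \<tau>s) = z" if "z \<in> V" for z using gV(2)[OF that] by simp
    show "\<sigma> (\<tau> - \<tau>s) \<in> V" if "\<tau> \<in> D" for \<tau> unfolding V_def using iV[OF that] by blast
    show "\<tau>s + g (\<sigma> (\<tau> - \<tau>s)) = \<tau>" if "\<tau> \<in> D" for \<tau> using g\<sigma>[OF iV[OF that]] by simp
    show "0 < W (g z)" if "z \<in> V" for z using qpos[OF gV(1)[OF that]] ppos[OF gV(1)[OF that]] by (simp add: W_def)
    \<comment> \<open>At \<open>g z\<close> the frequency is \<open>a * g z * q\<close> and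
      \<open>W\<close> is \<open>sqrt p / q\<close>, so the product is
      \<open>a * \<sigma> (g z)\<close>.\<close>
    show "\<omega> (\<tau>s + g z) * W (g z) = a * z" if "z \<in> V" for z
    proof -
      have "\<omega> (\<tau>s + g z) = a * g z * q (g z)" using \<omega>q[OF gV(1)[OF that]] by (simp add: \<omega>0_def)
      then have "\<omega> (\<tau>s + g z) * W (g z) = a * (g z * sqrt (p (g z)))"
        using qnz[OF gV(1)[OF that]] by (simp add: W_def)
      then show ?thesis using gV(2)[OF that] by (simp add: \<sigma>_def)
    qed
    show "((\<lambda>z. \<tau>s + g z) has_real_derivative W (g z)) (at z)" if "z \<in> V" for z
      using DERIV_add[OF DERIV_const gD[OF that], of \<tau>s] by simp
    show "((\<lambda>\<tau>. \<sigma> (\<tau> - \<tau>s)) has_real_derivative 1 / W (g (\<sigma> (\<tau> - \<tau>s)))) (at \<tau>)" if "\<tau> \<in> D" for \<tau>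
    proof -
      note i = iV[OF that]
      have "((\<lambda>\<tau>. \<tau> - \<tau>s) has_real_derivative 1) (at \<tau>)" by (auto intro!: derivative_eq_intros)
      from DERIV_chain2[where f=\<sigma>, OF \<sigma>D[OF i] this] show ?thesis
        unfolding g\<sigma>[OF i] W_def by (rule DERIV_cong) (simp add: field_simps)
    qed
    show "\<sigma> (\<tau> - \<tau>s) < \<sigma> (\<tau>' - \<tau>s)" if "\<tau> \<in> D" "\<tau>' \<in> D" "\<tau> < \<tau>'" for \<tau> \<tau>'
      by (rule \<sigma>mono[OF iV iV]) (use that in auto)
    show "cd 3 U V (\<lambda>x y z. W (g z))" if U: "open U" for U
      by (rule cd_comp_tau[OF U V0(1) oV cW[OF U] gV(1) gD _ cW[OF U]]) auto
    show "cd 4 U V (\<lambda>x y z. f x y (\<tau>s + g z))" if U: "open U" and f: "cd 4 U D f" for U f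
      by (rule cd_comp_tau[OF U V0(1) oV cW[OF U] gV(1) gD _ shift[OF U f]]) auto
  qed
qed

section \<open>Identification with the averaged quantities\<close>

lemma tint_d_tau:
  assumes U: "open U" "convex U" and V: "open V" "convex V" "0 \<in> V" and f: "cd (Suc k) U V f" and xz: "x \<in> U" "z \<in> V"
  shows "tint (d_tau f) x y z = f x y z - f x y 0"
proof -
  have "((\<lambda>t. d_tau f x y (t * z) * z) has_integral (f x y (1 * z) - f x y (0 * z))) {0..1}"
  proof (rule fundamental_theorem_of_calculus)
    fix t :: real assume t: "t \<in> {0..1}"
    have "((\<lambda>t. f x y (t * z)) has_real_derivative d_tau f x y (t * z) * z) (at t within {0..1})"
      by (rule DERIV_chain2[where f="f x y" and g="\<lambda>t. t * z",
            OF has_partialsD(3)[OF cd_partials[OF f] xz(1) scale_mem[OF U V t xz(2)]]])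
        (auto intro!: derivative_eq_intros)
    then show "((\<lambda>t. f x y (t * z)) has_vector_derivative d_tau f x y (t * z) * z) (at t within {0..1})"
      by (simp add: has_real_derivative_iff_has_vector_derivative)
  qed simp
  from integral_unique[OF this] show ?thesis by (simp add: tint_def mult.commute)
qed

text \<open>\<open>Sg\<close> leads from the new slow time to the old one and \<open>Tg\<close>
  back; the passage then runs from \<open>Tg \<tau>m < 0\<close> to \<open>Tg \<tau>p > 0\<close>.
  The range \<open>{i0..i1}\<close> of actions may also be a single point or empty.\<close>

locale slow_passage =
  fixes U D V :: "real set" and \<omega> :: "real \<Rightarrow> real" and H1 :: "real \<Rightarrow> real \<Rightarrow> real \<Rightarrow> real"
    and \<tau>s \<tau>m \<tau>p a :: real and Sg Tg w :: "real \<Rightarrow> real" and i0 i1 :: real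
  assumes DU: "open U" "convex U" and D: "open D" "convex D" and VV: "open V" "convex V" "0 \<in> V"
    and Sg: "\<And>z. z \<in> V \<Longrightarrow> Sg z \<in> D" "\<And>z. z \<in> V \<Longrightarrow> Tg (Sg z) = z"
    and Tg: "\<And>\<tau>. \<tau> \<in> D \<Longrightarrow> Tg \<tau> \<in> V" "\<And>\<tau>. \<tau> \<in> D \<Longrightarrow> Sg (Tg \<tau>) = \<tau>"
    and S0: "Sg 0 = \<tau>s" and w0: "w 0 = 1" and wpos: "\<And>z. z \<in> V \<Longrightarrow> 0 < w z"
    and \<omega>w: "\<And>z. z \<in> V \<Longrightarrow> \<omega> (Sg z) * w z = a * z"
    and SgD: "\<And>z. z \<in> V \<Longrightarrow> (Sg has_real_derivative w z) (at z)"
    and TgD: "\<And>\<tau>. \<tau> \<in> D \<Longrightarrow> (Tg has_real_derivative 1 / w (Tg \<tau>)) (at \<tau>)"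
    and Tgm: "\<And>\<tau> \<tau>'. \<tau> \<in> D \<Longrightarrow> \<tau>' \<in> D \<Longrightarrow> \<tau> < \<tau>' \<Longrightarrow> Tg \<tau> < Tg \<tau>'"
    and cw: "cd 3 U V (\<lambda>x y z. w z)" and cH: "cd 4 U V (\<lambda>x y z. H1 x y (Sg z))"
    and perH: "\<And>I \<phi> \<tau>. I \<in> U \<Longrightarrow> \<tau> \<in> D \<Longrightarrow> H1 I (\<phi> + 2 * pi) \<tau> = H1 I \<phi> \<tau>"
    and a0: "a \<noteq> 0" and \<tau>: "\<tau>s \<in> D" "\<tau>m \<in> D" "\<tau>p \<in> D" "\<tau>m < \<tau>s" "\<tau>s < \<tau>p"
    and i01: "{i0..i1} \<subseteq> U"
begin

abbreviation L where "L \<equiv> - Tg \<tau>m"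
abbreviation M where "M \<equiv> Tg \<tau>p"
abbreviation Hc where "Hc \<equiv> (\<lambda>x y z. H1 x y (Sg z))"

lemma Ts: "Tg \<tau>s = 0" using Sg(2)[OF VV(3)] S0 by simp

lemma LMpos: "0 < L" "0 < M" using Tgm[OF \<tau>(2,1,4)] Tgm[OF \<tau>(1,3,5)] Ts by auto

lemma rangeV: "{-L..M} \<subseteq> V"
proof
  fix z assume z: "z \<in> {-L..M}"
  have "is_interval V" using VV(2) by (simp add: is_interval_convex_1)
  then show "z \<in> V" by (rule mem_is_interval_1_I[OF _ Tg(1)[OF \<tau>(2)] Tg(1)[OF \<tau>(3)]]) (use z in auto)
qed

sublocale hamiltonian U V a "- Tg \<tau>m" "Tg \<tau>p" i0 i1 w "\<lambda>x y z. H1 x y (Sg z)"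
proof
  show "phase_periodic U V Hc" using perH Sg(1) by (simp add: phase_periodic_def)
  show "0 < - Tg \<tau>m" "0 < Tg \<tau>p" by (rule LMpos)+
  show "{- (- Tg \<tau>m)..Tg \<tau>p} \<subseteq> V" using rangeV by simp
qed (use DU VV a0 i01 cw cH in auto)

lemma Sg_range: "z \<in> {-L..M} \<Longrightarrow> Sg z \<in> {\<tau>m..\<tau>p}"
proof -
  assume z: "z \<in> {-L..M}"
  then have zV: "z \<in> V" using rangeV by blast
  note d = Sg(1)[OF zV]
  have "\<not> Sg z < \<tau>m" using Tgm[OF d \<tau>(2)] z Sg(2)[OF zV] by auto
  moreover have "\<not> \<tau>p < Sg z" using Tgm[OF \<tau>(3) d] z Sg(2)[OF zV] by auto
  ultimately show ?thesis by simp
qed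

lemma in_D: "t \<in> {\<tau>m..\<tau>p} \<Longrightarrow> t \<in> D"
proof -
  assume t: "t \<in> {\<tau>m..\<tau>p}"
  have "is_interval D" using D(2) by (simp add: is_interval_convex_1)
  then show "t \<in> D" by (rule mem_is_interval_1_I[OF _ \<tau>(2,3)]) (use t in auto)
qed

lemma ends: "Sg (- L) = \<tau>m" "Sg M = \<tau>p" "- L \<in> V" "M \<in> V"
  using Tg[OF \<tau>(2)] Tg[OF \<tau>(3)] by auto

lemma hb_eq: "hb x y z = H_bar H1 x (Sg z)"
  by (simp add: hb_def mean_def H_bar_def)

lemma h_eq: "h = (\<lambda>x y z. H_tilde H1 x y (Sg z))"
  by (simp add: fun_eq_iff h_def hb_eq H_tilde_def)

lemma dI_h_eq: "d_I h x y z = d_I (H_tilde H1) x y (Sg z)"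
  by (simp add: h_eq d_I_def)

lemma dphi_H_eq: "d_phi Hc x y z = d_phi H1 x y (Sg z)"
  by (simp add: d_phi_def)

lemma dI_H_eq: "d_I Hc x y z = d_I H1 x y (Sg z)"
  by (simp add: d_I_def)

lemma dI_hb_eq: "d_I hb x y z = deriv (\<lambda>x. H_bar H1 x (Sg z)) x"
  by (simp add: d_I_def hb_eq)

lemma T1_eq: "T1.T I \<phi> = integral UNIV (\<lambda>\<theta>. d_phi H1 (I 0) (\<phi> 0 + a / 2 * \<theta>\<^sup>2) \<tau>s)"
  unfolding T1.T_def by (simp add: dphi_H_eq w0 S0)

lemma T2_eq: "T2.T I \<phi> = integral UNIV (\<lambda>\<theta>. d_I (H_tilde H1) (I 0) (\<phi> 0 + a / 2 * \<theta>\<^sup>2) \<tau>s)"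
  unfolding T2.T_def by (simp add: dI_h_eq w0 S0)

lemma integrable_resonant:
  assumes "x \<in> {i0..i1}"
  shows "(\<lambda>\<theta>. d_phi H1 x (p + a / 2 * \<theta>\<^sup>2) \<tau>s) integrable_on UNIV"
    "(\<lambda>\<theta>. d_I (H_tilde H1) x (p + a / 2 * \<theta>\<^sup>2) \<tau>s) integrable_on UNIV"
proof -
  have bd: "\<exists>B. (\<forall>y. \<bar>f x y 0\<bar> \<le> B) \<and> (\<forall>y. \<bar>g x y 0\<bar> \<le> B)" if fg: "gd (Suc (Suc 0)) f" "gd (Suc (Suc 0)) g" for f g
  proof -
    obtain B1 where B1: "B1 > 0" "\<And>x y z. x \<in> {i0..i1} \<Longrightarrow> z \<in> {-L..M} \<Longrightarrow> \<bar>f x y z\<bar> \<le> B1"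
      using gd_bounded[OF fg(1)] by auto
    obtain B2 where B2: "B2 > 0" "\<And>x y z. x \<in> {i0..i1} \<Longrightarrow> z \<in> {-L..M} \<Longrightarrow> \<bar>g x y z\<bar> \<le> B2"
      using gd_bounded[OF fg(2)] by auto
    have "\<bar>f x y 0\<bar> \<le> B1 + B2" "\<bar>g x y 0\<bar> \<le> B1 + B2" for y
      using B1(2)[OF assms zero_in, of y] B2(2)[OF assms zero_in, of y] B1(1) B2(1) by linarith+
    then show ?thesis by blast
  qed
  obtain b1 where "\<forall>y. \<bar>W x y 0 * h x y 0\<bar> \<le> b1" "\<forall>y. \<bar>W x y 0 * Y x y 0\<bar> \<le> b1"
    using bd[OF T1.gG T1.gG2] by blast
  then show "(\<lambda>\<theta>. d_phi H1 x (p + a / 2 * \<theta>\<^sup>2) \<tau>s) integrable_on UNIV"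
    using T1.model_integral(1)[OF assms, of b1 p] by (simp add: dphi_H_eq w0 S0)
  obtain b2 where "\<forall>y. \<bar>W x y 0 * A1 x y 0\<bar> \<le> b2" "\<forall>y. \<bar>W x y 0 * B1 x y 0\<bar> \<le> b2"
    using bd[OF T2.gG T2.gG2] by blast
  then show "(\<lambda>\<theta>. d_I (H_tilde H1) x (p + a / 2 * \<theta>\<^sup>2) \<tau>s) integrable_on UNIV"
    using T2.model_integral(1)[OF assms, of b2 p] by (simp add: dI_h_eq w0 S0)
qed

text \<open>Turns the small denominator of \<open>u1\<close>, \<open>v1\<close> and
  \<open>R2\<close> into \<open>a * z / w z\<close>, the form in which the integrations by parts
  produce it.\<close>

lemma div_\<omega>: "z \<in> V \<Longrightarrow> z \<noteq> 0 \<Longrightarrow> c / \<omega> (Sg z) = w z * c / (a * z)"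
proof -
  assume z: "z \<in> V" "z \<noteq> 0"
  have "c / \<omega> (Sg z) = w z * c / (\<omega> (Sg z) * w z)" using wpos[OF z(1)] by simp
  then show ?thesis unfolding \<omega>w[OF z(1)] .
qed

lemma u1_eq: "z \<in> V \<Longrightarrow> z \<noteq> 0 \<Longrightarrow> u1 \<omega> H1 x y (Sg z) = w z * h x y z / (a * z)"
  unfolding u1_def h_eq using div_\<omega> by simp

text \<open>The frequency depends neither on action nor on phase, so it comes out of the derivative,
  the primitive and the mean; what remains is the primitive \<open>A1\<close> of zero mean.\<close>

lemma v1_eq:
  assumes z: "z \<in> V" "z \<noteq> 0" and x: "x \<in> U"
  shows "v1 \<omega> H1 x y (Sg z) = - (w z * A1 x y z / (a * z))"
proof -
  define c where "c = \<omega> (Sg z)"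
  have d: "d_I (u1 \<omega> H1) x \<psi> (Sg z) = 1 / c * d_I h x \<psi> z" for \<psi>
  proof (rule d_I_eqI)
    have "((\<lambda>t. 1 / c * h t \<psi> z) has_real_derivative 1 / c * d_I h x \<psi> z) (at x)"
      by (rule DERIV_cmult, rule has_partialsD(1)[OF cd_partials[OF gd_cd[OF gd_h]] x z(1)])
    then show "((\<lambda>t. u1 \<omega> H1 t \<psi> (Sg z)) has_real_derivative 1 / c * d_I h x \<psi> z) (at x)"
      by (simp add: u1_def h_eq c_def)
  qed
  have cf: "cd 3 U V (\<lambda>x y z. 1 / c * d_I h x y z)"
    by (rule cd_cmult[OF DU(1) VV(1) gd_cd[OF gd_dh(1)]])
  have "u1_I_primitive \<omega> H1 x y (Sg z) = (LBINT \<psi>=ereal 0..ereal y. 1 / c * d_I h x \<psi> z)" for y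
    unfolding u1_I_primitive_def d ..
  also have "\<dots> y = prim (\<lambda>x y z. 1 / c * d_I h x y z) x y z" for y
    by (rule prim_interval_integral[OF DU VV(1,2) cf x z(1)])
  also have "prim (\<lambda>x y z. 1 / c * d_I h x y z) x y z = 1 / c * prim (d_I h) x y z" for y
    unfolding prim_def by (simp only: integral_mult_right) simp
  finally have P: "u1_I_primitive \<omega> H1 x y (Sg z) = 1 / c * prim (d_I h) x y z" for y .
  have "phase_mean (\<lambda>\<phi>. 1 / c * prim (d_I h) x \<phi> z) = 1 / c * mean (prim (d_I h)) x y z"
    unfolding mean_def phase_mean_def by (simp only: integral_mult_right) simp
  then have "v1 \<omega> H1 x y (Sg z) = - (A1 x y z / c)"
    unfolding v1_def P A1_def zprim_def by (simp add: diff_divide_distrib)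
  then show ?thesis unfolding c_def using div_\<omega>[OF z, of "A1 x y z"] by simp
qed

text \<open>In the old time the density \<open>w\<close> contained in \<open>P0\<close> cancels
  against the derivative \<open>1 / w\<close> of \<open>Tg\<close>.\<close>

lemma Q_deriv:
  assumes x: "x \<in> U" and t: "t \<in> D"
  shows "((\<lambda>\<tau>. Q x 0 (Tg \<tau>)) has_real_derivative deriv (\<lambda>x. H_bar H1 x t) x) (at t)"
proof -
  have "cd (Suc 2) U V P0" using gd_cd[OF gd_P0] by simp
  from d_tau_tint[OF DU VV(1,2,3) this x Tg(1)[OF t], of 0, folded Q_def]
  have e: "d_tau Q x 0 (Tg t) = w (Tg t) * deriv (\<lambda>x. H_bar H1 x t) x"
    by (simp add: P0_def dI_hb_eq Tg(2)[OF t])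
  have "cd (Suc 2) U V Q" using gd_cd[OF gd_Q] by simp
  from has_partialsD(3)[OF cd_partials[OF this] x Tg(1)[OF t], of 0, unfolded e]
  have "((\<lambda>\<tau>. Q x 0 (Tg \<tau>)) has_real_derivative w (Tg t) * deriv (\<lambda>x. H_bar H1 x t) x * (1 / w (Tg t))) (at t)"
    by (rule DERIV_chain2[OF _ TgD[OF t]])
  then show ?thesis using wpos[OF Tg(1)[OF t]] by simp
qed

text \<open>\<open>Q\<close> vanishes at the resonance, where the two drift integrals meet; so each
  of them is a single end value.\<close>

lemma Q_integral:
  assumes x: "x \<in> U"
  shows "integral {\<tau>s..\<tau>p} (\<lambda>\<tau>. deriv (\<lambda>x. H_bar H1 x \<tau>) x) = Q x 0 M"
    "integral {\<tau>m..\<tau>s} (\<lambda>\<tau>. deriv (\<lambda>x. H_bar H1 x \<tau>) x) = - Q x 0 (- L)"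
proof -
  have Q0: "Q x 0 0 = 0" by (simp add: Q_def tint_def)
  have I: "((\<lambda>\<tau>. deriv (\<lambda>x. H_bar H1 x \<tau>) x) has_integral (Q x 0 (Tg v) - Q x 0 (Tg u))) {u..v}"
    if "u \<le> v" "{u..v} \<subseteq> {\<tau>m..\<tau>p}" for u v
  proof (rule fundamental_theorem_of_calculus[OF that(1)])
    fix t assume "t \<in> {u..v}"
    then have "t \<in> D" using that(2) in_D by blast
    from has_field_derivative_at_within[OF Q_deriv[OF x this]]
    show "((\<lambda>\<tau>. Q x 0 (Tg \<tau>)) has_vector_derivative deriv (\<lambda>x. H_bar H1 x t) x) (at t within {u..v})"
      by (simp add: has_real_derivative_iff_has_vector_derivative)
  qed
  show "integral {\<tau>s..\<tau>p} (\<lambda>\<tau>. deriv (\<lambda>x. H_bar H1 x \<tau>) x) = Q x 0 M"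
    using integral_unique[OF I[of \<tau>s \<tau>p]] \<tau> by (simp add: Ts Q0)
  show "integral {\<tau>m..\<tau>s} (\<lambda>\<tau>. deriv (\<lambda>x. H_bar H1 x \<tau>) x) = - Q x 0 (- L)"
    using integral_unique[OF I[of \<tau>m \<tau>s]] \<tau> by (simp add: Ts Q0)
qed

text \<open>By construction of the time change, \<open>a / 2 * (Tg \<tau>)\<^sup>2\<close> is an
  antiderivative of the frequency.\<close>

lemma \<omega>_integral: "integral {\<tau>m..\<tau>p} \<omega> = a / 2 * (M\<^sup>2 - L\<^sup>2)"
proof -
  have "(\<omega> has_integral (a / 2 * (Tg \<tau>p)\<^sup>2 - a / 2 * (Tg \<tau>m)\<^sup>2)) {\<tau>m..\<tau>p}"
  proof (rule fundamental_theorem_of_calculus)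
    fix t assume "t \<in> {\<tau>m..\<tau>p}"
    then have t: "t \<in> D" by (rule in_D)
    have "((\<lambda>\<tau>. a / 2 * (Tg \<tau>)\<^sup>2) has_real_derivative a * Tg t * (1 / w (Tg t))) (at t within {\<tau>m..\<tau>p})"
      by (auto intro!: derivative_eq_intros has_field_derivative_at_within[OF TgD[OF t]])
    moreover have "a * Tg t * (1 / w (Tg t)) = \<omega> t"
      using \<omega>w[OF Tg(1)[OF t]] wpos[OF Tg(1)[OF t]] Tg(2)[OF t] by (simp add: field_simps)
    ultimately show "((\<lambda>\<tau>. a / 2 * (Tg \<tau>)\<^sup>2) has_vector_derivative \<omega> t) (at t within {\<tau>m..\<tau>p})"
      by (simp add: has_real_derivative_iff_has_vector_derivative)
  qed (use \<tau> in simp)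
  from integral_unique[OF this] show ?thesis by (simp add: algebra_simps)
qed

definition n where "n = mean (\<lambda>x y z. h x y z * h x y z)"

lemma n_eq: "H_tilde_sq_mean H1 x (Sg z) = n x y z"
  by (simp add: n_def mean_def H_tilde_sq_mean_def h_eq power2_eq_square)

lemma gd_n: "gd (Suc 3) n" unfolding n_def by (rule gd_mean[OF gd_mult[OF gd_h gd_h]])

text \<open>Two derivatives pass under the mean, and the second action derivative of
  \<open>h\<^sup>2\<close> is \<open>2 * q\<close>.\<close>

lemma n_derivs:
  assumes xz: "x \<in> U" "z \<in> V"
  shows "d_I (d_I n) x y z = 2 * mc x y z"
proof -
  let ?hh = "\<lambda>x y z. h x y z * h x y z"
  have c: "cd (Suc 3) U V ?hh" by (rule gd_cd[OF gd_mult[OF gd_h gd_h]])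
  have c1: "cd (Suc 2) U V (d_I ?hh)" using cd_derivs(1)[OF c] by simp
  have e1: "d_I n x y z = mean (d_I ?hh) x y z" if "x \<in> U" for x
    unfolding n_def by (rule d_I_mean[OF DU VV(1,2) c that xz(2)])
  have dh: "((\<lambda>t. h t y z) has_real_derivative d_I h x y z) (at x)" if "x \<in> U" for x y
    by (rule has_partialsD(1)[OF cd_partials[OF gd_cd[OF gd_h]] that xz(2)])
  have dh2: "((\<lambda>t. d_I h t y z) has_real_derivative d_I (d_I h) x y z) (at x)" for y
    using has_partialsD(1)[OF cd_partials[of 2 U V "d_I h"] xz] gd_cd[OF gd_dh(1)] by simp
  have e2: "d_I ?hh x y z = 2 * (h x y z * d_I h x y z)" if "x \<in> U" for x y
    by (rule d_I_eqI) (rule DERIV_cong[OF DERIV_mult[OF dh[OF that, of y] dh[OF that, of y]]], simp add: mult.commute)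
  have e3: "d_I (d_I ?hh) x y z = 2 * q x y z" for y
  proof (rule d_I_eqI, rule has_field_derivative_transform_within_open[OF _ DU(1) xz(1)])
    show "((\<lambda>t. 2 * (h t y z * d_I h t y z)) has_real_derivative 2 * q x y z) (at x)"
      by (auto intro!: derivative_eq_intros dh[OF xz(1)] dh2 simp: q_def algebra_simps)
  qed (simp add: e2)
  have "d_I (d_I n) x y z = mean (d_I (d_I ?hh)) x y z"
  proof (rule d_I_eqI, rule has_field_derivative_transform_within_open[OF _ DU(1) xz(1)])
    show "((\<lambda>t. mean (d_I ?hh) t y z) has_real_derivative mean (d_I (d_I ?hh)) x y z) (at x)"
      by (rule has_partials_mean[OF DU VV(1,2) c1 xz])
  qed (simp add: e1)
  also have "\<dots> = 2 * mc x y z"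
    unfolding mc_def mean_def e3 phase_mean_def by simp
  finally show ?thesis .
qed

lemma R2_eq:
  assumes xz: "x \<in> U" "z \<in> V"
  shows "deriv (\<lambda>y. R2 \<omega> H1 y (Sg z)) x = - (mc x 0 z / \<omega> (Sg z))"
proof (rule DERIV_imp_deriv)
  have "cd (Suc 2) U V (d_I n)" using cd_derivs(1)[OF gd_cd[OF gd_n]] by simp
  from has_partialsD(1)[OF cd_partials[OF this] xz, of 0]
  have "((\<lambda>t. d_I n t 0 z) has_real_derivative 2 * mc x 0 z) (at x)"
    unfolding n_derivs[OF xz] .
  from DERIV_cmult[OF this, of "- (1 / (2 * \<omega> (Sg z)))"]
  show "((\<lambda>y. R2 \<omega> H1 y (Sg z)) has_real_derivative - (mc x 0 z / \<omega> (Sg z))) (at x)"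
    by (simp add: R2_def n_eq[of _ z 0] d_I_def)
qed

text \<open>One derivative beyond \<open>n_derivs\<close>; because of \<open>w 0 = 1\<close>,
  \<open>m\<close> and \<open>mc\<close> agree at the resonance. The factor \<open>2\<close> turns
  the coefficient \<open>ln (sqrt \<epsilon>) / a\<close> of \<open>d_I m\<close> into
  \<open>ln \<epsilon> / (4 * a)\<close> for the third derivative.\<close>

lemma third_deriv:
  assumes x: "x \<in> U"
  shows "(deriv ^^ 3) (\<lambda>x. H_tilde_sq_mean H1 x \<tau>s) x = 2 * d_I m x 0 0"
proof -
  have n0: "H_tilde_sq_mean H1 x \<tau>s = n x 0 0" for x using n_eq[of x 0 0] S0 by simp
  have d2: "deriv (deriv (\<lambda>x. n x 0 0)) x = d_I (d_I n) x 0 0" for x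
    by (simp add: d_I_def)
  have "(deriv ^^ 3) (\<lambda>x. H_tilde_sq_mean H1 x \<tau>s) x = deriv (deriv (deriv (\<lambda>x. n x 0 0))) x"
    by (simp add: n0 numeral_3_eq_3)
  also have "\<dots> = deriv (\<lambda>x. 2 * mc x 0 0) x"
  proof (rule deriv_cong_ev)
    have "\<forall>\<^sub>F y in nhds x. y \<in> U" using DU(1) x by (rule eventually_nhds_in_open)
    then show "\<forall>\<^sub>F y in nhds x. deriv (deriv (\<lambda>x. n x 0 0)) y = 2 * mc y 0 0"
      by eventually_elim (simp add: d2 n_derivs VV(3))
  qed simp
  also have "\<dots> = 2 * d_I mc x 0 0"
  proof (rule DERIV_imp_deriv, rule DERIV_cmult)
    have "cd (Suc 1) U V mc" using gd_cd[OF gd_mc] by (simp add: numeral_2_eq_2)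
    from has_partialsD(1)[OF cd_partials[OF this] x VV(3)]
    show "((\<lambda>t. mc t 0 0) has_real_derivative d_I mc x 0 0) (at x)" .
  qed
  also have "d_I mc x 0 0 = d_I m x 0 0" by (simp add: d_I_def w0)
  finally show ?thesis .
qed

text \<open>The smooth quotient of \<open>m - m (z = 0)\<close> by \<open>z\<close>, which removes the pole of the principal value.\<close>

definition bq where "bq x y z = integral {0..1} (\<lambda>t. 1 * d_tau m x (1 * y + 0) (t * z))"

lemma bq_eq: "x \<in> U \<Longrightarrow> z \<in> V \<Longrightarrow> z * bq x y z = m x y z - m x y 0"
  using tint_d_tau[OF DU VV gd_cd[OF gd_m]] by (simp add: tint_def bq_def)

lemma cd_bq: "cd (Suc 0) U V bq"
  unfolding bq_def[abs_def]
  by (rule cd_integral[OF DU VV(1,2) gd_cd[OF gd_derivs(3)[OF gd_m]]])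
    (auto intro!: continuous_intros scale_mem[OF DU VV])

lemma gd_bq: "gd (Suc 0) bq"
proof -
  have "d_tau m x (y + 2 * pi) z = d_tau m x y z" if "x \<in> U" "z \<in> V" for x y z
    using gd_derivs(3)[OF gd_m] that unfolding gd_def phase_periodic_def by blast
  then have "phase_periodic U V bq"
    unfolding phase_periodic_def bq_def using scale_mem[OF DU VV]
    by (auto intro!: Henstock_Kurzweil_Integration.integral_cong)
  with cd_bq show ?thesis by (simp add: gd_def)
qed

section \<open>The principal value\<close>

lemma cont_tau:
  assumes "gd k f" "x \<in> {i0..i1}" "T \<subseteq> {-L..M}"
  shows "continuous_on T (\<lambda>z. f x 0 z)"
proof -
  have "continuous_on T (\<lambda>z. (\<lambda>(x, y, z). f x y z) (x, 0, z))"
    by (rule continuous_on_compose2[OF cd_cont[OF gd_cd[OF assms(1)]]])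
      (use assms i01 rangeV in \<open>auto intro!: continuous_intros\<close>)
  then show ?thesis by simp
qed

text \<open>Subtracting the pole \<open>m x 0 0 / z\<close> leaves the regular integrand
  \<open>bq\<close>; the pole itself has the principal value
  \<open>m x 0 0 * (ln M - ln L)\<close>.\<close>

definition pv where "pv x = - (1 / a) * (integral {-L..M} (\<lambda>z. bq x 0 z) + m x 0 0 * (ln M - ln L))"

text \<open>The cuts \<open>u\<close> and \<open>v\<close> are independent: a cut symmetric in the
  old time is in general not symmetric in the new one, and \<open>ln v - ln u\<close> measures the
  asymmetry.\<close>

lemma cut_integral:
  assumes x: "x \<in> {i0..i1}" and u: "0 < u" "u \<le> M" and v: "0 < v" "v \<le> L"
  shows "integral {u..M} (\<lambda>z. m x 0 z / z) + integral {-L..-v} (\<lambda>z. m x 0 z / z)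
    = - a * pv x - integral {-v..u} (\<lambda>z. bq x 0 z) + m x 0 0 * (ln v - ln u)"
proof -
  have xU: "x \<in> U" using x i01 by blast
  have ib: "(\<lambda>z. bq x 0 z) integrable_on {l..r}" if "{l..r} \<subseteq> {-L..M}" for l r
    by (rule integrable_continuous_real[OF cont_tau[OF gd_bq x that]])
  have c: "integral {l..r} (\<lambda>z. m x 0 z / z) = integral {l..r} (\<lambda>z. bq x 0 z) + k"
    if sub: "{l..r} \<subseteq> {-L..M}" "0 \<notin> {l..r}" and k: "((\<lambda>z. m x 0 0 / z) has_integral k) {l..r}" for l r k
  proof -
    have "m x 0 z / z = bq x 0 z + m x 0 0 / z" if "z \<in> {l..r}" for z
    proof -
      have "z \<in> V" "z \<noteq> 0" using that sub rangeV by auto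
      then have "z * bq x 0 z = m x 0 z - m x 0 0" using bq_eq[OF xU] by blast
      then have "m x 0 z = z * bq x 0 z + m x 0 0" by simp
      then show ?thesis using \<open>z \<noteq> 0\<close> by (simp add: field_simps)
    qed
    then have "integral {l..r} (\<lambda>z. m x 0 z / z) = integral {l..r} (\<lambda>z. bq x 0 z + m x 0 0 / z)"
      by (intro Henstock_Kurzweil_Integration.integral_cong) blast
    also have "\<dots> = integral {l..r} (\<lambda>z. bq x 0 z) + integral {l..r} (\<lambda>z. m x 0 0 / z)"
      by (rule integral_add[OF ib[OF sub(1)]]) (use k in blast)
    finally show ?thesis using integral_unique[OF k] by simp
  qed
  have k1: "((\<lambda>z. m x 0 0 / z) has_integral (m x 0 0 * ln M - m x 0 0 * ln u)) {u..M}"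
  proof (rule fundamental_theorem_of_calculus[OF u(2)])
    fix z assume "z \<in> {u..M}"
    then have "z > 0" using u by auto
    then have "((\<lambda>z. m x 0 0 * ln z) has_real_derivative m x 0 0 / z) (at z within {u..M})"
      by (auto intro!: derivative_eq_intros simp: divide_inverse)
    then show "((\<lambda>z. m x 0 0 * ln z) has_vector_derivative m x 0 0 / z) (at z within {u..M})"
      by (simp add: has_real_derivative_iff_has_vector_derivative)
  qed
  have k2: "((\<lambda>z. m x 0 0 / z) has_integral (m x 0 0 * ln (- (- v)) - m x 0 0 * ln (- (- L)))) {-L..-v}"
  proof (rule fundamental_theorem_of_calculus)
    fix z assume "z \<in> {-L..-v}"
    then have "- z > 0" using v by auto
    then have "((\<lambda>z. m x 0 0 * ln (- z)) has_real_derivative m x 0 0 / z) (at z within {-L..-v})"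
      by (auto intro!: derivative_eq_intros simp: divide_inverse)
    then show "((\<lambda>z. m x 0 0 * ln (- z)) has_vector_derivative m x 0 0 / z) (at z within {-L..-v})"
      by (simp add: has_real_derivative_iff_has_vector_derivative)
  qed (use v in simp)
  have s1: "integral {u..M} (\<lambda>z. m x 0 z / z) = integral {u..M} (\<lambda>z. bq x 0 z) + (m x 0 0 * ln M - m x 0 0 * ln u)"
    by (rule c[OF _ _ k1]) (use u LMpos in auto)
  have s2: "integral {-L..-v} (\<lambda>z. m x 0 z / z) = integral {-L..-v} (\<lambda>z. bq x 0 z) + (m x 0 0 * ln v - m x 0 0 * ln L)"
    using c[OF _ _ k2] v LMpos by simp
  have s3: "integral {-L..M} (\<lambda>z. bq x 0 z) = integral {-L..-v} (\<lambda>z. bq x 0 z) + integral {-v..u} (\<lambda>z. bq x 0 z) + integral {u..M} (\<lambda>z. bq x 0 z)"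
    using Henstock_Kurzweil_Integration.integral_combine[of "-L" "-v" M "\<lambda>z. bq x 0 z"]
      Henstock_Kurzweil_Integration.integral_combine[of "-v" u M "\<lambda>z. bq x 0 z"] u v LMpos ib by simp
  have "- a * pv x = integral {-L..M} (\<lambda>z. bq x 0 z) + m x 0 0 * (ln M - ln L)" using a0 by (simp add: pv_def)
  then show ?thesis using s1 s2 s3 by (simp add: algebra_simps)
qed

text \<open>Substitution \<open>z = Tg \<tau>\<close> on an interval that avoids the resonance; the
  factors \<open>w\<close> of \<open>m\<close> and of the substitution combine to
  \<open>1 / \<omega>\<close>.\<close>

lemma R2_has_integral:
  assumes x: "x \<in> {i0..i1}" and ab: "\<alpha> \<le> \<beta>" "{\<alpha>..\<beta>} \<subseteq> {\<tau>m..\<tau>p}" "\<tau>s \<notin> {\<alpha>..\<beta>}"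
  shows "((\<lambda>\<tau>. deriv (\<lambda>y. R2 \<omega> H1 y \<tau>) x) has_integral - (1 / a) * integral {Tg \<alpha>..Tg \<beta>} (\<lambda>z. m x 0 z / z)) {\<alpha>..\<beta>}"
proof -
  have xU: "x \<in> U" using x i01 by blast
  have Tle: "Tg u \<le> Tg v" if "u \<in> D" "v \<in> D" "u \<le> v" for u v
    using Tgm[OF that(1,2)] that(3) by (cases "u = v") auto
  have dD: "t \<in> D" if "t \<in> {\<alpha>..\<beta>}" for t using that ab(2) in_D by blast
  have ends: "\<alpha> \<in> {\<alpha>..\<beta>}" "\<beta> \<in> {\<alpha>..\<beta>}" using ab(1) by auto
  have Tr: "Tg t \<in> {Tg \<alpha>..Tg \<beta>}" if "t \<in> {\<alpha>..\<beta>}" for t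
    using Tle[OF dD[OF ends(1)] dD[OF that]] Tle[OF dD[OF that] dD[OF ends(2)]] that by auto
  have sub: "{Tg \<alpha>..Tg \<beta>} \<subseteq> {-L..M}"
    using Tle[OF \<tau>(2) dD[OF ends(1)]] Tle[OF dD[OF ends(2)] \<tau>(3)] ab(2) ends by auto
  have nz: "0 \<notin> {Tg \<alpha>..Tg \<beta>}"
  proof
    assume z: "0 \<in> {Tg \<alpha>..Tg \<beta>}"
    have "\<tau>s < \<alpha> \<or> \<beta> < \<tau>s" using ab(1,3) by auto
    then show False
      using Tgm[OF \<tau>(1) dD[OF ends(1)]] Tgm[OF dD[OF ends(2)] \<tau>(1)] z Ts by auto
  qed
  have cm: "continuous_on {Tg \<alpha>..Tg \<beta>} (\<lambda>z. m x 0 z / z)"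
    by (intro continuous_on_divide cont_tau[OF gd_m x sub] continuous_on_id) (use nz in blast)
  define \<Phi> where "\<Phi> s = integral {Tg \<alpha>..s} (\<lambda>z. m x 0 z / z)" for s
  have "((\<lambda>\<tau>. deriv (\<lambda>y. R2 \<omega> H1 y \<tau>) x) has_integral (- (1 / a) * \<Phi> (Tg \<beta>) - - (1 / a) * \<Phi> (Tg \<alpha>))) {\<alpha>..\<beta>}"
  proof (rule fundamental_theorem_of_calculus[OF ab(1)])
    fix t assume t: "t \<in> {\<alpha>..\<beta>}"
    have "(\<Phi> has_real_derivative m x 0 (Tg t) / Tg t) (at (Tg t) within {Tg \<alpha>..Tg \<beta>})"
      unfolding \<Phi>_def by (rule integral_has_real_derivative[OF cm Tr[OF t]])
    then have "(\<Phi> has_real_derivative m x 0 (Tg t) / Tg t) (at (Tg t) within Tg ` {\<alpha>..\<beta>})"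
      by (rule has_field_derivative_subset) (use Tr in blast)
    from DERIV_image_chain[OF this has_field_derivative_at_within[OF TgD[OF dD[OF t]]]]
    have "((\<lambda>\<tau>. \<Phi> (Tg \<tau>)) has_real_derivative m x 0 (Tg t) / Tg t * (1 / w (Tg t))) (at t within {\<alpha>..\<beta>})"
      by (simp add: o_def)
    from DERIV_cmult[OF this, of "- (1 / a)"]
    have 1: "((\<lambda>\<tau>. - (1 / a) * \<Phi> (Tg \<tau>)) has_real_derivative - (1 / a) * (m x 0 (Tg t) / Tg t * (1 / w (Tg t)))) (at t within {\<alpha>..\<beta>})" .
    note TV = Tg(1)[OF dD[OF t]]
    have T0: "Tg t \<noteq> 0" using Tr[OF t] nz by auto
    have "deriv (\<lambda>y. R2 \<omega> H1 y t) x = - (mc x 0 (Tg t) / \<omega> (Sg (Tg t)))"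
      using R2_eq[OF xU TV] Tg(2)[OF dD[OF t]] by simp
    also have "\<dots> = - (1 / a) * (m x 0 (Tg t) / Tg t * (1 / w (Tg t)))"
      using div_\<omega>[OF TV T0, of "mc x 0 (Tg t)"] wpos[OF TV] T0 a0 by (simp add: field_simps)
    finally have "deriv (\<lambda>y. R2 \<omega> H1 y t) x = - (1 / a) * (m x 0 (Tg t) / Tg t * (1 / w (Tg t)))" .
    then show "((\<lambda>\<tau>. - (1 / a) * \<Phi> (Tg \<tau>)) has_vector_derivative deriv (\<lambda>y. R2 \<omega> H1 y t) x) (at t within {\<alpha>..\<beta>})"
      using 1 by (simp add: has_real_derivative_iff_has_vector_derivative)
  qed
  then show ?thesis by (simp add: \<Phi>_def)
qed

text \<open>The slope is \<open>1 / w 0 = 1\<close>. Hence the distances of the images of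
  \<open>\<tau>s + \<delta>\<close> and \<open>\<tau>s - \<delta>\<close> from \<open>0\<close> are
  both asymptotic to \<delta>, the difference of their logarithms tends to zero, and the principal
  value is the same in both times.\<close>

lemma Tg_slope: "((\<lambda>h. Tg (\<tau>s + h) / h) \<longlongrightarrow> 1) (at 0)"
  using TgD[OF \<tau>(1)] Ts w0 unfolding DERIV_def by simp

lemma has_pv:
  assumes x: "x \<in> {i0..i1}"
  shows "has_pv_integral (\<lambda>\<tau>. deriv (\<lambda>y. R2 \<omega> H1 y \<tau>) x) \<tau>m \<tau>s \<tau>p (pv x)"
  unfolding has_pv_integral_def
proof (intro conjI allI impI)
  let ?f = "\<lambda>\<tau>. deriv (\<lambda>y. R2 \<omega> H1 y \<tau>) x"
  fix \<delta> :: real assume d: "\<delta> > 0"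
  show "?f integrable_on {\<tau>m..\<tau>s - \<delta>}"
  \<comment> \<open>For large \<delta> the interval is empty, but \<open>has_pv_integral\<close>
    asks for integrability there too.\<close>
  proof (cases "\<tau>m \<le> \<tau>s - \<delta>")
    case True
    then show ?thesis using R2_has_integral[OF x True] d \<tau> by fastforce
  qed (simp add: integrable_on_empty)
  show "?f integrable_on {\<tau>s + \<delta>..\<tau>p}"
  proof (cases "\<tau>s + \<delta> \<le> \<tau>p")
    case True
    then show ?thesis using R2_has_integral[OF x True] d \<tau> by fastforce
  qed (simp add: integrable_on_empty)
next
  let ?f = "\<lambda>\<tau>. deriv (\<lambda>y. R2 \<omega> H1 y \<tau>) x"
  define u where "u \<delta> = Tg (\<tau>s + \<delta>)" for \<delta>
  define v where "v \<delta> = - Tg (\<tau>s - \<delta>)" for \<delta>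
  obtain B where B: "B > 0" "\<And>x y z. x \<in> {i0..i1} \<Longrightarrow> z \<in> {-L..M} \<Longrightarrow> \<bar>bq x y z\<bar> \<le> B"
    using gd_bounded[OF gd_bq] by auto
  have su: "((\<lambda>\<delta>. u \<delta> / \<delta>) \<longlongrightarrow> 1) (at_right 0)"
    unfolding u_def using Tg_slope by (rule filterlim_mono[OF _ order_refl at_le]) simp
  have sv: "((\<lambda>\<delta>. v \<delta> / \<delta>) \<longlongrightarrow> 1) (at_right 0)"
  proof -
    have "filterlim (\<lambda>\<delta>::real. - \<delta>) (at 0) (at_right 0)"
      unfolding filterlim_at by (auto intro!: tendsto_eq_intros simp: eventually_at_filter)
    from filterlim_compose[OF Tg_slope this] show ?thesis by (simp add: v_def)
  qed
  have id: "((\<lambda>\<delta>::real. \<delta>) \<longlongrightarrow> 0) (at_right 0)" by (rule tendsto_ident_at)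
  have ru: "\<forall>\<^sub>F \<delta> in at_right (0::real). \<delta> > 0" by (simp add: eventually_at_filter)
  have u0: "(u \<longlongrightarrow> 0) (at_right 0)"
  proof (rule Lim_transform_eventually)
    show "((\<lambda>\<delta>. u \<delta> / \<delta> * \<delta>) \<longlongrightarrow> 0) (at_right 0)" using tendsto_mult[OF su id] by simp
    show "\<forall>\<^sub>F \<delta> in at_right 0. u \<delta> / \<delta> * \<delta> = u \<delta>" using ru by eventually_elim simp
  qed
  have v0: "(v \<longlongrightarrow> 0) (at_right 0)"
  proof (rule Lim_transform_eventually)
    show "((\<lambda>\<delta>. v \<delta> / \<delta> * \<delta>) \<longlongrightarrow> 0) (at_right 0)" using tendsto_mult[OF sv id] by simp
    show "\<forall>\<^sub>F \<delta> in at_right 0. v \<delta> / \<delta> * \<delta> = v \<delta>" using ru by eventually_elim simp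
  qed
  define d0 where "d0 = min (\<tau>p - \<tau>s) (\<tau>s - \<tau>m)"
  have d0: "d0 > 0" using \<tau> by (simp add: d0_def)
  have sm: "\<forall>\<^sub>F \<delta> in at_right (0::real). 0 < \<delta> \<and> \<delta> < d0"
    using eventually_at_right_less[of 0] d0 by (auto simp: eventually_at_right_field)
  have rng: "\<tau>s + \<delta> \<in> D" "\<tau>s - \<delta> \<in> D" "0 < u \<delta>" "u \<delta> \<le> M" "0 < v \<delta>" "v \<delta> \<le> L" if "0 < \<delta>" "\<delta> < d0" for \<delta>
  proof -
    show i: "\<tau>s + \<delta> \<in> D" "\<tau>s - \<delta> \<in> D" using that \<tau> by (auto intro!: in_D simp: d0_def)
    show "0 < u \<delta>" "0 < v \<delta>" using Tgm[OF \<tau>(1) i(1)] Tgm[OF i(2) \<tau>(1)] Ts that by (auto simp: u_def v_def)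
    show "u \<delta> \<le> M" "v \<delta> \<le> L" using Tgm[OF i(1) \<tau>(3)] Tgm[OF \<tau>(2) i(2)] that by (auto simp: u_def v_def d0_def)
  qed
  \<comment> \<open>Each logarithm diverges as the cut closes; both are compared with
    \<open>ln \<delta>\<close>, since the quotients \<open>u \<delta> / \<delta>\<close> and
    \<open>v \<delta> / \<delta>\<close> have limits.\<close>
  have eq: "integral {\<tau>m..\<tau>s - \<delta>} ?f + integral {\<tau>s + \<delta>..\<tau>p} ?f
     = pv x + (1 / a) * integral {- v \<delta>..u \<delta>} (\<lambda>z. bq x 0 z) - (1 / a) * (m x 0 0 * (ln (v \<delta> / \<delta>) - ln (u \<delta> / \<delta>)))"
    if d: "0 < \<delta>" "\<delta> < d0" for \<delta>
  proof -
    note r = rng[OF d]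
    have "integral {\<tau>m..\<tau>s - \<delta>} ?f = - (1 / a) * integral {-L..- v \<delta>} (\<lambda>z. m x 0 z / z)"
      using integral_unique[OF R2_has_integral[OF x, of \<tau>m "\<tau>s - \<delta>"]] d \<tau> by (simp add: v_def d0_def)
    moreover have "integral {\<tau>s + \<delta>..\<tau>p} ?f = - (1 / a) * integral {u \<delta>..M} (\<lambda>z. m x 0 z / z)"
      using integral_unique[OF R2_has_integral[OF x, of "\<tau>s + \<delta>" \<tau>p]] d \<tau> by (simp add: u_def d0_def)
    ultimately have "integral {\<tau>m..\<tau>s - \<delta>} ?f + integral {\<tau>s + \<delta>..\<tau>p} ?f
      = - (1 / a) * (integral {u \<delta>..M} (\<lambda>z. m x 0 z / z) + integral {-L..- v \<delta>} (\<lambda>z. m x 0 z / z))"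
      by (simp only: distrib_left add.commute)
    also have "\<dots> = - (1 / a) * (- a * pv x - integral {- v \<delta>..u \<delta>} (\<lambda>z. bq x 0 z) + m x 0 0 * (ln (v \<delta>) - ln (u \<delta>)))"
      by (simp only: cut_integral[OF x r(3-6)])
    also have "ln (v \<delta>) - ln (u \<delta>) = ln (v \<delta> / \<delta>) - ln (u \<delta> / \<delta>)" using r d by (simp add: ln_div)
    finally show ?thesis using a0 by (simp add: algebra_simps)
  qed
  have I0: "((\<lambda>\<delta>. integral {- v \<delta>..u \<delta>} (\<lambda>z. bq x 0 z)) \<longlongrightarrow> 0) (at_right 0)"
  proof (rule Lim_null_comparison)
    show "((\<lambda>\<delta>. B * (u \<delta> - - v \<delta>)) \<longlongrightarrow> 0) (at_right 0)"
      using tendsto_mult[OF tendsto_const tendsto_diff[OF u0 tendsto_minus[OF v0]], of B] by simp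
    show "\<forall>\<^sub>F \<delta> in at_right 0. norm (integral {- v \<delta>..u \<delta>} (\<lambda>z. bq x 0 z)) \<le> B * (u \<delta> - - v \<delta>)"
      using sm
    proof eventually_elim
      case (elim \<delta>)
      then have r: "0 < u \<delta>" "u \<delta> \<le> M" "0 < v \<delta>" "v \<delta> \<le> L" using rng(3-6)[of \<delta>] by auto
      show ?case
        by (intro integral_bound cont_tau[OF gd_bq x]) (use r B(2)[OF x] in auto)
    qed
  qed
  have "((\<lambda>\<delta>. pv x + (1 / a) * integral {- v \<delta>..u \<delta>} (\<lambda>z. bq x 0 z) - (1 / a) * (m x 0 0 * (ln (v \<delta> / \<delta>) - ln (u \<delta> / \<delta>))))
    \<longlongrightarrow> pv x + (1 / a) * 0 - (1 / a) * (m x 0 0 * (ln 1 - ln 1))) (at_right 0)"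
    by (intro tendsto_intros I0 su sv) auto
  then have lim: "((\<lambda>\<delta>. pv x + (1 / a) * integral {- v \<delta>..u \<delta>} (\<lambda>z. bq x 0 z) - (1 / a) * (m x 0 0 * (ln (v \<delta> / \<delta>) - ln (u \<delta> / \<delta>))))
    \<longlongrightarrow> pv x) (at_right 0)" by simp
  show "((\<lambda>\<delta>. integral {\<tau>m..\<tau>s - \<delta>} ?f + integral {\<tau>s + \<delta>..\<tau>p} ?f) \<longlongrightarrow> pv x) (at_right 0)"
    by (rule Lim_transform_eventually[OF lim]) (use sm in \<open>eventually_elim, use eq in simp\<close>)
qed

lemma pv_integral_eq:
  assumes x: "x \<in> {i0..i1}"
  shows "pv_integral (\<lambda>\<tau>. deriv (\<lambda>y. R2 \<omega> H1 y \<tau>) x) \<tau>m \<tau>s \<tau>p = pv x"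
  unfolding pv_integral_def
proof (rule the_equality)
  show "has_pv_integral (\<lambda>\<tau>. deriv (\<lambda>y. R2 \<omega> H1 y \<tau>) x) \<tau>m \<tau>s \<tau>p (pv x)" by (rule has_pv[OF x])
  fix l assume "has_pv_integral (\<lambda>\<tau>. deriv (\<lambda>y. R2 \<omega> H1 y \<tau>) x) \<tau>m \<tau>s \<tau>p l"
  then show "l = pv x"
    using has_pv[OF x] tendsto_unique[OF trivial_limit_at_right_real] unfolding has_pv_integral_def by blast
qed

text \<open>This cut is symmetric in the new time, so the logarithms cancel exactly, and the gap
  from \<open>- sqrt \<epsilon>\<close> to \<open>sqrt \<epsilon>\<close> costs its length times a
  bound for \<open>bq\<close>.\<close>

lemma far0_pv:
  obtains C where "C > 0" "\<And>\<epsilon> I \<phi>. sol \<epsilon> I \<phi> \<Longrightarrow> \<bar>far0 \<epsilon> I + a * pv (I 0)\<bar> \<le> C * sqrt \<epsilon>"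
proof -
  obtain B where B: "B > 0" "\<And>x y z. x \<in> {i0..i1} \<Longrightarrow> z \<in> {-L..M} \<Longrightarrow> \<bar>bq x y z\<bar> \<le> B"
    using gd_bounded[OF gd_bq] by auto
  have "\<bar>far0 \<epsilon> I + a * pv (I 0)\<bar> \<le> 2 * B * sqrt \<epsilon>" if so: "sol \<epsilon> I \<phi>" for \<epsilon> I \<phi>
  proof -
    have I0: "I 0 \<in> {i0..i1}" by (rule solD(3)[OF so zero_in])
    have r: "0 < sqrt \<epsilon>" "sqrt \<epsilon> \<le> M" "sqrt \<epsilon> \<le> L" using solD(1,2)[OF so] S by auto
    have "far0 \<epsilon> I = - a * pv (I 0) - integral {- sqrt \<epsilon>..sqrt \<epsilon>} (\<lambda>z. bq (I 0) 0 z) + m (I 0) 0 0 * (ln (sqrt \<epsilon>) - ln (sqrt \<epsilon>))"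
      unfolding far0_def by (rule cut_integral[OF I0 r(1,2) r(1,3)])
    then have e: "far0 \<epsilon> I + a * pv (I 0) = - integral {- sqrt \<epsilon>..sqrt \<epsilon>} (\<lambda>z. bq (I 0) 0 z)" by simp
    have "norm (integral {- sqrt \<epsilon>..sqrt \<epsilon>} (\<lambda>z. bq (I 0) 0 z)) \<le> B * (sqrt \<epsilon> - - sqrt \<epsilon>)"
      by (intro integral_bound cont_tau[OF gd_bq I0]) (use r B(2)[OF I0] in auto)
    then show ?thesis unfolding e by simp
  qed
  then show ?thesis using that[of "2 * B"] B(1) by simp
qed

text \<open>With \<open>t = Sg z / \<epsilon>\<close> velocities are multiplied by
  \<open>w z / \<epsilon>\<close>: the \<epsilon> of the perturbation cancels, and
  \<open>\<omega> * w = a * z\<close> makes the frequency linear.\<close>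

lemma transfer_solution:
  assumes e: "0 < \<epsilon>" "sqrt \<epsilon> \<le> S"
    and so: "is_solution \<omega> H1 \<epsilon> {\<tau>m / \<epsilon>..\<tau>p / \<epsilon>} I \<phi>"
    and K: "\<And>t. t \<in> {\<tau>m / \<epsilon>..\<tau>p / \<epsilon>} \<Longrightarrow> I t \<in> {i0..i1}"
  shows "sol \<epsilon> (\<lambda>z. I (Sg z / \<epsilon>)) (\<lambda>z. \<phi> (Sg z / \<epsilon>))"
  unfolding sol_def
proof (intro conjI ballI e)
  fix z assume z: "z \<in> {- L..M}"
  then have zV: "z \<in> V" using rangeV by blast
  have r: "Sg z / \<epsilon> \<in> {\<tau>m / \<epsilon>..\<tau>p / \<epsilon>}" if "z \<in> {-L..M}" for z
    using Sg_range[OF that] e by (auto intro: divide_right_mono)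
  show "I (Sg z / \<epsilon>) \<in> {i0..i1}" by (rule K[OF r[OF z]])
  have g: "((\<lambda>z. Sg z / \<epsilon>) has_real_derivative w z / \<epsilon>) (at z within {- L..M})"
    by (rule DERIV_cdivide[OF has_field_derivative_at_within[OF SgD[OF zV]]])
  have im: "(\<lambda>z. Sg z / \<epsilon>) ` {- L..M} \<subseteq> {\<tau>m / \<epsilon>..\<tau>p / \<epsilon>}" using r by blast
  have t: "\<epsilon> * (Sg z / \<epsilon>) = Sg z" using e by simp
  note s = so[unfolded is_solution_def, rule_format, OF r[OF z], unfolded t]
  have "(I \<circ> (\<lambda>z. Sg z / \<epsilon>) has_real_derivative - \<epsilon> * d_phi H1 (I (Sg z / \<epsilon>)) (\<phi> (Sg z / \<epsilon>)) (Sg z) * (w z / \<epsilon>)) (at z within {- L..M})"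
    by (rule DERIV_image_chain[OF has_field_derivative_subset[OF conjunct1[OF s] im] g])
  then show "((\<lambda>z. I (Sg z / \<epsilon>)) has_real_derivative - (W (I (Sg z / \<epsilon>)) (\<phi> (Sg z / \<epsilon>)) z * d_phi Hc (I (Sg z / \<epsilon>)) (\<phi> (Sg z / \<epsilon>)) z)) (at z within {- L..M})"
    unfolding o_def by (rule DERIV_cong) (use e in \<open>simp add: dphi_H_eq\<close>)
  have "(\<phi> \<circ> (\<lambda>z. Sg z / \<epsilon>) has_real_derivative (\<omega> (Sg z) + \<epsilon> * d_I H1 (I (Sg z / \<epsilon>)) (\<phi> (Sg z / \<epsilon>)) (Sg z)) * (w z / \<epsilon>)) (at z within {- L..M})"
    by (rule DERIV_image_chain[OF has_field_derivative_subset[OF conjunct2[OF s] im] g])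
  then show "((\<lambda>z. \<phi> (Sg z / \<epsilon>)) has_real_derivative a * z / \<epsilon> + W (I (Sg z / \<epsilon>)) (\<phi> (Sg z / \<epsilon>)) z * d_I Hc (I (Sg z / \<epsilon>)) (\<phi> (Sg z / \<epsilon>)) z) (at z within {- L..M})"
    unfolding o_def
  proof (rule DERIV_cong)
    show "(\<omega> (Sg z) + \<epsilon> * d_I H1 (I (Sg z / \<epsilon>)) (\<phi> (Sg z / \<epsilon>)) (Sg z)) * (w z / \<epsilon>) =
       a * z / \<epsilon> + W (I (Sg z / \<epsilon>)) (\<phi> (Sg z / \<epsilon>)) z * d_I Hc (I (Sg z / \<epsilon>)) (\<phi> (Sg z / \<epsilon>)) z"
      using \<omega>w[OF zV] e by (simp add: dI_H_eq field_simps)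
  qed
qed

end

section \<open>The asymptotic expansions\<close>

lemma phase_remainder_algebra:
  fixes \<epsilon> a :: real
  assumes "a \<noteq> 0" "\<epsilon> \<noteq> 0"
  shows "(p + \<epsilon> * - (g / (a * M'))) - (q + \<epsilon> * - (g' / (a * - L')) + 1 / \<epsilon> * (a / 2 * (M'\<^sup>2 - L'\<^sup>2)) + - qL + qM + t2 + \<epsilon> * v
      - \<epsilon> * r * ln\<epsilon> / (4 * a) * (2 * d) * t1)
    = (p - q - a / (2 * \<epsilon>) * (M'\<^sup>2 - L'\<^sup>2) - (qM - qL) - t2 - \<epsilon> / a * (g / M' + g' / L') + \<epsilon> / a * f
      + \<epsilon> / a * (ln\<epsilon> / 2 * (d * (r * t1)))) - \<epsilon> / a * (f + a * v)"
  using assms by (simp add: algebra_simps add_divide_distrib diff_divide_distrib)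

context slow_passage
begin

text \<open>Written in the original variables, free of the time change and of \<open>i0\<close> and
  \<open>i1\<close>, so that the theorem can refer to it for every compact set of actions.\<close>

definition r1 where "r1 \<epsilon> I \<phi> = (I (\<tau>p / \<epsilon>) + \<epsilon> * u1 \<omega> H1 (I (\<tau>p / \<epsilon>)) (\<phi> (\<tau>p / \<epsilon>)) \<tau>p)
  - (I (\<tau>m / \<epsilon>) + \<epsilon> * u1 \<omega> H1 (I (\<tau>m / \<epsilon>)) (\<phi> (\<tau>m / \<epsilon>)) \<tau>m
    - sqrt \<epsilon> * integral UNIV (\<lambda>\<theta>. d_phi H1 (I (\<tau>s / \<epsilon>)) (\<phi> (\<tau>s / \<epsilon>) + a / 2 * \<theta>\<^sup>2) \<tau>s))"

definition r2 where "r2 \<epsilon> I \<phi> =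
  (\<phi> (\<tau>p / \<epsilon>) + \<epsilon> * v1 \<omega> H1 (I (\<tau>p / \<epsilon>)) (\<phi> (\<tau>p / \<epsilon>)) \<tau>p)
  - (\<phi> (\<tau>m / \<epsilon>) + \<epsilon> * v1 \<omega> H1 (I (\<tau>m / \<epsilon>)) (\<phi> (\<tau>m / \<epsilon>)) \<tau>m
    + 1 / \<epsilon> * integral {\<tau>m..\<tau>p} \<omega>
    + integral {\<tau>m..\<tau>s} (\<lambda>\<tau>. deriv (\<lambda>x. H_bar H1 x \<tau>)
        (I (\<tau>m / \<epsilon>) + \<epsilon> * u1 \<omega> H1 (I (\<tau>m / \<epsilon>)) (\<phi> (\<tau>m / \<epsilon>)) \<tau>m))
    + integral {\<tau>s..\<tau>p} (\<lambda>\<tau>. deriv (\<lambda>x. H_bar H1 x \<tau>)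
        (I (\<tau>p / \<epsilon>) + \<epsilon> * u1 \<omega> H1 (I (\<tau>p / \<epsilon>)) (\<phi> (\<tau>p / \<epsilon>)) \<tau>p))
    + sqrt \<epsilon> * integral UNIV (\<lambda>\<theta>. d_I (H_tilde H1) (I (\<tau>s / \<epsilon>)) (\<phi> (\<tau>s / \<epsilon>) + a / 2 * \<theta>\<^sup>2) \<tau>s)
    + \<epsilon> * pv_integral (\<lambda>\<tau>. deriv (\<lambda>x. R2 \<omega> H1 x \<tau>) (I (\<tau>s / \<epsilon>))) \<tau>m \<tau>s \<tau>p
    - \<epsilon> powr (3/2) * ln \<epsilon> / (4 * a)
        * (deriv ^^ 3) (\<lambda>x. H_tilde_sq_mean H1 x \<tau>s) (I (\<tau>s / \<epsilon>))
        * integral UNIV (\<lambda>\<theta>. d_phi H1 (I (\<tau>s / \<epsilon>)) (\<phi> (\<tau>s / \<epsilon>) + a / 2 * \<theta>\<^sup>2) \<tau>s))"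

lemma powr_three_halves: "0 < \<epsilon> \<Longrightarrow> \<epsilon> powr (3/2) = \<epsilon> * sqrt \<epsilon>"
  using powr_add[of \<epsilon> 1 "1/2"] by (simp add: powr_half_sqrt)

lemma J_plus_eq: "J 1 \<epsilon> (\<lambda>z. I (Sg z / \<epsilon>)) (\<lambda>z. \<phi> (Sg z / \<epsilon>)) =
    I (\<tau>p / \<epsilon>) + \<epsilon> * u1 \<omega> H1 (I (\<tau>p / \<epsilon>)) (\<phi> (\<tau>p / \<epsilon>)) \<tau>p"
  using u1_eq[OF ends(4)] LMpos by (simp add: J_plus tr_def ends)

lemma J_minus_eq: "J (-1) \<epsilon> (\<lambda>z. I (Sg z / \<epsilon>)) (\<lambda>z. \<phi> (Sg z / \<epsilon>)) =
    I (\<tau>m / \<epsilon>) + \<epsilon> * u1 \<omega> H1 (I (\<tau>m / \<epsilon>)) (\<phi> (\<tau>m / \<epsilon>)) \<tau>m"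
  using u1_eq[OF ends(3)] LMpos ends(1) by (simp add: J_minus tr_def)

text \<open>The margin \<rho> keeps the corrected actions inside \<open>{i0..i1}\<close>, as their
  distance from the action is of order \<epsilon>. The phase expansion is then
  \<open>phase_jump\<close> with \<open>far0\<close> exchanged for the principal value.\<close>

lemma expansions:
  assumes \<rho>: "0 < \<rho>"
  shows "\<exists>C. \<exists>\<epsilon>0>0. \<forall>\<epsilon> I \<phi>. 0 < \<epsilon> \<and> \<epsilon> < \<epsilon>0 \<and> is_solution \<omega> H1 \<epsilon> {\<tau>m / \<epsilon>..\<tau>p / \<epsilon>} I \<phi> \<and>
      (\<forall>t\<in>{\<tau>m / \<epsilon>..\<tau>p / \<epsilon>}. I t \<in> {i0 + \<rho>..i1 - \<rho>}) \<longrightarrow>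
      \<bar>r1 \<epsilon> I \<phi>\<bar> \<le> C * \<epsilon> powr (3/2) \<and> \<bar>r2 \<epsilon> I \<phi>\<bar> \<le> C * \<epsilon> powr (3/2)"
proof -
  obtain C1 where C1: "C1 > 0" "\<And>\<epsilon> I \<phi>. sol \<epsilon> I \<phi> \<Longrightarrow>
    \<bar>J 1 \<epsilon> I \<phi> - J (-1) \<epsilon> I \<phi> + sqrt \<epsilon> * T1.T I \<phi>\<bar> \<le> C1 * (\<epsilon> * sqrt \<epsilon>)"
    "\<And>\<epsilon> I \<phi>. sol \<epsilon> I \<phi> \<Longrightarrow> \<bar>T1.T I \<phi>\<bar> \<le> C1"
    using action_jump by blast
  obtain C2 where C2: "C2 > 0" "\<And>\<epsilon> I \<phi>. sol \<epsilon> I \<phi> \<Longrightarrow> J 1 \<epsilon> I \<phi> \<in> {i0..i1} \<Longrightarrow> J (-1) \<epsilon> I \<phi> \<in> {i0..i1} \<Longrightarrow>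
    \<bar>\<phi> M - \<phi> (- L) - a / (2 * \<epsilon>) * (M\<^sup>2 - L\<^sup>2) - (Q (J 1 \<epsilon> I \<phi>) 0 M - Q (J (-1) \<epsilon> I \<phi>) 0 (- L))
      - sqrt \<epsilon> * T2.T I \<phi> - \<epsilon> / a * (tr WA I \<phi> M / M + tr WA I \<phi> (- L) / L) + \<epsilon> / a * far0 \<epsilon> I
      + \<epsilon> / a * (ln (sqrt \<epsilon>) * (d_I m (I 0) 0 0 * (sqrt \<epsilon> * T1.T I \<phi>)))\<bar> \<le> C2 * (\<epsilon> * sqrt \<epsilon>)"
    using phase_jump by blast
  obtain C3 where C3: "C3 > 0" "\<And>\<epsilon> I \<phi>. sol \<epsilon> I \<phi> \<Longrightarrow> \<bar>far0 \<epsilon> I + a * pv (I 0)\<bar> \<le> C3 * sqrt \<epsilon>"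
    using far0_pv by blast
  obtain B where B: "B > 0" "\<And>x y z. x \<in> {i0..i1} \<Longrightarrow> z \<in> {-L..M} \<Longrightarrow> \<bar>Wh x y z\<bar> \<le> B"
    using gd_bounded[OF T1.gG] by auto
  define C where "C = C1 + C2 + C3 / \<bar>a\<bar>"
  \<comment> \<open>The first bound gives \<open>sqrt \<epsilon> \<le> S\<close>; the second makes
    the correction of the action, at most \<open>\<epsilon> / \<bar>a\<bar> * (B / S)\<close>,
    smaller than \<rho>.\<close>
  define \<epsilon>0 where "\<epsilon>0 = min (S\<^sup>2) (\<rho> * (\<bar>a\<bar> * S / B))"
  have \<epsilon>0: "\<epsilon>0 > 0" using S a0 B(1) \<rho> by (simp add: \<epsilon>0_def)
  have "\<bar>r1 \<epsilon> I \<phi>\<bar> \<le> C * \<epsilon> powr (3/2) \<and> \<bar>r2 \<epsilon> I \<phi>\<bar> \<le> C * \<epsilon> powr (3/2)"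
    if e: "0 < \<epsilon>" "\<epsilon> < \<epsilon>0" and so: "is_solution \<omega> H1 \<epsilon> {\<tau>m / \<epsilon>..\<tau>p / \<epsilon>} I \<phi>"
      and K: "\<And>t. t \<in> {\<tau>m / \<epsilon>..\<tau>p / \<epsilon>} \<Longrightarrow> I t \<in> {i0 + \<rho>..i1 - \<rho>}" for \<epsilon> I \<phi>
  proof -
    define I' where "I' = (\<lambda>z. I (Sg z / \<epsilon>))"
    define \<phi>' where "\<phi>' = (\<lambda>z. \<phi> (Sg z / \<epsilon>))"
    have "sqrt \<epsilon> \<le> sqrt (S\<^sup>2)" using e by (intro real_sqrt_le_mono) (simp add: \<epsilon>0_def)
    then have eS: "sqrt \<epsilon> \<le> S" using S by simp
    have sol: "sol \<epsilon> I' \<phi>'"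
      unfolding I'_def \<phi>'_def by (rule transfer_solution[OF e(1) eS so]) (use K \<rho> in force)
    have "\<epsilon> \<le> \<rho> * (\<bar>a\<bar> * S / B)" using e by (simp add: \<epsilon>0_def)
    then have small: "\<epsilon> / \<bar>a\<bar> * (B / S) \<le> \<rho>" using a0 S B(1) by (simp add: field_simps)
    have v: "I' M = I (\<tau>p / \<epsilon>)" "I' (- L) = I (\<tau>m / \<epsilon>)" "I' 0 = I (\<tau>s / \<epsilon>)"
      "\<phi>' M = \<phi> (\<tau>p / \<epsilon>)" "\<phi>' (- L) = \<phi> (\<tau>m / \<epsilon>)" "\<phi>' 0 = \<phi> (\<tau>s / \<epsilon>)"
      using ends S0 by (simp_all add: I'_def \<phi>'_def)
    have tms: "\<tau>p / \<epsilon> \<in> {\<tau>m / \<epsilon>..\<tau>p / \<epsilon>}" "\<tau>m / \<epsilon> \<in> {\<tau>m / \<epsilon>..\<tau>p / \<epsilon>}"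
      using \<tau> e by (auto intro!: divide_right_mono)
    have Jr: "J \<sigma> \<epsilon> I' \<phi>' \<in> {i0..i1}" if \<sigma>: "\<sigma> = 1 \<or> \<sigma> = -1" for \<sigma>
    proof -
      have s: "\<sigma> * E \<sigma> \<in> {-L..M}" using E_range[OF \<sigma>, of "E \<sigma>"] E_bounds(1)[of \<sigma>] by simp
      have "\<bar>tr Wh I' \<phi>' (\<sigma> * E \<sigma>)\<bar> \<le> B" unfolding tr_def by (rule B(2)[OF solD(3)[OF sol s] s])
      then have "\<bar>tr Wh I' \<phi>' (\<sigma> * E \<sigma>)\<bar> / E \<sigma> \<le> B / S" using E_bounds(2)[of \<sigma>] S(1) B(1) by (intro frac_le) auto
      then have "\<epsilon> / \<bar>a\<bar> * (\<bar>tr Wh I' \<phi>' (\<sigma> * E \<sigma>)\<bar> / E \<sigma>) \<le> \<epsilon> / \<bar>a\<bar> * (B / S)"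
        using e by (intro mult_left_mono) auto
      moreover have "\<bar>J \<sigma> \<epsilon> I' \<phi>' - I' (\<sigma> * E \<sigma>)\<bar> = \<epsilon> / \<bar>a\<bar> * (\<bar>tr Wh I' \<phi>' (\<sigma> * E \<sigma>)\<bar> / E \<sigma>)"
        using e E_bounds(1)[of \<sigma>] \<sigma> by (auto simp: J_def abs_mult)
      ultimately have "\<bar>J \<sigma> \<epsilon> I' \<phi>' - I' (\<sigma> * E \<sigma>)\<bar> \<le> \<rho>" using small by simp
      moreover have "I' (\<sigma> * E \<sigma>) \<in> {i0 + \<rho>..i1 - \<rho>}"
        using \<sigma> K[OF tms(1)] K[OF tms(2)] v by (auto simp: E_def)
      ultimately show ?thesis by auto
    qed
    note J1 = Jr[of 1, simplified] and J2 = Jr[of "-1", simplified]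
    have Jp: "J 1 \<epsilon> I' \<phi>' = I (\<tau>p / \<epsilon>) + \<epsilon> * u1 \<omega> H1 (I (\<tau>p / \<epsilon>)) (\<phi> (\<tau>p / \<epsilon>)) \<tau>p"
      and Jm: "J (-1) \<epsilon> I' \<phi>' = I (\<tau>m / \<epsilon>) + \<epsilon> * u1 \<omega> H1 (I (\<tau>m / \<epsilon>)) (\<phi> (\<tau>m / \<epsilon>)) \<tau>m"
      unfolding I'_def \<phi>'_def by (rule J_plus_eq J_minus_eq)+
    have Us: "J 1 \<epsilon> I' \<phi>' \<in> U" "J (-1) \<epsilon> I' \<phi>' \<in> U" "I (\<tau>p / \<epsilon>) \<in> U" "I (\<tau>m / \<epsilon>) \<in> U"
      "I' 0 \<in> U" "I' 0 \<in> {i0..i1}"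
      using Jr[of 1] Jr[of "-1"] i01 K[OF tms(1)] K[OF tms(2)] solD(3)[OF sol zero_in] \<rho> by fastforce+
    have C: "C1 \<le> C" using C2(1) C3(1) by (simp add: C_def)
    have ee: "0 \<le> \<epsilon> * sqrt \<epsilon>" using e by simp
    have R1: "\<bar>r1 \<epsilon> I \<phi>\<bar> \<le> C * (\<epsilon> * sqrt \<epsilon>)"
    proof -
      have "r1 \<epsilon> I \<phi> = J 1 \<epsilon> I' \<phi>' - J (-1) \<epsilon> I' \<phi>' + sqrt \<epsilon> * T1.T I' \<phi>'"
        unfolding r1_def T1_eq v Jp Jm by simp
      then have "\<bar>r1 \<epsilon> I \<phi>\<bar> \<le> C1 * (\<epsilon> * sqrt \<epsilon>)" using C1(2)[OF sol] by simp
      also have "\<dots> \<le> C * (\<epsilon> * sqrt \<epsilon>)" by (rule mult_right_mono[OF C ee])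
      finally show ?thesis .
    qed
    have R2: "\<bar>r2 \<epsilon> I \<phi>\<bar> \<le> C * (\<epsilon> * sqrt \<epsilon>)"
    proof -
      have Mp: "M \<noteq> 0" "- L \<noteq> 0" using LMpos by auto
      have vp: "v1 \<omega> H1 (I (\<tau>p / \<epsilon>)) (\<phi> (\<tau>p / \<epsilon>)) \<tau>p = - (tr WA I' \<phi>' M / (a * M))"
        using v1_eq[OF ends(4) Mp(1) Us(3)] by (simp add: tr_def v ends)
      have vm: "v1 \<omega> H1 (I (\<tau>m / \<epsilon>)) (\<phi> (\<tau>m / \<epsilon>)) \<tau>m = - (tr WA I' \<phi>' (- L) / (a * - L))"
        using v1_eq[OF ends(3) Mp(2) Us(4)] v ends by (simp add: tr_def)
      have e32: "\<epsilon> powr (3/2) = \<epsilon> * sqrt \<epsilon>" by (rule powr_three_halves[OF e(1)])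
      have "r2 \<epsilon> I \<phi> = (\<phi>' M + \<epsilon> * - (tr WA I' \<phi>' M / (a * M)))
        - (\<phi>' (- L) + \<epsilon> * - (tr WA I' \<phi>' (- L) / (a * - L)) + 1 / \<epsilon> * (a / 2 * (M\<^sup>2 - L\<^sup>2))
          + - Q (J (-1) \<epsilon> I' \<phi>') 0 (- L) + Q (J 1 \<epsilon> I' \<phi>') 0 M + sqrt \<epsilon> * T2.T I' \<phi>' + \<epsilon> * pv (I' 0)
          - \<epsilon> * sqrt \<epsilon> * ln \<epsilon> / (4 * a) * (2 * d_I m (I' 0) 0 0) * T1.T I' \<phi>')"
        unfolding r2_def vp vm e32 Jp[symmetric] Jm[symmetric] Q_integral(1)[OF Us(1)] Q_integral(2)[OF Us(2)]
        unfolding T1_eq T2_eq \<omega>_integral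
        by (simp only: v pv_integral_eq[OF Us(6), unfolded v(3)] third_deriv[OF Us(5), unfolded v(3)])
      also have "\<dots> = (\<phi>' M - \<phi>' (- L) - a / (2 * \<epsilon>) * (M\<^sup>2 - L\<^sup>2)
          - (Q (J 1 \<epsilon> I' \<phi>') 0 M - Q (J (-1) \<epsilon> I' \<phi>') 0 (- L))
          - sqrt \<epsilon> * T2.T I' \<phi>' - \<epsilon> / a * (tr WA I' \<phi>' M / M + tr WA I' \<phi>' (- L) / L) + \<epsilon> / a * far0 \<epsilon> I'
          + \<epsilon> / a * (ln \<epsilon> / 2 * (d_I m (I' 0) 0 0 * (sqrt \<epsilon> * T1.T I' \<phi>'))))
          - \<epsilon> / a * (far0 \<epsilon> I' + a * pv (I' 0))"
        by (rule phase_remainder_algebra[OF a0]) (use e in simp)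
      finally have r2: "r2 \<epsilon> I \<phi> = \<dots>" .
      have ls: "ln (sqrt \<epsilon>) = ln \<epsilon> / 2" using e by (simp add: ln_sqrt)
      have "\<bar>\<epsilon> / a * (far0 \<epsilon> I' + a * pv (I' 0))\<bar> = \<epsilon> / \<bar>a\<bar> * \<bar>far0 \<epsilon> I' + a * pv (I' 0)\<bar>"
        using e by (simp add: abs_mult)
      also have "\<dots> \<le> \<epsilon> / \<bar>a\<bar> * (C3 * sqrt \<epsilon>)" using e C3(2)[OF sol] by (intro mult_left_mono) auto
      also have "\<dots> = C3 / \<bar>a\<bar> * (\<epsilon> * sqrt \<epsilon>)" by simp
      finally have f: "\<bar>\<epsilon> / a * (far0 \<epsilon> I' + a * pv (I' 0))\<bar> \<le> C3 / \<bar>a\<bar> * (\<epsilon> * sqrt \<epsilon>)" .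
      have "\<bar>r2 \<epsilon> I \<phi>\<bar> \<le> C2 * (\<epsilon> * sqrt \<epsilon>) + C3 / \<bar>a\<bar> * (\<epsilon> * sqrt \<epsilon>)"
        unfolding r2 by (rule order_trans[OF abs_triangle_ineq4 add_mono[OF C2(2)[OF sol Jr Jr, unfolded ls] f]]) auto
      also have "\<dots> = (C2 + C3 / \<bar>a\<bar>) * (\<epsilon> * sqrt \<epsilon>)" by (simp only: distrib_right)
      also have "\<dots> \<le> C * (\<epsilon> * sqrt \<epsilon>)" by (rule mult_right_mono[OF _ ee]) (use C1(1) in \<open>simp add: C_def\<close>)
      finally show ?thesis .
    qed
    show ?thesis using R1 R2 powr_three_halves[OF e(1)] by simp
  qed
  then show ?thesis by (intro exI[of _ C] exI[of _ \<epsilon>0] conjI[OF \<epsilon>0] allI impI) blast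
qed

end

text \<open>The first two conjuncts secure the meaning of the third: \<open>integral\<close> and the
  description operator in \<open>pv_integral\<close> have the intended values only where the
  integrals and the principal value exist.\<close>

theorem theorem2p1:
  fixes D\<^sub>I D\<^sub>\<tau> :: "real set"
    and \<omega> :: "real \<Rightarrow> real"
    and H1 :: "real \<Rightarrow> real \<Rightarrow> real \<Rightarrow> real"
    and \<tau>s \<tau>m \<tau>p \<omega>s' :: real
  assumes "open D\<^sub>I" and "is_interval D\<^sub>I"
    and "open D\<^sub>\<tau>" and "is_interval D\<^sub>\<tau>"
    and "Ck_on 4 D\<^sub>\<tau> \<omega>"
    and "Ck_on 4 (D\<^sub>I \<times> UNIV \<times> D\<^sub>\<tau>) (\<lambda>(I, \<phi>, \<tau>). H1 I \<phi> \<tau>)"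
    and "\<And>I \<phi> \<tau>. I \<in> D\<^sub>I \<Longrightarrow> \<tau> \<in> D\<^sub>\<tau> \<Longrightarrow> H1 I (\<phi> + 2 * pi) \<tau> = H1 I \<phi> \<tau>"
    and "\<tau>s \<in> D\<^sub>\<tau>" and "\<omega> \<tau>s = 0"
    and "\<omega>s' = deriv \<omega> \<tau>s" and "\<omega>s' \<noteq> 0"
    and "\<And>\<tau>. \<tau> \<in> D\<^sub>\<tau> - {\<tau>s} \<Longrightarrow> \<omega> \<tau> \<noteq> 0"
    and "\<tau>m \<in> D\<^sub>\<tau>" and "\<tau>p \<in> D\<^sub>\<tau>" and "\<tau>m < \<tau>s" and "\<tau>s < \<tau>p"
  shows
    "(\<forall>x\<in>D\<^sub>I. \<forall>p.
        (\<lambda>\<theta>. d_phi H1 x (p + \<omega>s' / 2 * \<theta>\<^sup>2) \<tau>s) integrable_on UNIV \<and>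
        (\<lambda>\<theta>. d_I (H_tilde H1) x (p + \<omega>s' / 2 * \<theta>\<^sup>2) \<tau>s) integrable_on UNIV) \<and>
     (\<forall>x\<in>D\<^sub>I. \<exists>l. has_pv_integral (\<lambda>\<tau>. deriv (\<lambda>y. R2 \<omega> H1 y \<tau>) x) \<tau>m \<tau>s \<tau>p l) \<and>
     (\<forall>K. compact K \<and> K \<subseteq> D\<^sub>I \<longrightarrow>
       (\<exists>C. \<exists>\<epsilon>0>0. \<forall>\<epsilon> I \<phi>.
          0 < \<epsilon> \<and> \<epsilon> < \<epsilon>0 \<and>
          is_solution \<omega> H1 \<epsilon> {\<tau>m / \<epsilon>..\<tau>p / \<epsilon>} I \<phi> \<and>
          (\<forall>t\<in>{\<tau>m / \<epsilon>..\<tau>p / \<epsilon>}. I t \<in> K) \<longrightarrow>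
          (let Im = I (\<tau>m / \<epsilon>); Is = I (\<tau>s / \<epsilon>); Ip = I (\<tau>p / \<epsilon>);
               \<phi>m = \<phi> (\<tau>m / \<epsilon>); \<phi>s = \<phi> (\<tau>s / \<epsilon>); \<phi>p = \<phi> (\<tau>p / \<epsilon>);
               Jm = Im + \<epsilon> * u1 \<omega> H1 Im \<phi>m \<tau>m;
               Jp = Ip + \<epsilon> * u1 \<omega> H1 Ip \<phi>p \<tau>p
           in
             (\<exists>r. \<bar>r\<bar> \<le> C * \<epsilon> powr (3/2) \<and>
                Ip + \<epsilon> * u1 \<omega> H1 Ip \<phi>p \<tau>p =
                  Im + \<epsilon> * u1 \<omega> H1 Im \<phi>m \<tau>m
                  - sqrt \<epsilon> * integral UNIV (\<lambda>\<theta>. d_phi H1 Is (\<phi>s + \<omega>s' / 2 * \<theta>\<^sup>2) \<tau>s)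
                  + r) \<and>
             (\<exists>r. \<bar>r\<bar> \<le> C * \<epsilon> powr (3/2) \<and>
                \<phi>p + \<epsilon> * v1 \<omega> H1 Ip \<phi>p \<tau>p =
                  \<phi>m + \<epsilon> * v1 \<omega> H1 Im \<phi>m \<tau>m
                  + 1 / \<epsilon> * integral {\<tau>m..\<tau>p} \<omega>
                  + integral {\<tau>m..\<tau>s} (\<lambda>\<tau>. deriv (\<lambda>x. H_bar H1 x \<tau>) Jm)
                  + integral {\<tau>s..\<tau>p} (\<lambda>\<tau>. deriv (\<lambda>x. H_bar H1 x \<tau>) Jp)
                  + sqrt \<epsilon>
                      * integral UNIV (\<lambda>\<theta>. d_I (H_tilde H1) Is (\<phi>s + \<omega>s' / 2 * \<theta>\<^sup>2) \<tau>s)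
                  + \<epsilon> * pv_integral (\<lambda>\<tau>. deriv (\<lambda>x. R2 \<omega> H1 x \<tau>) Is) \<tau>m \<tau>s \<tau>p
                  - \<epsilon> powr (3/2) * ln \<epsilon> / (4 * \<omega>s')
                      * (deriv ^^ 3) (\<lambda>x. H_tilde_sq_mean H1 x \<tau>s) Is
                      * integral UNIV (\<lambda>\<theta>. d_phi H1 Is (\<phi>s + \<omega>s' / 2 * \<theta>\<^sup>2) \<tau>s)
                  + r))))"
proof -
  have iI: "convex D\<^sub>I" and iT: "convex D\<^sub>\<tau>" using assms(2,4) by (simp_all add: is_interval_convex)
  obtain V Sg Tg w where tc: "open V" "convex V" "0 \<in> V"
    "\<And>z. z \<in> V \<Longrightarrow> Sg z \<in> D\<^sub>\<tau>" "\<And>z. z \<in> V \<Longrightarrow> Tg (Sg z) = z"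
    "\<And>\<tau>. \<tau> \<in> D\<^sub>\<tau> \<Longrightarrow> Tg \<tau> \<in> V" "\<And>\<tau>. \<tau> \<in> D\<^sub>\<tau> \<Longrightarrow> Sg (Tg \<tau>) = \<tau>"
    "Sg 0 = \<tau>s" "w 0 = 1" "\<And>z. z \<in> V \<Longrightarrow> 0 < w z" "\<And>z. z \<in> V \<Longrightarrow> \<omega> (Sg z) * w z = \<omega>s' * z"
    "\<And>z. z \<in> V \<Longrightarrow> (Sg has_real_derivative w z) (at z)"
    "\<And>\<tau>. \<tau> \<in> D\<^sub>\<tau> \<Longrightarrow> (Tg has_real_derivative 1 / w (Tg \<tau>)) (at \<tau>)"
    "\<And>\<tau> \<tau>'. \<tau> \<in> D\<^sub>\<tau> \<Longrightarrow> \<tau>' \<in> D\<^sub>\<tau> \<Longrightarrow> \<tau> < \<tau>' \<Longrightarrow> Tg \<tau> < Tg \<tau>'"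
    "\<And>U. open U \<Longrightarrow> cd 3 U V (\<lambda>x y z. w z)"
    "\<And>U f. open U \<Longrightarrow> cd 4 U D\<^sub>\<tau> f \<Longrightarrow> cd 4 U V (\<lambda>x y z. f x y (Sg z))"
    using time_change[OF assms(3,4,5,8,9,10,11,12)] by blast
  have cH: "cd 4 D\<^sub>I V (\<lambda>x y z. H1 x y (Sg z))"
    by (rule tc(16)[OF assms(1) Ck_on_imp_cd[OF assms(1,3,6)]])
  have sp: "slow_passage D\<^sub>I D\<^sub>\<tau> V \<omega> H1 \<tau>s \<tau>m \<tau>p \<omega>s' Sg Tg w i0 i1" if "{i0..i1} \<subseteq> D\<^sub>I" for i0 i1
    by (rule slow_passage.intro[OF assms(1) iI assms(3) iT tc(1-14) tc(15)[OF assms(1)] cH assms(7,11,8,13-16) that])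
  have 1: "(\<lambda>\<theta>. d_phi H1 x (p + \<omega>s' / 2 * \<theta>\<^sup>2) \<tau>s) integrable_on UNIV \<and>
        (\<lambda>\<theta>. d_I (H_tilde H1) x (p + \<omega>s' / 2 * \<theta>\<^sup>2) \<tau>s) integrable_on UNIV"
    "\<exists>l. has_pv_integral (\<lambda>\<tau>. deriv (\<lambda>y. R2 \<omega> H1 y \<tau>) x) \<tau>m \<tau>s \<tau>p l" if "x \<in> D\<^sub>I" for x p
  proof -
    \<comment> \<open>For statements at a fixed action the range may shrink to that single
      point.\<close>
    interpret slow_passage D\<^sub>I D\<^sub>\<tau> V \<omega> H1 \<tau>s \<tau>m \<tau>p \<omega>s' Sg Tg w x x
      by (rule sp) (use that in simp)
    show "(\<lambda>\<theta>. d_phi H1 x (p + \<omega>s' / 2 * \<theta>\<^sup>2) \<tau>s) integrable_on UNIV \<and>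
        (\<lambda>\<theta>. d_I (H_tilde H1) x (p + \<omega>s' / 2 * \<theta>\<^sup>2) \<tau>s) integrable_on UNIV"
      using integrable_resonant[of x p] by simp
    show "\<exists>l. has_pv_integral (\<lambda>\<tau>. deriv (\<lambda>y. R2 \<omega> H1 y \<tau>) x) \<tau>m \<tau>s \<tau>p l"
      using has_pv[of x] by auto
  qed
  have 2: "\<exists>C. \<exists>\<epsilon>0>0. \<forall>\<epsilon> I \<phi>. 0 < \<epsilon> \<and> \<epsilon> < \<epsilon>0 \<and> is_solution \<omega> H1 \<epsilon> {\<tau>m / \<epsilon>..\<tau>p / \<epsilon>} I \<phi> \<and>
      (\<forall>t\<in>{\<tau>m / \<epsilon>..\<tau>p / \<epsilon>}. I t \<in> K) \<longrightarrow>
      \<bar>slow_passage.r1 \<omega> H1 \<tau>s \<tau>m \<tau>p \<omega>s' \<epsilon> I \<phi>\<bar> \<le> C * \<epsilon> powr (3/2) \<and>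
      \<bar>slow_passage.r2 \<omega> H1 \<tau>s \<tau>m \<tau>p \<omega>s' \<epsilon> I \<phi>\<bar> \<le> C * \<epsilon> powr (3/2)" if K: "compact K" "K \<subseteq> D\<^sub>I" for K
  proof (cases "K = {}")
    \<comment> \<open>No solution keeps its action in the empty set, as
      \<open>\<tau>m / \<epsilon>\<close> belongs to the time interval; so any constants
      serve.\<close>
    case True
    have "\<tau>m / \<epsilon> \<in> {\<tau>m / \<epsilon>..\<tau>p / \<epsilon>}" if "0 < \<epsilon>" for \<epsilon> :: real
      using that assms(15,16) by (auto intro: divide_right_mono)
    then show ?thesis using True by (intro exI[of _ 0] exI[of _ 1]) auto
  next
    case False
    obtain k0 where k0: "k0 \<in> K" "\<And>x. x \<in> K \<Longrightarrow> k0 \<le> x"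
      using compact_attains_inf[OF K(1) False] by blast
    obtain k1 where k1: "k1 \<in> K" "\<And>x. x \<in> K \<Longrightarrow> x \<le> k1"
      using compact_attains_sup[OF K(1) False] by blast
    \<comment> \<open>\<open>K\<close> lies between its extreme points \<open>k0\<close> and
      \<open>k1\<close>, and openness of \<open>D\<^sub>I\<close> at these two gives room for the
      margin \<rho>.\<close>
    obtain d0 where d0: "d0 > 0" "cball k0 d0 \<subseteq> D\<^sub>I" using assms(1) k0(1) K(2) open_contains_cball by blast
    obtain d1 where d1: "d1 > 0" "cball k1 d1 \<subseteq> D\<^sub>I" using assms(1) k1(1) K(2) open_contains_cball by blast
    define \<rho> where "\<rho> = min d0 d1"
    have \<rho>: "\<rho> > 0" using d0 d1 by (simp add: \<rho>_def)
    have "k0 - \<rho> \<in> D\<^sub>I"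
      by (rule subsetD[OF d0(2)]) (use d0 \<rho> in \<open>simp add: dist_real_def \<rho>_def\<close>)
    moreover have "k1 + \<rho> \<in> D\<^sub>I"
      by (rule subsetD[OF d1(2)]) (use d1 \<rho> in \<open>simp add: dist_real_def \<rho>_def\<close>)
    ultimately have sub: "{k0 - \<rho>..k1 + \<rho>} \<subseteq> D\<^sub>I"
      using interval_subset_is_interval[OF assms(2), of "k0 - \<rho>" "k1 + \<rho>"] by simp
    have "\<And>i. i \<in> K \<Longrightarrow> i \<in> {k0 - \<rho> + \<rho>..k1 + \<rho> - \<rho>}" using k0(2) k1(2) by auto
    then show ?thesis using slow_passage.expansions[OF sp[OF sub] \<rho>] by meson
  qed
  \<comment> \<open>The remainders do not depend on the range of actions, so their definitions can
    be unfolded with the empty range \<open>{1..0}\<close>, for which the inclusion in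
    \<open>D\<^sub>I\<close> is trivial.\<close>
  have sp1: "slow_passage D\<^sub>I D\<^sub>\<tau> V \<omega> H1 \<tau>s \<tau>m \<tau>p \<omega>s' Sg Tg w 1 0" by (rule sp) simp
  note rD = slow_passage.r1_def[OF sp1] slow_passage.r2_def[OF sp1]
  show ?thesis
  proof (intro conjI ballI allI impI)
    fix K assume K: "compact K \<and> K \<subseteq> D\<^sub>I"
    obtain C \<epsilon>0 where E: "\<epsilon>0 > 0" "\<And>\<epsilon> I \<phi>. 0 < \<epsilon> \<and> \<epsilon> < \<epsilon>0 \<and> is_solution \<omega> H1 \<epsilon> {\<tau>m / \<epsilon>..\<tau>p / \<epsilon>} I \<phi> \<and>
      (\<forall>t\<in>{\<tau>m / \<epsilon>..\<tau>p / \<epsilon>}. I t \<in> K) \<Longrightarrow>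
      \<bar>slow_passage.r1 \<omega> H1 \<tau>s \<tau>m \<tau>p \<omega>s' \<epsilon> I \<phi>\<bar> \<le> C * \<epsilon> powr (3/2) \<and>
      \<bar>slow_passage.r2 \<omega> H1 \<tau>s \<tau>m \<tau>p \<omega>s' \<epsilon> I \<phi>\<bar> \<le> C * \<epsilon> powr (3/2)"
      using 2[of K] K by blast
    have ex: "\<exists>r. \<bar>r\<bar> \<le> c \<and> x = y + r" if "\<bar>x - y\<bar> \<le> c" for x y c :: real
      using that by (intro exI[of _ "x - y"]) simp
    show "\<exists>C. \<exists>\<epsilon>0>0. \<forall>\<epsilon> I \<phi>.
          0 < \<epsilon> \<and> \<epsilon> < \<epsilon>0 \<and>
          is_solution \<omega> H1 \<epsilon> {\<tau>m / \<epsilon>..\<tau>p / \<epsilon>} I \<phi> \<and>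
          (\<forall>t\<in>{\<tau>m / \<epsilon>..\<tau>p / \<epsilon>}. I t \<in> K) \<longrightarrow> (let Im = I (\<tau>m / \<epsilon>); Is = I (\<tau>s / \<epsilon>); Ip = I (\<tau>p / \<epsilon>);
               \<phi>m = \<phi> (\<tau>m / \<epsilon>); \<phi>s = \<phi> (\<tau>s / \<epsilon>); \<phi>p = \<phi> (\<tau>p / \<epsilon>);
               Jm = Im + \<epsilon> * u1 \<omega> H1 Im \<phi>m \<tau>m;
               Jp = Ip + \<epsilon> * u1 \<omega> H1 Ip \<phi>p \<tau>p
           in
             (\<exists>r. \<bar>r\<bar> \<le> C * \<epsilon> powr (3/2) \<and>
                Ip + \<epsilon> * u1 \<omega> H1 Ip \<phi>p \<tau>p =
                  Im + \<epsilon> * u1 \<omega> H1 Im \<phi>m \<tau>m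
                  - sqrt \<epsilon> * integral UNIV (\<lambda>\<theta>. d_phi H1 Is (\<phi>s + \<omega>s' / 2 * \<theta>\<^sup>2) \<tau>s)
                  + r) \<and>
             (\<exists>r. \<bar>r\<bar> \<le> C * \<epsilon> powr (3/2) \<and>
                \<phi>p + \<epsilon> * v1 \<omega> H1 Ip \<phi>p \<tau>p =
                  \<phi>m + \<epsilon> * v1 \<omega> H1 Im \<phi>m \<tau>m
                  + 1 / \<epsilon> * integral {\<tau>m..\<tau>p} \<omega>
                  + integral {\<tau>m..\<tau>s} (\<lambda>\<tau>. deriv (\<lambda>x. H_bar H1 x \<tau>) Jm)
                  + integral {\<tau>s..\<tau>p} (\<lambda>\<tau>. deriv (\<lambda>x. H_bar H1 x \<tau>) Jp)
                  + sqrt \<epsilon>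
                      * integral UNIV (\<lambda>\<theta>. d_I (H_tilde H1) Is (\<phi>s + \<omega>s' / 2 * \<theta>\<^sup>2) \<tau>s)
                  + \<epsilon> * pv_integral (\<lambda>\<tau>. deriv (\<lambda>x. R2 \<omega> H1 x \<tau>) Is) \<tau>m \<tau>s \<tau>p
                  - \<epsilon> powr (3/2) * ln \<epsilon> / (4 * \<omega>s')
                      * (deriv ^^ 3) (\<lambda>x. H_tilde_sq_mean H1 x \<tau>s) Is
                      * integral UNIV (\<lambda>\<theta>. d_phi H1 Is (\<phi>s + \<omega>s' / 2 * \<theta>\<^sup>2) \<tau>s)
                  + r))"
      unfolding Let_def
      by (rule exI[of _ C], rule exI[of _ \<epsilon>0])
        (intro conjI E(1) allI impI ex; use E(2)[THEN conjunct1, unfolded rD] E(2)[THEN conjunct2, unfolded rD] in blast)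
  qed (use 1 in blast)+
qed

end
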